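(* Let $[a,b]\subset\mathbb{R}_0=\mathbb{R}\setminus\{0\}$ with $a<b$, let $D=[a,b]$ and $\eta(dx)=dx$, and let $k\ge 0$ be an integer. Let $X$ be a real Lévy process with Lévy density $s$ (with respect to Lebesgue measure) which is positive and bounded on $D$. For $m\ge1$ let $\mathcal{S}_m^k$ be the space of piecewise polynomials of degree at most $k$ on $[a,b]$ based on the regular partition of $[a,b]$ into $m$ intervals. For $T>0$, let $\mathcal{M}_T=\{m\ge 1: D_m\le T\}$ and let $\tilde{s}_T$ be the penalized projection estimator on $\{\mathcal{S}_m^k\}_{m\in\mathcal{M}_T}$, based on the jumps of $X$ on $[0,T]$, with penalization $$\mathrm{pen}(m)\equiv c\,\frac{\hat{V}_m}{T}+c'\,\frac{D_m}{T}+c''\,\frac{d_m}{T},$$ for some fixed $c>1$ and $c',c''>0$. Let $2\le p\le\infty$ and $0<\alpha<k+1$. If the restriction of $s$ to $D$ belongs to $\mathcal{B}^\alpha_\infty(L^p([a,b]))$, then $$\limsup_{T\to\infty}T^{2\alpha/(2\alpha+1)}\,\mathbb{E}\left[\|s-\tilde{s}_T\|_\eta^2\right]<\infty.$$ Moreover, for any $R>0$ and $L>0$, $$\limsup_{T\to\infty}T^{2\alpha/(2\alpha+1)}\sup_{s\in\Theta(R,L)}\mathbb{E}\left[\|s-\tilde{s}_T\|_\eta^2\right]<\infty,$$ where $\Theta(R,L)$ consists of all the Lévy densities $f$ (positive on $D$) such that $\|f\|_{L^\infty([a,b],dx)}<R$ and such that the restriction of $f$ to $[a,b]$ is a member of $\mathcal{B}^\alpha_\infty(L^p([a,b]))$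 with $|f|_{\mathcal{B}^\alpha_\infty(L^p)}<L$.
   Context: A Lévy density is a function $s:\mathbb{R}_0\to[0,\infty)$ with $\int_{\mathbb{R}_0}(1\wedge x^2)s(x)dx<\infty$; $X$ has Lévy density $s$ if its Lévy measure is $s(x)dx$ (drift and Gaussian component are arbitrary). In the supremum over $\Theta(R,L)$, the expectation is under the law for which $X$ has Lévy density $s$. Besov space: for $0<p\le\infty$ and $\alpha>0$, $\mathcal{B}^\alpha_\infty(L^p([a,b]))$ consists of those $f\in L^p([a,b],dx)$ if $p<\infty$ (or $f$ continuous if $p=\infty$) such that $$|f|_{\mathcal{B}^\alpha_\infty(L^p)}\equiv\sup_{\delta>0}\frac1{\delta^\alpha}\sup_{0<h\le\delta}\|\Delta_h^r(f,\cdot)\|_{L^p([a,b],dx)}<\infty,$$ with $r=\lfloor\alpha\rfloor+1$, where $\Delta_h(f,x)=f(x+h)-f(x)$, $\Delta_h^r(f,x)=\Delta_h(\Delta_h^{r-1}(f,\cdot),x)$, and $\Delta_h^r(f,x)$ is considered only for $x$ with $x,x+rh\in[a,b]$ (taken to be $0$ otherwise). Estimators: write $\Delta X(t)=X(t)-X(t^-)$ and let $\mathcal{J}(B)=\#\{t>0:(t,\Delta X(t))\in B,\Delta X(t)\ne0\}$ be the jump measure of $X$. $\|f\|_\eta^2=\int_a^bf^2(x)dx$, and $\|\cdot\|_\infty$ is the (essential) supremum norm on $[a,b]$. Let $d_m=\dim\mathcal{S}_m^k=m(k+1)$, and let $\{\varphi_{1,m},\dots,\varphi_{d_m,m}\}$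 be an orthonormal basis of $\mathcal{S}_m^k$ in $L^2([a,b],dx)$. Then: - $D_m=\sup\{\|f\|_\infty^2: f\in\mathcal{S}_m^k,\ \|f\|_\eta=1\}$. - $\hat{V}_m=\frac1T\iint_{[0,T]\times D}\left(\sum_{i=1}^{d_m}\varphi_{i,m}^2(x)\right)\mathcal{J}(dt,dx)$. - The projection estimator on $\mathcal{S}_m^k$ is $\hat{s}_m=\sum_{i=1}^{d_m}\hat\beta_{i,m}\varphi_{i,m}$, with $\hat\beta_{i,m}=\frac1T\iint_{[0,T]\times D}\varphi_{i,m}(x)\,\mathcal{J}(dt,dx)$. - The penalized projection estimator is $\tilde{s}_T=\hat{s}_{\hat m}$ with $\hat m\in\operatorname{argmin}_{m\in\mathcal{M}_T}\{-\|\hat{s}_m\|_\eta^2+\mathrm{pen}(m)\}$ (a measurable choice of minimizer; it is defined for all $T$ large enough that $\mathcal{M}_T\ne\emptyset$). *)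

theory Defs
  imports "HOL-Probability.Probability" "HOL-Computational_Algebra.Polynomial"
begin

section \<open>Levy processes, their jumps and their Levy densities\<close>

definition cadlag :: "(real \<Rightarrow> real) \<Rightarrow> bool" where
  "cadlag f \<longleftrightarrow>
     (\<forall>t\<ge>0. (f \<longlongrightarrow> f t) (at_right t)) \<and> (\<forall>t>0. \<exists>l. (f \<longlongrightarrow> l) (at_left t))"

text \<open>Only the restriction of the process to times \<open>t \<ge> 0\<close> matters. Stochastic continuity
  is not listed because it follows from the other clauses.\<close>

definition levy_process :: "'w measure \<Rightarrow> (real \<Rightarrow> 'w \<Rightarrow> real) \<Rightarrow> bool" where
  "levy_process M X \<longleftrightarrow>
     prob_space M \<and>
     (\<forall>t\<ge>0. X t \<in> borel_measurable M) \<and>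
     (AE \<omega> in M. X 0 \<omega> = 0) \<and>
     (\<forall>(n::nat) t. 0 \<le> t 0 \<and> (\<forall>i<n. t i \<le> t (Suc i)) \<longrightarrow>
        prob_space.indep_vars M (\<lambda>_. borel) (\<lambda>i \<omega>. X (t (Suc i)) \<omega> - X (t i) \<omega>) {..<n}) \<and>
     (\<forall>u\<ge>0. \<forall>t\<ge>0. distr M borel (\<lambda>\<omega>. X (u + t) \<omega> - X u \<omega>) = distr M borel (X t)) \<and>
     (AE \<omega> in M. cadlag (\<lambda>t. X t \<omega>))"

definition jump :: "(real \<Rightarrow> 'w \<Rightarrow> real) \<Rightarrow> real \<Rightarrow> 'w \<Rightarrow> real" where
  "jump X t \<omega> = X t \<omega> - Lim (at_left t) (\<lambda>u. X u \<omega>)"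

text \<open>The image of the counting measure on the set of jump times, i.e. the measure
  \<open>B \<mapsto> #{t > 0. (t, jump X t \<omega>) \<in> B \<and> jump X t \<omega> \<noteq> 0}\<close>.\<close>

definition jump_measure :: "(real \<Rightarrow> 'w \<Rightarrow> real) \<Rightarrow> 'w \<Rightarrow> (real \<times> real) measure" where
  "jump_measure X \<omega> =
     distr (count_space {t. 0 < t \<and> jump X t \<omega> \<noteq> 0}) borel (\<lambda>t. (t, jump X t \<omega>))"

text \<open>Levy densities live on the reals without 0; they are represented by functions on all
  reals whose value at 0 is irrelevant.\<close>

definition levy_density :: "(real \<Rightarrow> real) \<Rightarrow> bool" where
  "levy_density s \<longleftrightarrow>
     s \<in> borel_measurable borel \<and> (\<forall>x. x \<noteq> 0 \<longrightarrow> 0 \<le> s x) \<and>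
     (\<integral>\<^sup>+x. ennreal (min 1 (x\<^sup>2) * s x) \<partial>lborel) < \<infinity>"

text \<open>The Levy measure of a set \<open>A\<close> is the expected number of jumps per unit of time whose
  sizes lie in \<open>A\<close>. No condition is put on the drift and on the Gaussian component.\<close>

definition has_levy_density ::
    "'w measure \<Rightarrow> (real \<Rightarrow> 'w \<Rightarrow> real) \<Rightarrow> (real \<Rightarrow> real) \<Rightarrow> bool" where
  "has_levy_density M X s \<longleftrightarrow>
     levy_density s \<and>
     (\<forall>A\<in>sets borel.
        (\<integral>\<^sup>+\<omega>. emeasure (jump_measure X \<omega>) ({0<..1} \<times> A) \<partial>M) =
        emeasure (density lborel (\<lambda>x. ennreal (s x))) A)"


section \<open>Norms and Besov spaces on an interval\<close>

definition Linf_norm :: "real \<Rightarrow> real \<Rightarrow> (real \<Rightarrow> real) \<Rightarrow> ennreal" where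
  "Linf_norm a b f = esssup (restrict_space lborel {a..b}) (\<lambda>x. ennreal \<bar>f x\<bar>)"

definition Lp_norm :: "real \<Rightarrow> real \<Rightarrow> ennreal \<Rightarrow> (real \<Rightarrow> real) \<Rightarrow> ennreal" where
  "Lp_norm a b p f =
     (if p = \<infinity> then Linf_norm a b f
      else let I = (\<integral>\<^sup>+x\<in>{a..b}. ennreal (\<bar>f x\<bar> powr enn2real p) \<partial>lborel)
           in if I = \<infinity> then \<infinity> else ennreal (enn2real I powr (1 / enn2real p)))"

definition eta_inner :: "real \<Rightarrow> real \<Rightarrow> (real \<Rightarrow> real) \<Rightarrow> (real \<Rightarrow> real) \<Rightarrow> real" where
  "eta_inner a b f g = (LINT x:{a..b}|lborel. f x * g x)"

definition eta_norm :: "real \<Rightarrow> real \<Rightarrow> (real \<Rightarrow> real) \<Rightarrow> real" where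
  "eta_norm a b f = sqrt (LINT x:{a..b}|lborel. (f x)\<^sup>2)"

primrec fin_diff :: "real \<Rightarrow> nat \<Rightarrow> (real \<Rightarrow> real) \<Rightarrow> real \<Rightarrow> real" where
  "fin_diff h 0 f x = f x"
| "fin_diff h (Suc r) f x = fin_diff h r f (x + h) - fin_diff h r f x"

definition fin_diff_on :: "real \<Rightarrow> real \<Rightarrow> real \<Rightarrow> nat \<Rightarrow> (real \<Rightarrow> real) \<Rightarrow> real \<Rightarrow> real" where
  "fin_diff_on a b h r f x =
     (if x \<in> {a..b} \<and> x + real r * h \<in> {a..b} then fin_diff h r f x else 0)"

definition besov_seminorm ::
    "real \<Rightarrow> real \<Rightarrow> real \<Rightarrow> ennreal \<Rightarrow> (real \<Rightarrow> real) \<Rightarrow> ennreal" where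
  "besov_seminorm a b \<alpha> p f =
     (SUP \<delta>\<in>{0<..}. ennreal (1 / \<delta> powr \<alpha>) *
        (SUP h\<in>{0<..\<delta>}. Lp_norm a b p (fin_diff_on a b h (nat \<lfloor>\<alpha>\<rfloor> + 1) f)))"

text \<open>Membership depends on the restriction of \<open>f\<close> to \<open>{a..b}\<close> only.\<close>

definition besov :: "real \<Rightarrow> real \<Rightarrow> real \<Rightarrow> ennreal \<Rightarrow> (real \<Rightarrow> real) set" where
  "besov a b \<alpha> p =
     {f. (if p = \<infinity> then continuous_on {a..b} f
          else f \<in> borel_measurable (restrict_space lborel {a..b}) \<and> Lp_norm a b p f < \<infinity>) \<and>
         besov_seminorm a b \<alpha> p f < \<infinity>}"

definition levy_class ::
    "real \<Rightarrow> real \<Rightarrow> real \<Rightarrow> ennreal \<Rightarrow> real \<Rightarrow> real \<Rightarrow> (real \<Rightarrow> real) set" where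
  "levy_class a b \<alpha> p R L =
     {f. levy_density f \<and> (\<forall>x\<in>{a..b}. 0 < f x) \<and> Linf_norm a b f < ennreal R \<and>
         f \<in> besov a b \<alpha> p \<and> besov_seminorm a b \<alpha> p f < ennreal L}"


section \<open>Piecewise polynomials on the regular partition\<close>

text \<open>The cells are closed on the left and open on the right, except that the last one is
  closed. A piecewise polynomial is extended by 0 outside \<open>{a..b}\<close>, so that the pointwise
  space has dimension exactly \<open>m * (k + 1)\<close>.\<close>

definition grid_point :: "real \<Rightarrow> real \<Rightarrow> nat \<Rightarrow> nat \<Rightarrow> real" where
  "grid_point a b m i = a + real i * (b - a) / real m"

definition grid_cell :: "real \<Rightarrow> real \<Rightarrow> nat \<Rightarrow> nat \<Rightarrow> real set" where
  "grid_cell a b m i =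
     (if Suc i = m then {grid_point a b m i..b}
      else {grid_point a b m i..<grid_point a b m (Suc i)})"

definition pw_poly :: "real \<Rightarrow> real \<Rightarrow> nat \<Rightarrow> nat \<Rightarrow> (real \<Rightarrow> real) set" where
  "pw_poly a b k m =
     {f. (\<forall>x. x \<notin> {a..b} \<longrightarrow> f x = 0) \<and>
         (\<forall>i<m. \<exists>q. degree q \<le> k \<and> (\<forall>x\<in>grid_cell a b m i. f x = poly q x))}"

definition pw_dim :: "nat \<Rightarrow> nat \<Rightarrow> nat" where
  "pw_dim k m = m * (k + 1)"

definition pw_onb :: "real \<Rightarrow> real \<Rightarrow> nat \<Rightarrow> nat \<Rightarrow> (nat \<Rightarrow> real \<Rightarrow> real) \<Rightarrow> bool" where
  "pw_onb a b k m \<phi> \<longleftrightarrow>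
     (\<forall>i<pw_dim k m. \<phi> i \<in> pw_poly a b k m) \<and>
     (\<forall>i<pw_dim k m. \<forall>j<pw_dim k m. eta_inner a b (\<phi> i) (\<phi> j) = (if i = j then 1 else 0)) \<and>
     (\<forall>f\<in>pw_poly a b k m. \<exists>c. \<forall>x. f x = (\<Sum>i<pw_dim k m. c i * \<phi> i x))"

definition D_const :: "real \<Rightarrow> real \<Rightarrow> nat \<Rightarrow> nat \<Rightarrow> ennreal" where
  "D_const a b k m = (SUP f\<in>{f \<in> pw_poly a b k m. eta_norm a b f = 1}. (Linf_norm a b f)\<^sup>2)"

definition model_set :: "real \<Rightarrow> real \<Rightarrow> nat \<Rightarrow> real \<Rightarrow> nat set" where
  "model_set a b k T = {m. 1 \<le> m \<and> D_const a b k m \<le> ennreal T}"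


section \<open>The estimators\<close>

text \<open>In this section \<open>\<phi> m i\<close> for \<open>i < pw_dim k m\<close> is the chosen orthonormal basis of
  \<open>pw_poly a b k m\<close>.\<close>

definition jump_average ::
    "real \<Rightarrow> real \<Rightarrow> (real \<Rightarrow> 'w \<Rightarrow> real) \<Rightarrow> real \<Rightarrow> 'w \<Rightarrow> (real \<Rightarrow> real) \<Rightarrow> real" where
  "jump_average a b X T \<omega> g =
     (1 / T) * (LINT z:{0..T} \<times> {a..b}|jump_measure X \<omega>. g (snd z))"

definition V_hat ::
    "real \<Rightarrow> real \<Rightarrow> nat \<Rightarrow> (nat \<Rightarrow> nat \<Rightarrow> real \<Rightarrow> real) \<Rightarrow> (real \<Rightarrow> 'w \<Rightarrow> real) \<Rightarrow>
     real \<Rightarrow> 'w \<Rightarrow> nat \<Rightarrow> real" where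
  "V_hat a b k \<phi> X T \<omega> m = jump_average a b X T \<omega> (\<lambda>x. \<Sum>i<pw_dim k m. (\<phi> m i x)\<^sup>2)"

definition proj_est ::
    "real \<Rightarrow> real \<Rightarrow> nat \<Rightarrow> (nat \<Rightarrow> nat \<Rightarrow> real \<Rightarrow> real) \<Rightarrow> (real \<Rightarrow> 'w \<Rightarrow> real) \<Rightarrow>
     real \<Rightarrow> 'w \<Rightarrow> nat \<Rightarrow> real \<Rightarrow> real" where
  "proj_est a b k \<phi> X T \<omega> m x =
     (\<Sum>i<pw_dim k m. jump_average a b X T \<omega> (\<phi> m i) * \<phi> m i x)"

definition penalty ::
    "real \<Rightarrow> real \<Rightarrow> nat \<Rightarrow> (nat \<Rightarrow> nat \<Rightarrow> real \<Rightarrow> real) \<Rightarrow> real \<Rightarrow> real \<Rightarrow> real \<Rightarrow>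
     (real \<Rightarrow> 'w \<Rightarrow> real) \<Rightarrow> real \<Rightarrow> 'w \<Rightarrow> nat \<Rightarrow> real" where
  "penalty a b k \<phi> c c' c'' X T \<omega> m =
     c * V_hat a b k \<phi> X T \<omega> m / T + c' * enn2real (D_const a b k m) / T
       + c'' * real (pw_dim k m) / T"

text \<open>A measurable choice of minimizers of the penalized criterion. Nothing is required of
  \<open>mhat T\<close> for the small \<open>T\<close> for which there is no admissible model.\<close>

definition model_selector ::
    "real \<Rightarrow> real \<Rightarrow> nat \<Rightarrow> (nat \<Rightarrow> nat \<Rightarrow> real \<Rightarrow> real) \<Rightarrow> real \<Rightarrow> real \<Rightarrow> real \<Rightarrow>
     'w measure \<Rightarrow> (real \<Rightarrow> 'w \<Rightarrow> real) \<Rightarrow> (real \<Rightarrow> 'w \<Rightarrow> nat) \<Rightarrow> bool" where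
  "model_selector a b k \<phi> c c' c'' M X mhat \<longleftrightarrow>
     (\<forall>T>0. model_set a b k T \<noteq> {} \<longrightarrow>
        mhat T \<in> measurable M (count_space UNIV) \<and>
        (AE \<omega> in M. is_arg_min
           (\<lambda>m. - (eta_norm a b (proj_est a b k \<phi> X T \<omega> m))\<^sup>2 + penalty a b k \<phi> c c' c'' X T \<omega> m)
           (\<lambda>m. m \<in> model_set a b k T) (mhat T \<omega>)))"

definition penalized_est ::
    "real \<Rightarrow> real \<Rightarrow> nat \<Rightarrow> (nat \<Rightarrow> nat \<Rightarrow> real \<Rightarrow> real) \<Rightarrow> (real \<Rightarrow> 'w \<Rightarrow> real) \<Rightarrow>
     (real \<Rightarrow> 'w \<Rightarrow> nat) \<Rightarrow> real \<Rightarrow> 'w \<Rightarrow> real \<Rightarrow> real" where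
  "penalized_est a b k \<phi> X mhat T \<omega> = proj_est a b k \<phi> X T \<omega> (mhat T \<omega>)"

definition risk ::
    "real \<Rightarrow> real \<Rightarrow> nat \<Rightarrow> (nat \<Rightarrow> nat \<Rightarrow> real \<Rightarrow> real) \<Rightarrow> 'w measure \<Rightarrow>
     (real \<Rightarrow> 'w \<Rightarrow> real) \<Rightarrow> (real \<Rightarrow> 'w \<Rightarrow> nat) \<Rightarrow> (real \<Rightarrow> real) \<Rightarrow> real \<Rightarrow> ennreal" where
  "risk a b k \<phi> M X mhat s T =
     (\<integral>\<^sup>+\<omega>. ennreal ((eta_norm a b (\<lambda>x. s x - penalized_est a b k \<phi> X mhat T \<omega> x))\<^sup>2) \<partial>M)"

end

theory Submission
  imports Defs
begin

text \<open>The sum of \<open>g\<close> over the jumps up to time \<open>T\<close> is the limit of the sums of \<open>g\<close> over the \<open>n\<close>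
  i.i.d. increments along the regular grid, for every \<open>g\<close> that vanishes outside \<open>[a,b]\<close> and is
  almost surely continuous at the jumps. Its mean is found through the Laplace transform, and
  bounds for fourth moments pass to the limit by Fatou's lemma. They are applied to the linear
  statistic \<open>W\<close> of the difference of two projections of \<open>s\<close>, and to the degenerate quadratic
  statistic \<open>U\<close> that remains after \<open>V_hat\<close> is subtracted from \<open>T\<close> times the squared stochastic
  error of a model.

  Comparison of the penalized criterion at the selected and at a reference model bounds the loss
  by the bias and penalty of the latter plus multiples of \<open>W\<^sup>4\<close> and \<open>U\<^sup>4\<close>. The penalty makes these
  so small that their means, summed over all \<open>m\<close> in the model set, are \<open>O(log T / T)\<close>, so no
  exponential concentration inequality is needed.

  The bias is at most of order \<open>m\<close> to the power \<open>-2 \<alpha>\<close>: on each cell \<open>s\<close> is approximated by the polynomial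
  with the same averages on equal subintervals. The difference between two successive dyadic
  refinements is controlled by the differences of \<open>s\<close> of order \<open>r = \<lfloor>\<alpha>\<rfloor> + 1\<close>. The choice of \<open>m\<close>
  of order \<open>T\<close> to the power \<open>1 / (2 \<alpha> + 1)\<close> balances bias and penalty.\<close>

section \<open>Sums over increments and over jumps\<close>

text \<open>The hypotheses give the law of the increments and, through
  \<open>has_levy_density\<close>, the expected number of jumps up to time 1, but not the Poisson
  structure of the jumps. Moments of jump sums are therefore obtained from random walks with
  \<open>n\<close> i.i.d. steps, uniformly in \<open>n\<close>, by means of functionals that grow in
  mean by a factor of at most \<open>1 + C / n\<close> per step.

  Why order four: there may be about \<open>T\<close> models, and second powers of \<open>W\<close>
  and \<open>U\<close> would contribute \<open>1 / T\<close> for each of them, a constant in total.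
  Fourth powers contribute \<open>1 / (m T)\<close>: the weight of \<open>W\<^sup>4\<close> is of
  order \<open>T / (m \<tau>\<^sup>2)\<close> and its mean of order
  \<open>\<tau>\<^sup>2 / T\<^sup>2\<close>; the weight of \<open>U\<^sup>4\<close> is of order
  \<open>1 / (m\<^sup>3 T)\<close> and its mean of order \<open>m\<^sup>2\<close>. What remains is a
  harmonic sum.\<close>

text \<open>On the left of \<open>t\<close> the path is close to its left limit, and from
  \<open>t\<close> on it is close to \<open>f t\<close>. An increment between two nearby times on
  the same side is thus too small for \<open>K\<close>, and one across \<open>t\<close> is close to
  the jump at \<open>t\<close>.\<close>

lemma cadlag_local:
  assumes f: "cadlag f" and K: "closed K" "0 \<notin> K" and t: "0 \<le> t"
  shows "\<exists>\<delta>>0. \<forall>u v. 0 \<le> u \<longrightarrow> u < v \<longrightarrow> \<bar>u - t\<bar> < \<delta> \<longrightarrow> \<bar>v - t\<bar> < \<delta> \<longrightarrow> f v - f u \<in> K \<longrightarrow>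
           0 < t \<and> f t - Lim (at_left t) f \<in> K \<and> u < t \<and> t \<le> v"
proof -
  obtain e where e: "e > 0" "\<And>x. \<bar>x\<bar> < e \<Longrightarrow> x \<notin> K"
  proof -
    have "open (-K)" "0 \<in> -K" using K by (auto simp: open_Compl)
    then obtain e where "e > 0" "ball 0 e \<subseteq> -K" by (meson open_contains_ball)
    then show ?thesis using that[of e] by (auto simp: subset_eq)
  qed
  have right: "(f \<longlongrightarrow> f t) (at_right t)"
    using f t by (auto simp: cadlag_def)
  then have "eventually (\<lambda>v. dist (f v) (f t) < e/2) (at_right t)"
    using e(1) by (intro tendstoD) auto
  then obtain d1 where d1: "d1 > t" "\<And>v. t < v \<Longrightarrow> v < d1 \<Longrightarrow> \<bar>f v - f t\<bar> < e/2"
    by (auto simp: eventually_at_right_field dist_real_def)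
  show ?thesis
  proof (cases "t = 0")
    case True
    show ?thesis
    proof (intro exI[of _ "d1 - t"] conjI allI impI)
      fix u v assume uv: "0 \<le> u" "u < v" "\<bar>u - t\<bar> < d1 - t" "\<bar>v - t\<bar> < d1 - t" "f v - f u \<in> K"
      have "\<bar>f v - f t\<bar> < e/2" using d1(2)[of v] uv True by auto
      moreover have "\<bar>f u - f t\<bar> < e/2" using d1(2)[of u] uv True e(1) by (cases "u = t") auto
      ultimately have "\<bar>f v - f u\<bar> < e" by linarith
      with e(2) uv(5) have False by auto
      then show "0 < t" "f t - Lim (at_left t) f \<in> K" "u < t" "t \<le> v" by auto
    qed (use d1 in auto)
  next
    case False
    with t have tp: "t > 0" by simp
    then obtain l where l: "(f \<longlongrightarrow> l) (at_left t)" using f by (auto simp: cadlag_def)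
    then have Lim: "Lim (at_left t) f = l" by (intro tendsto_Lim) auto
    \<comment> \<open>If the jump at \<open>t\<close> is outside the closed set \<open>K\<close>,
      then so is everything within distance \<open>e'\<close> of it, and no increment across
      \<open>t\<close> can fall into \<open>K\<close>.\<close>
    obtain e' where e': "e' > 0" "e' \<le> e" "f t - l \<notin> K \<Longrightarrow> (\<forall>x. \<bar>x - (f t - l)\<bar> < e' \<longrightarrow> x \<notin> K)"
    proof (cases "f t - l \<in> K")
      case True then show ?thesis using that[of e] e by auto
    next
      case False
      then have "f t - l \<in> - K" by simp
      then obtain e1 where e1: "e1 > 0" "ball (f t - l) e1 \<subseteq> - K"
        using K(1) open_contains_ball[of "-K"] by (auto simp: open_Compl)
      have "x \<notin> K" if "\<bar>x - (f t - l)\<bar> < e1" for x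
        using e1(2) that by (auto simp: subset_eq dist_real_def abs_minus_commute)
      then show ?thesis using that[of "min e e1"] e e1 by auto
    qed
    have "eventually (\<lambda>v. dist (f v) (f t) < e'/2) (at_right t)"
      using e'(1) right by (intro tendstoD) auto
    then obtain d1 where d1: "d1 > t" "\<And>v. t < v \<Longrightarrow> v < d1 \<Longrightarrow> \<bar>f v - f t\<bar> < e'/2"
      by (auto simp: eventually_at_right_field dist_real_def)
    have "eventually (\<lambda>v. dist (f v) l < e'/2) (at_left t)"
      using e'(1) l by (intro tendstoD) auto
    then obtain d2 where d2: "d2 < t" "\<And>v. d2 < v \<Longrightarrow> v < t \<Longrightarrow> \<bar>f v - l\<bar> < e'/2"
      by (auto simp: eventually_at_left_field dist_real_def)
    show ?thesis
    proof (intro exI[of _ "min (d1 - t) (t - d2)"] conjI allI impI)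
      fix u v assume uv: "0 \<le> u" "u < v" "\<bar>u - t\<bar> < min (d1 - t) (t - d2)"
        "\<bar>v - t\<bar> < min (d1 - t) (t - d2)" "f v - f u \<in> K"
      have L: "w < t \<Longrightarrow> w \<in> {u, v} \<Longrightarrow> \<bar>f w - l\<bar> < e'/2" for w using d2(2)[of w] uv by auto
      have Rt: "w \<ge> t \<Longrightarrow> w \<in> {u, v} \<Longrightarrow> \<bar>f w - f t\<bar> < e'/2" for w
        using d1(2)[of w] uv e'(1) by (cases "w = t") auto
      have nv: "\<not> v < t"
      proof
        assume "v < t"
        then have "\<bar>f u - l\<bar> < e'/2" "\<bar>f v - l\<bar> < e'/2" using L[of u] L[of v] uv(2) by auto
        then have "\<bar>f v - f u\<bar> < e'" by linarith
        with e(2) uv(5) e'(2) show False by force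
      qed
      have nu: "\<not> u \<ge> t"
      proof
        assume "u \<ge> t"
        then have "\<bar>f u - f t\<bar> < e'/2" "\<bar>f v - f t\<bar> < e'/2" using Rt[of u] Rt[of v] uv(2) by auto
        then have "\<bar>f v - f u\<bar> < e'" by linarith
        with e(2) uv(5) e'(2) show False by force
      qed
      have "\<bar>f u - l\<bar> < e'/2" "\<bar>f v - f t\<bar> < e'/2" using L[of u] Rt[of v] nv nu by auto
      then have "\<bar>(f v - f u) - (f t - l)\<bar> < e'" by linarith
      then have "f t - l \<in> K" using e'(3) uv(5) by blast
      then show "0 < t" "f t - Lim (at_left t) f \<in> K" "u < t" "t \<le> v"
        using tp nu nv Lim by auto
    qed (use d1 d2 in auto)
  qed
qed

text \<open>Jumps with sizes in \<open>{a..b}\<close> are isolated, and \<open>{0..T}\<close> is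
  compact. \<open>cadlag_local\<close> is applied to \<open>{a-e..b+e}\<close>, which still avoids
  0, because an increment that ends at a jump time only approximates the jump.\<close>

lemma finite_jumps:
  assumes f: "cadlag f" and ab: "0 \<notin> {a..b}"
  shows "finite {t. 0 < t \<and> t \<le> T \<and> f t - Lim (at_left t) f \<in> {a..b}}" (is "finite ?J")
proof (cases "a \<le> b")
  case True
  define e where "e = (if a > 0 then a/2 else -b/2)"
  have e: "e > 0" "0 \<notin> {a-e..b+e}" using ab True by (auto simp: e_def split: if_splits)
  have "\<exists>\<delta>>0. ?J \<inter> ball t \<delta> \<subseteq> {t}" if t: "t \<in> {0..T}" for t
  proof -
    from cadlag_local[OF f closed_atLeastAtMost e(2), of t] t obtain \<delta> where \<delta>: "\<delta> > 0"
      "\<And>u v. 0 \<le> u \<Longrightarrow> u < v \<Longrightarrow> \<bar>u - t\<bar> < \<delta> \<Longrightarrow> \<bar>v - t\<bar> < \<delta> \<Longrightarrow> f v - f u \<in> {a-e..b+e} \<Longrightarrow> u < t \<and> t \<le> v"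
      by auto
    have "t' = t" if t': "t' \<in> ?J" "\<bar>t' - t\<bar> < \<delta>" for t'
    proof -
      from t' f obtain l where l: "(f \<longlongrightarrow> l) (at_left t')" by (auto simp: cadlag_def)
      then have Lim: "Lim (at_left t') f = l" by (intro tendsto_Lim) auto
      have "eventually (\<lambda>v. dist (f v) l < e) (at_left t')" using l e(1) by (intro tendstoD) auto
      then obtain d2 where d2: "d2 < t'" "\<And>v. d2 < v \<Longrightarrow> v < t' \<Longrightarrow> \<bar>f v - l\<bar> < e"
        by (auto simp: eventually_at_left_field dist_real_def)
      \<comment> \<open>The increment from a time \<open>u\<close> shortly before \<open>t'\<close>
        to \<open>t'\<close> itself lies in the enlarged interval, so \<open>t\<close> is in
        \<open>{u<..t'}\<close>. As \<open>u\<close> may be arbitrarily close to \<open>t'\<close>,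
        this forces \<open>t' = t\<close>.\<close>
      have key: "u < t \<and> t \<le> t'" if u: "max (max 0 d2) (t - \<delta>) < u" "u < t'" for u
      proof (rule \<delta>(2))
        show "f t' - f u \<in> {a-e..b+e}" using d2(2)[of u] u t'(1) Lim by auto
      qed (use u t' in auto)
      have lt: "max (max 0 d2) (t - \<delta>) < t'" using t' d2 by auto
      then have "t \<le> t'" using key dense by blast
      moreover have "t' \<le> t"
      proof (rule ccontr)
        assume "\<not> t' \<le> t"
        then have "max (max (max 0 d2) (t - \<delta>)) t < t'" using lt by auto
        then obtain u where "max (max (max 0 d2) (t - \<delta>)) t < u" "u < t'" using dense by blast
        with key[of u] show False by auto
      qed
      ultimately show ?thesis by simp
    qed
    then show ?thesis using \<delta>(1) by (intro exI[of _ \<delta>]) (auto simp: dist_real_def abs_minus_commute)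
  qed
  then have "\<forall>t\<in>{0..T}. \<exists>\<delta>. \<delta> > 0 \<and> ?J \<inter> ball t \<delta> \<subseteq> {t}" by blast
  from bchoice[OF this] obtain D where D0: "\<forall>t\<in>{0..T}. D t > 0 \<and> ?J \<inter> ball t (D t) \<subseteq> {t}" ..
  then have D: "D t > 0 \<and> ?J \<inter> ball t (D t) \<subseteq> {t}" if "t \<in> {0..T}" for t using that by (rule bspec)
  have cover: "{0..T} \<subseteq> (\<Union>c\<in>{0..T}. ball c (D c))"
  proof
    fix t assume t: "t \<in> {0..T}"
    then have "t \<in> ball t (D t)" using D[OF t] by (simp only: centre_in_ball)
    with t show "t \<in> (\<Union>c\<in>{0..T}. ball c (D c))" by (rule UN_I)
  qed
  have op: "open (ball c (D c))" for c by simp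
  obtain C where C: "C \<subseteq> {0..T}" "finite C" "{0..T} \<subseteq> (\<Union>c\<in>C. ball c (D c))"
    using compactE_image[OF compact_Icc op cover] by blast
  have "?J \<subseteq> C"
  proof
    fix t assume t: "t \<in> ?J"
    then have "t \<in> (\<Union>c\<in>C. ball c (D c))" by (intro subsetD[OF C(3)]) simp
    then obtain c where "c \<in> C" "t \<in> ball c (D c)" by (rule UN_E)
    then have "t \<in> {c}" using subsetD[OF conjunct2[OF D[of c]], of t] subsetD[OF C(1), of c] t by simp
    then show "t \<in> C" using \<open>c \<in> C\<close> by simp
  qed
  then show ?thesis using C(2) finite_subset by blast
qed auto

text \<open>A Lebesgue number of the cover of \<open>{0..T}\<close> by the balls of
  \<open>cadlag_local\<close> is a uniform \<delta>: every shorter interval lies in one of the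
  balls.\<close>

lemma cadlag_uniform:
  assumes f: "cadlag f" and K: "closed K" "0 \<notin> K"
  shows "\<exists>\<delta>>0. \<forall>u v. 0 \<le> u \<longrightarrow> u < v \<longrightarrow> v \<le> T \<longrightarrow> v - u < \<delta> \<longrightarrow> f v - f u \<in> K \<longrightarrow>
           (\<exists>t. 0 < t \<and> f t - Lim (at_left t) f \<in> K \<and> u < t \<and> t \<le> v)"
proof -
  have "\<forall>t\<in>{0..T}. \<exists>\<delta>>0. \<forall>u v. 0 \<le> u \<longrightarrow> u < v \<longrightarrow> \<bar>u - t\<bar> < \<delta> \<longrightarrow> \<bar>v - t\<bar> < \<delta> \<longrightarrow> f v - f u \<in> K \<longrightarrow>
           0 < t \<and> f t - Lim (at_left t) f \<in> K \<and> u < t \<and> t \<le> v"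
    using cadlag_local[OF f K] by auto
  from bchoice[OF this] obtain D where D: "\<And>t. t \<in> {0..T} \<Longrightarrow> D t > 0"
    "\<And>t u v. t \<in> {0..T} \<Longrightarrow> 0 \<le> u \<Longrightarrow> u < v \<Longrightarrow> \<bar>u - t\<bar> < D t \<Longrightarrow> \<bar>v - t\<bar> < D t \<Longrightarrow> f v - f u \<in> K \<Longrightarrow>
           0 < t \<and> f t - Lim (at_left t) f \<in> K \<and> u < t \<and> t \<le> v"
    by (elim exE) blast
  show ?thesis
  proof (cases "T \<ge> 0")
    case False
    then show ?thesis by (intro exI[of _ 1]) auto
  next
    case True
    have sub: "{0..T} \<subseteq> \<Union>((\<lambda>t. ball t (D t)) ` {0..T})"
    proof
      fix t assume t: "t \<in> {0..T}"
      then have "t \<in> ball t (D t)" using D(1)[OF t] by (simp only: centre_in_ball)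
      with t show "t \<in> \<Union>((\<lambda>t. ball t (D t)) ` {0..T})" by (rule UN_I)
    qed
    have ne: "(\<lambda>t. ball t (D t)) ` {0..T} \<noteq> {}" using True by auto
    have op: "\<And>B. B \<in> (\<lambda>t. ball t (D t)) ` {0..T} \<Longrightarrow> open B" by auto
    obtain \<epsilon> where \<epsilon>: "\<epsilon> > 0"
      "\<And>U. U \<subseteq> {0..T} \<Longrightarrow> diameter U < \<epsilon> \<Longrightarrow> \<exists>B\<in>(\<lambda>t. ball t (D t)) ` {0..T}. U \<subseteq> B"
      by (rule Lebesgue_number_lemma[OF compact_Icc ne sub op]) blast+
    show ?thesis
    proof (rule exI[of _ \<epsilon>], intro conjI allI impI)
      fix u v assume uv: "0 \<le> u" "u < v" "v \<le> T" "v - u < \<epsilon>" "f v - f u \<in> K"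
      have "{u..v} \<subseteq> {0..T}" "diameter {u..v} < \<epsilon>" using uv by auto
      from \<epsilon>(2)[OF this] obtain t where t: "t \<in> {0..T}" "{u..v} \<subseteq> ball t (D t)" by (elim bexE imageE) simp
      have "u \<in> ball t (D t)" by (rule subsetD[OF t(2)]) (use uv in simp)
      moreover have "v \<in> ball t (D t)" by (rule subsetD[OF t(2)]) (use uv in simp)
      ultimately
      have "\<bar>u - t\<bar> < D t" "\<bar>v - t\<bar> < D t" by (simp_all add: dist_real_def abs_minus_commute)
      from D(2)[OF t(1) uv(1,2) this uv(5)]
      show "\<exists>t. 0 < t \<and> f t - Lim (at_left t) f \<in> K \<and> u < t \<and> t \<le> v" by blast
    qed (rule \<epsilon>)
  qed
qed

text \<open>On a fine grid, an increment with value in \<open>{a..b}\<close> contains a jump with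
  size in \<open>{a..b}\<close>, and different jumps lie in different grid intervals. The sum then
  runs over finitely many increments, each of which converges to its jump.\<close>

lemma sum_increments_tendsto_sum_jumps:
  fixes f g :: "real \<Rightarrow> real"
  assumes f: "cadlag f" and ab: "0 \<notin> {a..b}" and T: "T > 0"
    and g: "\<And>x. x \<notin> {a..b} \<Longrightarrow> g x = 0"
    and cont: "\<And>t. 0 < t \<Longrightarrow> t \<le> T \<Longrightarrow> f t - Lim (at_left t) f \<in> {a..b} \<Longrightarrow>
                 isCont g (f t - Lim (at_left t) f)"
  shows "(\<lambda>n. \<Sum>i<n. g (f (real (Suc i) * T / real n) - f (real i * T / real n)))
           \<longlonglongrightarrow> (\<Sum>t\<in>{t. 0 < t \<and> t \<le> T \<and> f t - Lim (at_left t) f \<in> {a..b}}. g (f t - Lim (at_left t) f))"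
proof -
  define jp where "jp t = f t - Lim (at_left t) f" for t
  define J where "J = {t. 0 < t \<and> t \<le> T \<and> jp t \<in> {a..b}}"
  have finJ: "finite J" using finite_jumps[OF f ab] by (simp add: J_def jp_def)
  obtain \<delta> where \<delta>: "\<delta> > 0" "\<And>u v. 0 \<le> u \<Longrightarrow> u < v \<Longrightarrow> v \<le> T \<Longrightarrow> v - u < \<delta> \<Longrightarrow> f v - f u \<in> {a..b} \<Longrightarrow>
           (\<exists>t. 0 < t \<and> jp t \<in> {a..b} \<and> u < t \<and> t \<le> v)"
    using cadlag_uniform[OF f closed_atLeastAtMost ab, of T] unfolding jp_def by auto
  obtain \<gamma> where \<gamma>: "\<gamma> > 0" "\<And>s t. s \<in> J \<Longrightarrow> t \<in> J \<Longrightarrow> s \<noteq> t \<Longrightarrow> \<gamma> \<le> \<bar>s - t\<bar>"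
  proof (cases "J = {}")
    case True then show ?thesis using that[of 1] by auto
  next
    case False
    have fin: "finite (insert 1 ((\<lambda>(s,t). \<bar>s - t\<bar>) ` ((J \<times> J) \<inter> {(s,t). s \<noteq> t})))" (is "finite ?S")
      using finJ by auto
    have "Min ?S > 0" using fin by (auto)
    moreover have "Min ?S \<le> \<bar>s - t\<bar>" if "s \<in> J" "t \<in> J" "s \<noteq> t" for s t
      using fin that by (intro Min_le) auto
    ultimately show ?thesis using that by blast
  qed
  \<comment> \<open>The jump time \<open>t\<close> lies in the grid interval with number
    \<open>idx n t\<close>, taken open on the left and closed on the right. The ceiling is at least
    1 because \<open>t > 0\<close>, so the natural subtraction is exact.\<close>
  define idx where "idx n t = nat (\<lceil>t * real n / T\<rceil>) - 1" for n t
  have idx: "idx n t < n \<and> real (idx n t) * T / real n < t \<and> t \<le> real (Suc (idx n t)) * T / real n"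
    if t: "t \<in> J" and n: "n > 0" for n t
  proof -
    have pos: "t * real n / T > 0" using t n T by (auto simp: J_def)
    define z where "z = \<lceil>t * real n / T\<rceil>"
    have z: "z \<ge> 1" using pos by (simp add: z_def)
    then have S: "real (Suc (idx n t)) = of_int z" "real (idx n t) = of_int z - 1"
      unfolding idx_def z_def[symmetric] by linarith+
    have zz: "of_int z - 1 < t * real n / T" "t * real n / T \<le> of_int z"
      unfolding z_def by linarith+
    have "t * real n / T \<le> real n" using t T n by (auto simp: J_def field_simps)
    then have "of_int z - 1 < real n" using zz by linarith
    moreover have "(of_int z - 1) * T / real n < t" "t \<le> of_int z * T / real n"
      using zz T n by (simp_all add: field_simps)
    ultimately show ?thesis using S by auto
  qed
  define inc where "inc n i = f (real (Suc i) * T / real n) - f (real i * T / real n)" for n i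
  have ev: "eventually (\<lambda>n. (\<Sum>i<n. g (inc n i)) = (\<Sum>t\<in>J. g (inc n (idx n t)))) sequentially"
  proof -
    have "(\<lambda>n. T / real n) \<longlonglongrightarrow> 0" using tendsto_divide_0[OF tendsto_const filterlim_real_at_infinity_sequentially] by (simp add: filterlim_at_top_imp_at_infinity)
    then have "eventually (\<lambda>n. T / real n < min \<delta> \<gamma>) sequentially"
      using order_tendstoD(2)[of "\<lambda>n. T / real n" 0 sequentially "min \<delta> \<gamma>"] \<delta>(1) \<gamma>(1) by auto
    then show ?thesis using eventually_gt_at_top[of 0]
    proof eventually_elim
      case (elim n)
      then have n: "n > 0" and h: "T / real n < \<delta>" "T / real n < \<gamma>" by auto
      have inj: "inj_on (idx n) J"
      proof (rule inj_onI, rule ccontr)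
        fix s t assume st: "s \<in> J" "t \<in> J" "idx n s = idx n t" "s \<noteq> t"
        have "real (Suc (idx n t)) * T / real n - real (idx n t) * T / real n = T / real n"
          using n by (simp add: field_simps)
        moreover have "real (idx n t) * T / real n < s" "s \<le> real (Suc (idx n t)) * T / real n"
          using idx[OF st(1) n] unfolding st(3) by blast+
        moreover have "real (idx n t) * T / real n < t" "t \<le> real (Suc (idx n t)) * T / real n"
          using idx[OF st(2) n] by blast+
        ultimately have "\<bar>s - t\<bar> < T / real n" by linarith
        then show False using \<gamma>(2)[OF st(1,2,4)] h by linarith
      qed
      have sub: "idx n ` J \<subseteq> {..<n}" using idx n by auto
      have "g (inc n i) = 0" if i: "i \<in> {..<n} - idx n ` J" for i
      proof (rule g, rule notI)
        assume inK: "inc n i \<in> {a..b}"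
        let ?u = "real i * T / real n" and ?v = "real (Suc i) * T / real n"
        have d: "?v - ?u = T / real n" using n by (simp add: field_simps)
        have "?v \<le> T"
        proof -
          have "real (Suc i) \<le> real n" using i by auto
          then have "real (Suc i) * T \<le> real n * T" using T by (intro mult_right_mono) auto
          then show ?thesis using n by (simp add: divide_le_eq mult.commute)
        qed
        moreover have "0 \<le> ?u" using T by simp
        moreover have "?u < ?v" using d n T by (smt (verit) divide_pos_pos of_nat_0_less_iff)
        ultimately obtain t where t: "0 < t" "jp t \<in> {a..b}" "?u < t" "t \<le> ?v"
          using \<delta>(2)[of ?u ?v] inK h(1) unfolding inc_def d by blast
        have tJ: "t \<in> J" using t \<open>?v \<le> T\<close> by (auto simp: J_def)
        have "real (idx n t) < real (Suc i)" "real i < real (Suc (idx n t))"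
        proof -
          have "real (idx n t) * T / real n < ?v" "?u < real (Suc (idx n t)) * T / real n"
            using idx[OF tJ n] t by linarith+
          then show "real (idx n t) < real (Suc i)" "real i < real (Suc (idx n t))"
            using n T by (simp_all add: divide_less_cancel)
        qed
        then have "idx n t = i" by linarith
        then show False using tJ i by auto
      qed
      then have "(\<Sum>i<n. g (inc n i)) = (\<Sum>i\<in>idx n ` J. g (inc n i))"
        using sub by (intro sum.mono_neutral_right) auto
      also have "\<dots> = (\<Sum>t\<in>J. g (inc n (idx n t)))" using inj by (simp add: sum.reindex)
      finally show ?case .
    qed
  qed
  have "(\<lambda>n. \<Sum>t\<in>J. g (inc n (idx n t))) \<longlonglongrightarrow> (\<Sum>t\<in>J. g (jp t))"
  proof (rule tendsto_sum)
    fix t assume t: "t \<in> J"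
    have t0: "t > 0" using t by (auto simp: J_def)
    from f t0 obtain l where l: "(f \<longlongrightarrow> l) (at_left t)" by (auto simp: cadlag_def)
    have jpt: "jp t = f t - l" unfolding jp_def using tendsto_Lim[OF _ l] by simp
    have r: "(f \<longlongrightarrow> f t) (at_right t)" using f t0 by (auto simp: cadlag_def)
    have inv0: "(\<lambda>n. T / real n) \<longlonglongrightarrow> 0" using tendsto_divide_0[OF tendsto_const filterlim_real_at_infinity_sequentially] by (simp add: filterlim_at_top_imp_at_infinity)
    have dif: "real (Suc (idx n t)) * T / real n = real (idx n t) * T / real n + T / real n" for n
      by (simp add: field_simps add_divide_distrib)
    have evn: "eventually (\<lambda>n::nat. n > 0) sequentially" by (rule eventually_gt_at_top)
    have u0: "(\<lambda>n. real (idx n t) * T / real n) \<longlonglongrightarrow> t"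
    proof (rule tendsto_sandwich[of "\<lambda>n. t - T / real n" _ _ "\<lambda>n. t"])
      show "eventually (\<lambda>n. t - T / real n \<le> real (idx n t) * T / real n) sequentially"
        using evn
      proof eventually_elim
        case (elim n) then show ?case using idx[OF t elim] dif[of n] by linarith
      qed
      show "eventually (\<lambda>n. real (idx n t) * T / real n \<le> t) sequentially"
        using evn
      proof eventually_elim
        case (elim n) then show ?case using idx[OF t elim] by linarith
      qed
      show "(\<lambda>n. t - T / real n) \<longlonglongrightarrow> t" using tendsto_diff[OF tendsto_const inv0, of t] by simp
    qed simp
    have u: "filterlim (\<lambda>n. real (idx n t) * T / real n) (at_left t) sequentially"
      unfolding filterlim_at
    proof
      show "\<forall>\<^sub>F x in sequentially. real (idx x t) * T / real x \<in> {..<t} \<and> real (idx x t) * T / real x \<noteq> t"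
        using evn
      proof eventually_elim
        case (elim n) then show ?case using idx[OF t elim] by simp
      qed
    qed (rule u0)
    have v0: "(\<lambda>n. real (Suc (idx n t)) * T / real n) \<longlonglongrightarrow> t"
      unfolding dif using tendsto_add[OF u0 inv0] by simp
    \<comment> \<open>The right end point of the grid interval may equal \<open>t\<close>, so its
      limit is taken within \<open>{t..}\<close>. The left end point is strictly smaller than
      \<open>t\<close>, so \<open>at_left t\<close> serves there.\<close>
    have fv: "(\<lambda>n. f (real (Suc (idx n t)) * T / real n)) \<longlonglongrightarrow> f t"
    proof -
      have "(f \<longlongrightarrow> f t) (at t within {t..})"
        using r by (auto simp: tendsto_within_open_NO_MATCH at_within_Ici_at_right)
      then have "continuous (at t within {t..}) f" by (simp add: continuous_within)
      moreover have "\<forall>\<^sub>F n in sequentially. real (Suc (idx n t)) * T / real n \<in> {t..}"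
        using evn
      proof eventually_elim
        case (elim n) then show ?case using idx[OF t elim] by simp
      qed
      ultimately show ?thesis
        using v0 by (intro continuous_within_tendsto_compose[of t "{t..}" f])
    qed
    have fu: "(\<lambda>n. f (real (idx n t) * T / real n)) \<longlonglongrightarrow> l"
      using filterlim_compose[OF l u] .
    have "(\<lambda>n. inc n (idx n t)) \<longlonglongrightarrow> jp t"
      unfolding inc_def jpt by (rule tendsto_diff[OF fv fu])
    then show "(\<lambda>n. g (inc n (idx n t))) \<longlonglongrightarrow> g (jp t)"
      using cont t by (intro isCont_tendsto_compose[of _ g]) (auto simp: J_def jp_def)
  qed
  then have "(\<lambda>n. \<Sum>i<n. g (inc n i)) \<longlonglongrightarrow> (\<Sum>t\<in>J. g (jp t))"
    using tendsto_cong[OF ev] by blast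
  then show ?thesis unfolding inc_def J_def jp_def .
qed

section \<open>Jump sums, increment sums and the law of the increments\<close>

text \<open>Polymorphic, because both real and \<open>ennreal\<close> values of \<open>g\<close>
  occur. If infinitely many jumps qualify, the value is the default 0 of \<open>sum\<close>; on
  cadlag paths the index set is finite when \<open>{a..b}\<close> avoids 0.\<close>

definition jump_sum :: "(real \<Rightarrow> 'w \<Rightarrow> real) \<Rightarrow> real \<Rightarrow> real \<Rightarrow> real \<Rightarrow> (real \<Rightarrow> 'c::comm_monoid_add) \<Rightarrow> 'w \<Rightarrow> 'c" where
  "jump_sum X a b T g \<omega> = (\<Sum>t\<in>{t. 0 < t \<and> t \<le> T \<and> jump X t \<omega> \<in> {a..b}}. g (jump X t \<omega>))"

definition incr_sum :: "(real \<Rightarrow> 'w \<Rightarrow> real) \<Rightarrow> real \<Rightarrow> nat \<Rightarrow> (real \<Rightarrow> 'c::comm_monoid_add) \<Rightarrow> 'w \<Rightarrow> 'c" where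
  "incr_sum X T n g \<omega> = (\<Sum>i<n. g (X (real (Suc i) * T / real n) \<omega> - X (real i * T / real n) \<omega>))"

text \<open>Jump sums are limits of increment sums only off a null set, on which they are arbitrary.
  Hence they are shown to be measurable for the completion of \<open>M\<close>.\<close>

lemma measurable_completion_AE_eq:
  fixes f g :: "'w \<Rightarrow> 'c::topological_space"
  assumes "g \<in> borel_measurable (completion M)" "AE x in M. f x = g x"
  shows "f \<in> borel_measurable (completion M)"
proof (rule measurableI)
  fix A :: "'c set" assume A: "A \<in> sets borel"
  have 1: "Measurable.pred (completion M) (\<lambda>x. f x \<noteq> g x)"
    by (rule sets_completion_AE) (use assms(2) in auto)
  have s1: "{x \<in> space M. f x \<noteq> g x} \<in> sets (completion M)"
    using 1 by (simp add: pred_def)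
  have nl: "{x \<in> space M. f x \<noteq> g x} \<in> null_sets (completion M)"
    using AE_iff_null_sets[OF s1] assms(2) by (auto simp: AE_completion_iff)
  then obtain N where N: "N \<in> null_sets M" "{x \<in> space M. f x \<noteq> g x} \<subseteq> N"
    by (auto simp: null_sets_completion_iff2)
  have sub: "f -` A \<inter> space M \<inter> {x\<in>space M. f x \<noteq> g x} \<in> sets (completion M)"
    by (rule null_sets_completion[OF N(1)]) (use N(2) in auto)
  have gA: "g -` A \<inter> space M \<in> sets (completion M)"
    using measurable_sets[OF assms(1) A] by simp
  have "f -` A \<inter> space (completion M) =
     (g -` A \<inter> space M - {x\<in>space M. f x \<noteq> g x}) \<union> (f -` A \<inter> space M \<inter> {x\<in>space M. f x \<noteq> g x})"
    by auto
  also have "\<dots> \<in> sets (completion M)" using sub gA s1 by auto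
  finally show "f -` A \<inter> space (completion M) \<in> sets (completion M)" .
qed auto

locale levy_jumps =
  fixes M :: "'w measure" and X :: "real \<Rightarrow> 'w \<Rightarrow> real" and s :: "real \<Rightarrow> real"
  assumes levy: "levy_process M X" and dens: "has_levy_density M X s"
begin

sublocale prob_space M
  using levy by (simp add: levy_process_def)

lemma measurable_X [measurable]: "0 \<le> t \<Longrightarrow> X t \<in> borel_measurable M"
  using levy by (simp add: levy_process_def)

lemma AE_cadlag: "AE \<omega> in M. cadlag (\<lambda>t. X t \<omega>)"
  using levy by (simp add: levy_process_def)

lemma levy_indep:
  "0 \<le> t 0 \<and> (\<forall>i<n. t i \<le> t (Suc i)) \<Longrightarrow>
     indep_vars (\<lambda>_. borel) (\<lambda>i \<omega>. X (t (Suc i)) \<omega> - X (t i) \<omega>) {..<n}"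
  using levy unfolding levy_process_def by blast

lemma levy_stationary:
  "0 \<le> u \<Longrightarrow> 0 \<le> t \<Longrightarrow> distr M borel (\<lambda>\<omega>. X (u + t) \<omega> - X u \<omega>) = distr M borel (X t)"
  using levy unfolding levy_process_def by blast

lemma borel_s [measurable]: "s \<in> borel_measurable borel"
  using dens by (simp add: has_levy_density_def levy_density_def)

lemma s_nonneg: "x \<noteq> 0 \<Longrightarrow> 0 \<le> s x"
  using dens by (simp add: has_levy_density_def levy_density_def)

lemma measurable_incr_sum:
  fixes g :: "real \<Rightarrow> 'c::{second_countable_topology, topological_comm_monoid_add}"
  assumes [measurable]: "g \<in> borel_measurable borel" and T: "0 < T"
  shows "incr_sum X T n g \<in> borel_measurable M"
proof -
  have [measurable]: "X (real i * T / real n) \<in> borel_measurable M" for i using T by (intro measurable_X) auto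
  show ?thesis unfolding incr_sum_def by measurable
qed

lemma finite_jump_set:
  assumes "cadlag (\<lambda>t. X t \<omega>)" "0 \<notin> {a..b}"
  shows "finite {t. 0 < t \<and> t \<le> T \<and> jump X t \<omega> \<in> {a..b}}"
  using finite_jumps[OF assms, of T] by (simp add: jump_def)

lemma incr_sum_tendsto:
  assumes "0 \<notin> {a..b}" "0 < T" "\<And>x. x \<notin> {a..b} \<Longrightarrow> g x = 0"
    and "AE \<omega> in M. \<forall>t. 0 < t \<longrightarrow> jump X t \<omega> \<in> {a..b} \<longrightarrow> isCont g (jump X t \<omega>)"
  shows "AE \<omega> in M. (\<lambda>n. incr_sum X T n g \<omega>) \<longlonglongrightarrow> jump_sum X a b T (g :: real \<Rightarrow> real) \<omega>"
  using AE_cadlag assms(4)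
proof eventually_elim
  case (elim \<omega>)
  show ?case
    unfolding incr_sum_def jump_sum_def jump_def
    by (rule sum_increments_tendsto_sum_jumps) (use elim assms in \<open>auto simp: jump_def\<close>)
qed

lemma measurable_jump_sum_tendsto:
  assumes "0 < T" and [measurable]: "g \<in> borel_measurable borel"
    and "AE \<omega> in M. (\<lambda>n. incr_sum X T n g \<omega>) \<longlonglongrightarrow> jump_sum X a b T (g :: real \<Rightarrow> real) \<omega>"
  shows "jump_sum X a b T g \<in> borel_measurable (completion M)"
proof (rule measurable_completion_AE_eq)
  show "(\<lambda>\<omega>. lim (\<lambda>n. incr_sum X T n g \<omega>)) \<in> borel_measurable (completion M)"
    by (intro measurable_completion borel_measurable_lim_metric measurable_incr_sum assms)
  show "AE \<omega> in M. jump_sum X a b T g \<omega> = lim (\<lambda>n. incr_sum X T n g \<omega>)"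
    using assms(3) by eventually_elim (simp add: limI)
qed

text \<open>Independence and stationarity turn the increments over the grid into a sample from the
  law of \<open>X (T / real n)\<close>. The restriction to \<open>{..<n}\<close> makes the vector a
  point of the extensional product space.\<close>

lemma incr_distr:
  assumes T: "0 < T" and n: "0 < n"
    and F[measurable]: "F \<in> borel_measurable (PiM {..<n} (\<lambda>_. borel))"
  shows "(\<integral>\<^sup>+\<omega>. F (\<lambda>i\<in>{..<n}. X (real (Suc i) * T / real n) \<omega> - X (real i * T / real n) \<omega>) \<partial>M)
     = (\<integral>\<^sup>+x. F x \<partial>PiM {..<n} (\<lambda>_. distr M borel (X (T / real n))))"
proof -
  let ?Y = "\<lambda>i \<omega>. X (real (Suc i) * T / real n) \<omega> - X (real i * T / real n) \<omega>"
  have t1: "X (real i * T / real n) \<in> borel_measurable M" for i using T by (intro measurable_X) auto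
  have rv: "random_variable borel (?Y i)" for i using t1[of i] t1[of "Suc i"] by measurable
  have "indep_vars (\<lambda>_. borel) ?Y {..<n}"
  proof -
    have "0 \<le> (\<lambda>i. real i * T / real n) 0 \<and> (\<forall>i<n. (\<lambda>i. real i * T / real n) i \<le> (\<lambda>i. real i * T / real n) (Suc i))"
      using T n by (auto simp: divide_simps mult_right_mono)
    from levy_indep[OF this] show ?thesis .
  qed
  then have D: "distr M (PiM {..<n} (\<lambda>_. borel)) (\<lambda>x. \<lambda>i\<in>{..<n}. ?Y i x) = (PiM {..<n} (\<lambda>i. distr M borel (?Y i)))"
    using n by (subst (asm) indep_vars_iff_distr_eq_PiM') (use n rv in \<open>auto simp del: of_nat_Suc\<close>)
  have Y: "distr M borel (?Y i) = distr M borel (X (T / real n))" for i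
  proof -
    have "real (Suc i) * T / real n = real i * T / real n + T / real n" by (simp add: field_simps add_divide_distrib)
    then show ?thesis using levy_stationary[of "real i * T / real n" "T / real n"] T by simp
  qed
  have "(\<integral>\<^sup>+\<omega>. F (\<lambda>i\<in>{..<n}. ?Y i \<omega>) \<partial>M) = (\<integral>\<^sup>+x. F x \<partial>distr M (PiM {..<n} (\<lambda>_. borel)) (\<lambda>x. \<lambda>i\<in>{..<n}. ?Y i x))"
    by (subst nn_integral_distr) (use rv in measurable)
  also have "\<dots> = (\<integral>\<^sup>+x. F x \<partial>PiM {..<n} (\<lambda>_. distr M borel (X (T / real n))))"
    unfolding D Y ..
  finally show ?thesis .
qed

end

section \<open>Bounds by iteration over independent steps\<close>

text \<open>Integrating out the last coordinate replaces \<open>F (Suc n)\<close> by at most \<rho>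
  times \<open>F n\<close>. This controls a functional of a random walk whose conditional mean is
  multiplied by at most \<rho> in each step.\<close>

lemma nn_integral_PiM_iterate_le:
  fixes \<pi> :: "real measure" and F :: "nat \<Rightarrow> (nat \<Rightarrow> real) \<Rightarrow> ennreal"
  assumes "prob_space \<pi>" and sets: "sets \<pi> = sets borel"
    and F: "\<And>n. F n \<in> borel_measurable (PiM {..<n} (\<lambda>_. borel))"
    and step: "\<And>n x. (\<integral>\<^sup>+y. F (Suc n) (x(n := y)) \<partial>\<pi>) \<le> \<rho> * F n x"
  shows "(\<integral>\<^sup>+x. F n x \<partial>PiM {..<n} (\<lambda>_. \<pi>)) \<le> \<rho> ^ n * F 0 (\<lambda>_. undefined)"
proof (induction n)
  case 0
  show ?case by (simp add: lessThan_0 PiM_empty nn_integral_count_space_finite)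
next
  case (Suc n)
  interpret prob_space \<pi> by fact
  interpret product_sigma_finite "\<lambda>_::nat. \<pi>" by standard
  have S: "sets (PiM {..<n} (\<lambda>_. \<pi>)) = sets (PiM {..<n} (\<lambda>_. borel))" for n
    by (rule sets_PiM_cong) (auto simp: sets)
  have F': "F n \<in> borel_measurable (PiM {..<n} (\<lambda>_. \<pi>))" for n
    using F[of n] measurable_cong_sets[OF S refl] by blast
  have I: "{..<Suc n} = insert n {..<n}" by auto
  have "(\<integral>\<^sup>+x. F (Suc n) x \<partial>PiM {..<Suc n} (\<lambda>_. \<pi>)) = (\<integral>\<^sup>+x. (\<integral>\<^sup>+y. F (Suc n) (x(n := y)) \<partial>\<pi>) \<partial>PiM {..<n} (\<lambda>_. \<pi>))"
    using F'[of "Suc n"] unfolding I by (subst product_nn_integral_insert) auto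
  also have "\<dots> \<le> (\<integral>\<^sup>+x. \<rho> * F n x \<partial>PiM {..<n} (\<lambda>_. \<pi>))"
    by (intro nn_integral_mono step)
  also have "\<dots> = \<rho> * (\<integral>\<^sup>+x. F n x \<partial>PiM {..<n} (\<lambda>_. \<pi>))"
    using F' by (subst nn_integral_cmult) auto
  also have "\<dots> \<le> \<rho> * (\<rho> ^ n * F 0 (\<lambda>_. undefined))" by (intro mult_left_mono Suc.IH) auto
  finally show ?case by (simp add: mult.assoc)
qed

context levy_jumps begin

lemma nn_integral_incr_iterate_le:
  assumes T: "0 < T" and n: "0 < n"
    and F: "\<And>n. F n \<in> borel_measurable (PiM {..<n} (\<lambda>_. borel))"
    and step: "\<And>j x. (\<integral>\<^sup>+\<omega>. F (Suc j) (x(j := X (T / real n) \<omega>)) \<partial>M) \<le> \<rho> * F j x"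
    and meas: "\<And>j x. (\<lambda>y. F (Suc j) (x(j := y))) \<in> borel_measurable borel"
  shows "(\<integral>\<^sup>+\<omega>. F n (\<lambda>i\<in>{..<n}. X (real (Suc i) * T / real n) \<omega> - X (real i * T / real n) \<omega>) \<partial>M)
     \<le> \<rho> ^ n * F 0 (\<lambda>_. undefined)"
proof -
  have m: "X (T / real n) \<in> borel_measurable M" using T by (intro measurable_X) auto
  have "(\<integral>\<^sup>+x. F n x \<partial>PiM {..<n} (\<lambda>_. distr M borel (X (T / real n)))) \<le> \<rho> ^ n * F 0 (\<lambda>_. undefined)"
  proof (rule nn_integral_PiM_iterate_le)
    show "(\<integral>\<^sup>+y. F (Suc j) (x(j := y)) \<partial>distr M borel (X (T / real n))) \<le> \<rho> * F j x" for j x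
      using step[of j x] nn_integral_distr[OF m, of "\<lambda>y. F (Suc j) (x(j := y))"] meas[of j x] by simp
  qed (use m in \<open>auto intro!: prob_space_distr F\<close>)
  then show ?thesis using incr_distr[OF T n F] by simp
qed

text \<open>The factor \<open>1 + C / real n\<close> per step accumulates to at most
  \<open>exp C\<close>, uniformly in \<open>n\<close>. The moment bounds below come from choices of
  \<open>F\<close> that have such a step.\<close>

lemma incr_iterate_le:
  fixes F :: "nat \<Rightarrow> (nat \<Rightarrow> real) \<Rightarrow> real"
  assumes T: "0 < T" and n: "0 < n" and C: "0 \<le> C"
    and F: "\<And>n. F n \<in> borel_measurable (PiM {..<n} (\<lambda>_. borel))"
    and pos: "\<And>j x. 0 \<le> F j x"
    and int: "\<And>j x. integrable M (\<lambda>\<omega>. F (Suc j) (x(j := X (T / real n) \<omega>)))"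
    and step: "\<And>j x. (\<integral>\<omega>. F (Suc j) (x(j := X (T / real n) \<omega>)) \<partial>M) \<le> (1 + C / real n) * F j x"
    and meas: "\<And>j x. (\<lambda>y. F (Suc j) (x(j := y))) \<in> borel_measurable borel"
  shows "(\<integral>\<^sup>+\<omega>. ennreal (F n (\<lambda>i\<in>{..<n}. X (real (Suc i) * T / real n) \<omega> - X (real i * T / real n) \<omega>)) \<partial>M)
     \<le> ennreal (exp C * F 0 (\<lambda>_. undefined))"
proof -
  have st: "(\<integral>\<^sup>+\<omega>. ennreal (F (Suc j) (x(j := X (T / real n) \<omega>))) \<partial>M) \<le> ennreal (1 + C / real n) * ennreal (F j x)" for j x
  proof -
    have "(\<integral>\<^sup>+\<omega>. ennreal (F (Suc j) (x(j := X (T / real n) \<omega>))) \<partial>M)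
      = ennreal (\<integral>\<omega>. F (Suc j) (x(j := X (T / real n) \<omega>)) \<partial>M)"
      by (rule nn_integral_eq_integral[OF int]) (simp add: pos)
    also have "\<dots> \<le> ennreal ((1 + C / real n) * F j x)" by (rule ennreal_leI[OF step])
    finally show ?thesis using C pos by (simp add: ennreal_mult)
  qed
  have "(\<integral>\<^sup>+\<omega>. ennreal (F n (\<lambda>i\<in>{..<n}. X (real (Suc i) * T / real n) \<omega> - X (real i * T / real n) \<omega>)) \<partial>M)
     \<le> ennreal (1 + C / real n) ^ n * ennreal (F 0 (\<lambda>_. undefined))"
    by (rule nn_integral_incr_iterate_le[where F = "\<lambda>j x. ennreal (F j x)", OF T n _ st]) (use F meas in auto)
  also have "\<dots> = ennreal ((1 + C / real n) ^ n * F 0 (\<lambda>_. undefined))"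
    using C pos by (subst ennreal_power) (simp_all add: ennreal_mult del: ennreal_plus)
  also have "\<dots> \<le> ennreal (exp C * F 0 (\<lambda>_. undefined))"
    using exp_ge_one_plus_x_over_n_power_n[of n C] C n pos by (intro ennreal_leI mult_right_mono) auto
  finally show ?thesis .
qed

section \<open>Measurability of jump sums and their mean at time 1\<close>

lemma jump_sum_cong:
  "(\<And>x. x \<in> {a..b} \<Longrightarrow> g x = h x) \<Longrightarrow> jump_sum X a b T g \<omega> = jump_sum X a b T h \<omega>"
  unfolding jump_sum_def by (intro sum.cong) auto

text \<open>At this point a jump might hit an end point of \<open>{c..d}\<close> with positive
  probability, so the indicator is not yet known to be continuous at the jumps. It is a limit of
  continuous tents, supported in a slightly larger interval that still avoids 0.\<close>

lemma measurable_jump_sum_interval: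
  assumes ab: "0 \<notin> {a..b}" and T: "0 < T"
  shows "jump_sum X a b T (indicator {c..d} :: real \<Rightarrow> real) \<in> borel_measurable (completion M)"
proof (cases "max a c \<le> min b d")
  case False
  then have "jump_sum X a b T (indicator {c..d} :: real \<Rightarrow> real) = (\<lambda>_. 0)"
    by (intro ext) (auto simp: jump_sum_def intro!: sum.neutral split: split_indicator)
  then show ?thesis by simp
next
  case True
  define c' where "c' = max a c"
  define d' where "d' = min b d"
  define e where "e = (if a > 0 then a/2 else -b/2)"
  have e: "e > 0" "0 \<notin> {a-e..b+e}" using ab True by (auto simp: e_def split: if_splits)
  \<comment> \<open>From \<open>k0\<close> on the slope of the tent exceeds \<open>1 / e\<close>, so
    it reaches 0 within distance \<open>e\<close>.\<close>
  obtain k0 :: nat where k0: "1 / e < real k0" using reals_Archimedean2 by blast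
  define tent where "tent k x = max 0 (1 - real k * (max 0 (c' - x) + max 0 (x - d')))" for k :: nat and x :: real
  have tent0: "tent k x = 0" if k: "k \<ge> k0" and x: "x \<notin> {a-e..b+e}" for k x
  proof -
    have "e * real k \<ge> e * real k0" using k e by (intro mult_left_mono) auto
    moreover have "e * real k0 > 1" using k0 e by (simp add: field_simps)
    ultimately have ek: "real k * e > 1" by (simp add: mult.commute)
    have "max 0 (c' - x) + max 0 (x - d') \<ge> e" using x True by (auto simp: c'_def d'_def)
    then have "real k * (max 0 (c' - x) + max 0 (x - d')) \<ge> real k * e" by (intro mult_left_mono) auto
    with ek show ?thesis by (simp add: tent_def)
  qed
  have cont: "isCont (tent k) x" for k x unfolding tent_def by (intro continuous_intros)
  have meas: "jump_sum X (a-e) (b+e) T (tent k) \<in> borel_measurable (completion M)" if "k \<ge> k0" for k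
  proof (rule measurable_jump_sum_tendsto[OF T])
    show "tent k \<in> borel_measurable borel"
      by (intro borel_measurable_continuous_onI continuous_at_imp_continuous_on ballI cont)
    show "AE \<omega> in M. (\<lambda>n. incr_sum X T n (tent k) \<omega>) \<longlonglongrightarrow> jump_sum X (a - e) (b + e) T (tent k) \<omega>"
      by (rule incr_sum_tendsto[OF e(2) T]) (use tent0 that cont in auto)
  qed
  have lim: "(\<lambda>k. tent k x) \<longlonglongrightarrow> indicator {c'..d'} x" for x
  proof (cases "x \<in> {c'..d'}")
    case True then show ?thesis by (simp add: tent_def)
  next
    case False
    define y where "y = max 0 (c' - x) + max 0 (x - d')"
    have y: "y > 0" using False by (auto simp: y_def)
    obtain k1 :: nat where k1: "1 / y < real k1" using reals_Archimedean2 by blast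
    have "tent k x = 0" if "k \<ge> k1" for k
    proof -
      have "real k * y \<ge> real k1 * y" using that y by (intro mult_right_mono) auto
      moreover have "real k1 * y > 1" using k1 y by (simp add: field_simps)
      ultimately show ?thesis by (simp add: tent_def y_def[symmetric])
    qed
    then have "eventually (\<lambda>k. tent k x = 0) sequentially" by (auto simp: eventually_sequentially)
    then show ?thesis using False by (simp add: tendsto_eventually)
  qed
  have "(\<lambda>\<omega>. jump_sum X (a-e) (b+e) T (indicator {c'..d'} :: real \<Rightarrow> real) \<omega>) \<in> borel_measurable (completion M)"
  proof (rule borel_measurable_LIMSEQ_real)
    show "(\<lambda>k. jump_sum X (a-e) (b+e) T (tent (k + k0)) \<omega>) \<longlonglongrightarrow> jump_sum X (a-e) (b+e) T (indicator {c'..d'}) \<omega>" for \<omega>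
      unfolding jump_sum_def by (intro tendsto_sum LIMSEQ_ignore_initial_segment lim)
  qed (use meas in auto)
  then show ?thesis
  proof (rule measurable_completion_AE_eq)
    show "AE \<omega> in M. jump_sum X a b T (indicator {c..d} :: real \<Rightarrow> real) \<omega> = jump_sum X (a-e) (b+e) T (indicator {c'..d'}) \<omega>"
      using AE_cadlag
    proof eventually_elim
      case (elim \<omega>)
      have "jump_sum X a b T (indicator {c..d} :: real \<Rightarrow> real) \<omega> = jump_sum X a b T (indicator {c'..d'}) \<omega>"
        by (rule jump_sum_cong) (auto simp: c'_def d'_def split: split_indicator)
      also have "\<dots> = jump_sum X (a-e) (b+e) T (indicator {c'..d'}) \<omega>"
        unfolding jump_sum_def using finite_jump_set[OF elim e(2), of T] e(1)
        by (intro sum.mono_neutral_left) (auto simp: c'_def d'_def split: split_indicator)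
      finally show ?case .
    qed
  qed
qed

lemma measurable_jump_sum_indicator:
  assumes ab: "0 \<notin> {a..b}" and T: "0 < T" and A: "A \<in> sets borel"
  shows "jump_sum X a b T (indicator A :: real \<Rightarrow> real) \<in> borel_measurable (completion M)"
  using A
proof (induction A rule: borel_set_induct)
  case empty
  have eq: "jump_sum X a b T (indicator {} :: real \<Rightarrow> real) = (\<lambda>_. 0)" by (intro ext) (simp add: jump_sum_def)
  show ?case unfolding eq by simp
next
  case (interval c d) then show ?case using measurable_jump_sum_interval[OF ab T] by simp
next
  case (compl A)
  have "jump_sum X a b T (indicator (-A) :: real \<Rightarrow> real) =
     (\<lambda>\<omega>. jump_sum X a b T (indicator {a..b}) \<omega> - jump_sum X a b T (indicator A) \<omega>)"
    unfolding jump_sum_def sum_subtractf[symmetric] by (intro ext sum.cong refl) (auto split: split_indicator)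
  moreover note [measurable] = compl(2) measurable_jump_sum_interval[OF ab T, of a b]
  ultimately show ?case by simp
next
  case (union f)
  note [measurable] = union(3)
  have eq: "jump_sum X a b T (indicator (\<Union>i<k. f i) :: real \<Rightarrow> real) = (\<lambda>\<omega>. \<Sum>i<k. jump_sum X a b T (indicator (f i)) \<omega>)" for k
  proof (intro ext)
    fix \<omega>
    have "disjoint_family_on f {..<k}" using union(1) by (auto simp: disjoint_family_on_def)
    then show "jump_sum X a b T (indicator (\<Union>i<k. f i) :: real \<Rightarrow> real) \<omega> = (\<Sum>i<k. jump_sum X a b T (indicator (f i)) \<omega>)"
      by (simp add: jump_sum_def indicator_UN_disjoint sum.swap[of _ "{..<k}"])
  qed
  show ?case
  proof (rule borel_measurable_LIMSEQ_real)
    show "(\<lambda>k. jump_sum X a b T (indicator (\<Union>i<k. f i) :: real \<Rightarrow> real) \<omega>) \<longlonglongrightarrow> jump_sum X a b T (indicator (\<Union> (range f))) \<omega>" for \<omega>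
      unfolding jump_sum_def by (intro tendsto_sum LIMSEQ_indicator_UN)
  next
    show "jump_sum X a b T (indicator (\<Union>i<k. f i) :: real \<Rightarrow> real) \<in> borel_measurable (completion M)" for k
      unfolding eq by measurable
  qed
qed

lemma jump_sum_indicator_ennreal:
  "jump_sum X a b T (indicator A :: real \<Rightarrow> ennreal) \<omega> = ennreal (jump_sum X a b T (indicator A) \<omega>)"
  unfolding jump_sum_def by (subst sum_ennreal[symmetric]) (auto intro!: sum.cong simp: ennreal_indicator simp del: sum_ennreal)

lemma measurable_jump_sum_ennreal:
  fixes g :: "real \<Rightarrow> ennreal"
  assumes ab: "0 \<notin> {a..b}" and T: "0 < T" and g: "g \<in> borel_measurable borel"
  shows "jump_sum X a b T g \<in> borel_measurable (completion M)"
  using g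
proof (induction g rule: borel_measurable_induct)
  case (cong f g) then show ?case by (auto simp: fun_eq_iff[symmetric] cong: )
next
  case (set A)
  note [measurable] = measurable_jump_sum_indicator[OF ab T set]
  have "jump_sum X a b T (indicator A :: real \<Rightarrow> ennreal) = (\<lambda>\<omega>. ennreal (jump_sum X a b T (indicator A) \<omega>))"
    by (intro ext jump_sum_indicator_ennreal)
  then show ?case by simp
next
  case (mult u c)
  note [measurable] = mult(4)
  have "jump_sum X a b T (\<lambda>x. c * u x) = (\<lambda>\<omega>. c * jump_sum X a b T u \<omega>)"
    by (intro ext) (simp add: jump_sum_def sum_distrib_left)
  then show ?case by simp
next
  case (add u v)
  note [measurable] = add
  have "jump_sum X a b T (\<lambda>x. v x + u x) = (\<lambda>\<omega>. jump_sum X a b T v \<omega> + jump_sum X a b T u \<omega>)"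
    by (intro ext) (simp add: jump_sum_def sum.distrib)
  then show ?case by simp
next
  case (seq U)
  note [measurable] = seq
  have eq: "jump_sum X a b T (Sup (range U)) = (\<lambda>\<omega>. SUP i. jump_sum X a b T (U i) \<omega>)"
    using seq(3) by (intro ext) (auto simp: jump_sum_def image_comp ennreal_SUP_sum[symmetric] incseq_def le_fun_def)
  show ?case unfolding eq by measurable
qed

text \<open>The hypothesis on the Levy measure concerns jumps up to time 1, hence
  \<open>T = 1\<close>. It is the case of an indicator, from which the standard induction over
  measurable functions starts.\<close>

lemma nn_integral_jump_sum:
  fixes g :: "real \<Rightarrow> ennreal"
  assumes ab: "0 \<notin> {a..b}" and g: "g \<in> borel_measurable borel"
  shows "(\<integral>\<^sup>+\<omega>. jump_sum X a b 1 g \<omega> \<partial>M) = (\<integral>\<^sup>+x. g x * ennreal (s x) * indicator {a..b} x \<partial>lborel)"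
  using g
proof (induction g rule: borel_measurable_induct)
  case (cong f g) then show ?case by (auto simp: fun_eq_iff[symmetric] cong: )
next
  case (set A)
  let ?B = "A \<inter> {a..b}"
  have [measurable]: "A \<in> sets borel" by fact
  have "(\<integral>\<^sup>+\<omega>. jump_sum X a b 1 (indicator A :: real \<Rightarrow> ennreal) \<omega> \<partial>M) = (\<integral>\<^sup>+\<omega>. emeasure (jump_measure X \<omega>) ({0<..1} \<times> ?B) \<partial>M)"
  proof (rule nn_integral_cong_AE)
    show "AE \<omega> in M. jump_sum X a b 1 (indicator A :: real \<Rightarrow> ennreal) \<omega> = emeasure (jump_measure X \<omega>) ({0<..1} \<times> ?B)"
      using AE_cadlag
    proof eventually_elim
      case (elim \<omega>)
      let ?S = "{t. 0 < t \<and> jump X t \<omega> \<noteq> 0}" and ?J = "{t. 0 < t \<and> t \<le> 1 \<and> jump X t \<omega> \<in> {a..b}}"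
      have fin: "finite ?J" by (rule finite_jump_set[OF elim ab])
      have "emeasure (jump_measure X \<omega>) ({0<..1} \<times> ?B)
         = emeasure (count_space ?S) ((\<lambda>t. (t, jump X t \<omega>)) -` ({0<..1} \<times> ?B) \<inter> ?S)"
        unfolding jump_measure_def by (subst emeasure_distr) (auto intro!: borel_Times)
      also have "(\<lambda>t. (t, jump X t \<omega>)) -` ({0<..1} \<times> ?B) \<inter> ?S = ?J \<inter> {t. jump X t \<omega> \<in> A}" using ab by auto
      also have "emeasure (count_space ?S) (?J \<inter> {t. jump X t \<omega> \<in> A}) = of_nat (card (?J \<inter> {t. jump X t \<omega> \<in> A}))"
        using fin ab by (intro emeasure_count_space_finite) auto
      also have "\<dots> = (\<Sum>t\<in>?J \<inter> {t. jump X t \<omega> \<in> A}. 1)" by (simp only: sum_constant mult_1_right)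
      also have "\<dots> = (\<Sum>t\<in>?J. indicator {t. jump X t \<omega> \<in> A} t)"
        by (rule sum.mono_neutral_cong_left) (use fin in \<open>auto split: split_indicator\<close>)
      also have "\<dots> = jump_sum X a b 1 (indicator A :: real \<Rightarrow> ennreal) \<omega>"
        unfolding jump_sum_def by (intro sum.cong) (auto split: split_indicator)
      finally show ?case by simp
    qed
  qed
  also have "\<dots> = emeasure (density lborel (\<lambda>x. ennreal (s x))) ?B"
    using dens by (simp add: has_levy_density_def)
  also have "\<dots> = (\<integral>\<^sup>+x. ennreal (s x) * indicator ?B x \<partial>lborel)" by (rule emeasure_density) auto
  also have "\<dots> = (\<integral>\<^sup>+x. indicator A x * ennreal (s x) * indicator {a..b} x \<partial>lborel)"
    by (intro nn_integral_cong) (auto split: split_indicator)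
  finally show ?case .
next
  case (mult u c)
  note [measurable] = mult(2) measurable_jump_sum_ennreal[OF ab zero_less_one mult(2)]
  have "jump_sum X a b 1 (\<lambda>x. c * u x) = (\<lambda>\<omega>. c * jump_sum X a b 1 u \<omega>)"
    by (intro ext) (simp add: jump_sum_def sum_distrib_left)
  then have "(\<integral>\<^sup>+\<omega>. jump_sum X a b 1 (\<lambda>x. c * u x) \<omega> \<partial>M) = c * (\<integral>\<^sup>+\<omega>. jump_sum X a b 1 u \<omega> \<partial>completion M)"
    by (subst nn_integral_completion[symmetric]) (simp add: nn_integral_cmult)
  then show ?case using mult by (simp add: nn_integral_completion mult.assoc nn_integral_cmult)
next
  case (add u v)
  note uv[measurable] = \<open>u \<in> borel_measurable borel\<close> \<open>v \<in> borel_measurable borel\<close>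
  note [measurable] = measurable_jump_sum_ennreal[OF ab zero_less_one uv(1)] measurable_jump_sum_ennreal[OF ab zero_less_one uv(2)]
  have "jump_sum X a b 1 (\<lambda>x. v x + u x) = (\<lambda>\<omega>. jump_sum X a b 1 v \<omega> + jump_sum X a b 1 u \<omega>)"
    by (intro ext) (simp add: jump_sum_def sum.distrib)
  then have "(\<integral>\<^sup>+\<omega>. jump_sum X a b 1 (\<lambda>x. v x + u x) \<omega> \<partial>M) = (\<integral>\<^sup>+\<omega>. jump_sum X a b 1 v \<omega> \<partial>completion M) + (\<integral>\<^sup>+\<omega>. jump_sum X a b 1 u \<omega> \<partial>completion M)"
    by (subst nn_integral_completion[symmetric]) (simp add: nn_integral_add)
  then show ?case using add by (simp add: nn_integral_completion distrib_right nn_integral_add)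
next
  case (seq U)
  note [measurable] = seq(1) measurable_jump_sum_ennreal[OF ab zero_less_one seq(1)]
  have "jump_sum X a b 1 (Sup (range U)) = (\<lambda>\<omega>. SUP i. jump_sum X a b 1 (U i) \<omega>)"
    using seq(3) by (intro ext) (auto simp: jump_sum_def image_comp ennreal_SUP_sum[symmetric] incseq_def le_fun_def)
  moreover have "incseq (\<lambda>i \<omega>. jump_sum X a b 1 (U i) \<omega>)"
    using seq(3) by (auto simp: jump_sum_def incseq_def le_fun_def intro!: sum_mono)
  ultimately have "(\<integral>\<^sup>+\<omega>. jump_sum X a b 1 (Sup (range U)) \<omega> \<partial>M) = (SUP i. (\<integral>\<^sup>+\<omega>. jump_sum X a b 1 (U i) \<omega> \<partial>completion M))"
    by (subst nn_integral_completion[symmetric]) (simp add: nn_integral_monotone_convergence_SUP)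
  also have "\<dots> = (SUP i. (\<integral>\<^sup>+x. U i x * ennreal (s x) * indicator {a..b} x \<partial>lborel))"
    using seq by (simp add: nn_integral_completion)
  also have "\<dots> = (\<integral>\<^sup>+x. (SUP i. U i x * ennreal (s x) * indicator {a..b} x) \<partial>lborel)"
    using seq(3) by (intro nn_integral_monotone_convergence_SUP[symmetric])
      (auto simp: incseq_def le_fun_def intro!: mult_right_mono)
  also have "\<dots> = (\<integral>\<^sup>+x. (Sup (range U)) x * ennreal (s x) * indicator {a..b} x \<partial>lborel)"
    by (intro nn_integral_cong) (simp add: SUP_mult_right_ennreal image_comp)
  finally show ?case .
qed

text \<open>With \<open>e\<close> the distance from 0 to the interval, the weight
  \<open>min 1 (x\<^sup>2)\<close> of a Levy density is at least \<open>min 1 (e\<^sup>2)\<close> on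
  \<open>{a..b}\<close>.\<close>

lemma integrable_s:
  assumes ab: "0 \<notin> {a..b}"
  shows "set_integrable lborel {a..b} s"
proof (cases "a \<le> b")
  case False then show ?thesis by (simp add: set_integrable_def)
next
  case True
  define e where "e = (if a > 0 then a else -b)"
  have e: "e > 0" "\<And>x. x \<in> {a..b} \<Longrightarrow> e \<le> \<bar>x\<bar>" using ab True by (auto simp: e_def split: if_splits)
  have "(\<integral>\<^sup>+x. ennreal (indicator {a..b} x * s x) \<partial>lborel) \<le> (\<integral>\<^sup>+x. ennreal (1 / min 1 (e\<^sup>2)) * ennreal (min 1 (x\<^sup>2) * s x) \<partial>lborel)"
  proof (rule nn_integral_mono)
    fix x
    show "ennreal (indicator {a..b} x * s x) \<le> ennreal (1 / min 1 (e\<^sup>2)) * ennreal (min 1 (x\<^sup>2) * s x)"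
    proof (cases "x \<in> {a..b}")
      case True
      have "x \<noteq> 0" using True ab by auto
      have "e\<^sup>2 \<le> x\<^sup>2" using e(1) e(2)[OF True] by (metis abs_le_square_iff abs_of_pos)
      then have m: "min 1 (e\<^sup>2) \<le> min 1 (x\<^sup>2)" "min 1 (e\<^sup>2) > 0" using e by auto
      then have "1 \<le> min 1 (x\<^sup>2) / min 1 (e\<^sup>2)" by (simp add: field_simps)
      then have "s x \<le> (min 1 (x\<^sup>2) / min 1 (e\<^sup>2)) * s x" using s_nonneg[OF \<open>x \<noteq> 0\<close>] mult_right_mono by fastforce
      then have "ennreal (s x) \<le> ennreal (1 / min 1 (e\<^sup>2) * (min 1 (x\<^sup>2) * s x))" by (intro ennreal_leI) simp
      then show ?thesis using True m(2) s_nonneg[OF \<open>x \<noteq> 0\<close>] by (subst ennreal_mult[symmetric]) auto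
    qed auto
  qed
  also have "\<dots> = ennreal (1 / min 1 (e\<^sup>2)) * (\<integral>\<^sup>+x. ennreal (min 1 (x\<^sup>2) * s x) \<partial>lborel)"
    by (rule nn_integral_cmult) measurable
  also have "\<dots> < \<infinity>"
    using dens by (auto simp: has_levy_density_def levy_density_def ennreal_mult_less_top)
  finally have fin: "(\<integral>\<^sup>+x. ennreal (indicator {a..b} x * s x) \<partial>lborel) < \<infinity>" .
  have "integrable lborel (\<lambda>x. indicator {a..b} x * s x)"
  proof (rule integrableI_nonneg)
    show "AE x in lborel. 0 \<le> indicator {a..b} x * s x"
      using s_nonneg ab by (auto split: split_indicator)
  qed (use fin in auto)
  then show ?thesis by (simp add: set_integrable_def)
qed

end

section \<open>Integrals with respect to the Levy density\<close>

text \<open>After taking logarithms, \<open>- x - 2 * x\<^sup>2 \<le> ln (1 - x) \<le> - x\<close>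
  traps \<open>real n * x n\<close> between \<open>y n\<close> and
  \<open>y n - 2 * y n * x n\<close>. The correction vanishes because \<open>x n\<close> is at most
  \<open>y n / real n\<close>.\<close>

lemma tendsto_mult_of_power_one_minus:
  fixes x :: "nat \<Rightarrow> real"
  assumes x: "\<And>n. 0 \<le> x n" "\<And>n. x n \<le> 1/2" and c: "0 < c"
    and lim: "(\<lambda>n. (1 - x n) ^ n) \<longlonglongrightarrow> c"
  shows "(\<lambda>n. real n * x n) \<longlonglongrightarrow> - ln c"
proof -
  define y where "y n = - (real n * ln (1 - x n))" for n
  have y: "y \<longlonglongrightarrow> - ln c"
  proof -
    have "(\<lambda>n. ln ((1 - x n) ^ n)) \<longlonglongrightarrow> ln c" using lim c by (intro tendsto_ln) auto
    moreover have "ln ((1 - x n) ^ n) = real n * ln (1 - x n)" for n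
      using x(2)[of n] by (simp add: ln_realpow)
    ultimately have "(\<lambda>n. real n * ln (1 - x n)) \<longlonglongrightarrow> ln c" by simp
    then show ?thesis unfolding y_def by (rule tendsto_minus)
  qed
  have le: "real n * x n \<le> y n" for n
  proof -
    have "ln (1 - x n) \<le> - x n" using ln_le_minus_one[of "1 - x n"] x(2)[of n] by auto
    then have "real n * ln (1 - x n) \<le> real n * (- x n)" by (intro mult_left_mono) auto
    then show ?thesis by (simp add: y_def)
  qed
  have ge: "y n - 2 * (y n * x n) \<le> real n * x n" for n
  proof -
    have "- x n - 2 * (x n)\<^sup>2 \<le> ln (1 - x n)" using x by (intro ln_one_minus_pos_lower_bound)
    then have "real n * (- x n - 2 * (x n)\<^sup>2) \<le> real n * ln (1 - x n)" by (intro mult_left_mono) auto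
    then have "y n \<le> real n * x n + 2 * ((real n * x n) * x n)" by (simp add: y_def algebra_simps power2_eq_square)
    also have "(real n * x n) * x n \<le> y n * x n" using le x by (intro mult_right_mono) auto
    finally show ?thesis by simp
  qed
  have x0: "x \<longlonglongrightarrow> 0"
  proof (rule tendsto_sandwich[of "\<lambda>_. 0" _ _ "\<lambda>n. y n / real n"])
    show "(\<lambda>n. y n / real n) \<longlonglongrightarrow> 0"
      using tendsto_divide_0[OF y filterlim_at_top_imp_at_infinity[OF filterlim_real_sequentially]] .
    show "eventually (\<lambda>n. x n \<le> y n / real n) sequentially"
      using eventually_gt_at_top[of 0]
    proof eventually_elim
      case (elim n) then show ?case using le[of n] by (simp add: field_simps)
    qed
  qed (use x in auto)
  show ?thesis
  proof (rule tendsto_sandwich[of "\<lambda>n. y n - 2 * (y n * x n)" _ _ y])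
    show "(\<lambda>n. y n - 2 * (y n * x n)) \<longlonglongrightarrow> - ln c"
      using tendsto_diff[OF y tendsto_mult_left[OF tendsto_mult[OF y x0], of 2]] by simp
  qed (use le ge y in auto)
qed

text \<open>Bounded second moments give uniform integrability: truncation at level \<open>K\<close>
  costs at most \<open>C / K\<close>, for every \<open>n\<close> and, by Fatou's lemma, for the
  limit. The truncated variables converge by dominated convergence.\<close>

lemma (in prob_space) tendsto_expectation_of_second_moment:
  fixes Y :: "nat \<Rightarrow> 'a \<Rightarrow> real"
  assumes Y[measurable]: "\<And>n. Y n \<in> borel_measurable M" and Z[measurable]: "Z \<in> borel_measurable M"
    and pos: "\<And>n \<omega>. 0 \<le> Y n \<omega>" "\<And>\<omega>. 0 \<le> Z \<omega>"
    and lim: "AE \<omega> in M. (\<lambda>n. Y n \<omega>) \<longlonglongrightarrow> Z \<omega>"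
    and C: "\<And>n. (\<integral>\<^sup>+\<omega>. ennreal ((Y n \<omega>)\<^sup>2) \<partial>M) \<le> ennreal C" "0 \<le> C"
  shows "integrable M Z" "(\<lambda>n. expectation (Y n)) \<longlonglongrightarrow> expectation Z"
proof -
  have sq_bound: "integrable M W \<and> 0 \<le> expectation W - expectation (\<lambda>\<omega>. min (W \<omega>) K) \<and>
      expectation W - expectation (\<lambda>\<omega>. min (W \<omega>) K) \<le> C / K"
    if W[measurable]: "W \<in> borel_measurable M" and W0: "\<And>\<omega>. 0 \<le> W \<omega>"
      and W2: "(\<integral>\<^sup>+\<omega>. ennreal ((W \<omega>)\<^sup>2) \<partial>M) \<le> ennreal C" and K: "K > 0" for W K
  proof -
    have i2: "integrable M (\<lambda>\<omega>. (W \<omega>)\<^sup>2)"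
      by (rule integrableI_nonneg) (use W2 in \<open>auto intro: le_less_trans\<close>)
    have e2: "expectation (\<lambda>\<omega>. (W \<omega>)\<^sup>2) \<le> C"
      using W2 C(2) by (subst (asm) nn_integral_eq_integral[OF i2]) auto
    have i1: "integrable M W"
    proof (rule Bochner_Integration.integrable_bound[of M "\<lambda>\<omega>. 1 + (W \<omega>)\<^sup>2"])
      show "AE \<omega> in M. norm (W \<omega>) \<le> norm (1 + (W \<omega>)\<^sup>2)"
      proof (intro AE_I2)
        fix \<omega> have "0 \<le> (W \<omega> - 1)\<^sup>2" by simp
        then show "norm (W \<omega>) \<le> norm (1 + (W \<omega>)\<^sup>2)" using W0[of \<omega>] by (simp add: power2_eq_square algebra_simps)
      qed
    qed (use i2 in auto)
    have im: "integrable M (\<lambda>\<omega>. min (W \<omega>) K)"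
      using i1 by (rule Bochner_Integration.integrable_bound) (use W0 K in auto)
    have "expectation (\<lambda>\<omega>. min (W \<omega>) K) \<le> expectation W" by (rule Bochner_Integration.integral_mono[OF im i1]) simp
    moreover have "expectation W \<le> expectation (\<lambda>\<omega>. min (W \<omega>) K + (W \<omega>)\<^sup>2 / K)"
    proof (rule Bochner_Integration.integral_mono[OF i1])
      show "W \<omega> \<le> min (W \<omega>) K + (W \<omega>)\<^sup>2 / K" for \<omega>
      proof (cases "W \<omega> \<le> K")
        case False
        then have "W \<omega> * K \<le> W \<omega> * W \<omega>" using W0 by (intro mult_left_mono) auto
        then have "W \<omega> \<le> (W \<omega>)\<^sup>2 / K" using K by (simp add: field_simps power2_eq_square)
        then show ?thesis using K W0[of \<omega>] by (simp add: min_def)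
      qed (use K in auto)
    qed (use im i2 in auto)
    moreover have "expectation (\<lambda>\<omega>. min (W \<omega>) K + (W \<omega>)\<^sup>2 / K) = expectation (\<lambda>\<omega>. min (W \<omega>) K) + expectation (\<lambda>\<omega>. (W \<omega>)\<^sup>2) / K"
      using im i2 by simp
    moreover have "expectation (\<lambda>\<omega>. (W \<omega>)\<^sup>2) / K \<le> C / K" using e2 K by (intro divide_right_mono) auto
    ultimately show ?thesis using i1 by auto
  qed
  have Z2: "(\<integral>\<^sup>+\<omega>. ennreal ((Z \<omega>)\<^sup>2) \<partial>M) \<le> ennreal C"
  proof -
    have "(\<integral>\<^sup>+\<omega>. ennreal ((Z \<omega>)\<^sup>2) \<partial>M) = (\<integral>\<^sup>+\<omega>. liminf (\<lambda>n. ennreal ((Y n \<omega>)\<^sup>2)) \<partial>M)"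
    proof (rule nn_integral_cong_AE)
      show "AE \<omega> in M. ennreal ((Z \<omega>)\<^sup>2) = liminf (\<lambda>n. ennreal ((Y n \<omega>)\<^sup>2))"
        using lim
      proof eventually_elim
        case (elim \<omega>)
        then have "(\<lambda>n. ennreal ((Y n \<omega>)\<^sup>2)) \<longlonglongrightarrow> ennreal ((Z \<omega>)\<^sup>2)" by (intro tendsto_ennrealI tendsto_power)
        then show ?case by (rule lim_imp_Liminf[OF trivial_limit_sequentially, symmetric])
      qed
    qed
    also have "\<dots> \<le> liminf (\<lambda>n. \<integral>\<^sup>+\<omega>. ennreal ((Y n \<omega>)\<^sup>2) \<partial>M)" by (rule nn_integral_liminf) measurable
    also have "\<dots> \<le> ennreal C" by (rule Liminf_le) (use C in auto)
    finally show ?thesis .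
  qed
  show "integrable M Z" using sq_bound[OF Z pos(2) Z2 zero_less_one] by blast
  show "(\<lambda>n. expectation (Y n)) \<longlonglongrightarrow> expectation Z"
  proof (rule LIMSEQ_I)
    fix r :: real assume r: "r > 0"
    define K where "K = 3 * (C + 1) / r"
    have K: "K > 0" using r C by (simp add: K_def)
    have CK: "C / K < r / 3" using r C(2) K by (simp add: K_def field_simps)
    have "(\<lambda>n. expectation (\<lambda>\<omega>. min (Y n \<omega>) K)) \<longlonglongrightarrow> expectation (\<lambda>\<omega>. min (Z \<omega>) K)"
    proof (rule integral_dominated_convergence[where w = "\<lambda>_. K"])
      show "AE \<omega> in M. (\<lambda>n. min (Y n \<omega>) K) \<longlonglongrightarrow> min (Z \<omega>) K"
        using lim by eventually_elim (intro tendsto_min tendsto_const)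
      show "\<And>n. AE \<omega> in M. norm (min (Y n \<omega>) K) \<le> K" using pos K by auto
    qed auto
    then obtain n0 where n0: "\<And>n. n \<ge> n0 \<Longrightarrow> \<bar>expectation (\<lambda>\<omega>. min (Y n \<omega>) K) - expectation (\<lambda>\<omega>. min (Z \<omega>) K)\<bar> < r / 3"
      using r LIMSEQ_D[of _ _ "r/3"] by (metis divide_pos_pos real_norm_def zero_less_numeral)
    show "\<exists>no. \<forall>n\<ge>no. norm (expectation (Y n) - expectation Z) < r"
    proof (intro exI[of _ n0] allI impI)
      fix n assume n: "n \<ge> n0"
      show "norm (expectation (Y n) - expectation Z) < r"
        using sq_bound[OF Y pos(1) C(1) K, of n] sq_bound[OF Z pos(2) Z2 K] n0[OF n] CK
        unfolding real_norm_def by linarith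
    qed
  qed
qed

lemma sum_restrict_eq: "(\<Sum>i<n. g ((\<lambda>i\<in>{..<n}. y i) i)) = (\<Sum>i<(n::nat). g (y i))"
  by (intro sum.cong refl) simp

context levy_jumps begin

text \<open>The functions whose increment sums converge almost surely to their jump sums. Continuity
  is asked only at the jump sizes, and only almost surely, so that functions with breakpoints
  qualify.\<close>

definition regular :: "real \<Rightarrow> real \<Rightarrow> (real \<Rightarrow> real) \<Rightarrow> bool" where
  "regular a b g \<longleftrightarrow> g \<in> borel_measurable borel \<and> (\<exists>B. \<forall>x. \<bar>g x\<bar> \<le> B) \<and> (\<forall>x. x \<notin> {a..b} \<longrightarrow> g x = 0) \<and>
     (AE \<omega> in M. \<forall>t. 0 < t \<longrightarrow> jump X t \<omega> \<in> {a..b} \<longrightarrow> isCont g (jump X t \<omega>))"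

lemma regular_borel: "regular a b g \<Longrightarrow> g \<in> borel_measurable borel"
  by (simp add: regular_def)

lemma regular_incr_sum_tendsto:
  "0 \<notin> {a..b} \<Longrightarrow> regular a b g \<Longrightarrow> 0 < T \<Longrightarrow>
    AE \<omega> in M. (\<lambda>n. incr_sum X T n g \<omega>) \<longlonglongrightarrow> jump_sum X a b T g \<omega>"
  by (rule incr_sum_tendsto) (auto simp: regular_def)

lemma regular_measurable_jump_sum:
  "0 \<notin> {a..b} \<Longrightarrow> regular a b g \<Longrightarrow> 0 < T \<Longrightarrow> jump_sum X a b T g \<in> borel_measurable (completion M)"
  by (rule measurable_jump_sum_tendsto[OF _ _ regular_incr_sum_tendsto]) (auto simp: regular_def)

lemma prob_space_completion: "prob_space (completion M)"
  by standard (simp add: emeasure_space_1)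

lemma integrable_bounded:
  fixes f :: "real \<Rightarrow> real"
  assumes "f \<in> borel_measurable borel" "\<And>x. \<bar>f x\<bar> \<le> B" "0 \<le> t"
  shows "integrable M (\<lambda>\<omega>. f (X t \<omega>))"
  by (rule integrable_const_bound[of _ B]) (use assms in \<open>auto intro!: measurable_compose[OF measurable_X]\<close>)

lemma integral_prod_incr:
  fixes f :: "real \<Rightarrow> real"
  assumes T: "0 < T" and n: "0 < n" and f[measurable]: "f \<in> borel_measurable borel" and f01: "\<And>x. 0 \<le> f x" "\<And>x. f x \<le> 1"
  shows "(\<integral>\<omega>. (\<Prod>i<n. f (X (real (Suc i) * T / real n) \<omega> - X (real i * T / real n) \<omega>)) \<partial>M) = (\<integral>\<omega>. f (X (T / real n) \<omega>) \<partial>M) ^ n"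
proof -
  have m[measurable]: "X (T / real n) \<in> borel_measurable M" using T by (intro measurable_X) auto
  have m'[measurable]: "X (real i * T / real n) \<in> borel_measurable M" for i using T by (intro measurable_X) auto
  interpret D: prob_space "distr M borel (X (T / real n))" by (rule prob_space_distr) fact
  interpret P: product_sigma_finite "\<lambda>_::nat. distr M borel (X (T / real n))" by standard
  define pf where "pf x = (\<Prod>i<n. f (x i))" for x :: "nat \<Rightarrow> real"
  have "(\<integral>\<^sup>+\<omega>. ennreal (pf (\<lambda>i\<in>{..<n}. X (real (Suc i) * T / real n) \<omega> - X (real i * T / real n) \<omega>)) \<partial>M)
     = (\<integral>\<^sup>+x. ennreal (pf x) \<partial>PiM {..<n} (\<lambda>_. distr M borel (X (T / real n))))"
    unfolding pf_def by (rule incr_distr[OF T n]) measurable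
  also have "\<dots> = (\<integral>\<^sup>+x. (\<Prod>i<n. ennreal (f (x i))) \<partial>PiM {..<n} (\<lambda>_. distr M borel (X (T / real n))))"
    by (simp add: pf_def prod_ennreal f01)
  also have "\<dots> = (\<integral>\<^sup>+x. ennreal (f x) \<partial>distr M borel (X (T / real n))) ^ n"
    by (subst P.product_nn_integral_prod) auto
  also have "(\<integral>\<^sup>+x. ennreal (f x) \<partial>distr M borel (X (T / real n))) = (\<integral>\<^sup>+\<omega>. ennreal (f (X (T / real n) \<omega>)) \<partial>M)"
    by (subst nn_integral_distr) auto
  also have "\<dots> = ennreal (\<integral>\<omega>. f (X (T / real n) \<omega>) \<partial>M)"
    using f01 T by (intro nn_integral_eq_integral integrable_bounded[of _ 1]) auto
  finally have 1: "(\<integral>\<^sup>+\<omega>. ennreal (\<Prod>i<n. f (X (real (Suc i) * T / real n) \<omega> - X (real i * T / real n) \<omega>)) \<partial>M)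
     = ennreal ((\<integral>\<omega>. f (X (T / real n) \<omega>) \<partial>M) ^ n)"
    using f01 by (simp add: pf_def ennreal_power Bochner_Integration.integral_nonneg del: of_nat_Suc)
  have "integrable M (\<lambda>\<omega>. \<Prod>i<n. f (X (real (Suc i) * T / real n) \<omega> - X (real i * T / real n) \<omega>))"
    by (rule integrable_const_bound[of _ 1])
      (use f01 in \<open>auto intro!: prod_le_1 simp: abs_prod simp del: of_nat_Suc\<close>)
  from nn_integral_eq_integral[OF this] 1 show ?thesis
    using f01 by (simp add: prod_nonneg Bochner_Integration.integral_nonneg del: of_nat_Suc)
qed

text \<open>The limit exists because the Laplace transform of the sum of increments is an \<open>n\<close>-th
  power; it is additive and monotone in \<open>T\<close>, hence linear.\<close>

lemma tendsto_mean_small: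
  assumes ab: "0 \<notin> {a..b}" and h: "regular a b h" and h01: "\<And>x. 0 \<le> h x" "\<And>x. h x \<le> 1/2"
  shows "\<exists>l. \<forall>T>0. (\<lambda>n. real n * (\<integral>\<omega>. h (X (T / real n) \<omega>) \<partial>M)) \<longlonglongrightarrow> T * l"
proof -
  \<comment> \<open>Chosen so that \<open>exp (- g x) = 1 - h x\<close>: the Laplace transform of
    the increment sum of \<open>g\<close> is then exactly the \<open>n\<close>-th power of
    \<open>1 - Hh (T / real n)\<close>.\<close>
  define g where "g x = - ln (1 - h x)" for x
  have hb[measurable]: "h \<in> borel_measurable borel" using h by (rule regular_borel)
  have gb[measurable]: "g \<in> borel_measurable borel" unfolding g_def by measurable
  have g0: "0 \<le> g x" for x
    using h01[of x] ln_le_zero_iff[of "1 - h x"] by (auto simp: g_def)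
  have gle: "g x \<le> 1" for x
  proof -
    have "- h x - 2 * (h x)\<^sup>2 \<le> ln (1 - h x)" using h01 by (intro ln_one_minus_pos_lower_bound)
    moreover have "(h x)\<^sup>2 \<le> (1/2)\<^sup>2" using h01 by (intro power_mono)
    ultimately show ?thesis using h01(2)[of x] by (simp add: g_def power2_eq_square)
  qed
  have g: "regular a b g"
    unfolding regular_def
  proof (intro conjI)
    show "\<exists>B. \<forall>x. \<bar>g x\<bar> \<le> B" using gle g0 by (intro exI[of _ 1]) auto
    show "\<forall>x. x \<notin> {a..b} \<longrightarrow> g x = 0" using h by (auto simp: regular_def g_def)
    have "AE \<omega> in M. \<forall>t. 0 < t \<longrightarrow> jump X t \<omega> \<in> {a..b} \<longrightarrow> isCont h (jump X t \<omega>)" using h by (simp add: regular_def)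
    then show "AE \<omega> in M. \<forall>t. 0 < t \<longrightarrow> jump X t \<omega> \<in> {a..b} \<longrightarrow> isCont g (jump X t \<omega>)"
    proof eventually_elim
      case (elim \<omega>)
      have "1 - h x \<noteq> 0" for x using h01(2)[of x] by auto
      with elim show ?case unfolding g_def by (auto intro!: continuous_intros)
    qed
  qed (rule gb)
  define Hh where "Hh t = (\<integral>\<omega>. h (X t \<omega>) \<partial>M)" for t
  have Hi: "integrable M (\<lambda>\<omega>. h (X t \<omega>))" if "t \<ge> 0" for t
    using that h01 by (intro integrable_bounded[of _ "1/2"]) auto
  have H01: "0 \<le> Hh t" "Hh t \<le> 1/2" if "t \<ge> 0" for t
  proof -
    show "0 \<le> Hh t" unfolding Hh_def using h01 by (intro Bochner_Integration.integral_nonneg) auto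
    have "Hh t \<le> (\<integral>\<omega>. 1/2 \<partial>M)" unfolding Hh_def using h01 Hi[OF that] by (intro Bochner_Integration.integral_mono) auto
    then show "Hh t \<le> 1/2" by (simp add: prob_space)
  qed
  define c where "c T = (\<integral>\<omega>. exp (- jump_sum X a b T g \<omega>) \<partial>completion M)" for T
  interpret CM: prob_space "completion M" by (rule prob_space_completion)
  have jm: "jump_sum X a b T g \<in> borel_measurable (completion M)" if "T > 0" for T
    by (rule regular_measurable_jump_sum[OF ab g that])
  have j0: "0 \<le> jump_sum X a b T g \<omega>" for T \<omega> unfolding jump_sum_def using g0 by (intro sum_nonneg) auto
  have ji: "integrable (completion M) (\<lambda>\<omega>. exp (- jump_sum X a b T g \<omega>))" if "T > 0" for T
    by (rule CM.integrable_const_bound[of _ 1]) (use jm[OF that] j0 in auto)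
  have cpos: "c T > 0" if "T > 0" for T
  proof (rule ccontr)
    assume "\<not> c T > 0"
    moreover have "c T \<ge> 0" unfolding c_def by (intro Bochner_Integration.integral_nonneg) auto
    ultimately have "c T = 0" by simp
    then have "AE \<omega> in completion M. exp (- jump_sum X a b T g \<omega>) = 0"
      using ji[OF that] unfolding c_def by (subst (asm) integral_nonneg_eq_0_iff_AE) auto
    then show False by simp
  qed
  have clim: "(\<lambda>n. (1 - Hh (T / real n)) ^ n) \<longlonglongrightarrow> c T" if T: "T > 0" for T
  proof -
    have incr_m[measurable]: "incr_sum X T n g \<in> borel_measurable M" for n by (rule measurable_incr_sum[OF gb T])
    have "(\<lambda>n. \<integral>\<omega>. exp (- incr_sum X T n g \<omega>) \<partial>completion M) \<longlonglongrightarrow> c T"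
      unfolding c_def
    proof (rule integral_dominated_convergence[where w = "\<lambda>_. 1"])
      show "(\<lambda>\<omega>. exp (- jump_sum X a b T g \<omega>)) \<in> borel_measurable (completion M)"
        using jm[OF T] by measurable
      show "(\<lambda>\<omega>. exp (- incr_sum X T n g \<omega>)) \<in> borel_measurable (completion M)" for n
        using incr_m[THEN measurable_completion] by measurable
      show "AE \<omega> in completion M. (\<lambda>n. exp (- incr_sum X T n g \<omega>)) \<longlonglongrightarrow> exp (- jump_sum X a b T g \<omega>)"
        using AE_completion[OF regular_incr_sum_tendsto[OF ab g T]]
        by eventually_elim (intro tendsto_intros)
      have "0 \<le> incr_sum X T n g \<omega>" for n \<omega> unfolding incr_sum_def using g0 by (intro sum_nonneg) auto
      then show "AE \<omega> in completion M. norm (exp (- incr_sum X T n g \<omega>)) \<le> 1" for n by auto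
    qed simp
    moreover have "(\<integral>\<omega>. exp (- incr_sum X T n g \<omega>) \<partial>completion M) = (1 - Hh (T / real n)) ^ n" if n: "n > 0" for n
    proof -
      have "(\<integral>\<omega>. exp (- incr_sum X T n g \<omega>) \<partial>completion M) = (\<integral>\<omega>. exp (- incr_sum X T n g \<omega>) \<partial>M)"
        by (rule integral_completion) measurable
      also have "\<dots> = (\<integral>\<omega>. (\<Prod>i<n. (\<lambda>x. 1 - h x) (X (real (Suc i) * T / real n) \<omega> - X (real i * T / real n) \<omega>)) \<partial>M)"
      proof (intro Bochner_Integration.integral_cong refl)
        fix \<omega>
        have "1 - h x > 0" for x using h01(2)[of x] by linarith
        then have "exp (- g x) = 1 - h x" for x by (simp add: g_def)
        then show "exp (- incr_sum X T n g \<omega>) = (\<Prod>i<n. (\<lambda>x. 1 - h x) (X (real (Suc i) * T / real n) \<omega> - X (real i * T / real n) \<omega>))"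
          by (simp add: incr_sum_def sum_negf[symmetric] exp_sum del: of_nat_Suc)
      qed
      also have "\<dots> = (\<integral>\<omega>. 1 - h (X (T / real n) \<omega>) \<partial>M) ^ n"
      proof (rule integral_prod_incr[OF T n])
        show "0 \<le> 1 - h x" for x using h01(2)[of x] by simp
      qed (use h01 in auto)
      also have "(\<integral>\<omega>. 1 - h (X (T / real n) \<omega>) \<partial>M) = 1 - Hh (T / real n)"
        using Hi T by (simp add: Hh_def prob_space)
      finally show ?thesis .
    qed
    then have "eventually (\<lambda>n. (\<integral>\<omega>. exp (- incr_sum X T n g \<omega>) \<partial>completion M) = (1 - Hh (T / real n)) ^ n) sequentially"
      using eventually_gt_at_top[of 0] by (rule eventually_mono[rotated])
    ultimately show ?thesis by (subst (asm) tendsto_cong) auto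
  qed
  define lam where "lam T = - ln (c T)" for T
  have lim: "(\<lambda>n. real n * Hh (T / real n)) \<longlonglongrightarrow> lam T" if T: "T > 0" for T
    unfolding lam_def by (rule tendsto_mult_of_power_one_minus) (use H01 T cpos clim in auto)
  \<comment> \<open>Along the subsequence \<open>k * n\<close> the time step
    \<open>real k * T / real (k * n)\<close> is again \<open>T / real n\<close>.\<close>
  have scale: "lam (real k * T) = real k * lam T" if T: "T > 0" and k: "k > 0" for k T
  proof -
    have "strict_mono (\<lambda>n. k * n)" by (rule strict_monoI) (rule mult_less_mono2[OF _ k])
    then have "((\<lambda>n. real n * Hh (real k * T / real n)) \<circ> (\<lambda>n. k * n)) \<longlonglongrightarrow> lam (real k * T)"
      using T k by (intro LIMSEQ_subseq_LIMSEQ lim) simp_all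
    then have "(\<lambda>n. real (k * n) * Hh (real k * T / real (k * n))) \<longlonglongrightarrow> lam (real k * T)" unfolding o_def .
    moreover have "real (k * n) * Hh (real k * T / real (k * n)) = real k * (real n * Hh (T / real n))" for n
      using k by simp
    ultimately have "(\<lambda>n. real k * (real n * Hh (T / real n))) \<longlonglongrightarrow> lam (real k * T)" by (simp only:)
    moreover have "(\<lambda>n. real k * (real n * Hh (T / real n))) \<longlonglongrightarrow> real k * lam T" by (intro tendsto_mult_left lim T)
    ultimately show ?thesis by (rule LIMSEQ_unique)
  qed
  have mono: "lam T \<le> lam T'" if T: "0 < T" "T \<le> T'" for T T'
  proof -
    have "c T' \<le> c T"
      unfolding c_def
    proof (rule integral_mono_AE[OF ji ji])
      show "AE \<omega> in completion M. exp (- jump_sum X a b T' g \<omega>) \<le> exp (- jump_sum X a b T g \<omega>)"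
        using AE_completion[OF AE_cadlag]
      proof eventually_elim
        case (elim \<omega>)
        have "jump_sum X a b T g \<omega> \<le> jump_sum X a b T' g \<omega>"
          unfolding jump_sum_def using finite_jump_set[OF elim ab, of T'] T g0 by (intro sum_mono2) auto
        then show ?case by simp
      qed
    qed (use T in auto)
    then show ?thesis using cpos[of T'] T by (simp add: lam_def)
  qed
  have l0: "0 \<le> lam 1" by (rule LIMSEQ_le_const[OF lim[OF zero_less_one]]) (use H01 in auto)
  \<comment> \<open>By monotonicity, \<open>real k * lam T\<close> and
    \<open>real k * T * lam 1\<close> both lie between the values of \<open>lam\<close> at two
    consecutive integers, so they differ by at most \<open>lam 1\<close>. For large \<open>k\<close>
    this contradicts a fixed gap between \<open>lam T\<close> and \<open>T * lam 1\<close>.\<close>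
  have lin: "lam T = T * lam 1" if T: "T > 0" for T
  proof (rule ccontr)
    assume "lam T \<noteq> T * lam 1"
    then have d: "\<bar>lam T - T * lam 1\<bar> > 0" by simp
    obtain k0 :: nat where k0: "(lam 1 + 1) / \<bar>lam T - T * lam 1\<bar> < real k0" using reals_Archimedean2 by blast
    obtain k1 :: nat where k1: "1 / T < real k1" using reals_Archimedean2 by blast
    define k where "k = max k0 k1"
    have kT: "real k * T > 1"
    proof -
      have "1 < real k1 * T" using k1 T by (simp add: field_simps)
      also have "\<dots> \<le> real k * T" using T by (intro mult_right_mono) (auto simp: k_def)
      finally show ?thesis .
    qed
    then have k: "k > 0" by (cases k) auto
    define j where "j = nat \<lfloor>real k * T\<rfloor>"
    have j: "j \<ge> 1" "real j \<le> real k * T" "real k * T \<le> real (Suc j)"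
      using kT unfolding j_def by linarith+
    have "real j * lam 1 = lam (real j)" using scale[of 1 j] j by simp
    also have "\<dots> \<le> lam (real k * T)" using j by (intro mono) auto
    also have "\<dots> = real k * lam T" using scale[OF T k] .
    finally have A: "real j * lam 1 \<le> real k * lam T" .
    have "real k * lam T = lam (real k * T)" using scale[OF T k] by simp
    also have "\<dots> \<le> lam (real (Suc j))" using j kT by (intro mono) auto
    also have "\<dots> = real (Suc j) * lam 1" using scale[of 1 "Suc j"] by simp
    finally have B: "real k * lam T \<le> real (Suc j) * lam 1" .
    have C1: "real j * lam 1 \<le> (real k * T) * lam 1" "(real k * T) * lam 1 \<le> real (Suc j) * lam 1"
      using j l0 by (intro mult_right_mono; simp)+
    have "\<bar>real k * lam T - (real k * T) * lam 1\<bar> \<le> lam 1" using A B C1 by (simp add: algebra_simps abs_le_iff)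
    moreover have "real k * lam T - (real k * T) * lam 1 = real k * (lam T - T * lam 1)" by (simp add: algebra_simps)
    ultimately have "real k * \<bar>lam T - T * lam 1\<bar> \<le> lam 1" by (simp add: abs_mult)
    moreover have "real k * \<bar>lam T - T * lam 1\<bar> \<ge> real k0 * \<bar>lam T - T * lam 1\<bar>"
      using d by (intro mult_right_mono) (auto simp: k_def)
    moreover have "real k0 * \<bar>lam T - T * lam 1\<bar> > lam 1 + 1" using k0 d by (simp add: field_simps)
    ultimately show False by linarith
  qed
  show ?thesis
  proof (intro exI[of _ "lam 1"] allI impI)
    fix T :: real assume T: "T > 0"
    show "(\<lambda>n. real n * (\<integral>\<omega>. h (X (T / real n) \<omega>) \<partial>M)) \<longlonglongrightarrow> T * lam 1"
      using lim[OF T] unfolding lin[OF T] Hh_def .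
  qed
qed

text \<open>For the partial sums \<open>S\<close>, the functional
  \<open>S\<^sup>2 + B\<^sup>2 + B\<close> grows by a factor of at most \<open>1 + 1 / n\<close>:
  the added constant absorbs the second moment of the step and, with
  \<open>2 * S * B \<le> S\<^sup>2 + B\<^sup>2\<close>, the cross term.\<close>

lemma incr_sum_second_moment:
  assumes T: "0 < T" and n: "0 < n" and hb[measurable]: "h \<in> borel_measurable borel"
    and h01: "\<And>x. 0 \<le> h x" "\<And>x. h x \<le> 1" and B: "real n * (\<integral>\<omega>. h (X (T / real n) \<omega>) \<partial>M) \<le> B"
  shows "(\<integral>\<^sup>+\<omega>. ennreal ((incr_sum X T n h \<omega>)\<^sup>2) \<partial>M) \<le> ennreal (exp 1 * (B\<^sup>2 + B))"
proof -
  define \<mu> where "\<mu> = (\<integral>\<omega>. h (X (T / real n) \<omega>) \<partial>M)"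
  have Tn: "0 \<le> T / real n" using T by simp
  have m[measurable]: "X (T / real n) \<in> borel_measurable M" using Tn by (rule measurable_X)
  have i1: "integrable M (\<lambda>\<omega>. h (X (T / real n) \<omega>))"
    using h01 Tn by (intro integrable_bounded[of _ 1]) auto
  have hsq: "(h x)\<^sup>2 \<le> h x" for x using mult_left_mono[OF h01(2)[of x] h01(1)[of x]] by (simp add: power2_eq_square)
  have i2: "integrable M (\<lambda>\<omega>. (h (X (T / real n) \<omega>))\<^sup>2)"
    using i1 by (rule Bochner_Integration.integrable_bound) (use hsq h01 in auto)
  have m0: "0 \<le> \<mu>" unfolding \<mu>_def using h01 by (intro Bochner_Integration.integral_nonneg) auto
  have mB: "real n * \<mu> \<le> B" using B by (simp add: \<mu>_def)
  have B0: "0 \<le> B" using mB m0 by (meson mult_nonneg_nonneg of_nat_0_le_iff order_trans)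
  define F where "F j x = (\<Sum>i<j. h (x i))\<^sup>2 + (B\<^sup>2 + B)" for j :: nat and x :: "nat \<Rightarrow> real"
  have upd: "F (Suc j) (x(j := y)) = ((\<Sum>i<j. h (x i)) + h y)\<^sup>2 + (B\<^sup>2 + B)" for j x y
  proof -
    have "(\<Sum>i<j. h ((x(j := y)) i)) = (\<Sum>i<j. h (x i))" by (intro sum.cong) auto
    then show ?thesis by (simp add: F_def)
  qed
  have ex: "((S::real) + h y)\<^sup>2 = S\<^sup>2 + 2 * S * h y + (h y)\<^sup>2" for S y by (simp add: power2_sum)
  have "(\<integral>\<^sup>+\<omega>. ennreal (F n (\<lambda>i\<in>{..<n}. X (real (Suc i) * T / real n) \<omega> - X (real i * T / real n) \<omega>)) \<partial>M)
     \<le> ennreal (exp 1 * F 0 (\<lambda>_. undefined))"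
  proof (rule incr_iterate_le[OF T n])
    show "F j \<in> borel_measurable (PiM {..<j} (\<lambda>_. borel))" for j unfolding F_def by measurable
    show "0 \<le> F j x" for j x using B0 by (simp add: F_def)
    show "integrable M (\<lambda>\<omega>. F (Suc j) (x(j := X (T / real n) \<omega>)))" for j x
      unfolding upd ex using i1 i2 by (intro Bochner_Integration.integrable_add integrable_mult_right integrable_const)
    show "(\<lambda>y. F (Suc j) (x(j := y))) \<in> borel_measurable borel" for j x unfolding upd by measurable
    show "(\<integral>\<omega>. F (Suc j) (x(j := X (T / real n) \<omega>)) \<partial>M) \<le> (1 + 1 / real n) * F j x" for j x
    proof -
      define S where "S = (\<Sum>i<j. h (x i))"
      have "(\<integral>\<omega>. F (Suc j) (x(j := X (T / real n) \<omega>)) \<partial>M) = S\<^sup>2 + 2 * S * \<mu> + (\<integral>\<omega>. (h (X (T / real n) \<omega>))\<^sup>2 \<partial>M) + (B\<^sup>2 + B)"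
        unfolding upd ex S_def[symmetric] \<mu>_def using i1 i2 by (simp add: prob_space)
      also have "(\<integral>\<omega>. (h (X (T / real n) \<omega>))\<^sup>2 \<partial>M) \<le> \<mu>"
        unfolding \<mu>_def by (rule Bochner_Integration.integral_mono[OF i2 i1]) (rule hsq)
      finally have 1: "(\<integral>\<omega>. F (Suc j) (x(j := X (T / real n) \<omega>)) \<partial>M) \<le> S\<^sup>2 + (2 * S * \<mu> + \<mu>) + (B\<^sup>2 + B)" by simp
      have "real n * (2 * S * \<mu> + \<mu>) = 2 * S * (real n * \<mu>) + real n * \<mu>" by (simp add: algebra_simps)
      also have "\<dots> \<le> 2 * S * B + B"
      proof -
        have "0 \<le> S" unfolding S_def using h01 by (intro sum_nonneg) auto
        then show ?thesis using mB by (intro add_mono mult_left_mono) auto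
      qed
      also have "2 * S * B \<le> S\<^sup>2 + B\<^sup>2" using sum_squares_bound[of S B] by simp
      finally have "2 * S * \<mu> + \<mu> \<le> (S\<^sup>2 + B\<^sup>2 + B) / real n" using n by (simp add: field_simps)
      moreover have "(1 + 1 / real n) * F j x = S\<^sup>2 + (B\<^sup>2 + B) + (S\<^sup>2 + B\<^sup>2 + B) / real n"
        by (simp add: F_def S_def[symmetric] algebra_simps add_divide_distrib)
      ultimately show ?thesis using 1 by linarith
    qed
  qed simp
  also have "F 0 (\<lambda>_. undefined) = B\<^sup>2 + B" by (simp add: F_def)
  finally have le: "(\<integral>\<^sup>+\<omega>. ennreal (F n (\<lambda>i\<in>{..<n}. X (real (Suc i) * T / real n) \<omega> - X (real i * T / real n) \<omega>)) \<partial>M)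
     \<le> ennreal (exp 1 * (B\<^sup>2 + B))" .
  have eq: "F n (\<lambda>i\<in>{..<n}. X (real (Suc i) * T / real n) \<omega> - X (real i * T / real n) \<omega>) = (incr_sum X T n h \<omega>)\<^sup>2 + (B\<^sup>2 + B)" for \<omega>
    unfolding F_def incr_sum_def sum_restrict_eq ..
  show ?thesis
    by (rule order_trans[OF nn_integral_mono le], unfold eq, rule ennreal_leI) (simp add: B0)
qed

lemma expectation_incr_sum:
  assumes T: "0 < T" and hb[measurable]: "h \<in> borel_measurable borel" and B: "\<And>x. \<bar>h x\<bar> \<le> (B::real)"
  shows "integrable M (incr_sum X T n h)"
    "expectation (incr_sum X T n h) = real n * (\<integral>\<omega>. h (X (T / real n) \<omega>) \<partial>M)"
proof -
  have m: "X (real i * T / real n) \<in> borel_measurable M" for i using T by (intro measurable_X) auto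
  have int: "integrable M (\<lambda>\<omega>. h (X (real (Suc i) * T / real n) \<omega> - X (real i * T / real n) \<omega>))" for i
    using m[of i] m[of "Suc i"] B by (intro integrable_const_bound[of _ B]) (auto simp del: of_nat_Suc)
  show "integrable M (incr_sum X T n h)"
    unfolding incr_sum_def by (intro Bochner_Integration.integrable_sum int)
  have "expectation (incr_sum X T n h) = (\<Sum>i<n. (\<integral>\<omega>. h (X (real (Suc i) * T / real n) \<omega> - X (real i * T / real n) \<omega>) \<partial>M))"
    unfolding incr_sum_def by (rule Bochner_Integration.integral_sum) (rule int)
  also have "\<dots> = (\<Sum>i<n. (\<integral>\<omega>. h (X (T / real n) \<omega>) \<partial>M))"
  proof (intro sum.cong refl)
    fix i
    have e: "real (Suc i) * T / real n = real i * T / real n + T / real n" by (simp add: field_simps add_divide_distrib)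
    have m': "X (real i * T / real n + T / real n) \<in> borel_measurable M" "X (T / real n) \<in> borel_measurable M"
      using T by (auto intro!: measurable_X)
    have "(\<integral>\<omega>. h (X (real i * T / real n + T / real n) \<omega> - X (real i * T / real n) \<omega>) \<partial>M)
      = (\<integral>y. h y \<partial>distr M borel (\<lambda>\<omega>. X (real i * T / real n + T / real n) \<omega> - X (real i * T / real n) \<omega>))"
      using m[of i] m' by (intro integral_distr[symmetric]) auto
    also have "\<dots> = (\<integral>y. h y \<partial>distr M borel (X (T / real n)))" using T by (subst levy_stationary) auto
    also have "\<dots> = (\<integral>\<omega>. h (X (T / real n) \<omega>) \<partial>M)" using m' by (intro integral_distr) auto
    finally show "(\<integral>\<omega>. h (X (real (Suc i) * T / real n) \<omega> - X (real i * T / real n) \<omega>) \<partial>M) = (\<integral>\<omega>. h (X (T / real n) \<omega>) \<partial>M)"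
      unfolding e .
  qed
  finally show "expectation (incr_sum X T n h) = real n * (\<integral>\<omega>. h (X (T / real n) \<omega>) \<partial>M)" by simp
qed

text \<open>This identifies the rate \<open>l\<close> of \<open>tendsto_mean_small\<close>. At
  \<open>T = 1\<close> the second moments of the increment sums are bounded, so their means converge
  to the mean of the jump sum, which \<open>nn_integral_jump_sum\<close> computes.\<close>

lemma tendsto_mean_nonneg:
  assumes ab: "0 \<notin> {a..b}" and h: "regular a b h" and h01: "\<And>x. 0 \<le> h x" "\<And>x. h x \<le> 1/2" and T: "0 < T"
  shows "(\<lambda>n. real n * (\<integral>\<omega>. h (X (T / real n) \<omega>) \<partial>M)) \<longlonglongrightarrow> T * (LINT x:{a..b}|lborel. h x * s x)"
proof -
  obtain l where l: "\<And>T. T > 0 \<Longrightarrow> (\<lambda>n. real n * (\<integral>\<omega>. h (X (T / real n) \<omega>) \<partial>M)) \<longlonglongrightarrow> T * l"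
    using tendsto_mean_small[OF ab h h01] by blast
  have hb[measurable]: "h \<in> borel_measurable borel" using h by (rule regular_borel)
  interpret CM: prob_space "completion M" by (rule prob_space_completion)
  have l1: "(\<lambda>n. real n * (\<integral>\<omega>. h (X (1 / real n) \<omega>) \<partial>M)) \<longlonglongrightarrow> l" using l[of 1] by simp
  then have "Bseq (\<lambda>n. real n * (\<integral>\<omega>. h (X (1 / real n) \<omega>) \<partial>M))" by (intro convergent_imp_Bseq convergentI)
  then obtain B where B: "B > 0" "\<And>n. norm (real n * (\<integral>\<omega>. h (X (1 / real n) \<omega>) \<partial>M)) \<le> B" by (rule BseqE) blast
  have h1: "h x \<le> 1" for x using h01(2)[of x] by simp
  have n0: "incr_sum X 1 0 h \<omega> = 0" for \<omega> by (simp add: incr_sum_def)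
  have bound: "(\<integral>\<^sup>+\<omega>. ennreal ((incr_sum X 1 n h \<omega>)\<^sup>2) \<partial>completion M) \<le> ennreal (exp 1 * (B\<^sup>2 + B))" for n
  proof (cases "n = 0")
    case True then show ?thesis using B by (simp add: n0)
  next
    case False
    have "real n * (\<integral>\<omega>. h (X (1 / real n) \<omega>) \<partial>M) \<le> B" using B(2)[of n] by simp
    from incr_sum_second_moment[OF zero_less_one _ hb h01(1) h1 this] False
    show ?thesis by (simp add: nn_integral_completion)
  qed
  have jm[measurable]: "jump_sum X a b 1 h \<in> borel_measurable (completion M)"
    by (rule regular_measurable_jump_sum[OF ab h zero_less_one])
  have j0: "0 \<le> jump_sum X a b 1 h \<omega>" for \<omega> unfolding jump_sum_def using h01 by (intro sum_nonneg) auto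
  have i0: "0 \<le> incr_sum X 1 n h \<omega>" for n \<omega> unfolding incr_sum_def using h01 by (intro sum_nonneg) auto
  have im: "incr_sum X 1 n h \<in> borel_measurable (completion M)" for n
    by (intro measurable_completion measurable_incr_sum hb zero_less_one)
  have lim: "(\<lambda>n. CM.expectation (incr_sum X 1 n h)) \<longlonglongrightarrow> CM.expectation (jump_sum X a b 1 h)"
    and ji: "integrable (completion M) (jump_sum X a b 1 h)"
    using CM.tendsto_expectation_of_second_moment[OF im jm i0 j0 AE_completion[OF regular_incr_sum_tendsto[OF ab h zero_less_one]] bound] B
    by auto
  have eq: "CM.expectation (incr_sum X 1 n h) = real n * (\<integral>\<omega>. h (X (1 / real n) \<omega>) \<partial>M)" if n: "n > 0" for n
  proof -
    have "CM.expectation (incr_sum X 1 n h) = expectation (incr_sum X 1 n h)"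
      by (rule integral_completion) (intro measurable_incr_sum hb zero_less_one)
    then show ?thesis using expectation_incr_sum(2)[of 1 h 1 n] n h01 h1 by simp
  qed
  have "eventually (\<lambda>n. CM.expectation (incr_sum X 1 n h) = real n * (\<integral>\<omega>. h (X (1 / real n) \<omega>) \<partial>M)) sequentially"
    using eq eventually_gt_at_top[of 0] by (rule eventually_mono[rotated])
  then have "(\<lambda>n. real n * (\<integral>\<omega>. h (X (1 / real n) \<omega>) \<partial>M)) \<longlonglongrightarrow> CM.expectation (jump_sum X a b 1 h)"
    using lim by (subst (asm) tendsto_cong) auto
  then have l_eq: "l = CM.expectation (jump_sum X a b 1 h)" using l1 LIMSEQ_unique by blast
  have si: "integrable lborel (\<lambda>x. indicator {a..b} x * (h x * s x))"
  proof (rule Bochner_Integration.integrable_bound)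
    show "integrable lborel (\<lambda>x. indicator {a..b} x * s x)" using integrable_s[OF ab] by (simp add: set_integrable_def)
    show "AE x in lborel. norm (indicator {a..b} x * (h x * s x)) \<le> norm (indicator {a..b} x * s x)"
      using h01 h1 by (auto simp: abs_mult split: split_indicator intro!: mult_left_le_one_le)
  qed auto
  have snn: "0 \<le> indicator {a..b} x * (h x * s x)" for x
    using s_nonneg[of x] h01(1)[of x] ab by (cases "x = 0") auto
  have "ennreal (CM.expectation (jump_sum X a b 1 h)) = (\<integral>\<^sup>+\<omega>. ennreal (jump_sum X a b 1 h \<omega>) \<partial>completion M)"
    by (rule nn_integral_eq_integral[symmetric, OF ji]) (use j0 in auto)
  also have "\<dots> = (\<integral>\<^sup>+\<omega>. jump_sum X a b 1 (\<lambda>x. ennreal (h x)) \<omega> \<partial>M)"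
    using h01 by (simp add: nn_integral_completion jump_sum_def)
  also have "\<dots> = (\<integral>\<^sup>+x. ennreal (h x) * ennreal (s x) * indicator {a..b} x \<partial>lborel)"
    by (rule nn_integral_jump_sum[OF ab]) measurable
  also have "\<dots> = (\<integral>\<^sup>+x. ennreal (indicator {a..b} x * (h x * s x)) \<partial>lborel)"
    using h01 by (intro nn_integral_cong) (auto simp: ennreal_mult' split: split_indicator)
  also have "\<dots> = ennreal (\<integral>x. indicator {a..b} x * (h x * s x) \<partial>lborel)"
    by (rule nn_integral_eq_integral[OF si]) (use snn in auto)
  finally have "CM.expectation (jump_sum X a b 1 h) = (\<integral>x. indicator {a..b} x * (h x * s x) \<partial>lborel)"
    using j0 snn by (subst (asm) ennreal_inj) (auto intro!: Bochner_Integration.integral_nonneg)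
  then show ?thesis using l[OF T] by (simp add: l_eq set_lebesgue_integral_def)
qed

section \<open>Closure of the regular functions and the mean formula for all of them\<close>

lemma regularI_continuous:
  assumes "\<And>x. isCont g x" "\<And>x. \<bar>g x\<bar> \<le> B" "\<And>x. x \<notin> {a..b} \<Longrightarrow> g x = 0"
  shows "regular a b g"
  unfolding regular_def using assms
  by (auto intro!: borel_measurable_continuous_onI continuous_at_imp_continuous_on)

lemma regular_comp:
  assumes g: "regular a b g" and f: "\<And>x. isCont f x" "f 0 = 0"
  shows "regular a b (\<lambda>x. f (g x))"
proof -
  obtain B where B: "\<And>x. \<bar>g x\<bar> \<le> B" using g by (auto simp: regular_def)
  have "continuous_on {-B..B} f" by (intro continuous_at_imp_continuous_on ballI f(1))
  then have "bounded (f ` {-B..B})" using compact_continuous_image compact_imp_bounded compact_Icc by blast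
  then obtain C where C: "\<forall>z\<in>f ` {-B..B}. norm z \<le> C" unfolding bounded_iff by blast
  have "g x \<in> {-B..B}" for x using B[of x] by auto
  then have "\<bar>f (g x)\<bar> \<le> C" for x using C by simp
  then have 1: "\<exists>C. \<forall>x. \<bar>f (g x)\<bar> \<le> C" by blast
  have [measurable]: "g \<in> borel_measurable borel" using g by (rule regular_borel)
  have [measurable]: "f \<in> borel_measurable borel"
    by (intro borel_measurable_continuous_onI continuous_at_imp_continuous_on ballI f(1))
  have 2: "AE \<omega> in M. \<forall>t. 0 < t \<longrightarrow> jump X t \<omega> \<in> {a..b} \<longrightarrow> isCont (\<lambda>x. f (g x)) (jump X t \<omega>)"
    using g unfolding regular_def
    by (auto elim!: eventually_mono intro!: isCont_o2[OF _ f(1)])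
  show ?thesis unfolding regular_def using 1 2 g f(2) by (auto simp: regular_def)
qed

lemma regular_add:
  assumes f: "regular a b f" and g: "regular a b g"
  shows "regular a b (\<lambda>x. f x + g x)"
proof -
  obtain B C where "\<And>x. \<bar>f x\<bar> \<le> B" "\<And>x. \<bar>g x\<bar> \<le> C" using f g by (auto simp: regular_def)
  then have 1: "\<bar>f x + g x\<bar> \<le> B + C" for x by (meson abs_triangle_ineq add_mono order_trans)
  have "AE \<omega> in M. \<forall>t. 0 < t \<longrightarrow> jump X t \<omega> \<in> {a..b} \<longrightarrow> isCont f (jump X t \<omega>)"
    "AE \<omega> in M. \<forall>t. 0 < t \<longrightarrow> jump X t \<omega> \<in> {a..b} \<longrightarrow> isCont g (jump X t \<omega>)"
    using f g by (auto simp: regular_def)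
  then have "AE \<omega> in M. \<forall>t. 0 < t \<longrightarrow> jump X t \<omega> \<in> {a..b} \<longrightarrow> isCont (\<lambda>x. f x + g x) (jump X t \<omega>)"
    by eventually_elim (auto intro!: continuous_intros)
  then show ?thesis unfolding regular_def using 1 regular_borel[OF f] regular_borel[OF g] f g by (auto simp: regular_def)
qed

lemma regular_mult:
  assumes f: "regular a b f" and g: "regular a b g"
  shows "regular a b (\<lambda>x. f x * g x)"
proof -
  obtain B C where "\<And>x. \<bar>f x\<bar> \<le> B" "\<And>x. \<bar>g x\<bar> \<le> C" using f g by (auto simp: regular_def)
  then have 1: "\<bar>f x * g x\<bar> \<le> B * C" for x
    unfolding abs_mult by (intro mult_mono) (auto intro: order_trans[OF abs_ge_zero])
  have "AE \<omega> in M. \<forall>t. 0 < t \<longrightarrow> jump X t \<omega> \<in> {a..b} \<longrightarrow> isCont f (jump X t \<omega>)"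
    "AE \<omega> in M. \<forall>t. 0 < t \<longrightarrow> jump X t \<omega> \<in> {a..b} \<longrightarrow> isCont g (jump X t \<omega>)"
    using f g by (auto simp: regular_def)
  then have "AE \<omega> in M. \<forall>t. 0 < t \<longrightarrow> jump X t \<omega> \<in> {a..b} \<longrightarrow> isCont (\<lambda>x. f x * g x) (jump X t \<omega>)"
    by eventually_elim (auto intro!: continuous_intros)
  then show ?thesis unfolding regular_def using 1 regular_borel[OF f] regular_borel[OF g] f g by (auto simp: regular_def)
qed

lemma regular_zero: "regular a b (\<lambda>_. 0)"
  by (rule regularI_continuous[of _ 0]) auto

lemma regular_sum:
  "(\<And>i. i \<in> I \<Longrightarrow> regular a b (f i)) \<Longrightarrow> regular a b (\<lambda>x. \<Sum>i\<in>I. f i x)"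
  by (induction I rule: infinite_finite_induct) (auto intro!: regular_add simp: regular_zero)

lemma integrable_regular_s:
  assumes ab: "0 \<notin> {a..b}" and h: "regular a b h"
  shows "set_integrable lborel {a..b} (\<lambda>x. h x * s x)"
proof -
  obtain B where B: "\<And>x. \<bar>h x\<bar> \<le> B" using h by (auto simp: regular_def)
  have [measurable]: "h \<in> borel_measurable borel" using h by (rule regular_borel)
  show ?thesis unfolding set_integrable_def
  proof (rule Bochner_Integration.integrable_bound)
    show "integrable lborel (\<lambda>x. B * (indicator {a..b} x * s x))"
      using integrable_s[OF ab] by (intro integrable_mult_right) (simp add: set_integrable_def)
    show "AE x in lborel. norm (indicator {a..b} x *\<^sub>R (h x * s x)) \<le> norm (B * (indicator {a..b} x * s x))"
      using B by (auto simp: abs_mult split: split_indicator intro!: AE_I2 mult_right_mono order_trans[OF B abs_ge_self])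
  qed measurable
qed

text \<open>The positive and the negative part of \<open>h\<close>, divided by \<open>2 * B\<close>,
  take values in \<open>{0..1/2}\<close>, as the Laplace transform argument demands.\<close>

lemma tendsto_mean:
  assumes ab: "0 \<notin> {a..b}" and h: "regular a b h" and T: "0 < T"
  shows "(\<lambda>n. real n * (\<integral>\<omega>. h (X (T / real n) \<omega>) \<partial>M)) \<longlonglongrightarrow> T * (LINT x:{a..b}|lborel. h x * s x)"
proof -
  obtain B0 where B0: "\<And>x. \<bar>h x\<bar> \<le> B0" using h by (auto simp: regular_def)
  define B where "B = max 1 B0"
  have B: "\<bar>h x\<bar> \<le> B" "B > 0" for x using B0[of x] by (auto simp: B_def)
  define p where "p x = max 0 (h x) / (2 * B)" for x
  define q where "q x = max 0 (- h x) / (2 * B)" for x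
  have rp: "regular a b p" "regular a b q"
    unfolding p_def q_def using B
    by (auto intro!: regular_comp[OF h, of "\<lambda>y. max 0 y / (2 * B)"] regular_comp[OF h, of "\<lambda>y. max 0 (- y) / (2 * B)"] continuous_intros)
  have p01: "0 \<le> p x" "p x \<le> 1/2" "0 \<le> q x" "q x \<le> 1/2" for x
    using B(1)[of x] B(2) by (auto simp: p_def q_def field_simps)
  have hpq: "h x = 2 * B * (p x - q x)" for x using B(2) by (auto simp: p_def q_def max_def field_simps)
  note lp = tendsto_mean_nonneg[OF ab rp(1) p01(1,2) T]
  note lq = tendsto_mean_nonneg[OF ab rp(2) p01(3,4) T]
  have ip: "integrable M (\<lambda>\<omega>. p (X (T / real n) \<omega>))" "integrable M (\<lambda>\<omega>. q (X (T / real n) \<omega>))" for n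
    using T p01 regular_borel[OF rp(1)] regular_borel[OF rp(2)] by (auto intro!: integrable_bounded[of _ "1/2"])
  have "real n * (\<integral>\<omega>. h (X (T / real n) \<omega>) \<partial>M) = 2 * B * (real n * (\<integral>\<omega>. p (X (T / real n) \<omega>) \<partial>M) - real n * (\<integral>\<omega>. q (X (T / real n) \<omega>) \<partial>M))" for n
    unfolding hpq using ip[of n] by (simp add: algebra_simps)
  moreover have "T * (LINT x:{a..b}|lborel. h x * s x) = 2 * B * (T * (LINT x:{a..b}|lborel. p x * s x) - T * (LINT x:{a..b}|lborel. q x * s x))"
  proof -
    have "(LINT x:{a..b}|lborel. h x * s x) = (LINT x:{a..b}|lborel. 2 * B * (p x * s x - q x * s x))"
      unfolding hpq by (intro arg_cong[of _ _ "set_lebesgue_integral lborel {a..b}"]) (auto simp: algebra_simps)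
    also have "\<dots> = 2 * B * ((LINT x:{a..b}|lborel. p x * s x) - (LINT x:{a..b}|lborel. q x * s x))"
      using set_integral_diff(2)[OF integrable_regular_s[OF ab rp(1)] integrable_regular_s[OF ab rp(2)]] by simp
    finally have e: "(LINT x:{a..b}|lborel. h x * s x) = 2 * B * ((LINT x:{a..b}|lborel. p x * s x) - (LINT x:{a..b}|lborel. q x * s x))" .
    show ?thesis unfolding e by (simp add: algebra_simps)
  qed
  ultimately show ?thesis using lp lq by (auto intro!: tendsto_intros)
qed

text \<open>Tents that shrink to the point \<open>y\<close> have integrals against \<open>s\<close>
  that tend to 0. By Fatou's lemma these integrals bound, up to the factors \<open>T\<close> and
  1/2, the expected number of jumps of size \<open>y\<close> up to time \<open>T\<close>.\<close>

lemma AE_jump_neq: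
  assumes y: "y \<noteq> 0"
  shows "AE \<omega> in M. \<forall>t. 0 < t \<longrightarrow> jump X t \<omega> \<noteq> y"
proof -
  define a where "a = y - \<bar>y\<bar>/2"
  define b where "b = y + \<bar>y\<bar>/2"
  have ab: "0 \<notin> {a..b}" using y by (auto simp: a_def b_def abs_if)
  have yab: "y \<in> {a..b}" using y by (auto simp: a_def b_def)
  \<comment> \<open>A tent of height 1/2 at \<open>y\<close>. The summand
    \<open>1 / \<bar>y\<bar>\<close> of the slope keeps the support within \<open>{a..b}\<close>
    already for \<open>k = 0\<close>.\<close>
  define h where "h k x = max 0 (1/2 - (real k + 1 / \<bar>y\<bar>) * \<bar>x - y\<bar>)" for k :: nat and x
  have "0 \<le> (real k + 1 / \<bar>y\<bar>) * \<bar>x - y\<bar>" for k :: nat and x by simp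
  then have h01: "0 \<le> h k x" "h k x \<le> 1/2" for k x unfolding h_def by (auto simp: max_def)
  have hab: "h k x = 0" if "x \<notin> {a..b}" for k x
  proof -
    have "\<bar>x - y\<bar> \<ge> \<bar>y\<bar>/2" using that by (auto simp: a_def b_def)
    then have "1 / \<bar>y\<bar> * \<bar>x - y\<bar> \<ge> 1/2" using y by (simp add: field_simps)
    moreover have "0 \<le> real k * \<bar>x - y\<bar>" by simp
    ultimately have "(real k + 1 / \<bar>y\<bar>) * \<bar>x - y\<bar> \<ge> 1/2" unfolding distrib_right by linarith
    then show ?thesis unfolding h_def by (intro max_absorb1) linarith
  qed
  have reg: "regular a b (h k)" for k
  proof (rule regularI_continuous[of _ "1/2"])
    show "isCont (h k) x" for x unfolding h_def[abs_def] by (intro continuous_intros)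
    show "\<bar>h k x\<bar> \<le> 1/2" for x using h01[of k x] by simp
  qed (rule hab)
  have lim0: "(\<lambda>k. LINT x:{a..b}|lborel. h k x * s x) \<longlonglongrightarrow> 0"
  proof -
    have "(\<lambda>k. \<integral>x. indicator {a..b} x *\<^sub>R (h k x * s x) \<partial>lborel) \<longlonglongrightarrow> (\<integral>x. 0 \<partial>(lborel :: real measure))"
    proof (rule integral_dominated_convergence[where w = "\<lambda>x. indicator {a..b} x * s x"])
      show "integrable lborel (\<lambda>x. indicator {a..b} x * s x)"
        using integrable_s[OF ab] by (simp add: set_integrable_def)
      show "(\<lambda>x. indicator {a..b} x *\<^sub>R (h k x * s x)) \<in> borel_measurable lborel" for k
        using regular_borel[OF reg[of k]] by measurable
      show "AE x in lborel. (\<lambda>k. indicator {a..b} x *\<^sub>R (h k x * s x)) \<longlonglongrightarrow> 0"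
        using AE_lborel_singleton[of y]
      proof eventually_elim
        case (elim x)
        then have d: "\<bar>x - y\<bar> > 0" by simp
        obtain k0 :: nat where k0: "1 / \<bar>x - y\<bar> < real k0" using reals_Archimedean2 by blast
        have "h k x = 0" if "k \<ge> k0" for k
        proof -
          have "1 < real k0 * \<bar>x - y\<bar>" using k0 d by (simp add: field_simps)
          also have "\<dots> \<le> (real k + 1 / \<bar>y\<bar>) * \<bar>x - y\<bar>" using that by (intro mult_right_mono) (auto intro: order_trans[of _ "real k"])
          finally show ?thesis by (simp add: h_def)
        qed
        then have "eventually (\<lambda>k. indicator {a..b} x *\<^sub>R (h k x * s x) = 0) sequentially" by (auto simp: eventually_sequentially)
        then show ?case by (rule tendsto_eventually)
      qed
      show "AE x in lborel. norm (indicator {a..b} x *\<^sub>R (h k x * s x)) \<le> indicator {a..b} x * s x" for k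
      proof (intro AE_I2)
        fix x
        have "h k x * s x \<le> 1 * s x" if "x \<in> {a..b}"
          using h01[of k x] s_nonneg[of x] that ab by (intro mult_right_mono) auto
        then show "norm (indicator {a..b} x *\<^sub>R (h k x * s x)) \<le> indicator {a..b} x * s x"
          using h01[of k x] s_nonneg[of x] ab by (auto split: split_indicator simp: abs_mult)
      qed
    qed auto
    then show ?thesis by (simp add: set_lebesgue_integral_def)
  qed
  have nojump: "AE \<omega> in M. \<forall>t. 0 < t \<longrightarrow> t \<le> T \<longrightarrow> jump X t \<omega> \<noteq> y" if T: "T > 0" for T
  proof -
    have fatou: "(\<integral>\<^sup>+\<omega>. ennreal (jump_sum X a b T (h k) \<omega>) \<partial>M) \<le> ennreal (T * (LINT x:{a..b}|lborel. h k x * s x))" for k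
    proof -
      have i0: "0 \<le> incr_sum X T n (h k) \<omega>" for n \<omega> unfolding incr_sum_def using h01 by (intro sum_nonneg) auto
      have B: "\<bar>h k x\<bar> \<le> 1/2" for x using h01[of k x] by simp
      have "(\<integral>\<^sup>+\<omega>. ennreal (jump_sum X a b T (h k) \<omega>) \<partial>M) = (\<integral>\<^sup>+\<omega>. liminf (\<lambda>n. ennreal (incr_sum X T n (h k) \<omega>)) \<partial>M)"
      proof (rule nn_integral_cong_AE)
        show "AE \<omega> in M. ennreal (jump_sum X a b T (h k) \<omega>) = liminf (\<lambda>n. ennreal (incr_sum X T n (h k) \<omega>))"
          using regular_incr_sum_tendsto[OF ab reg T]
          by eventually_elim (intro lim_imp_Liminf[symmetric] tendsto_ennrealI trivial_limit_sequentially)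
      qed
      also have "\<dots> \<le> liminf (\<lambda>n. \<integral>\<^sup>+\<omega>. ennreal (incr_sum X T n (h k) \<omega>) \<partial>M)"
        by (intro nn_integral_liminf measurable_compose[OF measurable_incr_sum[OF regular_borel[OF reg[of k]] T]] measurable_ennreal)
      also have "\<dots> = liminf (\<lambda>n. ennreal (real n * (\<integral>\<omega>. h k (X (T / real n) \<omega>) \<partial>M)))"
        using expectation_incr_sum[OF T regular_borel[OF reg[of k]] B] i0
        by (simp add: nn_integral_eq_integral)
      also have "\<dots> = ennreal (T * (LINT x:{a..b}|lborel. h k x * s x))"
        by (intro lim_imp_Liminf tendsto_ennrealI tendsto_mean ab reg T trivial_limit_sequentially)
      finally show ?thesis .
    qed
    have "(\<integral>\<^sup>+\<omega>. jump_sum X a b T (\<lambda>x. ennreal (1/2) * indicator {y} x) \<omega> \<partial>M) \<le> 0"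
    proof (rule LIMSEQ_le_const)
      have "(\<lambda>k. ennreal (T * (LINT x:{a..b}|lborel. h k x * s x))) \<longlonglongrightarrow> ennreal (T * 0)"
        by (intro tendsto_ennrealI tendsto_mult_left lim0)
      then show "(\<lambda>k. ennreal (T * (LINT x:{a..b}|lborel. h k x * s x))) \<longlonglongrightarrow> 0" by simp
      have "(\<integral>\<^sup>+\<omega>. jump_sum X a b T (\<lambda>x. ennreal (1/2) * indicator {y} x) \<omega> \<partial>M) \<le> (\<integral>\<^sup>+\<omega>. ennreal (jump_sum X a b T (h k) \<omega>) \<partial>M)" for k
      proof (rule nn_integral_mono)
        fix \<omega>
        have "ennreal (jump_sum X a b T (h k) \<omega>) = jump_sum X a b T (\<lambda>x. ennreal (h k x)) \<omega>"
          unfolding jump_sum_def using h01 by (simp add: sum_ennreal)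
        moreover have "jump_sum X a b T (\<lambda>x. ennreal (1/2) * indicator {y} x) \<omega> \<le> jump_sum X a b T (\<lambda>x. ennreal (h k x)) \<omega>"
          unfolding jump_sum_def by (intro sum_mono) (auto simp: h_def split: split_indicator)
        ultimately show "jump_sum X a b T (\<lambda>x. ennreal (1/2) * indicator {y} x) \<omega> \<le> ennreal (jump_sum X a b T (h k) \<omega>)" by simp
      qed
      then show "\<exists>N. \<forall>k\<ge>N. (\<integral>\<^sup>+\<omega>. jump_sum X a b T (\<lambda>x. ennreal (1/2) * indicator {y} x) \<omega> \<partial>M) \<le> ennreal (T * (LINT x:{a..b}|lborel. h k x * s x))"
        using fatou order_trans by blast
    qed
    moreover have "jump_sum X a b T (\<lambda>x. ennreal (1/2) * indicator {y} x) \<in> borel_measurable (completion M)"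
      by (rule measurable_jump_sum_ennreal[OF ab T]) measurable
    ultimately have "AE \<omega> in completion M. jump_sum X a b T (\<lambda>x. ennreal (1/2) * indicator {y} x) \<omega> = 0"
      by (subst (asm) nn_integral_completion[symmetric]) (simp add: nn_integral_0_iff_AE)
    then have "AE \<omega> in M. jump_sum X a b T (\<lambda>x. ennreal (1/2) * indicator {y} x) \<omega> = 0" by (simp add: AE_completion_iff)
    then show ?thesis using AE_cadlag
    proof eventually_elim
      case (elim \<omega>)
      show ?case
      proof (intro allI impI notI)
        fix t assume t: "0 < t" "t \<le> T" "jump X t \<omega> = y"
        have "finite {t. 0 < t \<and> t \<le> T \<and> jump X t \<omega> \<in> {a..b}}" by (rule finite_jump_set[OF elim(2) ab])
        moreover have "t \<in> {t. 0 < t \<and> t \<le> T \<and> jump X t \<omega> \<in> {a..b}}" using t yab by simp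
        ultimately have "ennreal (1/2) * indicator {y} (jump X t \<omega>) = 0" using elim(1)
          unfolding jump_sum_def by (simp only: sum_eq_0_iff)
        then show False using t by simp
      qed
    qed
  qed
  have "AE \<omega> in M. \<forall>N::nat. \<forall>t. 0 < t \<longrightarrow> t \<le> real (Suc N) \<longrightarrow> jump X t \<omega> \<noteq> y"
    unfolding AE_all_countable by (intro allI nojump) simp
  then show ?thesis
  proof eventually_elim
    case (elim \<omega>)
    show ?case
    proof (intro allI impI)
      fix t :: real assume "0 < t"
      moreover obtain N :: nat where "t < real N" using reals_Archimedean2 by blast
      ultimately show "jump X t \<omega> \<noteq> y" using elim[rule_format, of t N] by simp
    qed
  qed
qed

text \<open>Almost surely no jump size falls into the finite set \<open>F\<close>, so continuity off
  \<open>F\<close> is continuity at the jumps. For piecewise polynomials \<open>F\<close> will be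
  the set of grid points, which contains \<open>a\<close> and \<open>b\<close>.\<close>

lemma regularI:
  assumes ab: "0 \<notin> {a..b}" and F: "finite F" and g: "g \<in> borel_measurable borel" "\<And>x. \<bar>g x\<bar> \<le> B" "\<And>x. x \<notin> {a..b} \<Longrightarrow> g x = 0"
    and cont: "\<And>x. x \<in> {a..b} \<Longrightarrow> x \<notin> F \<Longrightarrow> isCont g x"
  shows "regular a b g"
proof -
  have "AE \<omega> in M. \<forall>y\<in>F \<inter> {a..b}. \<forall>t. 0 < t \<longrightarrow> jump X t \<omega> \<noteq> y"
    using F ab by (intro AE_finite_allI AE_jump_neq) auto
  then have "AE \<omega> in M. \<forall>t. 0 < t \<longrightarrow> jump X t \<omega> \<in> {a..b} \<longrightarrow> isCont g (jump X t \<omega>)"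
  proof eventually_elim
    case (elim \<omega>)
    show ?case
    proof (intro allI impI)
      fix t assume t: "0 < t" "jump X t \<omega> \<in> {a..b}"
      then have "jump X t \<omega> \<notin> F" using elim by blast
      with t show "isCont g (jump X t \<omega>)" by (intro cont)
    qed
  qed
  then show ?thesis unfolding regular_def using g by blast
qed

end

section \<open>Fourth moments\<close>

text \<open>The cubic term is split by
  \<open>4 * S * z ^ 3 \<le> 2 * S\<^sup>2 * z\<^sup>2 + 2 * z ^ 4\<close>. What remains is a term
  linear in \<open>z\<close>, which has mean 0 for a centred step, and even powers of
  \<open>z\<close>.\<close>

lemma power4_add_le:
  fixes S z :: real
  shows "(S + z) ^ 4 \<le> S ^ 4 + 4 * S ^ 3 * z + 8 * S\<^sup>2 * z\<^sup>2 + 3 * z ^ 4"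
proof -
  have "0 \<le> 2 * z\<^sup>2 * (S - z)\<^sup>2" by simp
  then show ?thesis by (simp add: power2_eq_square power3_eq_cube power4_eq_xxxx algebra_simps)
qed

context levy_jumps begin

text \<open>The functional is the fourth power of the centred walk plus
  \<open>c = 16 * K\<^sup>2 + 12 * B\<^sup>2 * K\<close>. The first part of \<open>c\<close> arises
  from \<open>8 * S\<^sup>2 * K \<le> S ^ 4 + 16 * K\<^sup>2\<close>, the second from the fourth
  moment of a step bounded by \<open>2 * B\<close>. With this \<open>c\<close> one step multiplies
  the mean by at most \<open>1 + 1 / n\<close>.\<close>

lemma incr_fourth_moment:
  assumes T: "0 < T" and n: "0 < n" and g[measurable]: "g \<in> borel_measurable borel"
    and B: "\<And>x. \<bar>g x\<bar> \<le> B" and K: "real n * (\<integral>\<omega>. (g (X (T / real n) \<omega>))\<^sup>2 \<partial>M) \<le> K"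
  shows "(\<integral>\<^sup>+\<omega>. ennreal ((incr_sum X T n g \<omega> - real n * (\<integral>\<omega>. g (X (T / real n) \<omega>) \<partial>M)) ^ 4) \<partial>M)
     \<le> ennreal (exp 1 * (16 * K\<^sup>2 + 12 * B\<^sup>2 * K))"
proof -
  define \<mu> where "\<mu> = (\<integral>\<omega>. g (X (T / real n) \<omega>) \<partial>M)"
  define Y where "Y = X (T / real n)"
  have Tn: "0 \<le> T / real n" using T by simp
  have m[measurable]: "Y \<in> borel_measurable M" unfolding Y_def using Tn by (rule measurable_X)
  have B0: "0 \<le> B" using B[of 0] by (meson abs_ge_zero order_trans)
  have i1: "integrable M (\<lambda>\<omega>. g (Y \<omega>))" unfolding Y_def by (rule integrable_bounded[OF g B Tn])
  have mu: "\<bar>\<mu>\<bar> \<le> B"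
  proof -
    have "\<bar>\<mu>\<bar> \<le> (\<integral>\<omega>. \<bar>g (Y \<omega>)\<bar> \<partial>M)" unfolding \<mu>_def Y_def by (rule integral_abs_bound)
    also have "\<dots> \<le> (\<integral>\<omega>. B \<partial>M)" using i1 B by (intro Bochner_Integration.integral_mono) auto
    finally show ?thesis by (simp add: prob_space)
  qed
  define z where "z y = g y - \<mu>" for y
  have zb: "\<bar>z y\<bar> \<le> 2 * B" for y using B[of y] mu by (simp add: z_def)
  have zm[measurable]: "z \<in> borel_measurable borel" unfolding z_def by measurable
  have zi: "integrable M (\<lambda>\<omega>. (z (Y \<omega>)) ^ k)" for k
  proof (rule integrable_const_bound[of _ "(2 * B) ^ k"])
    show "AE \<omega> in M. norm (z (Y \<omega>) ^ k) \<le> (2 * B) ^ k"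
      unfolding real_norm_def power_abs by (intro AE_I2 power_mono zb) simp
  qed measurable
  have z1: "(\<integral>\<omega>. z (Y \<omega>) \<partial>M) = 0" unfolding z_def using i1 by (simp add: prob_space \<mu>_def Y_def)
  define q where "q = (\<integral>\<omega>. (g (Y \<omega>))\<^sup>2 \<partial>M)"
  have q0: "0 \<le> q" unfolding q_def by (intro Bochner_Integration.integral_nonneg) simp
  have nq: "real n * q \<le> K" using K by (simp add: q_def Y_def)
  have K0: "0 \<le> K" using nq q0 by (meson mult_nonneg_nonneg of_nat_0_le_iff order_trans)
  have i2: "integrable M (\<lambda>\<omega>. (g (Y \<omega>))\<^sup>2)"
    unfolding Y_def
  proof (rule integrable_bounded[of "\<lambda>x. (g x)\<^sup>2" "B\<^sup>2", OF _ _ Tn])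
    show "\<bar>(g x)\<^sup>2\<bar> \<le> B\<^sup>2" for x using power_mono[OF B[of x] abs_ge_zero, of 2] by simp
  qed measurable
  have z2: "(\<integral>\<omega>. (z (Y \<omega>)) ^ 2 \<partial>M) \<le> q"
  proof -
    have "(\<integral>\<omega>. (z (Y \<omega>)) ^ 2 \<partial>M) = q - \<mu>\<^sup>2"
      unfolding z_def power2_diff q_def using i1 i2 by (simp add: prob_space \<mu>_def[symmetric] Y_def[symmetric] power2_eq_square) (simp add: \<mu>_def Y_def)
    then show ?thesis by simp
  qed
  have z4: "(\<integral>\<omega>. (z (Y \<omega>)) ^ 4 \<partial>M) \<le> 4 * B\<^sup>2 * q"
  proof -
    have "(\<integral>\<omega>. (z (Y \<omega>)) ^ 4 \<partial>M) \<le> (\<integral>\<omega>. 4 * B\<^sup>2 * (z (Y \<omega>)) ^ 2 \<partial>M)"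
    proof (rule Bochner_Integration.integral_mono[OF zi])
      fix \<omega>
      have "(z (Y \<omega>))\<^sup>2 \<le> (2 * B)\<^sup>2" using zb[of "Y \<omega>"] by (metis abs_ge_zero power2_abs power_mono)
      then have "(z (Y \<omega>))\<^sup>2 * (z (Y \<omega>))\<^sup>2 \<le> (2 * B)\<^sup>2 * (z (Y \<omega>))\<^sup>2" by (intro mult_right_mono) auto
      then show "z (Y \<omega>) ^ 4 \<le> 4 * B\<^sup>2 * (z (Y \<omega>))\<^sup>2" by (simp add: power4_eq_xxxx power2_eq_square mult_ac)
    qed (use zi[of 2] in auto)
    also have "\<dots> \<le> 4 * B\<^sup>2 * q" using z2 by (simp add: mult_left_mono)
    finally show ?thesis .
  qed
  define c where "c = 16 * K\<^sup>2 + 12 * B\<^sup>2 * K"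
  have c0: "0 \<le> c" using K0 by (simp add: c_def)
  define F where "F j x = (\<Sum>i<j. z (x i)) ^ 4 + c" for j :: nat and x :: "nat \<Rightarrow> real"
  have upd: "F (Suc j) (x(j := y)) = ((\<Sum>i<j. z (x i)) + z y) ^ 4 + c" for j x y
  proof -
    have "(\<Sum>i<j. z ((x(j := y)) i)) = (\<Sum>i<j. z (x i))" by (intro sum.cong) auto
    then show ?thesis by (simp add: F_def)
  qed
  have "(\<integral>\<^sup>+\<omega>. ennreal (F n (\<lambda>i\<in>{..<n}. X (real (Suc i) * T / real n) \<omega> - X (real i * T / real n) \<omega>)) \<partial>M)
     \<le> ennreal (exp 1 * F 0 (\<lambda>_. undefined))"
  proof (rule incr_iterate_le[OF T n])
    show "F j \<in> borel_measurable (PiM {..<j} (\<lambda>_. borel))" for j unfolding F_def by measurable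
    show "0 \<le> F j x" for j x using c0 by (simp add: F_def)
    show int: "integrable M (\<lambda>\<omega>. F (Suc j) (x(j := X (T / real n) \<omega>)))" for j x
    proof (rule integrable_const_bound[of _ "(\<bar>\<Sum>i<j. z (x i)\<bar> + 2 * B) ^ 4 + c"])
      show "AE \<omega> in M. norm (F (Suc j) (x(j := X (T / real n) \<omega>))) \<le> (\<bar>\<Sum>i<j. z (x i)\<bar> + 2 * B) ^ 4 + c"
      proof (intro AE_I2)
        fix \<omega>
        have "\<bar>(\<Sum>i<j. z (x i)) + z (Y \<omega>)\<bar> \<le> \<bar>\<Sum>i<j. z (x i)\<bar> + 2 * B"
          using zb[of "Y \<omega>"] by linarith
        then have "\<bar>(\<Sum>i<j. z (x i)) + z (Y \<omega>)\<bar> ^ 4 \<le> (\<bar>\<Sum>i<j. z (x i)\<bar> + 2 * B) ^ 4" by (intro power_mono) auto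
        then show "norm (F (Suc j) (x(j := X (T / real n) \<omega>))) \<le> (\<bar>\<Sum>i<j. z (x i)\<bar> + 2 * B) ^ 4 + c"
          unfolding upd Y_def[symmetric] using c0 by simp
      qed
    qed (unfold upd Y_def[symmetric], measurable)
    show "(\<lambda>y. F (Suc j) (x(j := y))) \<in> borel_measurable borel" for j x unfolding upd by measurable
    show "(\<integral>\<omega>. F (Suc j) (x(j := X (T / real n) \<omega>)) \<partial>M) \<le> (1 + 1 / real n) * F j x" for j x
    proof -
      define S where "S = (\<Sum>i<j. z (x i))"
      have "(\<integral>\<omega>. F (Suc j) (x(j := X (T / real n) \<omega>)) \<partial>M)
          \<le> (\<integral>\<omega>. S ^ 4 + 4 * S ^ 3 * z (Y \<omega>) + 8 * S\<^sup>2 * (z (Y \<omega>))\<^sup>2 + 3 * (z (Y \<omega>)) ^ 4 + c \<partial>M)"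
      proof (rule Bochner_Integration.integral_mono[OF int])
        show "F (Suc j) (x(j := X (T / real n) \<omega>)) \<le> S ^ 4 + 4 * S ^ 3 * z (Y \<omega>) + 8 * S\<^sup>2 * (z (Y \<omega>))\<^sup>2 + 3 * (z (Y \<omega>)) ^ 4 + c" for \<omega>
          unfolding upd S_def[symmetric] Y_def[symmetric] using power4_add_le[of S "z (Y \<omega>)"] by simp
      qed (use zi[of 1] zi[of 2] zi[of 4] in auto)
      also have "\<dots> = S ^ 4 + 8 * S\<^sup>2 * (\<integral>\<omega>. (z (Y \<omega>))\<^sup>2 \<partial>M) + 3 * (\<integral>\<omega>. (z (Y \<omega>)) ^ 4 \<partial>M) + c"
        using zi[of 1] zi[of 2] zi[of 4] z1 by (simp add: prob_space)
      also have "\<dots> \<le> S ^ 4 + 8 * S\<^sup>2 * q + 3 * (4 * B\<^sup>2 * q) + c"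
        using z2 z4 by (intro add_mono mult_left_mono) auto
      finally have 1: "(\<integral>\<omega>. F (Suc j) (x(j := X (T / real n) \<omega>)) \<partial>M) \<le> S ^ 4 + (8 * S\<^sup>2 * q + 12 * B\<^sup>2 * q) + c" by simp
      have "real n * (8 * S\<^sup>2 * q + 12 * B\<^sup>2 * q) = 8 * S\<^sup>2 * (real n * q) + 12 * B\<^sup>2 * (real n * q)" by (simp add: algebra_simps)
      also have "\<dots> \<le> 8 * S\<^sup>2 * K + 12 * B\<^sup>2 * K" using nq by (intro add_mono mult_left_mono) auto
      also have "8 * S\<^sup>2 * K \<le> S ^ 4 + 16 * K\<^sup>2"
      proof -
        have "0 \<le> (S\<^sup>2 - 4 * K)\<^sup>2" by simp
        then show ?thesis by (simp add: power2_eq_square power4_eq_xxxx algebra_simps)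
      qed
      finally have "real n * (8 * S\<^sup>2 * q + 12 * B\<^sup>2 * q) \<le> S ^ 4 + c" by (simp add: c_def)
      then have "8 * S\<^sup>2 * q + 12 * B\<^sup>2 * q \<le> (S ^ 4 + c) / real n" using n by (simp add: field_simps)
      moreover have "(1 + 1 / real n) * F j x = S ^ 4 + c + (S ^ 4 + c) / real n"
        by (simp add: F_def S_def[symmetric] algebra_simps add_divide_distrib)
      ultimately show ?thesis using 1 by linarith
    qed
  qed simp
  also have "F 0 (\<lambda>_. undefined) = c" by (simp add: F_def)
  finally have le: "(\<integral>\<^sup>+\<omega>. ennreal (F n (\<lambda>i\<in>{..<n}. X (real (Suc i) * T / real n) \<omega> - X (real i * T / real n) \<omega>)) \<partial>M)
     \<le> ennreal (exp 1 * c)" .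
  have eq: "F n (\<lambda>i\<in>{..<n}. X (real (Suc i) * T / real n) \<omega> - X (real i * T / real n) \<omega>) = (incr_sum X T n g \<omega> - real n * \<mu>) ^ 4 + c" for \<omega>
    unfolding F_def incr_sum_def sum_restrict_eq z_def sum_subtractf by simp
  show ?thesis unfolding c_def[symmetric] \<mu>_def[symmetric]
    by (rule order_trans[OF nn_integral_mono le], unfold eq, rule ennreal_leI) (simp add: c0)
qed

text \<open>Fatou's lemma, with measurability asked of \<open>Y n\<close> only, so that the limit
  may be a function of jump sums.\<close>

lemma nn_integral_le_of_tendsto:
  fixes Y :: "nat \<Rightarrow> 'w \<Rightarrow> real"
  assumes Y: "\<And>n. Y n \<in> borel_measurable M" and lim: "AE \<omega> in M. (\<lambda>n. Y n \<omega>) \<longlonglongrightarrow> Z \<omega>"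
    and le: "eventually (\<lambda>n. (\<integral>\<^sup>+\<omega>. ennreal (Y n \<omega>) \<partial>M) \<le> C) sequentially"
  shows "(\<integral>\<^sup>+\<omega>. ennreal (Z \<omega>) \<partial>M) \<le> C"
proof -
  have "(\<integral>\<^sup>+\<omega>. ennreal (Z \<omega>) \<partial>M) = (\<integral>\<^sup>+\<omega>. liminf (\<lambda>n. ennreal (Y n \<omega>)) \<partial>M)"
  proof (rule nn_integral_cong_AE)
    show "AE \<omega> in M. ennreal (Z \<omega>) = liminf (\<lambda>n. ennreal (Y n \<omega>))"
      using lim by eventually_elim (intro lim_imp_Liminf[symmetric] tendsto_ennrealI trivial_limit_sequentially)
  qed
  also have "\<dots> \<le> liminf (\<lambda>n. \<integral>\<^sup>+\<omega>. ennreal (Y n \<omega>) \<partial>M)"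
    using Y by (intro nn_integral_liminf) measurable
  also have "\<dots> \<le> liminf (\<lambda>n. C)" using le by (rule Liminf_mono)
  finally show ?thesis by (simp add: Liminf_const)
qed

text \<open>The second moments of the increments converge to the left side of the assumption on
  \<open>K\<close>; as that inequality is strict, they are below \<open>K\<close> from some
  \<open>n\<close> on.\<close>

lemma jump_sum_fourth_moment:
  assumes ab: "0 \<notin> {a..b}" and T: "0 < T" and g: "regular a b g" and B: "\<And>x. \<bar>g x\<bar> \<le> B"
    and K: "T * (LINT x:{a..b}|lborel. (g x)\<^sup>2 * s x) < K"
  shows "(\<integral>\<^sup>+\<omega>. ennreal ((jump_sum X a b T g \<omega> - T * (LINT x:{a..b}|lborel. g x * s x)) ^ 4) \<partial>M)
     \<le> ennreal (exp 1 * (16 * K\<^sup>2 + 12 * B\<^sup>2 * K))"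
proof (rule nn_integral_le_of_tendsto)
  note gb[measurable] = regular_borel[OF g]
  show "(\<lambda>\<omega>. (incr_sum X T n g \<omega> - real n * (\<integral>\<omega>. g (X (T / real n) \<omega>) \<partial>M)) ^ 4) \<in> borel_measurable M" for n
  proof -
    have [measurable]: "incr_sum X T n g \<in> borel_measurable M" by (rule measurable_incr_sum[OF gb T])
    show ?thesis by measurable
  qed
  show "AE \<omega> in M. (\<lambda>n. (incr_sum X T n g \<omega> - real n * (\<integral>\<omega>. g (X (T / real n) \<omega>) \<partial>M)) ^ 4)
      \<longlonglongrightarrow> (jump_sum X a b T g \<omega> - T * (LINT x:{a..b}|lborel. g x * s x)) ^ 4"
    using regular_incr_sum_tendsto[OF ab g T]
    by eventually_elim (intro tendsto_intros tendsto_mean ab g T)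
  have "regular a b (\<lambda>x. (g x)\<^sup>2)" by (rule regular_comp[OF g]) (auto intro!: continuous_intros)
  from order_tendstoD(2)[OF tendsto_mean[OF ab this T] K]
  have "eventually (\<lambda>n. real n * (\<integral>\<omega>. (g (X (T / real n) \<omega>))\<^sup>2 \<partial>M) < K) sequentially" .
  then show "\<forall>\<^sub>F n in sequentially. (\<integral>\<^sup>+\<omega>. ennreal ((incr_sum X T n g \<omega> - real n * (\<integral>\<omega>. g (X (T / real n) \<omega>) \<partial>M)) ^ 4) \<partial>M)
     \<le> ennreal (exp 1 * (16 * K\<^sup>2 + 12 * B\<^sup>2 * K))"
    using eventually_gt_at_top[of 0]
    by eventually_elim (rule incr_fourth_moment[OF T _ gb B], auto)
qed

text \<open>The means of the increment sums tend to the right side, so they are eventually below it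
  plus any \<open>e > 0\<close>, and Fatou's lemma passes this to the jump sum.\<close>

lemma nn_integral_jump_sum_le:
  assumes ab: "0 \<notin> {a..b}" and T: "0 < T" and h: "regular a b h" and h0: "\<And>x. 0 \<le> h x"
  shows "(\<integral>\<^sup>+\<omega>. ennreal (jump_sum X a b T h \<omega>) \<partial>M) \<le> ennreal (T * (LINT x:{a..b}|lborel. h x * s x))"
proof -
  obtain B where B: "\<And>x. \<bar>h x\<bar> \<le> B" using h by (auto simp: regular_def)
  note hb = regular_borel[OF h]
  have i0: "0 \<le> incr_sum X T n h \<omega>" for n \<omega> unfolding incr_sum_def using h0 by (intro sum_nonneg) auto
  have eq: "(\<integral>\<^sup>+\<omega>. ennreal (incr_sum X T n h \<omega>) \<partial>M) = ennreal (real n * (\<integral>\<omega>. h (X (T / real n) \<omega>) \<partial>M))" for n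
    using expectation_incr_sum[OF T hb B] i0 by (simp add: nn_integral_eq_integral)
  show ?thesis
  proof (rule ennreal_le_epsilon)
    fix e :: real assume e: "0 < e"
    have h0': "0 \<le> T * (LINT x:{a..b}|lborel. h x * s x)"
      by (rule LIMSEQ_le_const[OF tendsto_mean[OF ab h T]]) (use h0 in \<open>auto intro!: mult_nonneg_nonneg Bochner_Integration.integral_nonneg\<close>)
    have "(\<integral>\<^sup>+\<omega>. ennreal (jump_sum X a b T h \<omega>) \<partial>M) \<le> ennreal (T * (LINT x:{a..b}|lborel. h x * s x) + e)"
    proof (rule nn_integral_le_of_tendsto[OF measurable_incr_sum[OF hb T] regular_incr_sum_tendsto[OF ab h T]])
      have "eventually (\<lambda>n. real n * (\<integral>\<omega>. h (X (T / real n) \<omega>) \<partial>M) < T * (LINT x:{a..b}|lborel. h x * s x) + e) sequentially"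
        using e by (intro order_tendstoD(2)[OF tendsto_mean[OF ab h T]]) simp
      then show "\<forall>\<^sub>F n in sequentially. (\<integral>\<^sup>+\<omega>. ennreal (incr_sum X T n h \<omega>) \<partial>M) \<le> ennreal (T * (LINT x:{a..b}|lborel. h x * s x) + e)"
        unfolding eq by eventually_elim (intro ennreal_leI, simp)
    qed
    then show "(\<integral>\<^sup>+\<omega>. ennreal (jump_sum X a b T h \<omega>) \<partial>M) \<le> ennreal (T * (LINT x:{a..b}|lborel. h x * s x)) + ennreal e"
      using e h0' by (simp add: ennreal_plus)
  qed
qed

end

section \<open>Piecewise polynomials and their sup norms\<close>

text \<open>For the end point \<open>b\<close> the floor is \<open>m\<close>; the minimum moves it
  into the last cell, which is the closed one.\<close>

definition cell_index :: "real \<Rightarrow> real \<Rightarrow> nat \<Rightarrow> real \<Rightarrow> nat" where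
  "cell_index a b m x = min (m - 1) (nat \<lfloor>(x - a) * real m / (b - a)\<rfloor>)"

lemma grid_point_mono: "a < b \<Longrightarrow> i \<le> j \<Longrightarrow> grid_point a b m i \<le> grid_point a b m j"
  by (auto simp: grid_point_def intro!: divide_right_mono mult_right_mono)

lemma grid_point_bounds: "a < b \<Longrightarrow> i \<le> m \<Longrightarrow> a \<le> grid_point a b m i \<and> grid_point a b m i \<le> b"
proof -
  assume ab: "a < b" and i: "i \<le> m"
  have "real i * (b - a) / real m \<le> b - a"
  proof (cases "m = 0")
    case False
    have "real i * (b - a) \<le> real m * (b - a)" using ab i by (intro mult_right_mono) auto
    then show ?thesis using False by (simp add: divide_le_eq mult.commute)
  qed (use ab in auto)
  then show ?thesis using ab by (auto simp: grid_point_def)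
qed

lemma grid_point_m: "0 < m \<Longrightarrow> grid_point a b m m = b"
  by (simp add: grid_point_def)

lemma grid_point_Suc: "grid_point a b m (Suc i) = grid_point a b m i + (b - a) / real m"
  by (simp add: grid_point_def distrib_right add_divide_distrib)

lemma grid_cell_subset_Icc:
  "0 < m \<Longrightarrow> grid_cell a b m i \<subseteq> {grid_point a b m i..grid_point a b m (Suc i)}"
  by (auto simp: grid_cell_def grid_point_m split: if_splits)

lemma greaterThanLessThan_subset_grid_cell:
  "0 < m \<Longrightarrow> {grid_point a b m i<..<grid_point a b m (Suc i)} \<subseteq> grid_cell a b m i"
  by (auto simp: grid_cell_def grid_point_m split: if_splits)

lemma grid_cell_subset:
  assumes "a < b" "i < m" shows "grid_cell a b m i \<subseteq> {a..b}"
  using grid_cell_subset_Icc[of m a b i] grid_point_bounds[OF assms(1), of i m] grid_point_bounds[OF assms(1), of "Suc i" m] assms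
  by auto

lemma cell_index_eq:
  assumes ab: "a < b" and i: "i < m" and x: "x \<in> grid_cell a b m i"
  shows "cell_index a b m x = i"
proof -
  define y where "y = (x - a) * real m / (b - a)"
  have m: "real m > 0" using i by simp
  have "grid_point a b m i \<le> x" using grid_cell_subset_Icc[of m a b i] x i by auto
  then have "real i * (b - a) \<le> (x - a) * real m" using m by (simp add: grid_point_def field_simps)
  then have lo: "real i \<le> y" using ab by (simp add: y_def le_divide_eq)
  show ?thesis
  proof (cases "Suc i = m")
    case True
    have "int i \<le> \<lfloor>y\<rfloor>" using lo by (simp add: le_floor_iff)
    then show ?thesis using True unfolding cell_index_def y_def[symmetric] by linarith
  next
    case False
    then have "x < grid_point a b m (Suc i)" using x by (simp add: grid_cell_def)
    then have "(x - a) * real m < real (Suc i) * (b - a)" using m by (simp add: grid_point_def field_simps)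
    then have "y < real (Suc i)" using ab by (simp add: y_def divide_less_eq)
    then have "\<lfloor>y\<rfloor> = int i" using lo by (intro floor_unique) auto
    then show ?thesis using i False unfolding cell_index_def y_def[symmetric] by simp
  qed
qed

lemma cell_index_less: "0 < m \<Longrightarrow> cell_index a b m x < m"
  by (auto simp: cell_index_def)

lemma mem_grid_cell_index:
  assumes ab: "a < b" and m: "0 < m" and x: "x \<in> {a..b}"
  shows "x \<in> grid_cell a b m (cell_index a b m x)"
proof -
  define y where "y = (x - a) * real m / (b - a)"
  have y0: "0 \<le> y" using ab x by (auto simp: y_def)
  have xy: "x = a + y * (b - a) / real m" using ab m by (simp add: y_def)
  have gp: "grid_point a b m i \<le> x \<longleftrightarrow> real i \<le> y" "x < grid_point a b m i \<longleftrightarrow> y < real i" for i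
    unfolding xy grid_point_def using ab m by (simp_all add: divide_le_cancel divide_less_cancel)
  show ?thesis
  proof (cases "y < real (m - 1)")
    case True
    then have "\<lfloor>y\<rfloor> < int (m - 1)" by (simp add: floor_less_iff)
    then have c: "cell_index a b m x = nat \<lfloor>y\<rfloor>" and c2: "Suc (nat \<lfloor>y\<rfloor>) \<noteq> m" using y0
      unfolding cell_index_def y_def[symmetric] by linarith+
    have "real (nat \<lfloor>y\<rfloor>) \<le> y" "y < real (Suc (nat \<lfloor>y\<rfloor>))" using y0 by linarith+
    then show ?thesis unfolding c grid_cell_def using c2 gp by auto
  next
    case False
    then have "int (m - 1) \<le> \<lfloor>y\<rfloor>" by (simp add: le_floor_iff)
    then have c: "cell_index a b m x = m - 1" unfolding cell_index_def y_def[symmetric] by linarith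
    show ?thesis unfolding c grid_cell_def using gp(1)[of "m - 1"] False m x by auto
  qed
qed

definition pw_of :: "real \<Rightarrow> real \<Rightarrow> nat \<Rightarrow> (nat \<Rightarrow> real poly) \<Rightarrow> real \<Rightarrow> real" where
  "pw_of a b m q x = (if x \<in> {a..b} then poly (q (cell_index a b m x)) x else 0)"

lemma pw_of_mem:
  assumes "a < b" "\<And>i. i < m \<Longrightarrow> degree (q i) \<le> k"
  shows "pw_of a b m q \<in> pw_poly a b k m"
  unfolding pw_poly_def
proof (intro CollectI conjI allI impI)
  fix i assume i: "i < m"
  show "\<exists>p. degree p \<le> k \<and> (\<forall>x\<in>grid_cell a b m i. pw_of a b m q x = poly p x)"
    using assms i grid_cell_subset[OF assms(1) i] cell_index_eq[OF assms(1) i]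
    by (intro exI[of _ "q i"]) (auto simp: pw_of_def)
qed (auto simp: pw_of_def)

lemma pw_polyE:
  assumes "a < b" "0 < m" "f \<in> pw_poly a b k m"
  obtains q where "\<And>i. i < m \<Longrightarrow> degree (q i) \<le> k" "f = pw_of a b m q"
    "\<And>i x. i < m \<Longrightarrow> x \<in> grid_cell a b m i \<Longrightarrow> f x = poly (q i) x"
proof -
  have "\<forall>i\<in>{..<m}. \<exists>p. degree p \<le> k \<and> (\<forall>x\<in>grid_cell a b m i. f x = poly p x)"
    using assms(3) by (auto simp: pw_poly_def)
  from bchoice[OF this] obtain q where q: "\<And>i. i < m \<Longrightarrow> degree (q i) \<le> k \<and> (\<forall>x\<in>grid_cell a b m i. f x = poly (q i) x)"
    by auto
  have "f x = pw_of a b m q x" for x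
    using q[OF cell_index_less[OF assms(2)]] mem_grid_cell_index[OF assms(1,2), of x] assms(3)
    by (auto simp: pw_of_def pw_poly_def)
  then show ?thesis using that[of q] q by blast
qed

lemma pw_poly_sum:
  assumes "\<And>i. i \<in> I \<Longrightarrow> f i \<in> pw_poly a b k m"
  shows "(\<lambda>x. \<Sum>i\<in>I. c i * f i x) \<in> pw_poly a b k m"
  unfolding pw_poly_def
proof (intro CollectI conjI allI impI)
  fix x assume "x \<notin> {a..b}"
  then show "(\<Sum>i\<in>I. c i * f i x) = 0" using assms by (intro sum.neutral) (auto simp: pw_poly_def)
next
  fix j assume j: "j < m"
  have "\<forall>i\<in>I. \<exists>p. degree p \<le> k \<and> (\<forall>x\<in>grid_cell a b m j. f i x = poly p x)"
    using assms j by (auto simp: pw_poly_def)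
  from bchoice[OF this] obtain q where q: "\<And>i. i \<in> I \<Longrightarrow> degree (q i) \<le> k \<and> (\<forall>x\<in>grid_cell a b m j. f i x = poly (q i) x)"
    by auto
  show "\<exists>p. degree p \<le> k \<and> (\<forall>x\<in>grid_cell a b m j. (\<Sum>i\<in>I. c i * f i x) = poly p x)"
  proof (intro exI[of _ "\<Sum>i\<in>I. smult (c i) (q i)"] conjI ballI)
    show "degree (\<Sum>i\<in>I. smult (c i) (q i)) \<le> k"
    proof (cases "finite I")
      case True
      then show ?thesis using q by (intro degree_sum_le) (auto intro: order_trans[OF degree_smult_le])
    qed simp
  qed (use q in \<open>simp add: poly_sum\<close>)
qed

lemma pw_of_borel:
  assumes "a < b" "0 < m"
  shows "pw_of a b m q \<in> borel_measurable borel"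
proof -
  have eq: "pw_of a b m q x = (\<Sum>i<m. indicator (grid_cell a b m i) x * poly (q i) x)" for x
  proof (cases "x \<in> {a..b}")
    case True
    have "(\<Sum>i<m. indicator (grid_cell a b m i) x * poly (q i) x) = (\<Sum>i\<in>{cell_index a b m x}. indicator (grid_cell a b m i) x * poly (q i) x)"
      using cell_index_less[OF assms(2), of a b x] cell_index_eq[OF assms(1), of _ m x]
      by (intro sum.mono_neutral_right) (auto split: split_indicator)
    then show ?thesis using True mem_grid_cell_index[OF assms True] by (simp add: pw_of_def)
  next
    case False
    then have "indicator (grid_cell a b m i) x = (0::real)" if "i < m" for i
      using grid_cell_subset[OF assms(1) that] by (auto split: split_indicator)
    then show ?thesis using False by (auto simp: pw_of_def)
  qed
  have [measurable]: "grid_cell a b m i \<in> sets borel" for i by (simp add: grid_cell_def)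
  have [measurable]: "poly p \<in> borel_measurable borel" for p :: "real poly"
    by (intro borel_measurable_continuous_onI continuous_intros)
  have "(\<lambda>x. \<Sum>i<m. indicator (grid_cell a b m i) x * poly (q i) x) \<in> borel_measurable borel" by measurable
  then show ?thesis by (simp add: eq[abs_def])
qed

lemma pw_poly_borel: "a < b \<Longrightarrow> 0 < m \<Longrightarrow> f \<in> pw_poly a b k m \<Longrightarrow> f \<in> borel_measurable borel"
  by (metis pw_polyE pw_of_borel)

lemma poly_bounded_Icc: "\<exists>B. \<forall>x\<in>{a..b}. \<bar>poly (p :: real poly) x\<bar> \<le> B"
proof -
  have "bounded (poly p ` {a..b})"
    by (intro compact_imp_bounded compact_continuous_image continuous_intros) auto
  then show ?thesis by (auto simp: bounded_iff)
qed

lemma pw_poly_bounded: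
  assumes "a < b" "0 < m" "f \<in> pw_poly a b k m"
  shows "\<exists>B. \<forall>x. \<bar>f x\<bar> \<le> B"
proof -
  obtain q where q: "f = pw_of a b m q" by (rule pw_polyE[OF assms]) blast
  have "\<forall>i. \<exists>B. \<forall>x\<in>{a..b}. \<bar>poly (q i) x\<bar> \<le> B" using poly_bounded_Icc by blast
  from choice[OF this] obtain B where "\<forall>i. \<forall>x\<in>{a..b}. \<bar>poly (q i) x\<bar> \<le> B i" ..
  then have B: "\<bar>poly (q i) x\<bar> \<le> B i" if "x \<in> {a..b}" for i x using that by blast
  have "\<bar>f x\<bar> \<le> (\<Sum>i<m. \<bar>B i\<bar>)" for x
  proof (cases "x \<in> {a..b}")
    case True
    have "\<bar>f x\<bar> \<le> \<bar>B (cell_index a b m x)\<bar>" using B[OF True] True by (auto simp: q pw_of_def intro: order_trans[OF _ abs_ge_self])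
    also have "\<dots> \<le> (\<Sum>i<m. \<bar>B i\<bar>)" using cell_index_less[OF assms(2)] by (intro member_le_sum) auto
    finally show ?thesis .
  qed (auto simp: q pw_of_def intro!: sum_nonneg)
  then show ?thesis by blast
qed

lemma pw_poly_isCont:
  assumes ab: "a < b" and m: "0 < m" and f: "f \<in> pw_poly a b k m"
    and x: "x \<in> {a..b}" "x \<notin> grid_point a b m ` {..m}"
  shows "isCont f x"
proof -
  obtain q where q: "\<And>i x. i < m \<Longrightarrow> x \<in> grid_cell a b m i \<Longrightarrow> f x = poly (q i) x"
    by (rule pw_polyE[OF ab m f]) blast
  define i where "i = cell_index a b m x"
  have i: "i < m" "x \<in> grid_cell a b m i"
    using cell_index_less[OF m] mem_grid_cell_index[OF ab m x(1)] by (auto simp: i_def)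
  have "x \<in> {grid_point a b m i..grid_point a b m (Suc i)}" using grid_cell_subset_Icc[OF m] i by blast
  moreover have "x \<noteq> grid_point a b m i" "x \<noteq> grid_point a b m (Suc i)" using x(2) i(1) by auto
  ultimately have xi: "x \<in> {grid_point a b m i<..<grid_point a b m (Suc i)}" by auto
  have "eventually (\<lambda>y. y \<in> {grid_point a b m i<..<grid_point a b m (Suc i)}) (nhds x)"
    using xi by (intro eventually_nhds_in_open) auto
  then have "eventually (\<lambda>y. f y = poly (q i) y) (nhds x)"
    by eventually_elim (use q[OF i(1)] greaterThanLessThan_subset_grid_cell[OF m, of a b i] in blast)
  then have "isCont f x \<longleftrightarrow> isCont (poly (q i)) x" by (rule isCont_cong)
  then show ?thesis by simp
qed

section \<open>Orthonormal expansions, sup norms and \<open>D_const\<close>\<close>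

lemma set_integrable_bounded:
  fixes f :: "real \<Rightarrow> real"
  assumes [measurable]: "f \<in> borel_measurable borel" and B: "\<And>x. x \<in> {a..b} \<Longrightarrow> \<bar>f x\<bar> \<le> B"
  shows "set_integrable lborel {a..b} f"
proof (cases "a \<le> b")
  case True
  have "0 \<le> B" using B[of a] True by (auto intro: order_trans[OF abs_ge_zero])
  then have "integrable lborel (\<lambda>x. B * indicator {a..b} x)"
    by (intro integrable_mult_right integrable_real_indicator) (auto simp: emeasure_lborel_Icc_eq)
  then show ?thesis unfolding set_integrable_def
    by (rule Bochner_Integration.integrable_bound) (use B \<open>0 \<le> B\<close> in \<open>auto split: split_indicator\<close>)
qed (simp add: set_integrable_def)

lemma integrable_pw_poly_mult:
  assumes ab: "a < b" and m: "0 < m" and m': "0 < m'" and f: "f \<in> pw_poly a b k m" and g: "g \<in> pw_poly a b k' m'"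
  shows "set_integrable lborel {a..b} (\<lambda>x. f x * g x)"
proof -
  obtain B C where "\<And>x. \<bar>f x\<bar> \<le> B" "\<And>x. \<bar>g x\<bar> \<le> C" using pw_poly_bounded[OF ab m f] pw_poly_bounded[OF ab m' g] by blast
  then have "\<bar>f x * g x\<bar> \<le> B * C" for x
    unfolding abs_mult by (intro mult_mono) (auto intro: order_trans[OF abs_ge_zero])
  moreover have "(\<lambda>x. f x * g x) \<in> borel_measurable borel"
    using pw_poly_borel[OF ab m f] pw_poly_borel[OF ab m' g] by measurable
  ultimately show ?thesis by (intro set_integrable_bounded)
qed

lemma set_integral_sum_real:
  fixes f :: "'i \<Rightarrow> real \<Rightarrow> real"
  assumes "\<And>i. i \<in> I \<Longrightarrow> set_integrable lborel A (f i)"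
  shows "(LINT x:A|lborel. (\<Sum>i\<in>I. f i x)) = (\<Sum>i\<in>I. (LINT x:A|lborel. f i x))"
    and "set_integrable lborel A (\<lambda>x. \<Sum>i\<in>I. f i x)"
proof -
  have "indicator A x *\<^sub>R (\<Sum>i\<in>I. f i x) = (\<Sum>i\<in>I. indicator A x *\<^sub>R f i x)" for x by (simp add: sum_distrib_left)
  then show "(LINT x:A|lborel. (\<Sum>i\<in>I. f i x)) = (\<Sum>i\<in>I. (LINT x:A|lborel. f i x))"
    "set_integrable lborel A (\<lambda>x. \<Sum>i\<in>I. f i x)"
    using assms unfolding set_lebesgue_integral_def set_integrable_def
    by (simp_all add: Bochner_Integration.integral_sum)
qed

lemma pw_onb_integral_square:
  assumes ab: "a < b" and m: "0 < m" and onb: "pw_onb a b k m \<phi>"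
  shows "(LINT x:{a..b}|lborel. (\<Sum>i<pw_dim k m. c i * \<phi> i x)\<^sup>2) = (\<Sum>i<pw_dim k m. (c i)\<^sup>2)"
proof -
  let ?d = "pw_dim k m"
  have mem: "\<phi> i \<in> pw_poly a b k m" if "i < ?d" for i using onb that by (simp add: pw_onb_def)
  have int: "set_integrable lborel {a..b} (\<lambda>x. c i * c j * (\<phi> i x * \<phi> j x))" if "i < ?d" "j < ?d" for i j
    using integrable_pw_poly_mult[OF ab m m mem[OF that(1)] mem[OF that(2)]] by simp
  have "(\<Sum>i<?d. c i * \<phi> i x)\<^sup>2 = (\<Sum>i<?d. \<Sum>j<?d. c i * c j * (\<phi> i x * \<phi> j x))" for x
    by (simp add: power2_eq_square sum_product mult_ac)
  then have "(LINT x:{a..b}|lborel. (\<Sum>i<?d. c i * \<phi> i x)\<^sup>2) = (\<Sum>i<?d. \<Sum>j<?d. (LINT x:{a..b}|lborel. c i * c j * (\<phi> i x * \<phi> j x)))"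
    by (simp only:) (subst set_integral_sum_real(1), auto intro!: set_integral_sum_real(2) int sum.cong set_integral_sum_real(1) simp del: set_integral_mult_right)
  also have "\<dots> = (\<Sum>i<?d. \<Sum>j<?d. if i = j then (c i)\<^sup>2 else 0)"
    using onb by (intro sum.cong refl) (auto simp: pw_onb_def eta_inner_def power2_eq_square)
  also have "\<dots> = (\<Sum>i<?d. (c i)\<^sup>2)" by simp
  finally show ?thesis .
qed

text \<open>The case \<open>m = 1\<close> is the equivalence of norms on polynomials of degree at most \<open>k\<close>; the
  general case follows by rescaling a cell to \<open>[a,b]\<close>.\<close>

lemma pw_poly_sup_bound:
  assumes ab: "a < b" and onb: "pw_onb a b k 1 \<phi>"
  shows "\<exists>C>0. \<forall>m>0. \<forall>f\<in>pw_poly a b k m. \<forall>x. (f x)\<^sup>2 \<le> C * real m * (LINT x:{a..b}|lborel. (f x)\<^sup>2)"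
proof -
  let ?d = "pw_dim k 1"
  have mem: "\<phi> i \<in> pw_poly a b k 1" if "i < ?d" for i using onb that by (simp add: pw_onb_def)
  have "\<forall>i\<in>{..<?d}. \<exists>B. \<forall>x. \<bar>\<phi> i x\<bar> \<le> B" using pw_poly_bounded[OF ab zero_less_one mem] by blast
  from bchoice[OF this] obtain B where B: "\<And>i x. i < ?d \<Longrightarrow> \<bar>\<phi> i x\<bar> \<le> B i" by auto
  \<comment> \<open>By Cauchy--Schwarz the squared value of a polynomial is at most the sum of its
    squared coefficients times the sum of the \<open>(B i)\<^sup>2\<close>. The added 1 makes
    \<open>C\<close> positive.\<close>
  define C where "C = 1 + (\<Sum>i<?d. (B i)\<^sup>2)"
  have C: "C > 0" "(\<Sum>i<?d. (B i)\<^sup>2) \<le> C" by (auto simp: C_def intro!: add_pos_nonneg sum_nonneg)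
  show ?thesis
  proof (intro exI[of _ C] conjI allI impI ballI C)
    fix m :: nat and f x assume m: "0 < m" and f: "f \<in> pw_poly a b k m"
    have I0: "0 \<le> (LINT x:{a..b}|lborel. (f x)\<^sup>2)" unfolding set_lebesgue_integral_def
      by (intro Bochner_Integration.integral_nonneg) auto
    show "(f x)\<^sup>2 \<le> C * real m * (LINT x:{a..b}|lborel. (f x)\<^sup>2)"
    proof (cases "x \<in> {a..b}")
      case False
      then have "f x = 0" using f by (auto simp: pw_poly_def)
      then show ?thesis using C I0 by simp
    next
      case True
      obtain q where q: "\<And>i. i < m \<Longrightarrow> degree (q i) \<le> k" "\<And>i x. i < m \<Longrightarrow> x \<in> grid_cell a b m i \<Longrightarrow> f x = poly (q i) x"
        by (rule pw_polyE[OF ab m f]) blast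
      define j where "j = cell_index a b m x"
      have j: "j < m" "x \<in> grid_cell a b m j" using cell_index_less[OF m] mem_grid_cell_index[OF ab m True] by (auto simp: j_def)
      define g where "g = grid_point a b m j"
      \<comment> \<open>The polynomial of the cell in the variable that stretches the cell affinely
        onto \<open>{a..b}\<close>.\<close>
      define Q where "Q = pcompose (q j) [:g - a / real m, 1 / real m:]"
      have Q: "poly Q y = poly (q j) (g + (y - a) / real m)" for y
        by (simp add: Q_def poly_pcompose diff_divide_distrib algebra_simps)
      have dQ: "degree Q \<le> k"
      proof -
        have "degree Q \<le> degree (q j) * degree [:g - a / real m, 1 / real m:]" unfolding Q_def by (rule degree_pcompose_le)
        also have "\<dots> \<le> degree (q j) * 1" by (intro mult_left_mono) auto
        finally show ?thesis using q(1)[OF j(1)] by simp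
      qed
      define F where "F = pw_of a b 1 (\<lambda>_. Q)"
      have Fmem: "F \<in> pw_poly a b k 1" unfolding F_def using dQ by (intro pw_of_mem ab)
      obtain c where c: "\<And>y. F y = (\<Sum>i<?d. c i * \<phi> i y)" using onb Fmem unfolding pw_onb_def by meson
      define y where "y = a + real m * (x - g)"
      have g1: "grid_point a b m (Suc j) = g + (b - a) / real m" by (simp add: g_def grid_point_Suc)
      have xg: "g \<le> x" "x \<le> g + (b - a) / real m" using grid_cell_subset_Icc[OF m, of a b j] j(2) g1 by (auto simp: g_def)
      have yab: "y \<in> {a..b}" using xg m by (auto simp: y_def field_simps)
      have "f x = F y" using q(2)[OF j] yab m by (simp add: F_def pw_of_def Q y_def)
      also have "(F y)\<^sup>2 \<le> (\<Sum>i<?d. (c i)\<^sup>2) * (\<Sum>i<?d. (\<phi> i y)\<^sup>2)"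
        unfolding c by (rule Cauchy_Schwarz_ineq_sum)
      also have "\<dots> \<le> (\<Sum>i<?d. (c i)\<^sup>2) * C"
      proof (intro mult_left_mono sum_nonneg order_trans[OF _ C(2)] sum_mono)
        fix i assume "i \<in> {..<?d}"
        then show "(\<phi> i y)\<^sup>2 \<le> (B i)\<^sup>2" using B[of i y] by (metis abs_ge_zero lessThan_iff power2_abs power_mono)
      qed simp_all
      finally have 1: "(f x)\<^sup>2 \<le> (\<Sum>i<?d. (c i)\<^sup>2) * C" .
      have 2: "(\<Sum>i<?d. (c i)\<^sup>2) = (LINT y:{a..b}|lborel. (F y)\<^sup>2)"
        unfolding c by (rule pw_onb_integral_square[OF ab zero_less_one onb, symmetric])
      \<comment> \<open>The change of variables stretches lengths by \<open>m\<close>; this is the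
        origin of the factor \<open>real m\<close> in the bound.\<close>
      have 3: "(LINT y:{a..b}|lborel. (F y)\<^sup>2) = real m * (\<integral>x. indicator {a..b} (a - real m * g + real m * x) * (F (a - real m * g + real m * x))\<^sup>2 \<partial>lborel)"
        unfolding set_lebesgue_integral_def using m lborel_integral_real_affine[of "real m" "\<lambda>y. indicator {a..b} y *\<^sub>R (F y)\<^sup>2" "a - real m * g"] by simp
      have 4: "(\<integral>x. indicator {a..b} (a - real m * g + real m * x) * (F (a - real m * g + real m * x))\<^sup>2 \<partial>lborel) \<le> (LINT x:{a..b}|lborel. (f x)\<^sup>2)"
        unfolding set_lebesgue_integral_def
      proof (rule integral_mono_AE')
        show "integrable lborel (\<lambda>x. indicator {a..b} x *\<^sub>R (f x)\<^sup>2)"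
          using integrable_pw_poly_mult[OF ab m m f f] by (simp add: set_integrable_def power2_eq_square)
        \<comment> \<open>The stretched interval corresponds to the closed cell. Its two end points,
          which need not belong to the cell, are excluded as a null set.\<close>
        show "AE x in lborel. indicator {a..b} (a - real m * g + real m * x) * (F (a - real m * g + real m * x))\<^sup>2 \<le> indicator {a..b} x *\<^sub>R (f x)\<^sup>2"
          using AE_lborel_singleton[of g] AE_lborel_singleton[of "g + (b - a) / real m"]
        proof eventually_elim
          case (elim t)
          show ?case
          proof (cases "a - real m * g + real m * t \<in> {a..b}")
            case T: True
            then have "g \<le> t" "t \<le> g + (b - a) / real m" using m by (auto simp: field_simps)
            then have tc: "t \<in> grid_cell a b m j"
              using elim g1 greaterThanLessThan_subset_grid_cell[OF m, of a b j] by (auto simp: g_def)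
            then have "f t = poly (q j) t" by (rule q(2)[OF j(1)])
            moreover have "F (a - real m * g + real m * t) = poly (q j) t"
            proof -
              have "g + (a - real m * g + real m * t - a) / real m = t" using m by (simp add: field_simps)
              then show ?thesis using T by (simp add: F_def pw_of_def Q)
            qed
            moreover have "t \<in> {a..b}" using tc grid_cell_subset[OF ab j(1)] by blast
            ultimately show ?thesis by (simp split: split_indicator)
          qed simp
        qed
        show "AE x in lborel. 0 \<le> indicator {a..b} x *\<^sub>R (f x)\<^sup>2" by simp
      qed
      have "(\<Sum>i<?d. (c i)\<^sup>2) * C \<le> (real m * (LINT x:{a..b}|lborel. (f x)\<^sup>2)) * C"
        unfolding 2 3 using 4 C(1) by (intro mult_right_mono mult_left_mono) auto
      with 1 show ?thesis by (simp add: mult_ac)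
    qed
  qed
qed

text \<open>The bound is applied to the reproducing kernel at \<open>x\<close>, the combination of
  the basis with coefficients \<open>\<phi> i x\<close>. Its value at \<open>x\<close> and its
  squared norm are both the sum \<open>S\<close> in question, so
  \<open>S\<^sup>2 \<le> C * S\<close>.\<close>

lemma sum_onb_square_le:
  assumes ab: "a < b" and m: "0 < m" and onb: "pw_onb a b k m \<phi>"
    and C: "\<And>f x. f \<in> pw_poly a b k m \<Longrightarrow> (f x)\<^sup>2 \<le> C * (LINT x:{a..b}|lborel. (f x)\<^sup>2)" and C0: "0 \<le> C"
  shows "(\<Sum>i<pw_dim k m. (\<phi> i x)\<^sup>2) \<le> C"
proof -
  define S where "S = (\<Sum>i<pw_dim k m. (\<phi> i x)\<^sup>2)"
  have "(\<lambda>y. \<Sum>i<pw_dim k m. \<phi> i x * \<phi> i y) \<in> pw_poly a b k m"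
    using onb by (intro pw_poly_sum) (auto simp: pw_onb_def)
  from C[OF this, of x] have "(\<Sum>i<pw_dim k m. \<phi> i x * \<phi> i x)\<^sup>2 \<le> C * S"
    unfolding pw_onb_integral_square[OF ab m onb] S_def .
  then have "S * S \<le> C * S" by (simp add: S_def power2_eq_square)
  moreover have "0 \<le> S" unfolding S_def by (intro sum_nonneg) auto
  ultimately show ?thesis using C0 unfolding S_def[symmetric] by (cases "S = 0") auto
qed

lemma D_const_le:
  assumes ab: "a < b" and m: "0 < m"
    and C: "\<And>f x. f \<in> pw_poly a b k m \<Longrightarrow> (f x)\<^sup>2 \<le> C * (LINT x:{a..b}|lborel. (f x)\<^sup>2)" and C0: "0 \<le> C"
  shows "D_const a b k m \<le> ennreal C"
  unfolding D_const_def
proof (rule SUP_least)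
  fix f assume "f \<in> {f \<in> pw_poly a b k m. eta_norm a b f = 1}"
  then have f: "f \<in> pw_poly a b k m" and n: "(LINT x:{a..b}|lborel. (f x)\<^sup>2) = 1" by (auto simp: eta_norm_def)
  have "\<bar>f x\<bar> \<le> sqrt C" for x using C[OF f, of x] n by (simp add: real_le_rsqrt)
  then have "Linf_norm a b f \<le> ennreal (sqrt C)"
    unfolding Linf_norm_def using pw_poly_borel[OF ab m f]
    by (intro esssup_I AE_I2 ennreal_leI) (auto intro!: measurable_restrict_space1)
  then have "(Linf_norm a b f)\<^sup>2 \<le> (ennreal (sqrt C))\<^sup>2" by (intro power_mono) auto
  also have "\<dots> = ennreal C" using C0 by (simp add: ennreal_power)
  finally show "(Linf_norm a b f)\<^sup>2 \<le> ennreal C" .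
qed

text \<open>The witness is the normalized indicator of the first cell. The bound makes the model set
  finite, with at most \<open>(b - a) * T\<close> members.\<close>

lemma D_const_ge:
  assumes ab: "a < b" and m: "0 < m"
  shows "ennreal (real m / (b - a)) \<le> D_const a b k m"
proof -
  define r where "r = sqrt (real m / (b - a))"
  have r: "r > 0" "r\<^sup>2 = real m / (b - a)" using ab m by (auto simp: r_def)
  define f where "f = pw_of a b m (\<lambda>i. if i = 0 then [:r:] else 0)"
  have f: "f \<in> pw_poly a b k m" unfolding f_def by (rule pw_of_mem[OF ab]) auto
  have fx: "f x = r * indicator (grid_cell a b m 0) x" for x
  proof (cases "x \<in> {a..b}")
    case True
    have "x \<in> grid_cell a b m 0 \<longleftrightarrow> cell_index a b m x = 0"
      using cell_index_eq[OF ab m, of x] mem_grid_cell_index[OF ab m True] by auto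
    then show ?thesis using True by (auto simp: f_def pw_of_def split: split_indicator)
  next
    case False
    then show ?thesis using grid_cell_subset[OF ab m] by (auto simp: f_def pw_of_def split: split_indicator)
  qed
  have em: "emeasure lborel (grid_cell a b m 0) = ennreal ((b - a) / real m)"
    using ab m by (auto simp: grid_cell_def grid_point_def divide_right_mono)
  have [measurable]: "grid_cell a b m 0 \<in> sets borel" by (simp add: grid_cell_def)
  have "(LINT x:{a..b}|lborel. (f x)\<^sup>2) = (\<integral>x. r\<^sup>2 * indicator (grid_cell a b m 0) x \<partial>lborel)"
    unfolding set_lebesgue_integral_def using grid_cell_subset[OF ab m]
    by (intro Bochner_Integration.integral_cong refl) (auto simp: fx split: split_indicator)
  also have "\<dots> = r\<^sup>2 * ((b - a) / real m)" using em ab m by (simp add: measure_def)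
  also have "\<dots> = 1" using r ab m by simp
  finally have n: "eta_norm a b f = 1" by (simp add: eta_norm_def)
  have "ennreal r \<le> Linf_norm a b f"
  proof (rule ccontr)
    assume "\<not> ennreal r \<le> Linf_norm a b f"
    then have lt: "Linf_norm a b f < ennreal r" by simp
    have "AE x in restrict_space lborel {a..b}. ennreal \<bar>f x\<bar> \<le> Linf_norm a b f"
      unfolding Linf_norm_def by (rule esssup_AE)
    then have "AE x in lborel. x \<in> {a..b} \<longrightarrow> ennreal \<bar>f x\<bar> \<le> Linf_norm a b f"
      by (subst (asm) AE_restrict_space_iff) auto
    then have "AE x in lborel. x \<notin> grid_cell a b m 0"
    proof eventually_elim
      case (elim x)
      show ?case
      proof
        assume x: "x \<in> grid_cell a b m 0"
        then have "x \<in> {a..b}" using grid_cell_subset[OF ab m] by blast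
        then have "ennreal r \<le> Linf_norm a b f" using elim x r by (simp add: fx)
        with lt show False by simp
      qed
    qed
    then have "emeasure lborel (grid_cell a b m 0) = 0"
      by (subst (asm) AE_iff_measurable[of "grid_cell a b m 0"]) auto
    then show False using em ab m by simp
  qed
  then have "(ennreal r)\<^sup>2 \<le> (Linf_norm a b f)\<^sup>2" by (intro power_mono) auto
  moreover have "(ennreal r)\<^sup>2 = ennreal (real m / (b - a))" using r by (simp add: ennreal_power)
  moreover have "(Linf_norm a b f)\<^sup>2 \<le> D_const a b k m"
    unfolding D_const_def using f n by (intro SUP_upper) auto
  ultimately show ?thesis by simp
qed

section \<open>The quadratic statistic\<close>

context levy_jumps begin

text \<open>With \<open>Q = U + V\<close> the squared length of the centred walk divided by \<open>T\<close> and \<open>V\<close> its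
  quadratic variation, the function \<open>U^4 + V^2 + d^2\<close> grows in mean by a factor of at most
  \<open>1 + O(1/n)\<close> at each of the \<open>n\<close> steps.\<close>

lemma incr_quadratic_fourth_moment:
  fixes \<phi> :: "nat \<Rightarrow> real \<Rightarrow> real"
  assumes T: "0 < T" and n: "0 < n" and d: "0 < d" and C1: "0 \<le> C1" and C2: "0 \<le> C2"
    and \<phi>[measurable]: "\<And>l. l < d \<Longrightarrow> \<phi> l \<in> borel_measurable borel"
    and D: "\<And>x. (\<Sum>l<d. (\<phi> l x)\<^sup>2) \<le> C2 * T"
    and var: "\<And>c. real n * (\<integral>\<omega>. (\<Sum>l<d. c l * \<phi> l (X (T / real n) \<omega>))\<^sup>2 \<partial>M) \<le> C1 * T * (\<Sum>l<d. (c l)\<^sup>2)"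
    and \<mu>_def: "\<And>l. \<mu> l = (\<integral>\<omega>. \<phi> l (X (T / real n) \<omega>) \<partial>M)"
  shows "(\<integral>\<^sup>+\<omega>. ennreal ((((\<Sum>l<d. (incr_sum X T n (\<phi> l) \<omega> - real n * \<mu> l)\<^sup>2) - incr_sum X T n (\<lambda>x. \<Sum>l<d. (\<phi> l x - \<mu> l)\<^sup>2) \<omega>) / T) ^ 4) \<partial>M)
     \<le> ennreal (exp (33 * C1 + 388 * C1 * C2) * (real d)\<^sup>2)"
proof -
  define Y where "Y = X (T / real n)"
  have Tn: "0 \<le> T / real n" using T by simp
  have m[measurable]: "Y \<in> borel_measurable M" unfolding Y_def using Tn by (rule measurable_X)
  define b where "b = sqrt (C2 * T)"
  have b2: "b\<^sup>2 = C2 * T" "0 \<le> b" using C2 T by (auto simp: b_def)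
  have \<phi>b: "\<bar>\<phi> l x\<bar> \<le> b" if "l < d" for l x
  proof -
    have "(\<phi> l x)\<^sup>2 \<le> (\<Sum>l<d. (\<phi> l x)\<^sup>2)" using that by (intro member_le_sum) auto
    then have "(\<phi> l x)\<^sup>2 \<le> b\<^sup>2" using D[of x] b2 by simp
    then show ?thesis using b2(2) abs_le_square_iff[of "\<phi> l x" b] by simp
  qed
  have i\<phi>: "integrable M (\<lambda>\<omega>. \<phi> l (Y \<omega>))" if "l < d" for l
    unfolding Y_def by (rule integrable_bounded[OF \<phi>[OF that] \<phi>b[OF that] Tn])
  have bounded_int: "integrable M (\<lambda>\<omega>. g (Y \<omega>))" if "g \<in> borel_measurable borel" "\<And>x. \<bar>g x\<bar> \<le> B" for g :: "real \<Rightarrow> real" and B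
    unfolding Y_def by (rule integrable_bounded[OF that Tn])
  have var': "(\<integral>\<omega>. (\<Sum>l<d. c l * \<phi> l (Y \<omega>))\<^sup>2 \<partial>M) \<le> C1 * T * (\<Sum>l<d. (c l)\<^sup>2) / real n" for c
    using var[of c] n by (simp add: Y_def field_simps)
  define v where "v l x = \<phi> l x - \<mu> l" for l x
  have vm[measurable]: "v l \<in> borel_measurable borel" if "l < d" for l unfolding v_def using \<phi>[OF that] by measurable
  have lin_b: "\<exists>B. \<forall>x. \<bar>\<Sum>l<d. c l * \<phi> l x\<bar> \<le> B" for c
  proof -
    have "\<bar>\<Sum>l<d. c l * \<phi> l x\<bar> \<le> (\<Sum>l<d. \<bar>c l\<bar> * b)" for x
      by (rule order_trans[OF sum_abs]) (auto simp: abs_mult intro!: sum_mono mult_left_mono \<phi>b)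
    then show ?thesis by blast
  qed
  have lin_int: "integrable M (\<lambda>\<omega>. \<Sum>l<d. c l * \<phi> l (Y \<omega>))" for c
    using i\<phi> by (intro Bochner_Integration.integrable_sum integrable_mult_right) auto
  have lin_mean: "(\<integral>\<omega>. (\<Sum>l<d. c l * \<phi> l (Y \<omega>)) \<partial>M) = (\<Sum>l<d. c l * \<mu> l)" for c
    using i\<phi> by (subst Bochner_Integration.integral_sum) (auto simp: \<mu>_def Y_def)
  have lin_m: "(\<lambda>x. \<Sum>l<d. c l * \<phi> l x) \<in> borel_measurable borel" for c
    using \<phi> by (intro borel_measurable_sum borel_measurable_times) auto
  have lin_sq_int: "integrable M (\<lambda>\<omega>. (\<Sum>l<d. c l * \<phi> l (Y \<omega>))\<^sup>2)" for c
  proof -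
    obtain B where B: "\<And>x. \<bar>\<Sum>l<d. c l * \<phi> l x\<bar> \<le> B" using lin_b by blast
    have "\<bar>(\<Sum>l<d. c l * \<phi> l x)\<^sup>2\<bar> \<le> B\<^sup>2" for x
      using power_mono[OF B, of x 2] by simp
    then show ?thesis using lin_m[of c] by (intro bounded_int[of "\<lambda>x. (\<Sum>l<d. c l * \<phi> l x)\<^sup>2" "B\<^sup>2"]) auto
  qed
  have v_lin: "(\<Sum>l<d. c l * v l x) = (\<Sum>l<d. c l * \<phi> l x) - (\<Sum>l<d. c l * \<mu> l)" for c x
    by (simp add: v_def right_diff_distrib sum_subtractf)
  have v1: "(\<integral>\<omega>. (\<Sum>l<d. c l * v l (Y \<omega>)) \<partial>M) = 0" for c
    unfolding v_lin using lin_int[of c] lin_mean[of c] by (simp add: prob_space)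
  have v2: "(\<integral>\<omega>. (\<Sum>l<d. c l * v l (Y \<omega>))\<^sup>2 \<partial>M) \<le> C1 * T * (\<Sum>l<d. (c l)\<^sup>2) / real n" for c
  proof -
    let ?m = "\<Sum>l<d. c l * \<mu> l"
    have "(\<integral>\<omega>. (\<Sum>l<d. c l * v l (Y \<omega>))\<^sup>2 \<partial>M) = (\<integral>\<omega>. (\<Sum>l<d. c l * \<phi> l (Y \<omega>))\<^sup>2 - 2 * ?m * (\<Sum>l<d. c l * \<phi> l (Y \<omega>)) + ?m\<^sup>2 \<partial>M)"
      unfolding v_lin by (intro Bochner_Integration.integral_cong refl) (simp add: power2_diff algebra_simps)
    also have "\<dots> = (\<integral>\<omega>. (\<Sum>l<d. c l * \<phi> l (Y \<omega>))\<^sup>2 \<partial>M) - 2 * ?m * ?m + ?m\<^sup>2"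
      using lin_sq_int[of c] lin_int[of c] lin_mean[of c] by (simp add: prob_space)
    also have "\<dots> \<le> (\<integral>\<omega>. (\<Sum>l<d. c l * \<phi> l (Y \<omega>))\<^sup>2 \<partial>M)" by (simp add: power2_eq_square)
    finally show ?thesis using var'[of c] by linarith
  qed
  define w where "w x = (\<Sum>l<d. (v l x)\<^sup>2) / T" for x
  have wm[measurable]: "w \<in> borel_measurable borel" unfolding w_def
    using vm by (intro borel_measurable_divide borel_measurable_sum borel_measurable_power borel_measurable_const) auto
  have w0: "0 \<le> w x" for x unfolding w_def using T by (intro divide_nonneg_nonneg sum_nonneg) auto
  \<comment> \<open>The squared length \<open>S\<close> of the mean vector is the mean of a linear
    statistic with these very coefficients. Cauchy--Schwarz bounds that mean by
    \<open>sqrt (S * (C2 * T))\<close>, and a factor \<open>S\<close> cancels.\<close>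
  have mu_sq: "(\<Sum>l<d. (\<mu> l)\<^sup>2) \<le> C2 * T"
  proof -
    define S where "S = (\<Sum>l<d. (\<mu> l)\<^sup>2)"
    have S0: "0 \<le> S" unfolding S_def by (intro sum_nonneg) auto
    have "S = (\<integral>\<omega>. (\<Sum>l<d. \<mu> l * \<phi> l (Y \<omega>)) \<partial>M)" unfolding lin_mean S_def by (simp add: power2_eq_square)
    also have "\<dots> \<le> (\<integral>\<omega>. sqrt (S * (C2 * T)) \<partial>M)"
    proof (rule Bochner_Integration.integral_mono[OF lin_int])
      fix \<omega>
      have "(\<Sum>l<d. \<mu> l * \<phi> l (Y \<omega>))\<^sup>2 \<le> S * (\<Sum>l<d. (\<phi> l (Y \<omega>))\<^sup>2)" unfolding S_def by (rule Cauchy_Schwarz_ineq_sum)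
      also have "\<dots> \<le> S * (C2 * T)" using D S0 by (intro mult_left_mono) auto
      finally show "(\<Sum>l<d. \<mu> l * \<phi> l (Y \<omega>)) \<le> sqrt (S * (C2 * T))" by (rule real_le_rsqrt)
    qed simp
    also have "\<dots> = sqrt (S * (C2 * T))" by (simp add: prob_space)
    finally have "S\<^sup>2 \<le> (sqrt (S * (C2 * T)))\<^sup>2" using S0 by (intro power_mono)
    then have "S * S \<le> S * (C2 * T)" using S0 C2 T by (simp add: power2_eq_square)
    then show ?thesis using S0 C2 T unfolding S_def[symmetric] by (cases "S = 0") auto
  qed
  have w4: "w x \<le> 4 * C2" for x
  proof -
    have "(\<Sum>l<d. (v l x)\<^sup>2) \<le> (\<Sum>l<d. 2 * (\<phi> l x)\<^sup>2 + 2 * (\<mu> l)\<^sup>2)"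
    proof (rule sum_mono)
      fix l
      have "0 \<le> (\<phi> l x + \<mu> l)\<^sup>2" by simp
      then show "(v l x)\<^sup>2 \<le> 2 * (\<phi> l x)\<^sup>2 + 2 * (\<mu> l)\<^sup>2" by (simp add: v_def power2_eq_square algebra_simps)
    qed
    also have "\<dots> = 2 * (\<Sum>l<d. (\<phi> l x)\<^sup>2) + 2 * (\<Sum>l<d. (\<mu> l)\<^sup>2)" by (simp add: sum.distrib sum_distrib_left)
    also have "\<dots> \<le> 4 * C2 * T" using D[of x] mu_sq by linarith
    finally show ?thesis using T by (simp add: w_def divide_le_eq)
  qed
  have wi: "integrable M (\<lambda>\<omega>. w (Y \<omega>))" by (rule bounded_int[OF wm, of "4 * C2"]) (use w0 w4 in auto)
  have w2i: "integrable M (\<lambda>\<omega>. (w (Y \<omega>))\<^sup>2)"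
  proof (rule bounded_int[of "\<lambda>x. (w x)\<^sup>2" "(4 * C2)\<^sup>2"])
    show "\<bar>(w x)\<^sup>2\<bar> \<le> (4 * C2)\<^sup>2" for x using power_mono[OF w4 w0, of x 2] by simp
  qed measurable
  have vsq_int: "integrable M (\<lambda>\<omega>. (v l (Y \<omega>))\<^sup>2)" if l: "l < d" for l
  proof (rule bounded_int[of "\<lambda>x. (v l x)\<^sup>2" "4 * C2 * T"])
    show "\<bar>(v l x)\<^sup>2\<bar> \<le> 4 * C2 * T" for x
    proof -
      have "(v l x)\<^sup>2 \<le> (\<Sum>l<d. (v l x)\<^sup>2)" using l by (intro member_le_sum) auto
      also have "\<dots> \<le> 4 * C2 * T" using w4[of x] T by (simp add: w_def divide_le_eq)
      finally show ?thesis by simp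
    qed
  qed (use vm[OF l] in measurable)
  have Ew: "(\<integral>\<omega>. w (Y \<omega>) \<partial>M) \<le> C1 * real d / real n"
  proof -
    have one: "(\<integral>\<omega>. (v l (Y \<omega>))\<^sup>2 \<partial>M) \<le> C1 * T / real n" if l: "l < d" for l
    proof -
      have "(\<Sum>i<d. (if i = l then 1 else 0) * v i x) = v l x" for x using l by (simp add: if_distrib[of "\<lambda>c. c * _"] cong: if_cong)
      moreover have "(\<Sum>i<d. (if i = l then 1 else 0 :: real)\<^sup>2) = 1" using l by (simp add: if_distrib[of "\<lambda>c. c\<^sup>2"] cong: if_cong)
      ultimately show ?thesis using v2[of "\<lambda>i. if i = l then 1 else 0"] by simp
    qed
    have "(\<integral>\<omega>. w (Y \<omega>) \<partial>M) = (\<Sum>l<d. (\<integral>\<omega>. (v l (Y \<omega>))\<^sup>2 \<partial>M)) / T"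
      unfolding w_def using vsq_int by (simp add: Bochner_Integration.integral_sum)
    also have "\<dots> \<le> (\<Sum>l<d. C1 * T / real n) / T" using T one by (intro divide_right_mono sum_mono) auto
    also have "\<dots> = C1 * real d / real n" using T by simp
    finally show ?thesis .
  qed
  have Ew2: "(\<integral>\<omega>. (w (Y \<omega>))\<^sup>2 \<partial>M) \<le> 4 * C2 * (C1 * real d / real n)"
  proof -
    have "(\<integral>\<omega>. (w (Y \<omega>))\<^sup>2 \<partial>M) \<le> (\<integral>\<omega>. 4 * C2 * w (Y \<omega>) \<partial>M)"
      using w0 w4 wi by (intro Bochner_Integration.integral_mono[OF w2i]) (auto simp: power2_eq_square intro!: mult_right_mono)
    also have "\<dots> \<le> 4 * C2 * (C1 * real d / real n)" using Ew C2 by (simp only: integral_mult_right_zero) (intro mult_left_mono, auto)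
    finally show ?thesis .
  qed
  define A where "A j x l = (\<Sum>i<j. v l (x i))" for j :: nat and x :: "nat \<Rightarrow> real" and l
  define V where "V j x = (\<Sum>i<j. w (x i))" for j :: nat and x :: "nat \<Rightarrow> real"
  define U where "U j x = (\<Sum>l<d. (A j x l)\<^sup>2) / T - V j x" for j x
  \<comment> \<open>\<open>(V j x)\<^sup>2\<close> is included because the conditional variance of
    the step of \<open>U\<close> is proportional to \<open>U + V\<close>, not to \<open>U\<close>.
    \<open>(real d)\<^sup>2\<close> absorbs the drift of \<open>V\<close>, which is at most
    \<open>C1 * d / n\<close> per step.\<close>
  define F where "F j x = (U j x) ^ 4 + (V j x)\<^sup>2 + (real d)\<^sup>2" for j x
  define \<delta> where "\<delta> j x y = (\<Sum>l<d. (2 / T * A j x l) * v l y)" for j x y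
  have A_upd: "A (Suc j) (x(j := y)) l = A j x l + v l y" for j x y l
  proof -
    have "(\<Sum>i<j. v l ((x(j := y)) i)) = (\<Sum>i<j. v l (x i))" by (intro sum.cong) auto
    then show ?thesis by (simp add: A_def)
  qed
  have V_upd: "V (Suc j) (x(j := y)) = V j x + w y" for j x y
  proof -
    have "(\<Sum>i<j. w ((x(j := y)) i)) = (\<Sum>i<j. w (x i))" by (intro sum.cong) auto
    then show ?thesis by (simp add: V_def)
  qed
  \<comment> \<open>The squared length of the walk changes by a cross term and by the squared length
    of the step. The latter cancels against the change of \<open>V\<close>, which leaves an
    increment linear in the centred step, hence of mean 0.\<close>
  have U_upd: "U (Suc j) (x(j := y)) = U j x + \<delta> j x y" for j x y
  proof -
    have "(\<Sum>l<d. (A j x l + v l y)\<^sup>2) = (\<Sum>l<d. (A j x l)\<^sup>2) + 2 * (\<Sum>l<d. A j x l * v l y) + (\<Sum>l<d. (v l y)\<^sup>2)"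
      by (simp add: power2_sum sum.distrib sum_distrib_left mult_ac)
    moreover have "\<delta> j x y = 2 * (\<Sum>l<d. A j x l * v l y) / T"
      unfolding \<delta>_def by (simp add: sum_distrib_left sum_divide_distrib mult_ac)
    ultimately show ?thesis unfolding U_def A_upd V_upd by (simp add: w_def add_divide_distrib)
  qed
  have F_upd: "F (Suc j) (x(j := y)) = (U j x + \<delta> j x y) ^ 4 + (V j x + w y)\<^sup>2 + (real d)\<^sup>2" for j x y
    unfolding F_def U_upd V_upd ..
  have \<delta>m[measurable]: "(\<lambda>y. \<delta> j x y) \<in> borel_measurable borel" for j x
    unfolding \<delta>_def using vm by (intro borel_measurable_sum borel_measurable_times) auto
  have QUV: "(\<Sum>l<d. (A j x l)\<^sup>2) = T * (U j x + V j x)" for j x using T by (simp add: U_def)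
  \<comment> \<open>The squared length of the walk is \<open>T * (U + V)\<close> and that of the
    step at most \<open>4 * C2 * T\<close>. This pointwise bound reduces the fourth moment of
    \<delta> to its second moment in \<open>E4\<close>.\<close>
  have \<delta>sq: "(\<delta> j x y)\<^sup>2 \<le> 16 * C2 * (U j x + V j x)" for j x y
  proof -
    have "(\<delta> j x y)\<^sup>2 \<le> (\<Sum>l<d. (2 / T * A j x l)\<^sup>2) * (\<Sum>l<d. (v l y)\<^sup>2)" unfolding \<delta>_def by (rule Cauchy_Schwarz_ineq_sum)
    also have "(\<Sum>l<d. (2 / T * A j x l)\<^sup>2) = (4 / T\<^sup>2) * (\<Sum>l<d. (A j x l)\<^sup>2)"
      by (simp add: power_mult_distrib power_divide sum_distrib_left)
    also have "(\<Sum>l<d. (v l y)\<^sup>2) = T * w y" using T by (simp add: w_def)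
    also have "(4 / T\<^sup>2) * (\<Sum>l<d. (A j x l)\<^sup>2) * (T * w y) = 4 * (U j x + V j x) * w y"
      unfolding QUV using T by (simp add: power2_eq_square)
    also have "\<dots> \<le> 4 * (U j x + V j x) * (4 * C2)"
    proof (rule mult_left_mono[OF w4])
      have "0 \<le> (\<Sum>l<d. (A j x l)\<^sup>2)" by (intro sum_nonneg) auto
      then show "0 \<le> 4 * (U j x + V j x)" unfolding QUV using T by (simp add: zero_le_mult_iff)
    qed
    finally show ?thesis by (simp add: algebra_simps)
  qed
  have Q0: "0 \<le> U j x + V j x" for j x
  proof -
    have "0 \<le> (\<Sum>l<d. (A j x l)\<^sup>2)" by (intro sum_nonneg) auto
    then show ?thesis unfolding QUV using T by (simp add: zero_le_mult_iff)
  qed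
  have V0: "0 \<le> V j x" for j x unfolding V_def using w0 by (intro sum_nonneg) auto
  have \<delta>b: "\<bar>\<delta> j x y\<bar> \<le> sqrt (16 * C2 * (U j x + V j x))" for j x y
    using \<delta>sq[of j x y] by (metis real_sqrt_abs real_sqrt_le_iff)
  have \<delta>i: "integrable M (\<lambda>\<omega>. (\<delta> j x (Y \<omega>)) ^ p)" for j x p
  proof (rule bounded_int[of "\<lambda>y. (\<delta> j x y) ^ p" "sqrt (16 * C2 * (U j x + V j x)) ^ p"])
    show "\<bar>\<delta> j x y ^ p\<bar> \<le> sqrt (16 * C2 * (U j x + V j x)) ^ p" for y
      unfolding power_abs by (intro power_mono \<delta>b) simp
  qed measurable
  have E1: "(\<integral>\<omega>. \<delta> j x (Y \<omega>) \<partial>M) = 0" for j x unfolding \<delta>_def by (rule v1)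
  have E2: "(\<integral>\<omega>. (\<delta> j x (Y \<omega>))\<^sup>2 \<partial>M) \<le> 4 * C1 * (U j x + V j x) / real n" for j x
  proof -
    have "(\<integral>\<omega>. (\<delta> j x (Y \<omega>))\<^sup>2 \<partial>M) \<le> C1 * T * (\<Sum>l<d. (2 / T * A j x l)\<^sup>2) / real n" unfolding \<delta>_def by (rule v2)
    also have "(\<Sum>l<d. (2 / T * A j x l)\<^sup>2) = (4 / T\<^sup>2) * (T * (U j x + V j x))"
      unfolding QUV[symmetric] by (simp add: power_mult_distrib power_divide sum_distrib_left)
    also have "C1 * T * ((4 / T\<^sup>2) * (T * (U j x + V j x))) / real n = 4 * C1 * (U j x + V j x) / real n"
      using T by (simp add: power2_eq_square)
    finally show ?thesis .
  qed
  have E4: "(\<integral>\<omega>. (\<delta> j x (Y \<omega>)) ^ 4 \<partial>M) \<le> 64 * C1 * C2 * (U j x + V j x)\<^sup>2 / real n" for j x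
  proof -
    have "(\<integral>\<omega>. (\<delta> j x (Y \<omega>)) ^ 4 \<partial>M) \<le> (\<integral>\<omega>. 16 * C2 * (U j x + V j x) * (\<delta> j x (Y \<omega>))\<^sup>2 \<partial>M)"
    proof (rule Bochner_Integration.integral_mono[OF \<delta>i])
      show "\<delta> j x (Y \<omega>) ^ 4 \<le> 16 * C2 * (U j x + V j x) * (\<delta> j x (Y \<omega>))\<^sup>2" for \<omega>
        using mult_right_mono[OF \<delta>sq[of j x "Y \<omega>"], of "(\<delta> j x (Y \<omega>))\<^sup>2"] by (simp add: power4_eq_xxxx power2_eq_square)
    qed (use \<delta>i[of j x 2] in simp)
    also have "\<dots> = 16 * C2 * (U j x + V j x) * (\<integral>\<omega>. (\<delta> j x (Y \<omega>))\<^sup>2 \<partial>M)" by simp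
    also have "\<dots> \<le> 16 * C2 * (U j x + V j x) * (4 * C1 * (U j x + V j x) / real n)"
      using E2 C2 Q0 by (intro mult_left_mono) auto
    also have "\<dots> = 64 * C1 * C2 * (U j x + V j x)\<^sup>2 / real n" by (simp add: power2_eq_square)
    finally show ?thesis .
  qed
  \<comment> \<open>The sum of the four contributions \<open>t1\<close> to \<open>t4\<close> below:
    33 is 32 + 1 and 388 is 384 + 4.\<close>
  define C5 where "C5 = 33 * C1 + 388 * C1 * C2"
  have C50: "0 \<le> C5" using C1 C2 by (simp add: C5_def)
  have Fm: "F j \<in> borel_measurable (PiM {..<j} (\<lambda>_. borel))" for j
  proof -
    have comp: "(\<lambda>x. x i) \<in> borel_measurable (PiM {..<j} (\<lambda>_. borel :: real measure))" if "i < j" for i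
      using measurable_component_singleton[of i "{..<j}" "\<lambda>_. borel :: real measure"] that by simp
    have vm': "(\<lambda>x. v l (x i)) \<in> borel_measurable (PiM {..<j} (\<lambda>_. borel))" if "l < d" "i < j" for l i
      by (rule measurable_compose[OF comp[OF that(2)] vm[OF that(1)]])
    have wm': "(\<lambda>x. w (x i)) \<in> borel_measurable (PiM {..<j} (\<lambda>_. borel))" if "i < j" for i
      by (rule measurable_compose[OF comp[OF that] wm])
    show ?thesis unfolding F_def U_def V_def A_def
      using vm' wm' by (intro borel_measurable_add borel_measurable_power borel_measurable_diff borel_measurable_divide borel_measurable_sum borel_measurable_const) auto
  qed
  have Fm': "(\<lambda>y. F (Suc j) (x(j := y))) \<in> borel_measurable borel" for j x unfolding F_upd by measurable
  have F_eq: "F (Suc j) (x(j := y)) \<le> (U j x) ^ 4 + 4 * (U j x) ^ 3 * \<delta> j x y + 8 * (U j x)\<^sup>2 * (\<delta> j x y)\<^sup>2 + 3 * (\<delta> j x y) ^ 4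
      + ((V j x)\<^sup>2 + 2 * V j x * w y + (w y)\<^sup>2) + (real d)\<^sup>2" for j x y
    unfolding F_upd using power4_add_le[of "U j x" "\<delta> j x y"] by (simp add: power2_sum)
  have bound_int: "integrable M (\<lambda>\<omega>. (U j x) ^ 4 + 4 * (U j x) ^ 3 * \<delta> j x (Y \<omega>) + 8 * (U j x)\<^sup>2 * (\<delta> j x (Y \<omega>))\<^sup>2 + 3 * (\<delta> j x (Y \<omega>)) ^ 4
      + ((V j x)\<^sup>2 + 2 * V j x * w (Y \<omega>) + (w (Y \<omega>))\<^sup>2) + (real d)\<^sup>2)" for j x
    using \<delta>i[of j x 1] \<delta>i[of j x 2] \<delta>i[of j x 4] wi w2i
    by (intro Bochner_Integration.integrable_add integrable_mult_right integrable_const) auto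
  have Fi: "integrable M (\<lambda>\<omega>. F (Suc j) (x(j := X (T / real n) \<omega>)))" for j x
  proof (rule Bochner_Integration.integrable_bound[OF bound_int[of j x]])
    show "(\<lambda>\<omega>. F (Suc j) (x(j := X (T / real n) \<omega>))) \<in> borel_measurable M"
      using measurable_compose[OF m Fm'[of j x]] by (simp add: Y_def)
    show "AE \<omega> in M. norm (F (Suc j) (x(j := X (T / real n) \<omega>))) \<le> norm ((U j x) ^ 4 + 4 * (U j x) ^ 3 * \<delta> j x (Y \<omega>) + 8 * (U j x)\<^sup>2 * (\<delta> j x (Y \<omega>))\<^sup>2 + 3 * (\<delta> j x (Y \<omega>)) ^ 4
      + ((V j x)\<^sup>2 + 2 * V j x * w (Y \<omega>) + (w (Y \<omega>))\<^sup>2) + (real d)\<^sup>2)"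
    proof (intro AE_I2)
      fix \<omega>
      have "0 \<le> F (Suc j) (x(j := Y \<omega>))" by (simp add: F_def)
      then show "norm (F (Suc j) (x(j := X (T / real n) \<omega>))) \<le> norm ((U j x) ^ 4 + 4 * (U j x) ^ 3 * \<delta> j x (Y \<omega>) + 8 * (U j x)\<^sup>2 * (\<delta> j x (Y \<omega>))\<^sup>2 + 3 * (\<delta> j x (Y \<omega>)) ^ 4
        + ((V j x)\<^sup>2 + 2 * V j x * w (Y \<omega>) + (w (Y \<omega>))\<^sup>2) + (real d)\<^sup>2)"
        using F_eq[of j x "Y \<omega>"] unfolding Y_def real_norm_def by linarith
    qed
  qed
  have step: "(\<integral>\<omega>. F (Suc j) (x(j := X (T / real n) \<omega>)) \<partial>M) \<le> (1 + C5 / real n) * F j x" for j x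
  proof -
    define u where "u = U j x"
    define z where "z = V j x"
    define e2 where "e2 = (\<integral>\<omega>. (\<delta> j x (Y \<omega>))\<^sup>2 \<partial>M)"
    define e4 where "e4 = (\<integral>\<omega>. (\<delta> j x (Y \<omega>)) ^ 4 \<partial>M)"
    define f1 where "f1 = (\<integral>\<omega>. w (Y \<omega>) \<partial>M)"
    define f2 where "f2 = (\<integral>\<omega>. (w (Y \<omega>))\<^sup>2 \<partial>M)"
    have z0: "0 \<le> z" and uz: "0 \<le> u + z" using V0 Q0 by (auto simp: z_def u_def)
    have "(\<integral>\<omega>. F (Suc j) (x(j := X (T / real n) \<omega>)) \<partial>M) \<le> (\<integral>\<omega>. u ^ 4 + 4 * u ^ 3 * \<delta> j x (Y \<omega>) + 8 * u\<^sup>2 * (\<delta> j x (Y \<omega>))\<^sup>2 + 3 * (\<delta> j x (Y \<omega>)) ^ 4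
      + (z\<^sup>2 + 2 * z * w (Y \<omega>) + (w (Y \<omega>))\<^sup>2) + (real d)\<^sup>2 \<partial>M)"
      unfolding u_def z_def using F_eq[of j x "Y _"] by (intro Bochner_Integration.integral_mono[OF Fi bound_int]) (simp add: Y_def)
    also have "\<dots> = u ^ 4 + 8 * u\<^sup>2 * e2 + 3 * e4 + (z\<^sup>2 + 2 * z * f1 + f2) + (real d)\<^sup>2"
      using \<delta>i[of j x 1] \<delta>i[of j x 2] \<delta>i[of j x 4] wi w2i E1[of j x]
      by (simp add: prob_space e2_def e4_def f1_def f2_def)
    finally have main: "(\<integral>\<omega>. F (Suc j) (x(j := X (T / real n) \<omega>)) \<partial>M) \<le> (u ^ 4 + z\<^sup>2 + (real d)\<^sup>2) + (8 * u\<^sup>2 * e2 + 3 * e4 + (2 * z * f1 + f2))" by linarith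
    \<comment> \<open>The current value of \<open>F\<close>. The bounds \<open>a1\<close> to
      \<open>a4\<close> express by it whatever the step adds; \<open>1 \<le> d\<close> allows
      constants and \<open>d\<close> itself to be absorbed into \<open>d\<^sup>2\<close>.\<close>
    define L where "L = u ^ 4 + z\<^sup>2 + (real d)\<^sup>2"
    define p where "p = u ^ 4"
    define r where "r = real d"
    define D where "D = (real d)\<^sup>2"
    have r1: "1 \<le> r" using d by (simp add: r_def)
    have D: "D = r\<^sup>2" by (simp add: D_def r_def)
    have rD: "r \<le> D" unfolding D using self_le_power[OF r1, of 2] by simp
    have p0: "0 \<le> p" and z20: "0 \<le> z\<^sup>2" by (simp_all add: p_def)
    have Lp: "L = p + z\<^sup>2 + D" by (simp add: L_def p_def D_def)
    have pu: "p = u\<^sup>2 * u\<^sup>2" by (simp add: p_def power4_eq_xxxx power2_eq_square)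
    have u2: "2 * u\<^sup>2 \<le> p + 1" unfolding pu using sum_squares_bound[of "u\<^sup>2" 1] by (simp add: power2_eq_square)
    have a1: "u\<^sup>2 * (u + z) \<le> L"
    proof -
      have q1: "u\<^sup>2 * z \<le> p / 4 + z\<^sup>2" unfolding pu using sum_squares_bound[of "u\<^sup>2 / 2" z] by (simp add: power2_eq_square)
      have q2: "2 * (u\<^sup>2 * u) \<le> p + u\<^sup>2" unfolding pu using sum_squares_bound[of "u\<^sup>2" u] by (simp add: power2_eq_square)
      have "u\<^sup>2 * (u + z) = u\<^sup>2 * u + u\<^sup>2 * z" by (rule distrib_left)
      then show ?thesis using q1 q2 u2 p0 r1 rD unfolding Lp by linarith
    qed
    have a2: "(u + z)\<^sup>2 \<le> 2 * L"
    proof -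
      have q1: "(u + z)\<^sup>2 \<le> 2 * u\<^sup>2 + 2 * z\<^sup>2" using sum_squares_bound[of u z] by (simp add: power2_sum)
      have "2 * u\<^sup>2 + 2 * z\<^sup>2 \<le> 2 * (p + z\<^sup>2 + D)" using u2 p0 r1 rD by argo
      then show ?thesis unfolding Lp by (rule order_trans[OF q1])
    qed
    have a3: "2 * (real d * z) \<le> L"
    proof -
      have "2 * (r * z) \<le> r\<^sup>2 + z\<^sup>2" using sum_squares_bound[of r z] by (simp add: mult.assoc)
      then show ?thesis using p0 unfolding Lp D r_def[symmetric] by linarith
    qed
    have a4: "real d \<le> L" using rD p0 z20 unfolding Lp r_def[symmetric] by linarith
    have t1: "8 * u\<^sup>2 * e2 \<le> 32 * C1 * L / real n"
    proof -
      have "8 * u\<^sup>2 * e2 \<le> 8 * u\<^sup>2 * (4 * C1 * (u + z) / real n)"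
        unfolding e2_def u_def z_def by (intro mult_left_mono E2) simp
      also have "\<dots> = 32 * C1 * (u\<^sup>2 * (u + z)) / real n" by simp
      also have "\<dots> \<le> 32 * C1 * L / real n" using a1 C1 by (intro divide_right_mono mult_left_mono) auto
      finally show ?thesis .
    qed
    have t2: "3 * e4 \<le> 384 * C1 * C2 * L / real n"
    proof -
      have "3 * e4 \<le> 3 * (64 * C1 * C2 * (u + z)\<^sup>2 / real n)"
        unfolding e4_def u_def z_def by (intro mult_left_mono E4) simp
      also have "\<dots> = 192 * C1 * C2 * (u + z)\<^sup>2 / real n" by simp
      also have "\<dots> \<le> 192 * C1 * C2 * (2 * L) / real n" using a2 C1 C2 by (intro divide_right_mono mult_left_mono) auto
      finally show ?thesis by simp
    qed
    have t3: "2 * z * f1 \<le> C1 * L / real n"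
    proof -
      have "2 * z * f1 \<le> 2 * z * (C1 * real d / real n)" unfolding f1_def using z0 Ew by (intro mult_left_mono) auto
      also have "\<dots> = C1 * (2 * (real d * z)) / real n" by simp
      also have "\<dots> \<le> C1 * L / real n" using a3 C1 by (intro divide_right_mono mult_left_mono) auto
      finally show ?thesis .
    qed
    have t4: "f2 \<le> 4 * C1 * C2 * L / real n"
    proof -
      have "f2 \<le> 4 * C1 * C2 * real d / real n" using Ew2 by (simp add: f2_def mult_ac)
      also have "\<dots> \<le> 4 * C1 * C2 * L / real n" using a4 C1 C2 by (intro divide_right_mono mult_left_mono) auto
      finally show ?thesis .
    qed
    have sumL: "32 * C1 * L / real n + 384 * C1 * C2 * L / real n + C1 * L / real n + 4 * C1 * C2 * L / real n = C5 * L / real n"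
      by (simp add: C5_def add_divide_distrib[symmetric] algebra_simps)
    have "(1 + C5 / real n) * F j x = L + C5 * L / real n"
      by (simp add: F_def L_def u_def z_def distrib_right)
    then show ?thesis using main t1 t2 t3 t4 sumL unfolding L_def[symmetric] by linarith
  qed
  have "(\<integral>\<^sup>+\<omega>. ennreal (F n (\<lambda>i\<in>{..<n}. X (real (Suc i) * T / real n) \<omega> - X (real i * T / real n) \<omega>)) \<partial>M)
     \<le> ennreal (exp C5 * F 0 (\<lambda>_. undefined))"
    by (rule incr_iterate_le[OF T n C50 Fm _ Fi step Fm']) (simp add: F_def)
  also have "F 0 (\<lambda>_. undefined) = (real d)\<^sup>2" by (simp add: F_def U_def V_def A_def)
  finally have le: "(\<integral>\<^sup>+\<omega>. ennreal (F n (\<lambda>i\<in>{..<n}. X (real (Suc i) * T / real n) \<omega> - X (real i * T / real n) \<omega>)) \<partial>M)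
     \<le> ennreal (exp C5 * (real d)\<^sup>2)" .
  have eqU: "U n (\<lambda>i\<in>{..<n}. X (real (Suc i) * T / real n) \<omega> - X (real i * T / real n) \<omega>)
     = ((\<Sum>l<d. (incr_sum X T n (\<phi> l) \<omega> - real n * \<mu> l)\<^sup>2) - incr_sum X T n (\<lambda>x. \<Sum>l<d. (\<phi> l x - \<mu> l)\<^sup>2) \<omega>) / T" for \<omega>
  proof -
    have 1: "A n (\<lambda>i\<in>{..<n}. X (real (Suc i) * T / real n) \<omega> - X (real i * T / real n) \<omega>) l = incr_sum X T n (\<phi> l) \<omega> - real n * \<mu> l" for l
      unfolding A_def sum_restrict_eq v_def sum_subtractf incr_sum_def by simp
    have 2: "V n (\<lambda>i\<in>{..<n}. X (real (Suc i) * T / real n) \<omega> - X (real i * T / real n) \<omega>) = incr_sum X T n (\<lambda>x. \<Sum>l<d. (\<phi> l x - \<mu> l)\<^sup>2) \<omega> / T"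
      unfolding V_def w_def v_def incr_sum_def sum_divide_distrib by (intro sum.cong) auto
    show ?thesis unfolding U_def 1 2 by (simp add: diff_divide_distrib)
  qed
  show ?thesis
    unfolding C5_def[symmetric]
  proof (rule order_trans[OF nn_integral_mono le], rule ennreal_leI)
    fix \<omega>
    show "(((\<Sum>l<d. (incr_sum X T n (\<phi> l) \<omega> - real n * \<mu> l)\<^sup>2) - incr_sum X T n (\<lambda>x. \<Sum>l<d. (\<phi> l x - \<mu> l)\<^sup>2) \<omega>) / T) ^ 4
      \<le> F n (\<lambda>i\<in>{..<n}. X (real (Suc i) * T / real n) \<omega> - X (real i * T / real n) \<omega>)"
      unfolding F_def eqU[symmetric] by simp
  qed
qed

text \<open>As \<open>n\<close> times the mean of a step converges, the mean itself tends to 0. So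
  the centring persists in the walk but disappears from its quadratic variation, whose limit is the
  jump sum of the squares.\<close>

lemma jump_quadratic_fourth_moment:
  fixes \<phi> :: "nat \<Rightarrow> real \<Rightarrow> real"
  assumes ab: "0 \<notin> {a..b}" and T: "0 < T" and d: "0 < d" and R: "0 \<le> R" and C2: "0 \<le> C2"
    and \<phi>: "\<And>l. l < d \<Longrightarrow> regular a b (\<phi> l)"
    and D: "\<And>x. (\<Sum>l<d. (\<phi> l x)\<^sup>2) \<le> C2 * T"
    and var: "\<And>c. (LINT x:{a..b}|lborel. (\<Sum>l<d. c l * \<phi> l x)\<^sup>2 * s x) \<le> R * (\<Sum>l<d. (c l)\<^sup>2)"
  shows "(\<integral>\<^sup>+\<omega>. ennreal ((((\<Sum>l<d. (jump_sum X a b T (\<phi> l) \<omega> - T * (LINT x:{a..b}|lborel. \<phi> l x * s x))\<^sup>2)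
            - jump_sum X a b T (\<lambda>x. \<Sum>l<d. (\<phi> l x)\<^sup>2) \<omega>) / T) ^ 4) \<partial>M)
     \<le> ennreal (exp (33 * (R + 1) + 388 * (R + 1) * C2) * (real d)\<^sup>2)"
proof (rule nn_integral_le_of_tendsto)
  define \<mu> where "\<mu> n l = (\<integral>\<omega>. \<phi> l (X (T / real n) \<omega>) \<partial>M)" for n l
  define \<beta> where "\<beta> l = T * (LINT x:{a..b}|lborel. \<phi> l x * s x)" for l
  let ?Z = "\<lambda>n \<omega>. (((\<Sum>l<d. (incr_sum X T n (\<phi> l) \<omega> - real n * \<mu> n l)\<^sup>2) - incr_sum X T n (\<lambda>x. \<Sum>l<d. (\<phi> l x - \<mu> n l)\<^sup>2) \<omega>) / T) ^ 4"
  have \<phi>b: "\<phi> l \<in> borel_measurable borel" if "l < d" for l using \<phi>[OF that] by (rule regular_borel)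
  show "?Z n \<in> borel_measurable M" for n
  proof -
    have "incr_sum X T n (\<phi> l) \<in> borel_measurable M" if "l < d" for l by (rule measurable_incr_sum[OF \<phi>b[OF that] T])
    moreover have "incr_sum X T n (\<lambda>x. \<Sum>l<d. (\<phi> l x - \<mu> n l)\<^sup>2) \<in> borel_measurable M"
      using \<phi>b by (intro measurable_incr_sum[OF _ T] borel_measurable_sum borel_measurable_power borel_measurable_diff) auto
    ultimately show ?thesis
      by (intro borel_measurable_power borel_measurable_divide borel_measurable_diff borel_measurable_sum borel_measurable_const) auto
  qed
  have mean: "(\<lambda>n. real n * \<mu> n l) \<longlonglongrightarrow> \<beta> l" if "l < d" for l
    unfolding \<mu>_def \<beta>_def by (rule tendsto_mean[OF ab \<phi>[OF that] T])
  have mu0: "(\<lambda>n. \<mu> n l) \<longlonglongrightarrow> 0" if "l < d" for l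
  proof -
    have "(\<lambda>n. real n * \<mu> n l / real n) \<longlonglongrightarrow> 0"
      using tendsto_divide_0[OF mean[OF that] filterlim_at_top_imp_at_infinity[OF filterlim_real_sequentially]] .
    moreover have "eventually (\<lambda>n. real n * \<mu> n l / real n = \<mu> n l) sequentially"
      using eventually_gt_at_top[of 0] by eventually_elim simp
    ultimately show ?thesis by (rule Lim_transform_eventually)
  qed
  have sq: "regular a b (\<lambda>x. \<Sum>l<d. (\<phi> l x)\<^sup>2)"
    using \<phi> by (intro regular_sum regular_comp[of _ _ _ "\<lambda>y. y\<^sup>2"]) (auto intro!: continuous_intros)
  have all: "AE \<omega> in M. \<forall>l<d. (\<lambda>n. incr_sum X T n (\<phi> l) \<omega>) \<longlonglongrightarrow> jump_sum X a b T (\<phi> l) \<omega>"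
  proof -
    have "AE \<omega> in M. \<forall>l\<in>{..<d}. (\<lambda>n. incr_sum X T n (\<phi> l) \<omega>) \<longlonglongrightarrow> jump_sum X a b T (\<phi> l) \<omega>"
      by (intro AE_finite_allI regular_incr_sum_tendsto[OF ab _ T] \<phi>) auto
    then show ?thesis by (rule eventually_mono) auto
  qed
  show "AE \<omega> in M. (\<lambda>n. ?Z n \<omega>) \<longlonglongrightarrow> (((\<Sum>l<d. (jump_sum X a b T (\<phi> l) \<omega> - T * (LINT x:{a..b}|lborel. \<phi> l x * s x))\<^sup>2)
            - jump_sum X a b T (\<lambda>x. \<Sum>l<d. (\<phi> l x)\<^sup>2) \<omega>) / T) ^ 4"
    using all regular_incr_sum_tendsto[OF ab sq T]
  proof eventually_elim
    case (elim \<omega>)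
    have expand: "incr_sum X T n (\<lambda>x. \<Sum>l<d. (\<phi> l x - \<mu> n l)\<^sup>2) \<omega> = incr_sum X T n (\<lambda>x. \<Sum>l<d. (\<phi> l x)\<^sup>2) \<omega>
        - 2 * (\<Sum>l<d. \<mu> n l * incr_sum X T n (\<phi> l) \<omega>) + (\<Sum>l<d. (real n * \<mu> n l) * \<mu> n l)" for n
    proof -
      let ?y = "\<lambda>i. X (real (Suc i) * T / real n) \<omega> - X (real i * T / real n) \<omega>"
      have "(\<Sum>l<d. (\<phi> l y - \<mu> n l)\<^sup>2) = (\<Sum>l<d. (\<phi> l y)\<^sup>2) - 2 * (\<Sum>l<d. \<mu> n l * \<phi> l y) + (\<Sum>l<d. \<mu> n l * \<mu> n l)" for y
        by (simp add: power2_eq_square sum_distrib_left sum.distrib[symmetric] sum_subtractf[symmetric] algebra_simps)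
      then have "incr_sum X T n (\<lambda>x. \<Sum>l<d. (\<phi> l x - \<mu> n l)\<^sup>2) \<omega> = (\<Sum>i<n. (\<Sum>l<d. (\<phi> l (?y i))\<^sup>2)) - 2 * (\<Sum>i<n. \<Sum>l<d. \<mu> n l * \<phi> l (?y i)) + (\<Sum>i<n. (\<Sum>l<d. \<mu> n l * \<mu> n l))"
        unfolding incr_sum_def by (simp only: sum.distrib sum_subtractf sum_distrib_left[symmetric])
      also have "(\<Sum>i<n. \<Sum>l<d. \<mu> n l * \<phi> l (?y i)) = (\<Sum>l<d. \<mu> n l * incr_sum X T n (\<phi> l) \<omega>)"
        unfolding incr_sum_def sum_distrib_left by (rule sum.swap)
      also have "(\<Sum>i<n. (\<Sum>l<d. \<mu> n l * \<mu> n l)) = (\<Sum>l<d. (real n * \<mu> n l) * \<mu> n l)"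
        by (simp add: sum_distrib_left mult_ac)
      finally show ?thesis by (simp only: incr_sum_def)
    qed
    have "(\<lambda>n. incr_sum X T n (\<lambda>x. \<Sum>l<d. (\<phi> l x - \<mu> n l)\<^sup>2) \<omega>) \<longlonglongrightarrow>
       jump_sum X a b T (\<lambda>x. \<Sum>l<d. (\<phi> l x)\<^sup>2) \<omega> - 2 * (\<Sum>l<d. 0 * jump_sum X a b T (\<phi> l) \<omega>) + (\<Sum>l<d. \<beta> l * 0)"
      unfolding expand using elim mean mu0 by (intro tendsto_add tendsto_diff tendsto_mult tendsto_const tendsto_sum) auto
    then have lim2: "(\<lambda>n. incr_sum X T n (\<lambda>x. \<Sum>l<d. (\<phi> l x - \<mu> n l)\<^sup>2) \<omega>) \<longlonglongrightarrow> jump_sum X a b T (\<lambda>x. \<Sum>l<d. (\<phi> l x)\<^sup>2) \<omega>"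
      by simp
    show ?case unfolding \<beta>_def[symmetric]
      using elim(1) mean T by (intro tendsto_power tendsto_divide tendsto_diff tendsto_sum tendsto_const lim2) auto
  qed
  have reg2: "regular a b (\<lambda>x. \<phi> l x * \<phi> l' x)" if "l < d" "l' < d" for l l' using \<phi> that by (intro regular_mult)
  define G where "G l l' = (LINT x:{a..b}|lborel. \<phi> l x * \<phi> l' x * s x)" for l l'
  define g where "g n l l' = real n * (\<integral>\<omega>. \<phi> l (X (T / real n) \<omega>) * \<phi> l' (X (T / real n) \<omega>) \<partial>M)" for n l l'
  have glim: "(\<lambda>n. g n l l') \<longlonglongrightarrow> T * G l l'" if "l < d" "l' < d" for l l'
    unfolding g_def G_def by (rule tendsto_mean[OF ab reg2[OF that] T])
  \<comment> \<open>The Gram matrix of the increments converges entry by entry. An error of at most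
    \<open>T / d\<close> in each entry changes the quadratic form by at most \<open>T\<close> times
    the sum of the squared coefficients, whence \<open>R + 1\<close> instead of
    \<open>R\<close>.\<close>
  have "eventually (\<lambda>n. \<forall>l\<in>{..<d}. \<forall>l'\<in>{..<d}. \<bar>g n l l' - T * G l l'\<bar> < T / real d) sequentially"
  proof (intro eventually_ball_finite ballI)
    fix l l' assume "l \<in> {..<d}" "l' \<in> {..<d}"
    then have "(\<lambda>n. g n l l') \<longlonglongrightarrow> T * G l l'" by (intro glim) auto
    then show "eventually (\<lambda>n. \<bar>g n l l' - T * G l l'\<bar> < T / real d) sequentially"
      using tendstoD[of _ "T * G l l'" sequentially "T / real d"] T d by (simp only: dist_real_def zero_less_divide_iff) simp
  qed auto
  then show "\<forall>\<^sub>F n in sequentially. (\<integral>\<^sup>+\<omega>. ennreal (?Z n \<omega>) \<partial>M) \<le> ennreal (exp (33 * (R + 1) + 388 * (R + 1) * C2) * (real d)\<^sup>2)"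
    using eventually_gt_at_top[of 0]
  proof eventually_elim
    case (elim n)
    show ?case
    proof (rule incr_quadratic_fourth_moment[OF T elim(2) d _ C2 \<phi>b D])
      fix c :: "nat \<Rightarrow> real"
      define S where "S = (\<Sum>l<d. (c l)\<^sup>2)"
      have "(\<integral>\<omega>. (\<Sum>l<d. c l * \<phi> l (X (T / real n) \<omega>))\<^sup>2 \<partial>M)
         = (\<integral>\<omega>. (\<Sum>l<d. \<Sum>l'<d. c l * c l' * (\<phi> l (X (T / real n) \<omega>) * \<phi> l' (X (T / real n) \<omega>))) \<partial>M)"
        by (simp add: power2_eq_square sum_product mult_ac)
      also have "\<dots> = (\<Sum>l<d. \<Sum>l'<d. c l * c l' * (\<integral>\<omega>. \<phi> l (X (T / real n) \<omega>) * \<phi> l' (X (T / real n) \<omega>) \<partial>M))"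
      proof -
        have int: "integrable M (\<lambda>\<omega>. \<phi> l (X (T / real n) \<omega>) * \<phi> l' (X (T / real n) \<omega>))" if l: "l < d" "l' < d" for l l'
        proof -
          obtain B where "\<And>x. \<bar>\<phi> l x * \<phi> l' x\<bar> \<le> B" using reg2[OF l] by (auto simp: regular_def)
          then show ?thesis using T by (intro integrable_bounded[OF regular_borel[OF reg2[OF l]], of B]) auto
        qed
        have "(\<integral>\<omega>. (\<Sum>l<d. \<Sum>l'<d. c l * c l' * (\<phi> l (X (T / real n) \<omega>) * \<phi> l' (X (T / real n) \<omega>))) \<partial>M)
          = (\<Sum>l<d. (\<integral>\<omega>. (\<Sum>l'<d. c l * c l' * (\<phi> l (X (T / real n) \<omega>) * \<phi> l' (X (T / real n) \<omega>))) \<partial>M))"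
          by (rule Bochner_Integration.integral_sum) (auto intro!: Bochner_Integration.integrable_sum integrable_mult_right int)
        also have "\<dots> = (\<Sum>l<d. \<Sum>l'<d. (\<integral>\<omega>. c l * c l' * (\<phi> l (X (T / real n) \<omega>) * \<phi> l' (X (T / real n) \<omega>)) \<partial>M))"
          by (intro sum.cong refl Bochner_Integration.integral_sum integrable_mult_right int) auto
        finally show ?thesis by simp
      qed
      finally have 1: "real n * (\<integral>\<omega>. (\<Sum>l<d. c l * \<phi> l (X (T / real n) \<omega>))\<^sup>2 \<partial>M) = (\<Sum>l<d. \<Sum>l'<d. c l * c l' * g n l l')"
        by (simp add: g_def sum_distrib_left mult_ac)
      have 2: "(LINT x:{a..b}|lborel. (\<Sum>l<d. c l * \<phi> l x)\<^sup>2 * s x) = (\<Sum>l<d. \<Sum>l'<d. c l * c l' * G l l')"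
      proof -
        have int: "set_integrable lborel {a..b} (\<lambda>x. c l * c l' * (\<phi> l x * \<phi> l' x * s x))" if "l < d" "l' < d" for l l'
          using integrable_regular_s[OF ab reg2[OF that]] by simp
        have "(\<Sum>l<d. c l * \<phi> l x)\<^sup>2 = (\<Sum>l<d. \<Sum>l'<d. c l * c l' * (\<phi> l x * \<phi> l' x))" for x
          by (simp add: power2_eq_square sum_product mult_ac)
        then have "(\<Sum>l<d. c l * \<phi> l x)\<^sup>2 * s x = (\<Sum>l<d. \<Sum>l'<d. c l * c l' * (\<phi> l x * \<phi> l' x * s x))" for x
          by (simp only: sum_distrib_right mult.assoc)
        then have "(LINT x:{a..b}|lborel. (\<Sum>l<d. c l * \<phi> l x)\<^sup>2 * s x) = (LINT x:{a..b}|lborel. (\<Sum>l<d. \<Sum>l'<d. c l * c l' * (\<phi> l x * \<phi> l' x * s x)))" by simp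
        also have "\<dots> = (\<Sum>l<d. (LINT x:{a..b}|lborel. (\<Sum>l'<d. c l * c l' * (\<phi> l x * \<phi> l' x * s x))))"
          by (rule set_integral_sum_real(1)) (rule set_integral_sum_real(2), use int in auto)
        also have "\<dots> = (\<Sum>l<d. \<Sum>l'<d. (LINT x:{a..b}|lborel. c l * c l' * (\<phi> l x * \<phi> l' x * s x)))"
          by (intro sum.cong refl set_integral_sum_real(1)) (use int in auto)
        finally show ?thesis by (simp add: G_def)
      qed
      have "(\<Sum>l<d. \<Sum>l'<d. c l * c l' * g n l l') \<le> (\<Sum>l<d. \<Sum>l'<d. c l * c l' * (T * G l l') + \<bar>c l\<bar> * \<bar>c l'\<bar> * (T / real d))"
      proof (intro sum_mono)
        fix l l' assume l: "l \<in> {..<d}" "l' \<in> {..<d}"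
        have "c l * c l' * (g n l l' - T * G l l') \<le> \<bar>c l * c l' * (g n l l' - T * G l l')\<bar>" by (rule abs_ge_self)
        also have "\<dots> = \<bar>c l\<bar> * \<bar>c l'\<bar> * \<bar>g n l l' - T * G l l'\<bar>" by (simp add: abs_mult)
        also have "\<dots> \<le> \<bar>c l\<bar> * \<bar>c l'\<bar> * (T / real d)" using elim(1) l by (intro mult_left_mono) (auto intro: less_imp_le)
        finally show "c l * c l' * g n l l' \<le> c l * c l' * (T * G l l') + \<bar>c l\<bar> * \<bar>c l'\<bar> * (T / real d)"
          by (simp add: right_diff_distrib)
      qed
      also have "\<dots> = T * (\<Sum>l<d. \<Sum>l'<d. c l * c l' * G l l') + (T / real d) * (\<Sum>l<d. \<bar>c l\<bar>)\<^sup>2"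
        by (simp add: sum.distrib power2_eq_square sum_product sum_distrib_left mult_ac)
      also have "\<dots> \<le> T * (R * S) + (T / real d) * (S * real d)"
      proof (intro add_mono mult_left_mono)
        show "(\<Sum>l<d. \<Sum>l'<d. c l * c l' * G l l') \<le> R * S" using var[of c] unfolding 2 S_def .
        have "(\<Sum>l<d. \<bar>c l\<bar> * 1)\<^sup>2 \<le> (\<Sum>l<d. \<bar>c l\<bar>\<^sup>2) * (\<Sum>l<d. 1\<^sup>2)" by (rule Cauchy_Schwarz_ineq_sum)
        then show "(\<Sum>l<d. \<bar>c l\<bar>)\<^sup>2 \<le> S * real d" by (simp add: S_def)
      qed (use T in auto)
      also have "\<dots> = (R + 1) * T * S" using d by (simp add: algebra_simps)
      finally show "real n * (\<integral>\<omega>. (\<Sum>l<d. c l * \<phi> l (X (T / real n) \<omega>))\<^sup>2 \<partial>M) \<le> (R + 1) * T * (\<Sum>l<d. (c l)\<^sup>2)"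
        unfolding 1 S_def .
    qed (use R in \<open>auto simp: \<mu>_def\<close>)
  qed
qed

end

section \<open>Approximation of Besov functions\<close>

definition lagrange_basis :: "nat \<Rightarrow> nat \<Rightarrow> real poly" where
  "lagrange_basis r j = smult (1 / (\<Prod>i\<in>{..r} - {j}. real j - real i)) (\<Prod>i\<in>{..r} - {j}. [:- real i, 1:])"

lemma degree_lagrange_basis: "j \<le> r \<Longrightarrow> degree (lagrange_basis r j) \<le> r"
proof -
  assume j: "j \<le> r"
  have "degree (\<Prod>i\<in>{..r} - {j}. [:- real i, 1:]) \<le> (\<Sum>i\<in>{..r} - {j}. degree [:- real i, 1:])"
    using degree_prod_sum_le[of "{..r} - {j}" "\<lambda>i. [:- real i, 1:]"] by (simp add: o_def)
  also have "\<dots> = r" using j by simp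
  finally show ?thesis unfolding lagrange_basis_def using degree_smult_le order_trans by blast
qed

lemma poly_lagrange_basis:
  assumes "i \<le> r" "j \<le> r"
  shows "poly (lagrange_basis r j) (real i) = (if i = j then 1 else 0)"
proof (cases "i = j")
  case True
  have "(\<Prod>i\<in>{..r} - {j}. real j - real i) \<noteq> 0" by auto
  then show ?thesis using True by (simp add: lagrange_basis_def poly_prod)
next
  case False
  then have "(\<Prod>l\<in>{..r} - {j}. real i - real l) = 0" using assms by (intro prod_zero) auto
  then show ?thesis using False by (simp add: lagrange_basis_def poly_prod)
qed

definition lagrange_interp :: "nat \<Rightarrow> (nat \<Rightarrow> real) \<Rightarrow> real poly" where
  "lagrange_interp r v = (\<Sum>j\<le>r. smult (v j) (lagrange_basis r j))"

lemma degree_lagrange_interp: "degree (lagrange_interp r v) \<le> r"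
  unfolding lagrange_interp_def
  by (intro degree_sum_le) (auto intro: order_trans[OF degree_smult_le] degree_lagrange_basis)

lemma poly_lagrange_interp: "i \<le> r \<Longrightarrow> poly (lagrange_interp r v) (real i) = v i"
  by (simp add: lagrange_interp_def poly_sum poly_lagrange_basis if_distrib[of "\<lambda>x. _ * x"] cong: if_cong)

lemma poly_eq_of_agree_nat:
  fixes p q :: "real poly"
  assumes "degree p \<le> r" "degree q \<le> r" "\<And>i. i \<le> r \<Longrightarrow> poly p (real i) = poly q (real i)"
  shows "p = q"
proof (rule ccontr)
  assume "p \<noteq> q"
  then have nz: "p - q \<noteq> 0" by simp
  have "real ` {..r} \<subseteq> {x. poly (p - q) x = 0}" using assms(3) by auto
  then have "card (real ` {..r}) \<le> card {x. poly (p - q) x = 0}" using poly_roots_finite[OF nz] by (intro card_mono)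
  also have "\<dots> \<le> degree (p - q)" using nz by (rule card_poly_roots_bound)
  also have "\<dots> \<le> r" using assms by (intro degree_diff_le)
  finally show False by (simp add: card_image)
qed

text \<open>For \<open>r > 0\<close> this is the polynomial of degree at most \<open>r - 1\<close>
  with average \<open>e i\<close> on the interval from \<open>i\<close> to \<open>i + 1\<close>, for
  \<open>i < r\<close>: the derivative of the interpolant of the cumulative sums at 0, ...,
  \<open>r\<close>.\<close>

definition avg_poly :: "nat \<Rightarrow> (nat \<Rightarrow> real) \<Rightarrow> real poly" where
  "avg_poly r e = pderiv (lagrange_interp r (\<lambda>j. \<Sum>i<j. e i))"

lemma degree_avg_poly: "degree (avg_poly r e) \<le> r - 1"
  using degree_lagrange_interp[of r] by (simp add: avg_poly_def degree_pderiv diff_le_mono)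

text \<open>The sequence \<open>e\<close> below consists of the integrals of \<open>pderiv P\<close> over consecutive unit
  intervals, so \<open>avg_poly\<close> recovers a polynomial of degree less than \<open>r\<close> from its averages.\<close>

lemma avg_poly_reproduces:
  assumes "degree P \<le> r" "\<And>i. i < r \<Longrightarrow> e i = poly P (real (Suc i)) - poly P (real i)"
  shows "avg_poly r e = pderiv P"
proof -
  have "(\<Sum>i<j. e i) = poly P (real j) - poly P 0" if "j \<le> r" for j
    using that assms(2) by (induction j) auto
  then have "lagrange_interp r (\<lambda>j. \<Sum>i<j. e i) = P - [:poly P 0:]"
    using assms(1) by (intro poly_eq_of_agree_nat[of _ r])
      (auto simp: poly_lagrange_interp intro!: degree_lagrange_interp degree_diff_le)
  then show ?thesis by (simp add: avg_poly_def pderiv_diff pderiv_pCons)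
qed

lemma pderiv_sum: "pderiv (\<Sum>i\<in>I. f i) = (\<Sum>i\<in>I. pderiv (f i))"
  by (induction I rule: infinite_finite_induct) (auto simp: pderiv_add)

lemma poly_avg_poly:
  "poly (avg_poly r e) t = (\<Sum>j\<le>r. (\<Sum>i<j. e i) * poly (pderiv (lagrange_basis r j)) t)"
  by (simp add: avg_poly_def lagrange_interp_def pderiv_sum pderiv_smult poly_sum)

lemma poly_avg_poly_diff:
  "poly (avg_poly r (\<lambda>i. e i - e' i)) t = poly (avg_poly r e) t - poly (avg_poly r e') t"
  by (simp add: poly_avg_poly sum_subtractf left_diff_distrib)

lemma avg_poly_bound:
  "\<exists>B\<ge>0. \<forall>e t. t \<in> {0..real r} \<longrightarrow> \<bar>poly (avg_poly r e) t\<bar> \<le> B * (\<Sum>i<r. \<bar>e i\<bar>)"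
proof -
  have "\<forall>j. \<exists>B. \<forall>x\<in>{0..real r}. \<bar>poly (pderiv (lagrange_basis r j)) x\<bar> \<le> B" using poly_bounded_Icc by blast
  from choice[OF this] obtain C where C: "\<And>j x. x \<in> {0..real r} \<Longrightarrow> \<bar>poly (pderiv (lagrange_basis r j)) x\<bar> \<le> C j" by blast
  show ?thesis
  proof (intro exI[of _ "\<Sum>j\<le>r. \<bar>C j\<bar>"] conjI allI impI sum_nonneg)
    fix e t assume t: "t \<in> {0..real r}"
    have "\<bar>poly (avg_poly r e) t\<bar> \<le> (\<Sum>j\<le>r. \<bar>(\<Sum>i<j. e i) * poly (pderiv (lagrange_basis r j)) t\<bar>)"
      unfolding poly_avg_poly by (rule sum_abs)
    also have "\<dots> \<le> (\<Sum>j\<le>r. (\<Sum>i<r. \<bar>e i\<bar>) * \<bar>C j\<bar>)"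
    proof (rule sum_mono)
      fix j assume j: "j \<in> {..r}"
      have "\<bar>\<Sum>i<j. e i\<bar> \<le> (\<Sum>i<j. \<bar>e i\<bar>)" by (rule sum_abs)
      also have "\<dots> \<le> (\<Sum>i<r. \<bar>e i\<bar>)" using j by (intro sum_mono2) auto
      finally show "\<bar>(\<Sum>i<j. e i) * poly (pderiv (lagrange_basis r j)) t\<bar> \<le> (\<Sum>i<r. \<bar>e i\<bar>) * \<bar>C j\<bar>"
        unfolding abs_mult using C[OF t, of j] by (intro mult_mono) (auto intro: sum_nonneg)
    qed
    finally show "\<bar>poly (avg_poly r e) t\<bar> \<le> (\<Sum>j\<le>r. \<bar>C j\<bar>) * (\<Sum>i<r. \<bar>e i\<bar>)"
      by (simp add: sum_distrib_right mult.commute)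
  qed auto
qed

section \<open>Finite differences and the refinement estimate\<close>

primrec nat_diff :: "nat \<Rightarrow> (nat \<Rightarrow> real) \<Rightarrow> nat \<Rightarrow> real" where
  "nat_diff 0 e l = e l"
| "nat_diff (Suc r) e l = nat_diff r e (Suc l) - nat_diff r e l"

lemma nat_diff_Suc': "nat_diff (Suc r) e l = nat_diff r (\<lambda>i. e (Suc i) - e i) l"
  by (induction r arbitrary: l) auto

lemma nat_diff_subtract: "nat_diff r (\<lambda>i. e i - e' i) l = nat_diff r e l - nat_diff r e' l"
  by (induction r arbitrary: l) auto

lemma nat_diff_fin_diff: "nat_diff r (\<lambda>l. f (x + real l * h)) l = fin_diff h r f (x + real l * h)"
  by (induction r arbitrary: l) (auto simp: algebra_simps)

text \<open>The recursion of \<open>fin_diff\<close> takes the last difference outside. Moving a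
  difference inside instead lets an induction apply it to a polynomial and lower the degree.\<close>

lemma fin_diff_sum_shift: "fin_diff h (Suc r) f x = fin_diff h r (\<lambda>x. f (x + h) - f x) x"
proof (induction r arbitrary: x)
  case (Suc r)
  have "fin_diff h (Suc (Suc r)) f x = fin_diff h (Suc r) f (x + h) - fin_diff h (Suc r) f x" by (rule fin_diff.simps(2))
  then show ?case unfolding Suc.IH by simp
qed simp

text \<open>A shift of the argument preserves degree and leading coefficient, so the leading terms
  cancel.\<close>

lemma degree_shift_diff_less:
  fixes p :: "real poly"
  assumes "degree p > 0"
  shows "degree (pcompose p [:h, 1:] - p) < degree p"
proof -
  have d: "degree (pcompose p [:h, 1:]) = degree p" by (simp add: degree_pcompose)
  have "coeff (pcompose p [:h, 1:]) (degree p) = lead_coeff p"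
    using lead_coeff_comp[of "[:h, 1:]" p] d by simp
  then have c: "coeff (pcompose p [:h, 1:] - p) (degree p) = 0" by simp
  have le: "degree (pcompose p [:h, 1:] - p) \<le> degree p" using d by (intro degree_diff_le) auto
  show ?thesis
  proof (rule ccontr)
    assume "\<not> ?thesis"
    then have e: "degree (pcompose p [:h, 1:] - p) = degree p" using le by simp
    then have "lead_coeff (pcompose p [:h, 1:] - p) = 0" using c by simp
    then have "pcompose p [:h, 1:] - p = 0" by (simp only: leading_coeff_0_iff)
    with e assms show False by simp
  qed
qed

lemma fin_diff_poly:
  fixes p :: "real poly"
  shows "degree p < r \<Longrightarrow> fin_diff h r (poly p) x = 0"
proof (induction r arbitrary: p x)
  case (Suc r)
  have eq: "(\<lambda>x. poly p (x + h) - poly p x) = poly (pcompose p [:h, 1:] - p)"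
    by (auto simp: poly_pcompose add.commute)
  show ?case
  proof (cases "degree p = 0")
    case True
    then obtain c where "p = [:c:]" by (rule degree_eq_zeroE)
    then have "poly p = (\<lambda>_. c)" by auto
    moreover have "fin_diff h r (\<lambda>_. 0::real) x = 0" for x by (induction r arbitrary: x) auto
    ultimately show ?thesis unfolding fin_diff_sum_shift by simp
  next
    case False
    then have "degree (pcompose p [:h, 1:] - p) < r" using degree_shift_diff_less[of p h] Suc.prems by simp
    then show ?thesis unfolding fin_diff_sum_shift eq by (rule Suc.IH)
  qed
qed simp

text \<open>A discrete Taylor bound. A sequence that begins with \<open>r\<close> zeros is an
  \<open>r\<close>-fold iterated sum of its \<open>r\<close>-th differences, and each summation over
  at most \<open>n\<close> terms costs a factor of at most \<open>n + 1\<close>.\<close>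

lemma abs_le_nat_diff:
  assumes "\<And>i. i < r \<Longrightarrow> e i = 0" "r \<le> n"
  shows "\<bar>e n\<bar> \<le> (real n + 1) ^ r * (\<Sum>i\<le>n - r. \<bar>nat_diff r e i\<bar>)"
  using assms
proof (induction r arbitrary: e n)
  case 0
  have "\<bar>e n\<bar> \<le> (\<Sum>i\<le>n. \<bar>e i\<bar>)" by (rule member_le_sum) auto
  then show ?case by simp
next
  case (Suc r)
  define e' where "e' i = e (Suc i) - e i" for i
  have e'0: "e' i = 0" if "i < r" for i using Suc.prems(1)[of i] Suc.prems(1)[of "Suc i"] that by (simp add: e'_def)
  define S where "S = (\<Sum>i\<le>n - Suc r. \<bar>nat_diff (Suc r) e i\<bar>)"
  have S0: "0 \<le> S" unfolding S_def by (rule sum_nonneg) simp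
  have tele: "e n = (\<Sum>i<n. e' i)" using Suc.prems(1)[of 0] by (simp add: e'_def sum_lessThan_telescope)
  have bd: "\<bar>e' i\<bar> \<le> (real n + 1) ^ r * S" if i: "i < n" for i
  proof (cases "i < r")
    case True then show ?thesis using e'0 S0 by simp
  next
    case False
    have "\<bar>e' i\<bar> \<le> (real i + 1) ^ r * (\<Sum>l\<le>i - r. \<bar>nat_diff r e' l\<bar>)"
      using False by (intro Suc.IH e'0) auto
    also have "\<dots> \<le> (real n + 1) ^ r * (\<Sum>l\<le>n - Suc r. \<bar>nat_diff r e' l\<bar>)"
      using i by (intro mult_mono power_mono sum_mono2) (auto intro: sum_nonneg)
    also have "(\<Sum>l\<le>n - Suc r. \<bar>nat_diff r e' l\<bar>) = S" unfolding S_def nat_diff_Suc' e'_def ..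
    finally show ?thesis .
  qed
  have "\<bar>e n\<bar> \<le> (\<Sum>i<n. \<bar>e' i\<bar>)" unfolding tele by (rule sum_abs)
  also have "\<dots> \<le> (\<Sum>i<n. (real n + 1) ^ r * S)" using bd by (intro sum_mono) auto
  also have "\<dots> = real n * ((real n + 1) ^ r * S)" by simp
  also have "\<dots> \<le> (real n + 1) * ((real n + 1) ^ r * S)" using S0 by (intro mult_right_mono) auto
  finally show ?case by (simp add: S_def mult_ac del: nat_diff.simps)
qed

text \<open>The averages \<open>a\<close> over \<open>2 * r\<close> consecutive short intervals determine the approximant of
  the coarse level and both approximants of the fine level. All of these agree with the same
  polynomial if the \<open>r\<close>-th differences of \<open>a\<close> vanish.\<close>

lemma avg_poly_refine:
  assumes r: "0 < r"
  shows "\<exists>C\<ge>0. \<forall>a t.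
     (t \<in> {0..real r} \<longrightarrow> \<bar>poly (avg_poly r (\<lambda>i. (a (2*i) + a (2*i+1)) / 2)) (t / 2) - poly (avg_poly r a) t\<bar>
        \<le> C * (\<Sum>l<r. \<bar>nat_diff r a l\<bar>)) \<and>
     (t \<in> {real r..2 * real r} \<longrightarrow> \<bar>poly (avg_poly r (\<lambda>i. (a (2*i) + a (2*i+1)) / 2)) (t / 2) - poly (avg_poly r (\<lambda>i. a (r + i))) (t - real r)\<bar>
        \<le> C * (\<Sum>l<r. \<bar>nat_diff r a l\<bar>))"
proof -
  obtain B where B: "B \<ge> 0" "\<And>e t. t \<in> {0..real r} \<Longrightarrow> \<bar>poly (avg_poly r e) t\<bar> \<le> B * (\<Sum>i<r. \<bar>e i\<bar>)"
    using avg_poly_bound[of r] by blast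
  define C where "C = 2 * B * (2 * real r * (2 * real r) ^ r)"
  have C0: "C \<ge> 0" using B by (simp add: C_def)
  show ?thesis
  proof (intro exI[of _ C] conjI allI C0)
    fix a :: "nat \<Rightarrow> real" and t :: real
    define P where "P = lagrange_interp r (\<lambda>j. \<Sum>i<j. a i)"
    have dP: "degree P \<le> r" unfolding P_def by (rule degree_lagrange_interp)
    define b where "b i = poly P (real (Suc i)) - poly P (real i)" for i
    have ba: "b i = a i" if "i < r" for i using that unfolding b_def P_def by (simp add: poly_lagrange_interp del: of_nat_Suc)
    \<comment> \<open>The averages split into those of the polynomial \<open>pderiv P\<close>, which
      is fitted to the first \<open>r\<close> of them, and a rest \<open>e\<close>. The rest starts
      with \<open>r\<close> zeros and has the same \<open>r\<close>-th differences as
      \<open>a\<close>, so it is small on all \<open>2 * r\<close> positions.\<close>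
    define e where "e i = a i - b i" for i
    have e0: "e i = 0" if "i < r" for i using ba[OF that] by (simp add: e_def)
    have ndb: "nat_diff r b l = 0" for l
    proof -
      have "nat_diff r b l = nat_diff (Suc r) (\<lambda>i. poly P (0 + real i * 1)) l"
        unfolding nat_diff_Suc' b_def by simp
      also have "\<dots> = 0" unfolding nat_diff_fin_diff by (rule fin_diff_poly) (use dP in simp)
      finally show ?thesis .
    qed
    have nde: "nat_diff r e l = nat_diff r a l" for l
      unfolding e_def nat_diff_subtract ndb by simp
    define S where "S = (\<Sum>l<r. \<bar>nat_diff r a l\<bar>)"
    have S0: "0 \<le> S" unfolding S_def by (rule sum_nonneg) simp
    have eb: "\<bar>e n\<bar> \<le> (2 * real r) ^ r * S" if n: "n < 2 * r" for n
    proof (cases "n < r")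
      case True then show ?thesis using e0 S0 by simp
    next
      case False
      then have "\<bar>e n\<bar> \<le> (real n + 1) ^ r * (\<Sum>i\<le>n - r. \<bar>nat_diff r e i\<bar>)" by (intro abs_le_nat_diff e0) auto
      also have "\<dots> \<le> (2 * real r) ^ r * S"
        unfolding S_def nde using n r by (intro mult_mono power_mono sum_mono2) (auto intro: sum_nonneg)
      finally show ?thesis .
    qed
    have total: "(\<Sum>i<2*r. \<bar>e i\<bar>) \<le> 2 * real r * (2 * real r) ^ r * S"
    proof -
      have "(\<Sum>i<2*r. \<bar>e i\<bar>) \<le> (\<Sum>i<2*r. (2 * real r) ^ r * S)" using eb by (intro sum_mono) auto
      then show ?thesis by simp
    qed
    have small: "\<bar>poly (avg_poly r u) x\<bar> \<le> B * (\<Sum>i<2*r. \<bar>e i\<bar>)"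
      if "x \<in> {0..real r}" "(\<Sum>i<r. \<bar>u i\<bar>) \<le> (\<Sum>i<2*r. \<bar>e i\<bar>)" for u x
      using B(2)[OF that(1), of u] mult_left_mono[OF that(2) B(1)] by linarith
    \<comment> \<open>Averages over intervals of double length, in terms of those over the short
      ones.\<close>
    define co where "co a i = (a (2*i) + a (2*i+1)) / 2" for a :: "nat \<Rightarrow> real" and i :: nat
    have coe: "(\<Sum>i<r. \<bar>co e i\<bar>) \<le> (\<Sum>i<2*r. \<bar>e i\<bar>)"
    proof -
      have "(\<Sum>i<r. \<bar>co e i\<bar>) \<le> (\<Sum>i<r. \<bar>e (2*i)\<bar> + \<bar>e (2*i+1)\<bar>)"
        by (intro sum_mono) (auto simp: co_def)
      also have "\<dots> = (\<Sum>i<2*r. \<bar>e i\<bar>)" by (induction r) auto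
      finally show ?thesis .
    qed
    have le: "(\<Sum>i<r. \<bar>e i\<bar>) \<le> (\<Sum>i<2*r. \<bar>e i\<bar>)" by (intro sum_mono2) auto
    have ri: "(\<Sum>i<r. \<bar>e (r + i)\<bar>) \<le> (\<Sum>i<2*r. \<bar>e i\<bar>)"
    proof -
      have "(\<Sum>i<r. \<bar>e (r + i)\<bar>) = (\<Sum>i\<in>{r..<2*r}. \<bar>e i\<bar>)"
        using sum.shift_bounds_nat_ivl[of "\<lambda>i. \<bar>e i\<bar>" 0 r r] by (simp add: atLeast0LessThan add.commute mult_2)
      also have "\<dots> \<le> (\<Sum>i<2*r. \<bar>e i\<bar>)" by (intro sum_mono2) auto
      finally show ?thesis .
    qed
    have cob: "poly (avg_poly r (co b)) (t/2) = poly (pderiv P) t"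
    proof -
      \<comment> \<open>\<open>P\<close> in the coarse variable. The factor 1/2 compensates the
        chain rule, so that its derivative at \<open>t / 2\<close> is \<open>pderiv P\<close> at
        \<open>t\<close>.\<close>
      define Q where "Q = smult (1/2) (pcompose P [:0, 2:])"
      have "degree Q \<le> r" unfolding Q_def using dP degree_pcompose_le[of P "[:0,2:]"] by simp
      moreover have "co b i = poly Q (real (Suc i)) - poly Q (real i)" for i
        by (simp add: co_def b_def Q_def poly_pcompose algebra_simps diff_divide_distrib)
      ultimately have "avg_poly r (co b) = pderiv Q" by (rule avg_poly_reproduces)
      then show ?thesis by (simp add: Q_def pderiv_smult pderiv_pcompose pderiv_pCons poly_pcompose)
    qed
    have fib: "poly (avg_poly r b) t = poly (pderiv P) t"
      using avg_poly_reproduces[OF dP, of b] b_def by simp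
    have fib2: "poly (avg_poly r (\<lambda>i. b (r + i))) (t - real r) = poly (pderiv P) t"
    proof -
      define Q where "Q = pcompose P [:real r, 1:]"
      have "degree Q \<le> r" unfolding Q_def using dP degree_pcompose_le[of P "[:real r,1:]"] by simp
      moreover have "b (r + i) = poly Q (real (Suc i)) - poly Q (real i)" for i
        by (simp add: b_def Q_def poly_pcompose algebra_simps)
      ultimately have "avg_poly r (\<lambda>i. b (r + i)) = pderiv Q" by (rule avg_poly_reproduces)
      then show ?thesis by (simp add: Q_def pderiv_pcompose pderiv_pCons poly_pcompose)
    qed
    have co_e: "poly (avg_poly r (co e)) x = poly (avg_poly r (co a)) x - poly (avg_poly r (co b)) x" for x
    proof -
      have "co e = (\<lambda>i. co a i - co b i)" by (auto simp: co_def e_def fun_eq_iff diff_divide_distrib add_divide_distrib)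
      then show ?thesis by (simp add: poly_avg_poly_diff)
    qed
    have e_e: "poly (avg_poly r e) x = poly (avg_poly r a) x - poly (avg_poly r b) x" for x
      unfolding e_def by (rule poly_avg_poly_diff)
    have e_r: "poly (avg_poly r (\<lambda>i. e (r + i))) x = poly (avg_poly r (\<lambda>i. a (r + i))) x - poly (avg_poly r (\<lambda>i. b (r + i))) x" for x
      unfolding e_def by (rule poly_avg_poly_diff)
    have fin: "2 * (B * (\<Sum>i<2*r. \<bar>e i\<bar>)) \<le> C * S"
      using mult_left_mono[OF total, of "2 * B"] B(1) by (simp add: C_def mult_ac)
    show "t \<in> {0..real r} \<longrightarrow> \<bar>poly (avg_poly r (\<lambda>i. (a (2*i) + a (2*i+1)) / 2)) (t / 2) - poly (avg_poly r a) t\<bar> \<le> C * (\<Sum>l<r. \<bar>nat_diff r a l\<bar>)"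
    proof
      assume t: "t \<in> {0..real r}"
      have "\<bar>poly (avg_poly r (co e)) (t/2)\<bar> \<le> B * (\<Sum>i<2*r. \<bar>e i\<bar>)" using t by (intro small coe) auto
      moreover have "\<bar>poly (avg_poly r e) t\<bar> \<le> B * (\<Sum>i<2*r. \<bar>e i\<bar>)" using t by (intro small le) auto
      ultimately have "\<bar>poly (avg_poly r (co a)) (t/2) - poly (avg_poly r a) t\<bar> \<le> C * S"
        using fin unfolding co_e e_e cob fib by linarith
      then show "\<bar>poly (avg_poly r (\<lambda>i. (a (2*i) + a (2*i+1)) / 2)) (t / 2) - poly (avg_poly r a) t\<bar> \<le> C * (\<Sum>l<r. \<bar>nat_diff r a l\<bar>)"
        unfolding S_def co_def .
    qed
    show "t \<in> {real r..2 * real r} \<longrightarrow> \<bar>poly (avg_poly r (\<lambda>i. (a (2*i) + a (2*i+1)) / 2)) (t / 2) - poly (avg_poly r (\<lambda>i. a (r + i))) (t - real r)\<bar> \<le> C * (\<Sum>l<r. \<bar>nat_diff r a l\<bar>)"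
    proof
      assume t: "t \<in> {real r..2 * real r}"
      have "\<bar>poly (avg_poly r (co e)) (t/2)\<bar> \<le> B * (\<Sum>i<2*r. \<bar>e i\<bar>)" using t by (intro small coe) auto
      moreover have "\<bar>poly (avg_poly r (\<lambda>i. e (r + i))) (t - real r)\<bar> \<le> B * (\<Sum>i<2*r. \<bar>e i\<bar>)" using t by (intro small ri) auto
      ultimately have "\<bar>poly (avg_poly r (co a)) (t/2) - poly (avg_poly r (\<lambda>i. a (r + i))) (t - real r)\<bar> \<le> C * S"
        using fin unfolding co_e e_r cob fib2 by linarith
      then show "\<bar>poly (avg_poly r (\<lambda>i. (a (2*i) + a (2*i+1)) / 2)) (t / 2) - poly (avg_poly r (\<lambda>i. a (r + i))) (t - real r)\<bar> \<le> C * (\<Sum>l<r. \<bar>nat_diff r a l\<bar>)"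
        unfolding S_def co_def .
    qed
  qed
qed

section \<open>Bounded functions, local averages and cellwise integration\<close>

text \<open>This class is closed under the operations of this section, and its members are
  integrable over bounded Borel sets, which settles the integrability conditions uniformly.\<close>

definition bdd_borel :: "(real \<Rightarrow> real) \<Rightarrow> bool" where
  "bdd_borel f \<longleftrightarrow> f \<in> borel_measurable borel \<and> (\<exists>B. \<forall>x. \<bar>f x\<bar> \<le> B)"

lemma bdd_borel_measurable: "bdd_borel f \<Longrightarrow> f \<in> borel_measurable borel"
  by (simp add: bdd_borel_def)

lemma bdd_borel_diff: "bdd_borel f \<Longrightarrow> bdd_borel g \<Longrightarrow> bdd_borel (\<lambda>x. f x - g x)"
proof -
  assume f: "bdd_borel f" and g: "bdd_borel g"
  then obtain B C where "\<And>x. \<bar>f x\<bar> \<le> B" "\<And>x. \<bar>g x\<bar> \<le> C" by (auto simp: bdd_borel_def)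
  then have "\<bar>f x - g x\<bar> \<le> B + C" for x by (meson abs_triangle_ineq4 add_mono order_trans)
  moreover have "(\<lambda>x. f x - g x) \<in> borel_measurable borel" using f g by (auto simp: bdd_borel_def)
  ultimately show ?thesis by (auto simp: bdd_borel_def)
qed

lemma bdd_borel_mult: "bdd_borel f \<Longrightarrow> bdd_borel g \<Longrightarrow> bdd_borel (\<lambda>x. f x * g x)"
proof -
  assume f: "bdd_borel f" and g: "bdd_borel g"
  then obtain B C where "\<And>x. \<bar>f x\<bar> \<le> B" "\<And>x. \<bar>g x\<bar> \<le> C" by (auto simp: bdd_borel_def)
  then have "\<bar>f x * g x\<bar> \<le> B * C" for x
    unfolding abs_mult by (intro mult_mono) (auto intro: order_trans[OF abs_ge_zero])
  moreover have "(\<lambda>x. f x * g x) \<in> borel_measurable borel" using f g by (auto simp: bdd_borel_def)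
  ultimately show ?thesis by (auto simp: bdd_borel_def)
qed

lemma bdd_borel_square: "bdd_borel f \<Longrightarrow> bdd_borel (\<lambda>x. (f x)\<^sup>2)"
  unfolding power2_eq_square by (rule bdd_borel_mult)

lemma bdd_borel_const: "bdd_borel (\<lambda>_. c)"
  by (auto simp: bdd_borel_def)

lemma bdd_borel_shift: "bdd_borel f \<Longrightarrow> bdd_borel (\<lambda>x. f (x + h))"
  by (auto simp: bdd_borel_def)

lemma bdd_borel_fin_diff: "bdd_borel f \<Longrightarrow> bdd_borel (fin_diff h r f)"
proof (induction r)
  case 0 then show ?case by (simp add: fun_eq_iff cong: )
next
  case (Suc r)
  have "fin_diff h (Suc r) f = (\<lambda>x. fin_diff h r f (x + h) - fin_diff h r f x)" by (rule ext) simp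
  then show ?case using bdd_borel_diff[OF bdd_borel_shift[OF Suc.IH[OF Suc.prems]] Suc.IH[OF Suc.prems]] by simp
qed

lemma bdd_borel_fin_diff_on: "bdd_borel f \<Longrightarrow> bdd_borel (fin_diff_on a b h r f)"
proof -
  assume "bdd_borel f"
  then have f: "bdd_borel (fin_diff h r f)" by (rule bdd_borel_fin_diff)
  then obtain B where B: "\<And>x. \<bar>fin_diff h r f x\<bar> \<le> B" by (auto simp: bdd_borel_def)
  have [measurable]: "fin_diff h r f \<in> borel_measurable borel" using f by (rule bdd_borel_measurable)
  have "fin_diff_on a b h r f \<in> borel_measurable borel" unfolding fin_diff_on_def by measurable
  moreover have "\<bar>fin_diff_on a b h r f x\<bar> \<le> \<bar>B\<bar>" for x using B[of x] by (auto simp: fin_diff_on_def)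
  ultimately show ?thesis by (auto simp: bdd_borel_def)
qed

lemma bdd_borel_pw_poly: "a < b \<Longrightarrow> 0 < m \<Longrightarrow> f \<in> pw_poly a b k m \<Longrightarrow> bdd_borel f"
  unfolding bdd_borel_def using pw_poly_borel pw_poly_bounded by blast

lemma set_integrable_bdd:
  assumes f: "bdd_borel f" and S: "S \<in> sets borel" "S \<subseteq> {a..b}"
  shows "set_integrable lborel S f"
proof -
  have "set_integrable lborel {a..b} f" using f by (auto simp: bdd_borel_def intro: set_integrable_bounded)
  then show ?thesis by (rule set_integrable_subset) (use S in auto)
qed

definition interval_avg :: "real \<Rightarrow> real \<Rightarrow> (real \<Rightarrow> real) \<Rightarrow> nat \<Rightarrow> real" where
  "interval_avg a h f i = (1 / h) * (LINT x:{a + real i * h..<a + real (Suc i) * h}|lborel. f x)"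

lemma interval_sub: "{a + real i * h..<a + real (Suc i) * h} \<subseteq> {a + real i * h..a + real (Suc i) * h}"
  by auto

lemma set_integrable_bdd_interval:
  "bdd_borel f \<Longrightarrow> set_integrable lborel {a + real i * h..<a + real (Suc i) * h} f"
  by (rule set_integrable_bdd[OF _ _ interval_sub]) auto

lemma interval_avg_diff:
  "bdd_borel f \<Longrightarrow> bdd_borel g \<Longrightarrow> interval_avg a h (\<lambda>x. f x - g x) i = interval_avg a h f i - interval_avg a h g i"
  unfolding interval_avg_def using set_integrable_bdd_interval
  by (subst set_integral_diff(2)) (auto simp: right_diff_distrib simp del: of_nat_Suc)

lemma interval_avg_const: "h > 0 \<Longrightarrow> interval_avg a h (\<lambda>_. c) i = c"
proof -
  assume h: "h > 0"
  have le: "a + real i * h \<le> a + real (Suc i) * h" using h by (simp add: distrib_right)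
  have "(LINT x:{a + real i * h..<a + real (Suc i) * h}|lborel. c) = c * h"
    using le unfolding set_lebesgue_integral_def by (simp add: algebra_simps)
  then show ?thesis using h by (simp add: interval_avg_def)
qed

lemma interval_avg_shift:
  "interval_avg a h f (Suc i) = interval_avg a h (\<lambda>x. f (x + h)) i"
proof -
  have "(LINT x:{a + real (Suc i) * h..<a + real (Suc (Suc i)) * h}|lborel. f x) =
     (\<integral>x. indicator {a + real (Suc i) * h..<a + real (Suc (Suc i)) * h} (h + 1 * x) *\<^sub>R f (h + 1 * x) \<partial>lborel)"
    unfolding set_lebesgue_integral_def
    using lborel_integral_real_affine[of 1 "\<lambda>x. indicator {a + real (Suc i) * h..<a + real (Suc (Suc i)) * h} x *\<^sub>R f x" h] by simp
  also have "\<dots> = (LINT x:{a + real i * h..<a + real (Suc i) * h}|lborel. f (x + h))"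
    unfolding set_lebesgue_integral_def
    by (intro Bochner_Integration.integral_cong refl) (auto simp: algebra_simps split: split_indicator)
  finally show ?thesis by (simp add: interval_avg_def)
qed

text \<open>The step of the difference equals the length of the intervals, and averaging commutes
  with translation, so differences of averages are averages of differences.\<close>

lemma nat_diff_interval_avg:
  assumes f: "bdd_borel f"
  shows "nat_diff r (\<lambda>l. interval_avg a h f (n + l)) l = interval_avg a h (fin_diff h r f) (n + l)"
proof (induction r arbitrary: l)
  case 0 then show ?case by (simp add: interval_avg_def)
next
  case (Suc r)
  have e: "fin_diff h (Suc r) f = (\<lambda>x. fin_diff h r f (x + h) - fin_diff h r f x)" by (rule ext) simp
  have "nat_diff (Suc r) (\<lambda>l. interval_avg a h f (n + l)) l
     = interval_avg a h (fin_diff h r f) (Suc (n + l)) - interval_avg a h (fin_diff h r f) (n + l)"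
    by (simp add: Suc.IH)
  also have "\<dots> = interval_avg a h (fin_diff h (Suc r) f) (n + l)"
    unfolding interval_avg_shift e using bdd_borel_fin_diff[OF f]
    by (intro interval_avg_diff[symmetric] bdd_borel_shift) auto
  finally show ?case .
qed

text \<open>The variance of \<open>f\<close> over the interval is nonnegative.\<close>

lemma interval_avg_square_le:
  assumes f: "bdd_borel f" and h: "h > 0"
  shows "(interval_avg a h f i)\<^sup>2 \<le> (1 / h) * (LINT x:{a + real i * h..<a + real (Suc i) * h}|lborel. (f x)\<^sup>2)"
proof -
  let ?S = "{a + real i * h..<a + real (Suc i) * h}"
  define \<mu> where "\<mu> = interval_avg a h f i"
  have i1: "set_integrable lborel ?S f" and i2: "set_integrable lborel ?S (\<lambda>x. (f x)\<^sup>2)"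
    by (rule set_integrable_bdd_interval[OF f] set_integrable_bdd_interval[OF bdd_borel_square[OF f]])+
  have c: "(LINT x:?S|lborel. \<mu>\<^sup>2) = \<mu>\<^sup>2 * h"
    using interval_avg_const[OF h, of a "\<mu>\<^sup>2" i] h by (simp add: interval_avg_def field_simps)
  have ic: "set_integrable lborel ?S (\<lambda>x. \<mu>\<^sup>2)"
    by (rule set_integrable_bdd_interval[OF bdd_borel_const])
  have I: "(LINT x:?S|lborel. f x) = \<mu> * h" using h by (simp add: \<mu>_def interval_avg_def)
  have "0 \<le> (LINT x:?S|lborel. (f x - \<mu>)\<^sup>2)"
    unfolding set_lebesgue_integral_def by (intro Bochner_Integration.integral_nonneg) auto
  also have "(LINT x:?S|lborel. (f x - \<mu>)\<^sup>2) = (LINT x:?S|lborel. ((f x)\<^sup>2 - 2 * \<mu> * f x) + \<mu>\<^sup>2)"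
    by (simp add: power2_eq_square algebra_simps)
  also have "\<dots> = (LINT x:?S|lborel. (f x)\<^sup>2) - 2 * \<mu> * (LINT x:?S|lborel. f x) + (LINT x:?S|lborel. \<mu>\<^sup>2)"
    using i1 i2 ic by (simp add: set_integral_add set_integral_diff)
  also have "\<dots> = (LINT x:?S|lborel. (f x)\<^sup>2) - \<mu>\<^sup>2 * h" unfolding I c by (simp add: power2_eq_square)
  finally show ?thesis using h by (simp add: \<mu>_def[symmetric] field_simps)
qed

lemma interval_avg_halve:
  assumes f: "bdd_borel f" and h: "h > 0"
  shows "interval_avg a (2 * h) f i = (interval_avg a h f (2 * i) + interval_avg a h f (2 * i + 1)) / 2"
proof -
  let ?A = "{a + real (2 * i) * h..<a + real (Suc (2 * i)) * h}" and ?B = "{a + real (2 * i + 1) * h..<a + real (Suc (2 * i + 1)) * h}"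
  have U: "{a + real i * (2 * h)..<a + real (Suc i) * (2 * h)} = ?A \<union> ?B"
    using h by (auto simp: algebra_simps)
  have "(LINT x:?A \<union> ?B|lborel. f x) = (LINT x:?A|lborel. f x) + (LINT x:?B|lborel. f x)"
    by (intro set_integral_Un set_integrable_bdd_interval[OF f]) auto
  then show ?thesis using h unfolding interval_avg_def U by (simp add: field_simps)
qed

lemma sum_indicator_le:
  assumes "finite I" "\<And>i. i \<in> I \<Longrightarrow> S i \<subseteq> A" "disjoint_family_on S I"
  shows "(\<Sum>i\<in>I. indicator (S i) x :: real) \<le> indicator A x"
proof -
  have "(\<Sum>i\<in>I. indicator (S i) x :: real) = indicator (\<Union>(S ` I)) x"
    using assms(1,3) by (rule indicator_UN_disjoint[symmetric])
  also have "\<dots> \<le> indicator A x" using assms(2) by (auto split: split_indicator)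
  finally show ?thesis .
qed

lemma disjoint_intervals: "h > 0 \<Longrightarrow> disjoint_family_on (\<lambda>i. {a + real i * h..<a + real (Suc i) * h}) I"
proof (unfold disjoint_family_on_def, intro ballI impI)
  fix i j :: nat assume h: "h > 0" and ij: "i \<noteq> j"
  have False if "i < j" "x \<in> {a + real i * h..<a + real (Suc i) * h}" "x \<in> {a + real j * h..<a + real (Suc j) * h}" for i j :: nat and x
  proof -
    have "real (Suc i) * h \<le> real j * h" using that h by (intro mult_right_mono) auto
    then show False using that by auto
  qed
  then show "{a + real i * h..<a + real (Suc i) * h} \<inter> {a + real j * h..<a + real (Suc j) * h} = {}"
    using ij by (meson disjoint_iff linorder_neqE_nat)
qed

lemma disjoint_intervals_shift:
  assumes "h > 0"
  shows "disjoint_family_on (\<lambda>i. {a + real (n + i) * h..<a + real (Suc (n + i)) * h}) I"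
  unfolding disjoint_family_on_def
proof (intro ballI impI)
  fix i j :: nat assume "i \<noteq> j"
  then have "n + i \<noteq> n + j" by simp
  then show "{a + real (n + i) * h..<a + real (Suc (n + i)) * h} \<inter> {a + real (n + j) * h..<a + real (Suc (n + j)) * h} = {}"
    using disjoint_intervals[OF assms, of a UNIV] unfolding disjoint_family_on_def by blast
qed

lemma sum_set_integral_le:
  assumes G: "bdd_borel G" "\<And>x. 0 \<le> G x" and I: "finite I" and S: "\<And>i. i \<in> I \<Longrightarrow> S i \<in> sets borel" "\<And>i. i \<in> I \<Longrightarrow> S i \<subseteq> A" "disjoint_family_on S I"
    and A: "A \<in> sets borel" "A \<subseteq> {c..d}"
  shows "(\<Sum>i\<in>I. (LINT x:S i|lborel. G x)) \<le> (LINT x:A|lborel. G x)"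
proof -
  have int: "integrable lborel (\<lambda>x. indicator (S i) x *\<^sub>R G x)" if "i \<in> I" for i
    using set_integrable_bdd[OF G(1), of "S i" c d] S that A by (auto simp: set_integrable_def)
  have intA: "integrable lborel (\<lambda>x. indicator A x *\<^sub>R G x)"
    using set_integrable_bdd[OF G(1) A] by (simp add: set_integrable_def)
  have "(\<Sum>i\<in>I. (LINT x:S i|lborel. G x)) = (\<integral>x. (\<Sum>i\<in>I. indicator (S i) x *\<^sub>R G x) \<partial>lborel)"
    unfolding set_lebesgue_integral_def using int by (simp add: Bochner_Integration.integral_sum)
  also have "\<dots> \<le> (\<integral>x. indicator A x *\<^sub>R G x \<partial>lborel)"
  proof (rule Bochner_Integration.integral_mono[OF _ intA])
    show "integrable lborel (\<lambda>x. \<Sum>i\<in>I. indicator (S i) x *\<^sub>R G x)" using int by (rule Bochner_Integration.integrable_sum)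
    show "(\<Sum>i\<in>I. indicator (S i) x *\<^sub>R G x) \<le> indicator A x *\<^sub>R G x" for x
      using mult_right_mono[OF sum_indicator_le[OF I S(2,3), of x] G(2)[of x]] by (simp add: sum_distrib_right)
  qed
  finally show ?thesis by (simp add: set_lebesgue_integral_def)
qed

lemma grid_cell_borel [measurable]: "grid_cell a b m i \<in> sets borel"
  by (simp add: grid_cell_def)

lemma disjoint_grid_cell: "a < b \<Longrightarrow> disjoint_family_on (grid_cell a b m) {..<m}"
  unfolding disjoint_family_on_def using cell_index_eq by (metis disjoint_iff lessThan_iff)

lemma measure_grid_cell: "a < b \<Longrightarrow> i < m \<Longrightarrow> measure lborel (grid_cell a b m i) = (b - a) / real m"
proof -
  assume ab: "a < b" and i: "i < m"
  have le: "grid_point a b m i \<le> grid_point a b m (Suc i)" using ab by (rule grid_point_mono) simp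
  show ?thesis
  proof (cases "Suc i = m")
    case True
    then have e: "b = grid_point a b m (Suc i)" using i by (simp add: grid_point_m)
    then have "measure lborel (grid_cell a b m i) = b - grid_point a b m i" using True le by (simp add: grid_cell_def)
    with e grid_point_Suc[of a b m i] show ?thesis by linarith
  next
    case False then show ?thesis using le by (simp add: grid_cell_def grid_point_Suc)
  qed
qed

text \<open>On a cell the square of \<open>w\<close> is bounded by a constant, so integration
  multiplies it by the length of the cell; the local integrals of \<open>G\<close> add up.\<close>

lemma integral_square_le_of_cells:
  assumes ab: "a < b" and m: "0 < m" and c: "0 \<le> c" and G: "bdd_borel G" "\<And>x. 0 \<le> G x"
    and w: "\<And>j x. j < m \<Longrightarrow> x \<in> grid_cell a b m j \<Longrightarrow> (w x)\<^sup>2 \<le> c * (LINT y:grid_cell a b m j|lborel. G y)"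
  shows "(LINT x:{a..b}|lborel. (w x)\<^sup>2) \<le> c * ((b - a) / real m) * (LINT x:{a..b}|lborel. G x)"
proof -
  define I where "I j = (LINT y:grid_cell a b m j|lborel. G y)" for j
  have I0: "0 \<le> I j" for j unfolding I_def set_lebesgue_integral_def
    using G(2) by (intro Bochner_Integration.integral_nonneg) auto
  define U where "U x = (\<Sum>j<m. indicator (grid_cell a b m j) x * (c * I j))" for x
  have em: "emeasure lborel (grid_cell a b m j) < \<infinity>" if "j < m" for j
    using emeasure_mono[OF grid_cell_subset[OF ab that], of lborel] by (auto simp: emeasure_lborel_Icc_eq top_unique less_top[symmetric] intro: le_less_trans)
  have int: "integrable lborel (\<lambda>x. indicator (grid_cell a b m j) x * (c * I j))" if "j < m" for j
    using em[OF that] by (intro integrable_mult_left integrable_real_indicator) auto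
  have "(LINT x:{a..b}|lborel. (w x)\<^sup>2) \<le> (\<integral>x. U x \<partial>lborel)"
    unfolding set_lebesgue_integral_def
  proof (rule integral_mono_AE')
    show "integrable lborel U" unfolding U_def using int by (intro Bochner_Integration.integrable_sum) auto
    show "AE x in lborel. 0 \<le> U x" unfolding U_def using I0 c by (intro AE_I2 sum_nonneg) auto
    show "AE x in lborel. indicator {a..b} x *\<^sub>R (w x)\<^sup>2 \<le> U x"
    proof (intro AE_I2)
      fix x
      show "indicator {a..b} x *\<^sub>R (w x)\<^sup>2 \<le> U x"
      proof (cases "x \<in> {a..b}")
        case True
        define j where "j = cell_index a b m x"
        have j: "j < m" "x \<in> grid_cell a b m j" using cell_index_less[OF m] mem_grid_cell_index[OF ab m True] by (auto simp: j_def)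
        have "(w x)\<^sup>2 \<le> indicator (grid_cell a b m j) x * (c * I j)" using w[OF j] j by (simp add: I_def)
        also have "\<dots> \<le> U x" unfolding U_def
          using j I0 c by (intro member_le_sum[of j "{..<m}" "\<lambda>j. indicator (grid_cell a b m j) x * (c * I j)"]) auto
        finally show ?thesis using True by simp
      next
        case False then show ?thesis unfolding U_def using I0 c by (auto intro!: sum_nonneg)
      qed
    qed
  qed
  also have "(\<integral>x. U x \<partial>lborel) = (\<Sum>j<m. ((b - a) / real m) * (c * I j))"
    unfolding U_def using int measure_grid_cell[OF ab] by (subst Bochner_Integration.integral_sum) auto
  also have "\<dots> = c * ((b - a) / real m) * (\<Sum>j<m. I j)"
    unfolding sum_distrib_left by (intro sum.cong refl) (simp only: mult_ac)
  also have "\<dots> \<le> c * ((b - a) / real m) * (LINT x:{a..b}|lborel. G x)"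
    unfolding I_def using ab c
    by (intro mult_left_mono sum_set_integral_le[OF G, of _ _ _ a b] disjoint_grid_cell grid_cell_subset) auto
  finally show ?thesis .
qed

section \<open>The local averaging operator\<close>

text \<open>Each of the \<open>N\<close> cells is cut into \<open>r\<close> pieces of length
  \<open>h\<close>, numbered through from \<open>a\<close>, and the polynomial on the cell matches
  the averages of \<open>f\<close> over its pieces. Averages, unlike point values, make the operator
  bounded in \<open>L\<^sup>2\<close> and insensitive to null sets.\<close>

definition quasi_interp :: "real \<Rightarrow> real \<Rightarrow> nat \<Rightarrow> nat \<Rightarrow> (real \<Rightarrow> real) \<Rightarrow> real \<Rightarrow> real" where
  "quasi_interp a b r N f = pw_of a b N (\<lambda>j. let h = (b - a) / (real N * real r) in
     pcompose (avg_poly r (\<lambda>i. interval_avg a h f (j * r + i))) [:- grid_point a b N j / h, 1 / h:])"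

lemma quasi_interp_mem:
  assumes ab: "a < b"
  shows "quasi_interp a b r N f \<in> pw_poly a b (r - 1) N"
  unfolding quasi_interp_def Let_def
proof (rule pw_of_mem[OF ab])
  fix i
  let ?h = "(b - a) / (real N * real r)"
  let ?p = "avg_poly r (\<lambda>l. interval_avg a ?h f (i * r + l))" and ?l = "[:- grid_point a b N i / ?h, 1 / ?h:]"
  have "degree (pcompose ?p ?l) \<le> degree ?p * degree ?l" by (rule degree_pcompose_le)
  also have "\<dots> \<le> degree ?p * 1" by (intro mult_left_mono) auto
  also have "\<dots> \<le> r - 1" using degree_avg_poly by simp
  finally show "degree (pcompose ?p ?l) \<le> r - 1" .
qed

lemma quasi_interp_eq:
  assumes ab: "a < b" and j: "j < N" "x \<in> grid_cell a b N j"
  shows "quasi_interp a b r N f x = poly (avg_poly r (\<lambda>i. interval_avg a ((b - a) / (real N * real r)) f (j * r + i)))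
     ((x - grid_point a b N j) / ((b - a) / (real N * real r)))"
proof -
  have "x \<in> {a..b}" using grid_cell_subset[OF ab j(1)] j(2) by blast
  moreover have "- (grid_point a b N j / h) + x / h = (x - grid_point a b N j) / h" for h :: real
    by (simp add: diff_divide_distrib)
  ultimately show ?thesis
    using cell_index_eq[OF ab j] unfolding quasi_interp_def Let_def pw_of_def
    by (simp add: poly_pcompose diff_divide_distrib mult.commute)
qed

lemma grid_fine:
  assumes "0 < N" "0 < r"
  shows "grid_point a b N j = a + real (j * r) * ((b - a) / (real N * real r))"
    and "grid_point a b N (Suc j) = a + real (j * r + r) * ((b - a) / (real N * real r))"
  using assms by (simp_all add: grid_point_def field_simps)

lemma fine_subset_grid_cell:
  assumes ab: "a < b" and r: "0 < r" and j: "j < N" and i: "i < r"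
  shows "{a + real (j * r + i) * ((b - a) / (real N * real r))..<a + real (Suc (j * r + i)) * ((b - a) / (real N * real r))} \<subseteq> grid_cell a b N j"
proof -
  let ?h = "(b - a) / (real N * real r)"
  have h: "?h > 0" using ab r j by auto
  have "real (j * r) * ?h \<le> real (j * r + i) * ?h" "real (Suc (j * r + i)) * ?h \<le> real (j * r + r) * ?h"
    using h i by (intro mult_right_mono; simp)+
  then have "grid_point a b N j \<le> a + real (j * r + i) * ?h" "a + real (Suc (j * r + i)) * ?h \<le> grid_point a b N (Suc j)"
    using grid_fine[of N r a b j] j r by auto
  moreover have "grid_point a b N (Suc j) \<le> b" using grid_point_bounds[OF ab, of "Suc j" N] j by auto
  ultimately show ?thesis unfolding grid_cell_def by auto
qed

lemma grid_cell_local_coord: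
  assumes ab: "a < b" and r: "0 < r" and j: "j < N" "x \<in> grid_cell a b N j"
  shows "(x - grid_point a b N j) / ((b - a) / (real N * real r)) \<in> {0..real r}"
proof -
  have N: "0 < N" using j by simp
  have "x \<in> {grid_point a b N j..grid_point a b N (Suc j)}" using grid_cell_subset_Icc[OF N] j by blast
  then have "0 \<le> x - grid_point a b N j" "x - grid_point a b N j \<le> (b - a) / real N" by (auto simp: grid_point_Suc)
  moreover have h: "(b - a) / (real N * real r) > 0" using ab r N by simp
  moreover have e: "real r * ((b - a) / (real N * real r)) = (b - a) / real N" using r by simp
  ultimately have "0 \<le> (x - grid_point a b N j) / ((b - a) / (real N * real r))"
    "(x - grid_point a b N j) / ((b - a) / (real N * real r)) \<le> real r"
    unfolding pos_divide_le_eq[OF h] e by (auto intro!: divide_nonneg_pos[OF _ h] simp del: divide_divide_eq_right)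
  then show ?thesis unfolding atLeastAtMost_iff ..
qed

text \<open>The cellwise bound has the factor \<open>B\<^sup>2 * r / h\<close>. A cell has length
  \<open>r * h\<close>, so \<open>h\<close> cancels and the constant is independent of
  \<open>N\<close>.\<close>

lemma quasi_interp_L2_bound:
  assumes ab: "a < b" and r: "0 < r"
  shows "\<exists>C\<ge>0. \<forall>N>0. \<forall>u. bdd_borel u \<longrightarrow>
    (LINT x:{a..b}|lborel. (quasi_interp a b r N u x)\<^sup>2) \<le> C * (LINT x:{a..b}|lborel. (u x)\<^sup>2)"
proof -
  obtain B where B: "B \<ge> 0" "\<And>e t. t \<in> {0..real r} \<Longrightarrow> \<bar>poly (avg_poly r e) t\<bar> \<le> B * (\<Sum>i<r. \<bar>e i\<bar>)"
    using avg_poly_bound[of r] by blast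
  show ?thesis
  proof (intro exI[of _ "B\<^sup>2 * real r * real r"] conjI allI impI)
    fix N u assume N: "0 < (N::nat)" and u: "bdd_borel u"
    define h where "h = (b - a) / (real N * real r)"
    have h: "h > 0" using ab N r by (simp add: h_def)
    have "(LINT x:{a..b}|lborel. (quasi_interp a b r N u x)\<^sup>2) \<le> (B\<^sup>2 * real r / h) * ((b - a) / real N) * (LINT x:{a..b}|lborel. (u x)\<^sup>2)"
    proof (rule integral_square_le_of_cells[OF ab N])
      fix j x assume j: "j < N" "x \<in> grid_cell a b N j"
      let ?A = "\<lambda>i. interval_avg a h u (j * r + i)"
      let ?S = "\<lambda>i. {a + real (j * r + i) * h..<a + real (Suc (j * r + i)) * h}"
      have "\<bar>quasi_interp a b r N u x\<bar> \<le> B * (\<Sum>i<r. \<bar>?A i\<bar>)"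
        unfolding quasi_interp_eq[OF ab j] h_def by (rule B(2)[OF grid_cell_local_coord[OF ab r j]])
      then have "(quasi_interp a b r N u x)\<^sup>2 \<le> (B * (\<Sum>i<r. \<bar>?A i\<bar>))\<^sup>2"
        by (metis abs_ge_zero power2_abs power_mono)
      also have "\<dots> = B\<^sup>2 * (\<Sum>i<r. \<bar>?A i\<bar> * 1)\<^sup>2" by (simp add: power_mult_distrib)
      also have "\<dots> \<le> B\<^sup>2 * ((\<Sum>i<r. \<bar>?A i\<bar>\<^sup>2) * (\<Sum>i<r. 1\<^sup>2))"
        by (intro mult_left_mono Cauchy_Schwarz_ineq_sum) auto
      also have "\<dots> \<le> B\<^sup>2 * ((\<Sum>i<r. (1 / h) * (LINT y:?S i|lborel. (u y)\<^sup>2)) * real r)"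
        using interval_avg_square_le[OF u h, of a]
        by (auto intro!: mult_left_mono mult_right_mono sum_mono simp del: of_nat_Suc of_nat_add of_nat_mult)
      also have "\<dots> = (B\<^sup>2 * real r / h) * (\<Sum>i<r. (LINT y:?S i|lborel. (u y)\<^sup>2))"
        unfolding sum_distrib_left[symmetric] by (simp add: mult_ac)
      also have "\<dots> \<le> (B\<^sup>2 * real r / h) * (LINT y:grid_cell a b N j|lborel. (u y)\<^sup>2)"
      proof (intro mult_left_mono sum_set_integral_le[OF bdd_borel_square[OF u], of _ _ _ a b])
        show "?S i \<subseteq> grid_cell a b N j" if "i \<in> {..<r}" for i
          using fine_subset_grid_cell[OF ab r j(1), of i] that by (simp add: h_def)
        show "disjoint_family_on ?S {..<r}"
          by (rule disjoint_intervals_shift[OF h])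
        show "grid_cell a b N j \<subseteq> {a..b}" by (rule grid_cell_subset[OF ab j(1)])
      qed (use h in auto)
      finally show "(quasi_interp a b r N u x)\<^sup>2 \<le> (B\<^sup>2 * real r / h) * (LINT y:grid_cell a b N j|lborel. (u y)\<^sup>2)" .
    qed (use h u in \<open>auto intro: bdd_borel_square\<close>)
    also have "(B\<^sup>2 * real r / h) * ((b - a) / real N) = B\<^sup>2 * real r * real r"
      using ab N r by (simp add: h_def field_simps)
    finally show "(LINT x:{a..b}|lborel. (quasi_interp a b r N u x)\<^sup>2) \<le> B\<^sup>2 * real r * real r * (LINT x:{a..b}|lborel. (u x)\<^sup>2)" .
  qed (use B in auto)
qed

lemma quasi_interp_diff:
  assumes ab: "a < b" and N: "0 < N" and f: "bdd_borel f" and g: "bdd_borel g"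
  shows "quasi_interp a b r N (\<lambda>x. f x - g x) x = quasi_interp a b r N f x - quasi_interp a b r N g x"
proof (cases "x \<in> {a..b}")
  case True
  define j where "j = cell_index a b N x"
  have j: "j < N" "x \<in> grid_cell a b N j" using cell_index_less[OF N] mem_grid_cell_index[OF ab N True] by (auto simp: j_def)
  show ?thesis unfolding quasi_interp_eq[OF ab j] interval_avg_diff[OF f g] by (rule poly_avg_poly_diff)
next
  case False
  then show ?thesis unfolding quasi_interp_def pw_of_def by (simp only: if_False)
qed

text \<open>On each coarse cell \<open>avg_poly_refine\<close> is applied to the averages over its
  \<open>2 * r\<close> fine pieces, with \<open>h\<close> the fine length. Only the first
  \<open>r\<close> of the differences occur; for these, \<open>x + r * h\<close> stays in the coarse
  cell or at its right end, so \<open>fin_diff_on\<close> is not cut off.\<close>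

lemma quasi_interp_refine:
  assumes ab: "a < b" and r: "0 < r"
  shows "\<exists>C\<ge>0. \<forall>N>0. \<forall>f. bdd_borel f \<longrightarrow>
    (LINT x:{a..b}|lborel. (quasi_interp a b r N f x - quasi_interp a b r (2 * N) f x)\<^sup>2)
      \<le> C * (LINT x:{a..b}|lborel. (fin_diff_on a b ((b - a) / (real (2 * N) * real r)) r f x)\<^sup>2)"
proof -
  obtain C where C: "C \<ge> 0"
    "\<And>a t. t \<in> {0..real r} \<Longrightarrow> \<bar>poly (avg_poly r (\<lambda>i. (a (2*i) + a (2*i+1)) / 2)) (t / 2) - poly (avg_poly r a) t\<bar> \<le> C * (\<Sum>l<r. \<bar>nat_diff r a l\<bar>)"
    "\<And>a t. t \<in> {real r..2 * real r} \<Longrightarrow> \<bar>poly (avg_poly r (\<lambda>i. (a (2*i) + a (2*i+1)) / 2)) (t / 2) - poly (avg_poly r (\<lambda>i. a (r + i))) (t - real r)\<bar> \<le> C * (\<Sum>l<r. \<bar>nat_diff r a l\<bar>)"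
    using avg_poly_refine[OF r] by blast
  show ?thesis
  proof (intro exI[of _ "C\<^sup>2 * real r * (2 * real r)"] conjI allI impI)
    fix N f assume N: "0 < (N::nat)" and f: "bdd_borel f"
    define h where "h = (b - a) / (real (2 * N) * real r)"
    have h: "h > 0" using ab N r by (simp add: h_def)
    have h2: "(b - a) / (real N * real r) = 2 * h" using N r by (simp add: h_def field_simps)
    define G where "G x = (fin_diff_on a b h r f x)\<^sup>2" for x
    have G: "bdd_borel G" "\<And>x. 0 \<le> G x" unfolding G_def using f by (auto intro: bdd_borel_square bdd_borel_fin_diff_on)
    have "(LINT x:{a..b}|lborel. (quasi_interp a b r N f x - quasi_interp a b r (2 * N) f x)\<^sup>2)
       \<le> (C\<^sup>2 * real r / h) * ((b - a) / real N) * (LINT x:{a..b}|lborel. G x)"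
    proof (rule integral_square_le_of_cells[OF ab N _ G])
      fix j x assume j: "j < N" "x \<in> grid_cell a b N j"
      define A where "A l = interval_avg a h f (2 * j * r + l)" for l
      define g where "g = grid_point a b N j"
      define t where "t = (x - g) / h"
      have xab: "x \<in> {a..b}" using grid_cell_subset[OF ab j(1)] j(2) by blast
      have gf: "grid_point a b (2 * N) (2 * j) = g" "grid_point a b (2 * N) (2 * j + 1) = g + real r * h"
        "grid_point a b N (Suc j) = g + 2 * real r * h"
        using N r by (simp_all add: g_def grid_point_def h_def field_simps)
      have xg: "g \<le> x" "x \<le> g + 2 * real r * h" using grid_cell_subset_Icc[OF N, of a b j] j(2) gf(3) by (auto simp: g_def)
      have co: "quasi_interp a b r N f x = poly (avg_poly r (\<lambda>i. (A (2*i) + A (2*i+1)) / 2)) (t / 2)"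
      proof -
        have fe: "(\<lambda>i. interval_avg a (2 * h) f (j * r + i)) = (\<lambda>i. (A (2*i) + A (2*i+1)) / 2)"
          unfolding interval_avg_halve[OF f h] A_def by (simp add: algebra_simps)
        have te: "(x - grid_point a b N j) / (2 * h) = t / 2" by (simp add: t_def g_def)
        show ?thesis unfolding quasi_interp_eq[OF ab j] h2 fe te ..
      qed
      define J where "J = cell_index a b (2 * N) x"
      have J: "J < 2 * N" "x \<in> grid_cell a b (2 * N) J"
        using cell_index_less[of "2 * N"] mem_grid_cell_index[OF ab _ xab, of "2 * N"] N by (auto simp: J_def)
      have fi: "quasi_interp a b r (2 * N) f x = poly (avg_poly r (\<lambda>i. interval_avg a h f (J * r + i))) ((x - grid_point a b (2 * N) J) / h)"
        unfolding quasi_interp_eq[OF ab J] h_def ..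
      have xJ: "grid_point a b (2 * N) J \<le> x" "x \<le> grid_point a b (2 * N) (Suc J)" "J < 2 * N - 1 \<Longrightarrow> x < grid_point a b (2 * N) (Suc J)"
        using grid_cell_subset_Icc[of "2 * N" a b J] J N by (auto simp: grid_cell_def split: if_splits)
      \<comment> \<open>The fine cell of \<open>x\<close> is one of the two halves of its coarse
        cell.\<close>
      have Jj: "J = 2 * j \<or> J = 2 * j + 1"
      proof -
        have mono: "grid_point a b (2 * N) p < grid_point a b (2 * N) q" if "p < q" for p q
          using that ab N by (auto simp: grid_point_def divide_strict_right_mono)
        have g2: "grid_point a b (2 * N) (2 * j + 2) = g + 2 * real r * h"
          using N r by (simp add: g_def grid_point_def h_def field_simps)
        have "\<not> J < 2 * j"
        proof
          assume "J < 2 * j"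
          then have "x < grid_point a b (2 * N) (Suc J)" using xJ(3) j(1) by simp
          also have "\<dots> \<le> grid_point a b (2 * N) (2 * j)" using \<open>J < 2 * j\<close> ab by (intro grid_point_mono) auto
          finally show False using gf xg by simp
        qed
        moreover have "\<not> J \<ge> 2 * j + 2"
        proof
          assume Jge: "J \<ge> 2 * j + 2"
          then have "g + 2 * real r * h \<le> x" using grid_point_mono[OF ab Jge, of "2 * N"] xJ(1) g2 by simp
          \<comment> \<open>If \<open>j\<close> is the last coarse cell, \<open>J\<close> would be
            at least \<open>2 * N\<close>; otherwise the coarse cell is open on the right.\<close>
          moreover have "x < g + 2 * real r * h"
            using j J Jge gf(3) by (auto simp: grid_cell_def split: if_splits)
          ultimately show False by simp
        qed
        ultimately show ?thesis by linarith
      qed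
      have main: "\<bar>quasi_interp a b r N f x - quasi_interp a b r (2 * N) f x\<bar> \<le> C * (\<Sum>l<r. \<bar>nat_diff r A l\<bar>)"
        using Jj
      proof
        assume J2: "J = 2 * j"
        have "t \<in> {0..real r}" using xJ(1,2) gf h unfolding J2 t_def by (auto simp: field_simps)
        moreover have "quasi_interp a b r (2 * N) f x = poly (avg_poly r A) t"
          unfolding fi J2 gf t_def A_def ..
        ultimately show ?thesis unfolding co using C(2) by simp
      next
        assume J2: "J = 2 * j + 1"
        have S: "grid_point a b (2 * N) (Suc (2 * j + 1)) = g + 2 * real r * h"
          using N r by (simp add: g_def grid_point_def h_def field_simps)
        have "t \<in> {real r..2 * real r}" using xJ(1,2) gf(2) S h unfolding J2 t_def by (auto simp: field_simps)
        moreover have "quasi_interp a b r (2 * N) f x = poly (avg_poly r (\<lambda>i. A (r + i))) (t - real r)"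
        proof -
          have "(x - (g + real r * h)) / h = t - real r" using h by (simp add: t_def field_simps)
          moreover have "(\<lambda>i. interval_avg a h f ((2 * j + 1) * r + i)) = (\<lambda>i. A (r + i))"
            unfolding A_def by (intro ext arg_cong[of _ _ "interval_avg a h f"]) (simp add: algebra_simps)
          ultimately show ?thesis unfolding fi J2 gf by simp
        qed
        ultimately show ?thesis unfolding co using C(3) by simp
      qed
      let ?S = "\<lambda>l. {a + real (2 * j * r + l) * h..<a + real (Suc (2 * j * r + l)) * h}"
      have nd: "nat_diff r A l = interval_avg a h (fin_diff h r f) (2 * j * r + l)" for l
        unfolding A_def by (rule nat_diff_interval_avg[OF f])
      have ga: "g = a + real (2 * j * r) * h" using N r by (simp add: g_def grid_point_def h_def field_simps)
      have endb: "g + 2 * real r * h \<le> b" using grid_point_bounds[OF ab, of "Suc j" N] j(1) gf(3) by simp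
      have inS: "a \<le> y \<and> y + real r * h \<le> g + 2 * real r * h \<and> y < g + real r * h \<and> g \<le> y" if "l < r" "y \<in> ?S l" for l y
      proof -
        have "real (2 * j * r) * h \<le> real (2 * j * r + l) * h" "real (Suc (2 * j * r + l)) * h \<le> real (2 * j * r + r) * h"
          using h that(1) by (intro mult_right_mono; simp)+
        moreover have "real (2 * j * r + r) * h = real (2 * j * r) * h + real r * h" by (simp add: distrib_right)
        moreover have "0 \<le> real (2 * j * r) * h" using h by simp
        moreover have "a + real (2 * j * r + l) * h \<le> y" "y < a + real (Suc (2 * j * r + l)) * h"
          using that(2) unfolding atLeastLessThan_iff by blast+
        ultimately show ?thesis using ga by (intro conjI; linarith)
      qed
      have rh: "0 < real r * h" using r h by simp
      have subS: "?S l \<subseteq> grid_cell a b N j" if "l < r" for l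
      proof
        fix y assume "y \<in> ?S l"
        from inS[OF that this] endb rh show "y \<in> grid_cell a b N j" unfolding grid_cell_def gf(3) g_def[symmetric] by auto
      qed
      have sq: "(nat_diff r A l)\<^sup>2 \<le> (1 / h) * (LINT y:?S l|lborel. G y)" if l: "l < r" for l
      proof -
        have "(nat_diff r A l)\<^sup>2 \<le> (1 / h) * (LINT y:?S l|lborel. (fin_diff h r f y)\<^sup>2)"
          unfolding nd by (rule interval_avg_square_le[OF bdd_borel_fin_diff[OF f] h])
        also have "(LINT y:?S l|lborel. (fin_diff h r f y)\<^sup>2) = (LINT y:?S l|lborel. G y)"
        proof (rule set_lebesgue_integral_cong)
          show "\<forall>y. y \<in> ?S l \<longrightarrow> (fin_diff h r f y)\<^sup>2 = G y"
          proof (intro allI impI)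
            fix y assume "y \<in> ?S l"
            from inS[OF l this] endb rh show "(fin_diff h r f y)\<^sup>2 = G y" by (auto simp: G_def fin_diff_on_def)
          qed
        qed simp
        finally show ?thesis .
      qed
      have "(quasi_interp a b r N f x - quasi_interp a b r (2 * N) f x)\<^sup>2 \<le> (C * (\<Sum>l<r. \<bar>nat_diff r A l\<bar>))\<^sup>2"
        using main by (metis abs_ge_zero power2_abs power_mono)
      also have "\<dots> = C\<^sup>2 * (\<Sum>l<r. \<bar>nat_diff r A l\<bar> * 1)\<^sup>2" by (simp add: power_mult_distrib)
      also have "\<dots> \<le> C\<^sup>2 * ((\<Sum>l<r. \<bar>nat_diff r A l\<bar>\<^sup>2) * (\<Sum>l<r. 1\<^sup>2))"
        by (intro mult_left_mono Cauchy_Schwarz_ineq_sum) auto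
      also have "\<dots> \<le> C\<^sup>2 * ((\<Sum>l<r. (1 / h) * (LINT y:?S l|lborel. G y)) * real r)"
        using sq by (auto intro!: mult_left_mono mult_right_mono sum_mono simp del: of_nat_Suc of_nat_add of_nat_mult)
      also have "\<dots> = (C\<^sup>2 * real r / h) * (\<Sum>l<r. (LINT y:?S l|lborel. G y))"
        unfolding sum_distrib_left[symmetric] by (simp add: mult_ac)
      also have "\<dots> \<le> (C\<^sup>2 * real r / h) * (LINT y:grid_cell a b N j|lborel. G y)"
      proof (intro mult_left_mono sum_set_integral_le[OF G, of _ _ _ a b])
        show "disjoint_family_on ?S {..<r}"
          by (rule disjoint_intervals_shift[OF h])
        show "grid_cell a b N j \<subseteq> {a..b}" by (rule grid_cell_subset[OF ab j(1)])
        show "\<And>l. l \<in> {..<r} \<Longrightarrow> ?S l \<subseteq> grid_cell a b N j" using subS by simp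
      qed (use h in auto)
      finally show "(quasi_interp a b r N f x - quasi_interp a b r (2 * N) f x)\<^sup>2 \<le> (C\<^sup>2 * real r / h) * (LINT y:grid_cell a b N j|lborel. G y)" .
    qed (use h in auto)
    also have "(C\<^sup>2 * real r / h) * ((b - a) / real N) = C\<^sup>2 * real r * (2 * real r)"
      using ab N r by (simp add: h_def field_simps)
    finally show "(LINT x:{a..b}|lborel. (quasi_interp a b r N f x - quasi_interp a b r (2 * N) f x)\<^sup>2)
      \<le> C\<^sup>2 * real r * (2 * real r) * (LINT x:{a..b}|lborel. (fin_diff_on a b ((b - a) / (real (2 * N) * real r)) r f x)\<^sup>2)"
      unfolding G_def h_def .
  qed (use C in auto)
qed

section \<open>Convergence and rate of the approximants\<close>

lemma avg_poly_const: "0 < r \<Longrightarrow> poly (avg_poly r (\<lambda>_. c)) t = c"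
  using avg_poly_reproduces[of "[:0, c:]" r "\<lambda>_. c"] by (simp add: pderiv_pCons algebra_simps)

text \<open>Constants are reproduced, so at \<open>x\<close> the error is the operator applied to
  the oscillation of \<open>g\<close> around \<open>g x\<close>, which uniform continuity makes
  small on one cell.\<close>

lemma quasi_interp_tendsto_continuous:
  assumes ab: "a < b" and r: "0 < r" and g: "continuous_on UNIV g" "bdd_borel g" and e: "e > 0"
  shows "\<exists>N0. \<forall>N\<ge>N0. 0 < N \<longrightarrow> (\<forall>x\<in>{a..b}. \<bar>g x - quasi_interp a b r N g x\<bar> \<le> e)"
proof -
  obtain B where B: "B \<ge> 0" "\<And>e t. t \<in> {0..real r} \<Longrightarrow> \<bar>poly (avg_poly r e) t\<bar> \<le> B * (\<Sum>i<r. \<bar>e i\<bar>)"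
    using avg_poly_bound[of r] by blast
  \<comment> \<open>The operator amplifies an oscillation \<open>e'\<close> by at most
    \<open>B * real r\<close>; the added 1 keeps the denominator positive.\<close>
  define e' where "e' = e / (B * real r + 1)"
  have den: "B * real r + 1 > 0" using B by (simp add: add_nonneg_pos)
  have e': "e' > 0" using e den by (simp add: e'_def)
  have "uniformly_continuous_on {a..b} g"
    by (intro compact_uniformly_continuous continuous_on_subset[OF g(1)]) auto
  then obtain \<delta> where \<delta>: "\<delta> > 0" "\<And>x y. x \<in> {a..b} \<Longrightarrow> y \<in> {a..b} \<Longrightarrow> dist x y < \<delta> \<Longrightarrow> dist (g x) (g y) < e'"
    using e' unfolding uniformly_continuous_on_def by metis
  obtain N0 :: nat where N0: "(b - a) / \<delta> < real N0" using reals_Archimedean2 by blast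
  show ?thesis
  proof (intro exI[of _ N0] allI impI ballI)
    fix N x assume N: "N0 \<le> N" "0 < N" and x: "x \<in> {a..b}"
    define h where "h = (b - a) / (real N * real r)"
    have h: "h > 0" using ab N r by (simp add: h_def)
    have small: "(b - a) / real N < \<delta>"
    proof -
      have "(b - a) / \<delta> < real N" using N0 N(1) by linarith
      then show ?thesis using \<delta>(1) N(2) by (simp add: field_simps)
    qed
    define j where "j = cell_index a b N x"
    have j: "j < N" "x \<in> grid_cell a b N j" using cell_index_less[OF N(2)] mem_grid_cell_index[OF ab N(2) x] by (auto simp: j_def)
    let ?A = "\<lambda>i. interval_avg a h g (j * r + i)"
    let ?t = "(x - grid_point a b N j) / h"
    have t: "?t \<in> {0..real r}" unfolding h_def by (rule grid_cell_local_coord[OF ab r j])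
    have A: "\<bar>?A i - g x\<bar> \<le> e'" if i: "i < r" for i
    proof -
      let ?S = "{a + real (j * r + i) * h..<a + real (Suc (j * r + i)) * h}"
      have S: "?S \<subseteq> grid_cell a b N j" using fine_subset_grid_cell[OF ab r j(1) i] by (simp add: h_def)
      have osc: "\<bar>g y - g x\<bar> \<le> e'" if y: "y \<in> ?S" for y
      proof -
        have "y \<in> grid_cell a b N j" using y S by blast
        then have "y \<in> {grid_point a b N j..grid_point a b N (Suc j)}" "x \<in> {grid_point a b N j..grid_point a b N (Suc j)}" "y \<in> {a..b}"
          using grid_cell_subset_Icc[OF N(2), of a b j] j grid_cell_subset[OF ab j(1)] by blast+
        then have "dist y x < \<delta>" using small by (auto simp: grid_point_Suc dist_real_def)
        then show ?thesis using \<delta>(2)[OF \<open>y \<in> {a..b}\<close> x] by (simp add: dist_real_def)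
      qed
      have "?A i - g x = interval_avg a h (\<lambda>y. g y - g x) (j * r + i)"
        using interval_avg_diff[OF g(2) bdd_borel_const, of a h "g x"] interval_avg_const[OF h] by simp
      also have "\<bar>\<dots>\<bar> \<le> interval_avg a h (\<lambda>_. e') (j * r + i)"
      proof -
        have bd: "bdd_borel (\<lambda>y. g y - g x)" by (intro bdd_borel_diff g(2) bdd_borel_const)
        have "\<bar>LINT y:?S|lborel. (g y - g x)\<bar> \<le> (LINT y:?S|lborel. e')"
        proof -
          have "\<bar>LINT y:?S|lborel. (g y - g x)\<bar> \<le> (LINT y:?S|lborel. \<bar>g y - g x\<bar>)"
            using set_integral_norm_bound[OF set_integrable_bdd_interval[OF bd, of a "j * r + i" h]] by (simp only: real_norm_def)
          also have "\<dots> \<le> (LINT y:?S|lborel. e')"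
            by (intro set_integral_mono set_integrable_abs set_integrable_bdd_interval bd bdd_borel_const) (use osc in blast)
          finally show ?thesis .
        qed
        then show ?thesis using h unfolding interval_avg_def by (simp add: abs_mult divide_right_mono)
      qed
      finally show ?thesis using interval_avg_const[OF h] by simp
    qed
    have "quasi_interp a b r N g x - g x = poly (avg_poly r (\<lambda>i. ?A i - g x)) ?t"
      unfolding poly_avg_poly_diff avg_poly_const[OF r] quasi_interp_eq[OF ab j] h_def ..
    also have "\<bar>\<dots>\<bar> \<le> B * (\<Sum>i<r. \<bar>?A i - g x\<bar>)" by (rule B(2)[OF t])
    also have "\<dots> \<le> B * (\<Sum>i<r. e')" using A B(1) by (intro mult_left_mono sum_mono) auto
    also have "\<dots> = (B * real r) * e'" by simp
    also have "\<dots> \<le> (B * real r + 1) * e'" using e' by simp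
    also have "\<dots> = e" using den by (simp add: e'_def)
    finally show "\<bar>g x - quasi_interp a b r N g x\<bar> \<le> e" by (simp add: abs_minus_commute)
  qed
qed

text \<open>A Lebesgue measurable function is almost everywhere a limit of continuous functions.
  Clipping these at the bound \<open>B\<close> of \<open>f\<close> preserves the limit and provides
  the dominating function.\<close>

lemma continuous_L2_approx:
  assumes f: "bdd_borel f" and e: "e > 0"
  shows "\<exists>g. continuous_on UNIV g \<and> bdd_borel g \<and> (LINT x:{a..b}|lborel. (f x - g x)\<^sup>2) < e"
proof -
  obtain B where B: "\<And>x. \<bar>f x\<bar> \<le> B" using f by (auto simp: bdd_borel_def)
  have [measurable]: "f \<in> borel_measurable borel" using f by (rule bdd_borel_measurable)
  have "f \<in> borel_measurable lebesgue" by (intro measurable_completion) simp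
  then have "f measurable_on UNIV" by (intro lebesgue_measurable_imp_measurable_on) simp_all
  then obtain Nu G where Nu: "negligible Nu" and G: "\<And>n. continuous_on UNIV (G n)"
    "\<And>x. x \<notin> Nu \<Longrightarrow> (\<lambda>n. G n x) \<longlonglongrightarrow> f x" unfolding measurable_on_def by auto
  define g where "g n x = max (-B) (min B (G n x))" for n :: nat and x
  have gc: "continuous_on UNIV (g n)" for n unfolding g_def using G(1) by (intro continuous_intros)
  have B0: "0 \<le> B" using B[of 0] by (meson abs_ge_zero order_trans)
  have gB: "\<bar>g n x\<bar> \<le> B" for n x using B0 by (auto simp: g_def)
  have gb: "bdd_borel (g n)" for n using gc gB by (auto simp: bdd_borel_def intro: borel_measurable_continuous_onI)
  have [measurable]: "g n \<in> borel_measurable borel" for n using gb by (rule bdd_borel_measurable)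
  have "AE x in lebesgue. x \<notin> Nu" using Nu by (intro AE_not_in) (simp add: negligible_iff_null_sets)
  then have ae: "AE x in lborel. x \<notin> Nu" by (simp add: AE_completion_iff)
  have lim: "(\<lambda>n. g n x) \<longlonglongrightarrow> f x" if "x \<notin> Nu" for x
  proof -
    have "(\<lambda>n. max (-B) (min B (G n x))) \<longlonglongrightarrow> max (-B) (min B (f x))"
      by (intro tendsto_max tendsto_min tendsto_const G(2) that)
    then show ?thesis using B[of x] by (simp add: g_def abs_le_iff)
  qed
  have "(\<lambda>n. \<integral>x. indicator {a..b} x *\<^sub>R (f x - g n x)\<^sup>2 \<partial>lborel) \<longlonglongrightarrow> (\<integral>x. 0 \<partial>(lborel :: real measure))"
  proof (rule integral_dominated_convergence[where w = "\<lambda>x. indicator {a..b} x * (2 * B)\<^sup>2"])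
    show "AE x in lborel. (\<lambda>n. indicator {a..b} x *\<^sub>R (f x - g n x)\<^sup>2) \<longlonglongrightarrow> 0"
      using ae
    proof eventually_elim
      case (elim x)
      have "(\<lambda>n. indicator {a..b} x *\<^sub>R (f x - g n x)\<^sup>2) \<longlonglongrightarrow> indicator {a..b} x *\<^sub>R (f x - f x)\<^sup>2"
        by (intro tendsto_intros lim elim)
      then show ?case by simp
    qed
    show "integrable lborel (\<lambda>x. indicator {a..b} x * (2 * B)\<^sup>2)"
      by (intro integrable_mult_left integrable_real_indicator) (auto simp: emeasure_lborel_Icc_eq)
    show "AE x in lborel. norm (indicator {a..b} x *\<^sub>R (f x - g n x)\<^sup>2) \<le> indicator {a..b} x * (2 * B)\<^sup>2" for n
    proof (intro AE_I2)
      fix x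
      have "\<bar>f x - g n x\<bar> \<le> 2 * B" using B[of x] gB[of n x] by linarith
      then have "(f x - g n x)\<^sup>2 \<le> (2 * B)\<^sup>2" by (metis abs_ge_zero power2_abs power_mono)
      then show "norm (indicator {a..b} x *\<^sub>R (f x - g n x)\<^sup>2) \<le> indicator {a..b} x * (2 * B)\<^sup>2"
        by (simp split: split_indicator)
    qed
  qed auto
  then have "eventually (\<lambda>n. (LINT x:{a..b}|lborel. (f x - g n x)\<^sup>2) < e) sequentially"
    using order_tendstoD(2)[of _ "0::real" sequentially e] e by (simp add: set_lebesgue_integral_def)
  then obtain n where "(LINT x:{a..b}|lborel. (f x - g n x)\<^sup>2) < e" by (auto simp: eventually_sequentially)
  then show ?thesis using gc gb by blast
qed

lemma set_integral_bdd_mono: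
  "bdd_borel f \<Longrightarrow> bdd_borel g \<Longrightarrow> (\<And>x. x \<in> {a..b} \<Longrightarrow> f x \<le> g x) \<Longrightarrow>
    (LINT x:{a..b}|lborel. f x) \<le> (LINT x:{a..b}|lborel. g x)"
  by (intro set_integral_mono set_integrable_bdd[of _ _ a b]) auto

lemma bdd_borel_add: "bdd_borel f \<Longrightarrow> bdd_borel g \<Longrightarrow> bdd_borel (\<lambda>x. f x + g x)"
  using bdd_borel_diff[of f "\<lambda>x. 0 - g x"] bdd_borel_diff[OF bdd_borel_const, of g 0] by simp

lemma bdd_borel_cmult: "bdd_borel f \<Longrightarrow> bdd_borel (\<lambda>x. c * f x)"
  by (intro bdd_borel_mult bdd_borel_const)

lemma bdd_borel_sum: "(\<And>i. i \<in> I \<Longrightarrow> bdd_borel (f i)) \<Longrightarrow> bdd_borel (\<lambda>x. \<Sum>i\<in>I. f i x)"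
  by (induction I rule: infinite_finite_induct) (auto intro: bdd_borel_add bdd_borel_const)

text \<open>Density argument: with a continuous \<open>g\<close> near \<open>f\<close> and
  \<open>u = f - g\<close>, the error is that of \<open>g\<close> plus \<open>u\<close> minus the
  image of \<open>u\<close>, and the image is controlled by the \<open>L\<^sup>2\<close> bound
  uniformly in \<open>N\<close>.\<close>

lemma quasi_interp_tendsto:
  assumes ab: "a < b" and r: "0 < r" and f: "bdd_borel f" and e: "e > 0"
  shows "\<exists>N0. \<forall>N\<ge>N0. 0 < N \<longrightarrow> (LINT x:{a..b}|lborel. (f x - quasi_interp a b r N f x)\<^sup>2) \<le> e"
proof -
  obtain C where C: "C \<ge> 0" "\<And>N u. 0 < N \<Longrightarrow> bdd_borel u \<Longrightarrow>
    (LINT x:{a..b}|lborel. (quasi_interp a b r N u x)\<^sup>2) \<le> C * (LINT x:{a..b}|lborel. (u x)\<^sup>2)"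
    using quasi_interp_L2_bound[OF ab r] by blast
  \<comment> \<open>The square of a sum of three terms is at most 3 times the sum of the squares.
    The two terms with \<open>u\<close> contribute \<open>3 * e1 * (1 + C) = e / 2\<close>, and
    \<open>e2\<close> is chosen to contribute the other half.\<close>
  define e1 where "e1 = (e / 6) / (1 + C)"
  have e1: "e1 > 0" using e C by (simp add: e1_def)
  obtain g where g: "continuous_on UNIV g" "bdd_borel g" "(LINT x:{a..b}|lborel. (f x - g x)\<^sup>2) < e1"
    using continuous_L2_approx[OF f e1] by blast
  define e2 where "e2 = sqrt ((e / 6) / (b - a))"
  have e2: "e2 > 0" "e2\<^sup>2 = (e / 6) / (b - a)" using e ab by (auto simp: e2_def)
  obtain N0 where N0: "\<And>N x. N \<ge> N0 \<Longrightarrow> 0 < N \<Longrightarrow> x \<in> {a..b} \<Longrightarrow> \<bar>g x - quasi_interp a b r N g x\<bar> \<le> e2"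
    using quasi_interp_tendsto_continuous[OF ab r g(1,2) e2(1)] by blast
  show ?thesis
  proof (intro exI[of _ N0] allI impI)
    fix N assume N: "N0 \<le> N" "0 < N"
    define u where "u x = f x - g x" for x
    have u: "bdd_borel u" unfolding u_def by (intro bdd_borel_diff f g)
    have qb: "bdd_borel (quasi_interp a b r N v)" for v using bdd_borel_pw_poly[OF ab N(2) quasi_interp_mem[OF ab]] .
    have "(LINT x:{a..b}|lborel. (f x - quasi_interp a b r N f x)\<^sup>2)
       \<le> (LINT x:{a..b}|lborel. (3 * (u x)\<^sup>2 + 3 * e2\<^sup>2) + 3 * (quasi_interp a b r N u x)\<^sup>2)"
    proof (rule set_integral_bdd_mono)
      fix x assume x: "x \<in> {a..b}"
      define p where "p = u x"
      define q where "q = g x - quasi_interp a b r N g x"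
      define w where "w = quasi_interp a b r N u x"
      have "quasi_interp a b r N u x = quasi_interp a b r N f x - quasi_interp a b r N g x"
        unfolding u_def by (rule quasi_interp_diff[OF ab N(2) f g(2)])
      then have eq: "f x - quasi_interp a b r N f x = p + q - w" by (simp add: p_def q_def w_def u_def)
      have "0 \<le> (p - q)\<^sup>2 + (p + w)\<^sup>2 + (q + w)\<^sup>2" by simp
      then have "(p + q - w)\<^sup>2 \<le> 3 * p\<^sup>2 + 3 * q\<^sup>2 + 3 * w\<^sup>2" by (simp add: power2_eq_square algebra_simps)
      moreover have "q\<^sup>2 \<le> e2\<^sup>2" using N0[OF N x] unfolding q_def by (metis abs_ge_zero power2_abs power_mono)
      ultimately show "(f x - quasi_interp a b r N f x)\<^sup>2 \<le> (3 * (u x)\<^sup>2 + 3 * e2\<^sup>2) + 3 * (quasi_interp a b r N u x)\<^sup>2"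
        unfolding eq p_def w_def by linarith
    qed (auto intro!: bdd_borel_square bdd_borel_add bdd_borel_cmult bdd_borel_diff bdd_borel_const bdd_borel_mult f u qb)
    also have "\<dots> = 3 * (LINT x:{a..b}|lborel. (u x)\<^sup>2) + 3 * e2\<^sup>2 * (b - a) + 3 * (LINT x:{a..b}|lborel. (quasi_interp a b r N u x)\<^sup>2)"
    proof -
      have "set_integrable lborel {a..b} (\<lambda>x. 3 * (u x)\<^sup>2)" "set_integrable lborel {a..b} (\<lambda>x. 3 * e2\<^sup>2)"
        "set_integrable lborel {a..b} (\<lambda>x. 3 * (quasi_interp a b r N u x)\<^sup>2)"
        by (auto intro!: set_integrable_bdd[of _ _ a b] bdd_borel_square bdd_borel_cmult bdd_borel_const u qb)
      moreover have "(LINT x:{a..b}|lborel. 3 * e2\<^sup>2) = 3 * e2\<^sup>2 * (b - a)"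
        using ab unfolding set_lebesgue_integral_def by simp
      ultimately show ?thesis by (simp add: set_integral_add del: set_integral_const)
    qed
    also have "\<dots> \<le> 3 * e1 + 3 * e2\<^sup>2 * (b - a) + 3 * (C * e1)"
    proof -
      have "(LINT x:{a..b}|lborel. (u x)\<^sup>2) \<le> e1" using g(3) by (simp add: u_def)
      moreover have "(LINT x:{a..b}|lborel. (quasi_interp a b r N u x)\<^sup>2) \<le> C * e1"
        using C(2)[OF N(2) u] mult_left_mono[OF \<open>(LINT x:{a..b}|lborel. (u x)\<^sup>2) \<le> e1\<close> C(1)] by linarith
      ultimately show ?thesis by linarith
    qed
    also have "\<dots> = 3 * e1 * (1 + C) + 3 * e2\<^sup>2 * (b - a)" by (simp add: algebra_simps)
    also have "\<dots> = e"
    proof -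
      have "1 + C \<noteq> 0" using C(1) by linarith
      then have "e1 * (1 + C) = e / 6" unfolding e1_def by (rule nonzero_eq_divide_eq[THEN iffD1, OF _ refl])
      moreover have "e2\<^sup>2 * (b - a) = e / 6" unfolding e2(2) using ab by (intro nonzero_eq_divide_eq[THEN iffD1, OF _ refl]) simp
      ultimately show ?thesis by linarith
    qed
    finally show "(LINT x:{a..b}|lborel. (f x - quasi_interp a b r N f x)\<^sup>2) \<le> e" .
  qed
qed

text \<open>Weighted Cauchy--Schwarz along the dyadic refinements, so that no triangle inequality in
  \<open>L\<^sup>2\<close> is needed.\<close>

lemma sum_square_le_geometric:
  fixes u :: "nat \<Rightarrow> real"
  assumes q: "0 < q" "q < 1"
  shows "(\<Sum>i<n. u i)\<^sup>2 \<le> (1 / (1 - q)) * (\<Sum>i<n. (u i)\<^sup>2 / q ^ i)"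
proof -
  have "(\<Sum>i<n. u i)\<^sup>2 = (\<Sum>i<n. sqrt (q ^ i) * (u i / sqrt (q ^ i)))\<^sup>2"
    using q by (intro arg_cong[of _ _ "\<lambda>x. x\<^sup>2"] sum.cong) auto
  also have "\<dots> \<le> (\<Sum>i<n. (sqrt (q ^ i))\<^sup>2) * (\<Sum>i<n. (u i / sqrt (q ^ i))\<^sup>2)" by (rule Cauchy_Schwarz_ineq_sum)
  also have "\<dots> = (\<Sum>i<n. q ^ i) * (\<Sum>i<n. (u i)\<^sup>2 / q ^ i)" using q by (simp add: power_divide)
  also have "(\<Sum>i<n. q ^ i) \<le> 1 / (1 - q)"
    using q sum_gp_strict[of q n] by (simp add: divide_right_mono)
  finally show ?thesis using q by (simp add: mult_right_mono sum_nonneg)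
qed

lemma power2_sum_le: "(p + q)\<^sup>2 \<le> 2 * p\<^sup>2 + 2 * (q :: real)\<^sup>2"
  using sum_squares_bound[of p q] by (simp add: power2_sum)

text \<open>Doubling the number of cells repeatedly, the squared \<open>i\<close>-th increment is of
  order \<open>q ^ (2 * i)\<close> with \<open>q = 2 powr (- \<alpha>)\<close>. The weight
  \<open>1 / q ^ i\<close> of the Cauchy--Schwarz step still leaves a geometric series. The
  remainder after \<open>n\<close> doublings vanishes by
  \<open>quasi_interp_tendsto\<close>.\<close>

lemma quasi_interp_rate:
  assumes ab: "a < b" and r: "0 < r" and \<alpha>: "0 < \<alpha>"
  shows "\<exists>C\<ge>0. \<forall>f L. bdd_borel f \<longrightarrow> 0 \<le> L \<longrightarrow>
     (\<forall>h>0. (LINT x:{a..b}|lborel. (fin_diff_on a b h r f x)\<^sup>2) \<le> L * h powr (2 * \<alpha>)) \<longrightarrow>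
     (\<forall>m>0. (LINT x:{a..b}|lborel. (f x - quasi_interp a b r m f x)\<^sup>2) \<le> C * L * real m powr (- (2 * \<alpha>)))"
proof -
  obtain K where K: "K \<ge> 0" "\<And>N f. 0 < N \<Longrightarrow> bdd_borel f \<Longrightarrow>
    (LINT x:{a..b}|lborel. (quasi_interp a b r N f x - quasi_interp a b r (2 * N) f x)\<^sup>2)
      \<le> K * (LINT x:{a..b}|lborel. (fin_diff_on a b ((b - a) / (real (2 * N) * real r)) r f x)\<^sup>2)"
    using quasi_interp_refine[OF ab r] by blast
  define q where "q = 2 powr (- \<alpha>)"
  have q: "0 < q" "q < 1" using \<alpha> by (auto simp: q_def powr_less_one)
  define c0 where "c0 = ((b - a) / (2 * real r)) powr (2 * \<alpha>)"
  have c0: "c0 \<ge> 0" by (simp add: c0_def)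
  \<comment> \<open>The factor 2 comes from splitting off the remainder, one factor
    \<open>1 / (1 - q)\<close> from the weighted Cauchy--Schwarz inequality and the other from the
    final geometric series.\<close>
  define C where "C = 2 * (1 / (1 - q)) * (K * c0 * (1 / (1 - q)))"
  have C0: "C \<ge> 0" using q K c0 by (simp add: C_def)
  show ?thesis
  proof (intro exI[of _ C] conjI allI impI C0)
    fix f L m assume f: "bdd_borel f" and L: "0 \<le> (L::real)" and m: "0 < (m::nat)"
      and mod: "\<forall>h>0. (LINT x:{a..b}|lborel. (fin_diff_on a b h r f x)\<^sup>2) \<le> L * h powr (2 * \<alpha>)"
    define N where "N i = 2 ^ i * m" for i :: nat
    have N: "N i > 0" "N (Suc i) = 2 * N i" for i using m by (auto simp: N_def)
    define Q where "Q i = quasi_interp a b r (N i) f" for i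
    have Qb: "bdd_borel (Q i)" for i unfolding Q_def using bdd_borel_pw_poly[OF ab N(1) quasi_interp_mem[OF ab]] .
    have step: "(LINT x:{a..b}|lborel. (Q i x - Q (Suc i) x)\<^sup>2) \<le> K * (L * (c0 * real m powr (- (2 * \<alpha>)) * (q ^ i)\<^sup>2))" for i
    proof -
      let ?h = "(b - a) / (real (2 * N i) * real r)"
      have h: "?h > 0" using ab r N(1)[of i] by simp
      have hp: "?h powr (2 * \<alpha>) = c0 * real m powr (- (2 * \<alpha>)) * (q ^ i)\<^sup>2"
      proof -
        have e: "?h = ((b - a) / (2 * real r)) * (1 / real m) * (1 / 2 ^ i)" by (simp add: N_def)
        have "?h powr (2 * \<alpha>) = c0 * (1 / real m) powr (2 * \<alpha>) * (1 / 2 ^ i) powr (2 * \<alpha>)"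
          unfolding e c0_def powr_mult ..
        moreover have "(1 / real m) powr (2 * \<alpha>) = real m powr (- (2 * \<alpha>))"
          using m by (simp add: powr_divide powr_minus_divide)
        moreover have "(1 / 2 ^ i :: real) powr (2 * \<alpha>) = (q ^ i)\<^sup>2"
        proof -
          have "(1 / 2 ^ i :: real) = 2 powr (- real i)" by (simp add: powr_minus_divide powr_realpow)
          then have "(1 / 2 ^ i :: real) powr (2 * \<alpha>) = 2 powr (- real i * (2 * \<alpha>))" by (simp add: powr_powr)
          also have "\<dots> = (2 powr (- \<alpha>)) powr (real (i * 2))" by (simp add: powr_powr algebra_simps)
          also have "\<dots> = q ^ (i * 2)" using q unfolding q_def by (simp add: powr_realpow[symmetric])
          finally show ?thesis by (simp add: power_mult)
        qed
        ultimately show ?thesis by simp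
      qed
      have "(LINT x:{a..b}|lborel. (Q i x - Q (Suc i) x)\<^sup>2) \<le> K * (LINT x:{a..b}|lborel. (fin_diff_on a b ?h r f x)\<^sup>2)"
        unfolding Q_def N(2) by (rule K(2)[OF N(1) f])
      also have "\<dots> \<le> K * (L * ?h powr (2 * \<alpha>))" using mod h K(1) by (intro mult_left_mono) auto
      finally show ?thesis unfolding hp .
    qed
    have main: "(LINT x:{a..b}|lborel. (f x - Q 0 x)\<^sup>2) \<le> C * L * real m powr (- (2 * \<alpha>)) + 2 * (LINT x:{a..b}|lborel. (f x - Q n x)\<^sup>2)" for n
    proof -
      define c1 where "c1 = 2 * (1 / (1 - q))"
      have c1: "c1 \<ge> 0" using q by (simp add: c1_def)
      have "(LINT x:{a..b}|lborel. (f x - Q 0 x)\<^sup>2) \<le> (LINT x:{a..b}|lborel. (\<Sum>i<n. c1 / q ^ i * (Q i x - Q (Suc i) x)\<^sup>2) + 2 * (f x - Q n x)\<^sup>2)"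
      proof (rule set_integral_bdd_mono)
        fix x
        have "(\<Sum>i<n. Q (Suc i) x - Q i x) = Q n x - Q 0 x" by (rule sum_lessThan_telescope)
        then have eq: "f x - Q 0 x = (\<Sum>i<n. Q (Suc i) x - Q i x) + (f x - Q n x)" by simp
        have 1: "(f x - Q 0 x)\<^sup>2 \<le> 2 * (\<Sum>i<n. Q (Suc i) x - Q i x)\<^sup>2 + 2 * (f x - Q n x)\<^sup>2"
          unfolding eq by (rule power2_sum_le)
        have "2 * (\<Sum>i<n. Q (Suc i) x - Q i x)\<^sup>2 \<le> 2 * ((1 / (1 - q)) * (\<Sum>i<n. (Q (Suc i) x - Q i x)\<^sup>2 / q ^ i))"
          by (intro mult_left_mono sum_square_le_geometric[OF q]) simp
        also have "\<dots> = (\<Sum>i<n. c1 / q ^ i * (Q i x - Q (Suc i) x)\<^sup>2)"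
          by (simp add: c1_def sum_distrib_left power2_commute)
        finally show "(f x - Q 0 x)\<^sup>2 \<le> (\<Sum>i<n. c1 / q ^ i * (Q i x - Q (Suc i) x)\<^sup>2) + 2 * (f x - Q n x)\<^sup>2" using 1 by linarith
      qed (intro bdd_borel_add bdd_borel_sum bdd_borel_cmult bdd_borel_square bdd_borel_diff f Qb)+
      also have "\<dots> = (\<Sum>i<n. c1 / q ^ i * (LINT x:{a..b}|lborel. (Q i x - Q (Suc i) x)\<^sup>2)) + 2 * (LINT x:{a..b}|lborel. (f x - Q n x)\<^sup>2)"
      proof -
        have i1: "set_integrable lborel {a..b} (\<lambda>x. c1 / q ^ i * (Q i x - Q (Suc i) x)\<^sup>2)" for i
          by (intro set_integrable_bdd[of _ _ a b] bdd_borel_square bdd_borel_cmult bdd_borel_diff Qb) auto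
        have i2: "set_integrable lborel {a..b} (\<lambda>x. 2 * (f x - Q n x)\<^sup>2)"
          by (intro set_integrable_bdd[of _ _ a b] bdd_borel_square bdd_borel_cmult bdd_borel_diff Qb f) auto
        show ?thesis
          unfolding set_integral_add(2)[OF set_integral_sum_real(2)[OF i1] i2] set_integral_sum_real(1)[OF i1] by simp
      qed
      also have "(\<Sum>i<n. c1 / q ^ i * (LINT x:{a..b}|lborel. (Q i x - Q (Suc i) x)\<^sup>2)) \<le> (\<Sum>i<n. c1 * (K * c0) * L * real m powr (- (2 * \<alpha>)) * q ^ i)"
      proof (rule sum_mono)
        fix i
        have "c1 / q ^ i * (LINT x:{a..b}|lborel. (Q i x - Q (Suc i) x)\<^sup>2) \<le> c1 / q ^ i * (K * (L * (c0 * real m powr (- (2 * \<alpha>)) * (q ^ i)\<^sup>2)))"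
          using c1 q by (intro mult_left_mono step) auto
        also have "\<dots> = c1 * (K * c0) * L * real m powr (- (2 * \<alpha>)) * q ^ i"
          using q by (simp add: power2_eq_square field_simps)
        finally show "c1 / q ^ i * (LINT x:{a..b}|lborel. (Q i x - Q (Suc i) x)\<^sup>2) \<le> c1 * (K * c0) * L * real m powr (- (2 * \<alpha>)) * q ^ i" .
      qed
      also have "(\<Sum>i<n. c1 * (K * c0) * L * real m powr (- (2 * \<alpha>)) * q ^ i) = c1 * (K * c0) * L * real m powr (- (2 * \<alpha>)) * (\<Sum>i<n. q ^ i)"
        by (simp add: sum_distrib_left)
      also have "\<dots> \<le> c1 * (K * c0) * L * real m powr (- (2 * \<alpha>)) * (1 / (1 - q))"
      proof (rule mult_left_mono)
        show "(\<Sum>i<n. q ^ i) \<le> 1 / (1 - q)" using q sum_gp_strict[of q n] by (simp add: divide_right_mono)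
      qed (use c1 K c0 L in auto)
      also have "\<dots> = C * L * real m powr (- (2 * \<alpha>))" by (simp add: C_def c1_def)
      finally show ?thesis by simp
    qed
    show "(LINT x:{a..b}|lborel. (f x - quasi_interp a b r m f x)\<^sup>2) \<le> C * L * real m powr (- (2 * \<alpha>))"
    proof (rule field_le_epsilon)
      fix e :: real assume e: "0 < e"
      obtain N0 where N0: "\<And>M. M \<ge> N0 \<Longrightarrow> 0 < M \<Longrightarrow> (LINT x:{a..b}|lborel. (f x - quasi_interp a b r M f x)\<^sup>2) \<le> e / 2"
        using quasi_interp_tendsto[OF ab r f, of "e / 2"] e by auto
      have "N0 \<le> N N0"
      proof -
        have "N0 \<le> 2 ^ N0" using less_exp[of N0] by simp
        also have "\<dots> \<le> N N0" using m by (simp add: N_def)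
        finally show ?thesis .
      qed
      from N0[OF this N(1)] have "(LINT x:{a..b}|lborel. (f x - Q N0 x)\<^sup>2) \<le> e / 2" by (simp add: Q_def)
      with main[of N0] show "(LINT x:{a..b}|lborel. (f x - quasi_interp a b r m f x)\<^sup>2) \<le> C * L * real m powr (- (2 * \<alpha>)) + e"
        by (simp add: Q_def N_def)
    qed
  qed
qed

section \<open>From the Besov seminorm to approximation in mean square\<close>

text \<open>For finite \<open>p\<close>, put \<open>u = \<bar>g x\<bar> / A\<close>; as the exponent
  is at least 2, \<open>u\<^sup>2 \<le> 1 + u powr P\<close> holds pointwise. Integration gives
  \<open>b - a\<close> from the first term and at most 1 from the second, both times
  \<open>A\<^sup>2\<close>.\<close>

lemma nn_integral_square_le_of_Lp_norm:
  assumes ab: "a < b" and p: "2 \<le> p" and g[measurable]: "g \<in> borel_measurable borel" and A: "0 < A"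
    and le: "Lp_norm a b p g \<le> ennreal A"
  shows "(\<integral>\<^sup>+x. ennreal (indicator {a..b} x * (g x)\<^sup>2) \<partial>lborel) \<le> ennreal (A\<^sup>2 * ((b - a) + 1))"
proof (cases "p = \<infinity>")
  case True
  have "AE x in restrict_space lborel {a..b}. ennreal \<bar>g x\<bar> \<le> Linf_norm a b g"
    unfolding Linf_norm_def by (rule esssup_AE)
  then have "AE x in lborel. x \<in> {a..b} \<longrightarrow> ennreal \<bar>g x\<bar> \<le> Linf_norm a b g"
    by (subst (asm) AE_restrict_space_iff) auto
  then have "AE x in lborel. ennreal (indicator {a..b} x * (g x)\<^sup>2) \<le> ennreal (A\<^sup>2) * indicator {a..b} x"
  proof eventually_elim
    case (elim x)
    show ?case
    proof (cases "x \<in> {a..b}")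
      case x: True
      then have "ennreal \<bar>g x\<bar> \<le> ennreal A" using elim le True by (auto simp: Lp_norm_def intro: order_trans)
      then have "\<bar>g x\<bar> \<le> A" using A by (simp add: ennreal_le_iff)
      then have "(g x)\<^sup>2 \<le> A\<^sup>2" by (metis abs_ge_zero power2_abs power_mono)
      then show ?thesis using x by (simp add: ennreal_leI)
    qed simp
  qed
  then have "(\<integral>\<^sup>+x. ennreal (indicator {a..b} x * (g x)\<^sup>2) \<partial>lborel) \<le> (\<integral>\<^sup>+x. ennreal (A\<^sup>2) * indicator {a..b} x \<partial>lborel)"
    by (rule nn_integral_mono_AE)
  also have "\<dots> = ennreal (A\<^sup>2 * (b - a))"
    using ab by (simp add: nn_integral_cmult_indicator ennreal_mult)
  also have "\<dots> \<le> ennreal (A\<^sup>2 * ((b - a) + 1))" by (intro ennreal_leI mult_left_mono) auto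
  finally show ?thesis .
next
  case False
  define P where "P = enn2real p"
  have pP: "p = ennreal P" using False by (simp add: P_def less_top)
  then have "ennreal 2 \<le> ennreal P" using p by simp
  then have P2: "2 \<le> P" by (subst (asm) ennreal_le_iff) (auto simp: P_def)
  define I where "I = (\<integral>\<^sup>+x\<in>{a..b}. ennreal (\<bar>g x\<bar> powr P) \<partial>lborel)"
  have norm: "Lp_norm a b p g = (if I = \<infinity> then \<infinity> else ennreal (enn2real I powr (1 / P)))"
    using False by (simp add: Lp_norm_def I_def P_def)
  have Ifin: "I \<noteq> \<infinity>" using norm le by (auto simp: top_unique)
  then have "ennreal (enn2real I powr (1 / P)) \<le> ennreal A" using norm le by simp
  then have rt: "enn2real I powr (1 / P) \<le> A" using A by (simp add: ennreal_le_iff)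
  have "enn2real I = (enn2real I powr (1 / P)) powr P" using P2 by (simp add: powr_powr)
  also have "\<dots> \<le> A powr P" using rt P2 by (intro powr_mono2) auto
  finally have IA: "I \<le> ennreal (A powr P)" using Ifin by (metis ennreal_enn2real ennreal_leI infinity_ennreal_def less_top)
  have pt: "(g x)\<^sup>2 \<le> A\<^sup>2 + A powr (2 - P) * \<bar>g x\<bar> powr P" for x
  proof -
    define u where "u = \<bar>g x\<bar> / A"
    have u0: "0 \<le> u" using A by (simp add: u_def)
    have "u\<^sup>2 \<le> 1 + u powr P"
    proof (cases "u \<le> 1")
      case True
      then have "u\<^sup>2 \<le> 1" using u0 by (simp add: power_le_one)
      then show ?thesis by (simp add: add_increasing2)
    next
      case False
      then have "u powr 2 \<le> u powr P" using P2 by (intro powr_mono) auto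
      then show ?thesis using False by (simp add: powr_numeral)
    qed
    then have "A\<^sup>2 * u\<^sup>2 \<le> A\<^sup>2 * (1 + u powr P)" by (intro mult_left_mono) auto
    moreover have "A\<^sup>2 * u\<^sup>2 = (g x)\<^sup>2" using A by (simp add: u_def power_divide)
    moreover have "A\<^sup>2 * u powr P = A powr (2 - P) * \<bar>g x\<bar> powr P"
    proof -
      have "u powr P = \<bar>g x\<bar> powr P / A powr P" unfolding u_def by (rule powr_divide)
      moreover have "A powr (2 - P) = A\<^sup>2 / A powr P" using A by (simp add: powr_diff powr_numeral)
      ultimately show ?thesis by simp
    qed
    ultimately show ?thesis by (simp add: distrib_left)
  qed
  have "(\<integral>\<^sup>+x. ennreal (indicator {a..b} x * (g x)\<^sup>2) \<partial>lborel)
     \<le> (\<integral>\<^sup>+x. ennreal (A\<^sup>2) * indicator {a..b} x + ennreal (A powr (2 - P)) * (ennreal (\<bar>g x\<bar> powr P) * indicator {a..b} x) \<partial>lborel)"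
  proof (rule nn_integral_mono)
    fix x
    show "ennreal (indicator {a..b} x * (g x)\<^sup>2) \<le> ennreal (A\<^sup>2) * indicator {a..b} x + ennreal (A powr (2 - P)) * (ennreal (\<bar>g x\<bar> powr P) * indicator {a..b} x)"
    proof (cases "x \<in> {a..b}")
      case True
      have "ennreal ((g x)\<^sup>2) \<le> ennreal (A\<^sup>2 + A powr (2 - P) * \<bar>g x\<bar> powr P)" by (rule ennreal_leI[OF pt])
      also have "\<dots> = ennreal (A\<^sup>2) + ennreal (A powr (2 - P)) * ennreal (\<bar>g x\<bar> powr P)"
        by (simp add: ennreal_plus ennreal_mult)
      finally show ?thesis using True by simp
    qed simp
  qed
  also have "\<dots> = ennreal (A\<^sup>2) * emeasure lborel {a..b} + ennreal (A powr (2 - P)) * I"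
    unfolding I_def by (subst nn_integral_add) (auto simp: nn_integral_cmult nn_integral_cmult_indicator)
  also have "\<dots> \<le> ennreal (A\<^sup>2) * ennreal (b - a) + ennreal (A powr (2 - P)) * ennreal (A powr P)"
    using IA ab by (intro add_mono mult_left_mono) auto
  also have "\<dots> = ennreal (A\<^sup>2 * (b - a) + A powr (2 - P) * A powr P)"
    using ab by (simp add: ennreal_plus ennreal_mult)
  also have "A powr (2 - P) * A powr P = A\<^sup>2" using A by (simp add: powr_add[symmetric] powr_numeral)
  also have "A\<^sup>2 * (b - a) + A\<^sup>2 = A\<^sup>2 * ((b - a) + 1)" by (simp add: algebra_simps)
  finally show ?thesis .
qed

lemma Lp_norm_le_of_besov:
  assumes h: "0 < h" and le: "besov_seminorm a b \<alpha> p f \<le> ennreal L" and L: "0 \<le> L"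
  shows "Lp_norm a b p (fin_diff_on a b h (nat \<lfloor>\<alpha>\<rfloor> + 1) f) \<le> ennreal (L * h powr \<alpha>)"
proof -
  let ?N = "Lp_norm a b p (fin_diff_on a b h (nat \<lfloor>\<alpha>\<rfloor> + 1) f)"
  have "?N \<le> (SUP h\<in>{0<..h}. Lp_norm a b p (fin_diff_on a b h (nat \<lfloor>\<alpha>\<rfloor> + 1) f))"
    using h by (intro SUP_upper2[of h]) auto
  then have "ennreal (1 / h powr \<alpha>) * ?N \<le> ennreal (1 / h powr \<alpha>) * (SUP h\<in>{0<..h}. Lp_norm a b p (fin_diff_on a b h (nat \<lfloor>\<alpha>\<rfloor> + 1) f))"
    by (rule mult_left_mono) simp
  also have "\<dots> \<le> besov_seminorm a b \<alpha> p f"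
    unfolding besov_seminorm_def using h by (intro SUP_upper2[of h]) auto
  also note le
  finally have "ennreal (h powr \<alpha>) * (ennreal (1 / h powr \<alpha>) * ?N) \<le> ennreal (h powr \<alpha>) * ennreal L"
    by (rule mult_left_mono) simp
  also have "ennreal (h powr \<alpha>) * (ennreal (1 / h powr \<alpha>) * ?N) = ?N"
    using h by (simp add: mult.assoc[symmetric] ennreal_mult[symmetric])
  also have "ennreal (h powr \<alpha>) * ennreal L = ennreal (L * h powr \<alpha>)"
    using L by (simp add: ennreal_mult[symmetric] mult.commute)
  finally show ?thesis .
qed

lemma fin_diff_cong: "(\<And>i. i \<le> r \<Longrightarrow> f (x + real i * h) = g (x + real i * h)) \<Longrightarrow> fin_diff h r f x = fin_diff h r g x"
proof (induction r arbitrary: x)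
  case 0
  from 0[of 0] show ?case by simp
next
  case (Suc r)
  have "f (x + h + real i * h) = g (x + h + real i * h)" if "i \<le> r" for i
    using Suc.prems[of "Suc i"] that by (simp add: algebra_simps)
  then have "fin_diff h r f (x + h) = fin_diff h r g (x + h)" by (rule Suc.IH)
  moreover have "fin_diff h r f x = fin_diff h r g x" using Suc.prems by (intro Suc.IH) auto
  ultimately show ?case by simp
qed

lemma AE_lborel_shift:
  fixes c :: real
  assumes "AE x in lborel. P x" shows "AE x in lborel. P (x + c)"
proof -
  have "distr lborel borel (\<lambda>x. c + x) = (lborel :: real measure)"
    using lborel_distr_plus[of c] by simp
  then have "AE x in distr lborel borel (\<lambda>x. c + x). P x" using assms by (simp only:)
  then have "AE x in lborel. P (c + x)" by (rule AE_distrD[rotated]) simp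
  then show ?thesis by (simp add: add.commute)
qed

lemma AE_fin_diff_on_cong:
  assumes h: "0 < h" and ae: "AE x in lborel. x \<in> {a..b} \<longrightarrow> f x = g x"
  shows "AE x in lborel. fin_diff_on a b h r f x = fin_diff_on a b h r g x"
proof -
  have "AE x in lborel. \<forall>i\<in>{..r}. x + real i * h \<in> {a..b} \<longrightarrow> f (x + real i * h) = g (x + real i * h)"
    by (intro AE_finite_allI AE_lborel_shift[OF ae]) simp
  then show ?thesis
  proof eventually_elim
    case (elim x)
    have "f (x + real i * h) = g (x + real i * h)" if i: "i \<le> r" and x: "x \<in> {a..b}" "x + real r * h \<in> {a..b}" for i
    proof -
      have "0 \<le> real i * h" "real i * h \<le> real r * h" using h i by (auto intro: mult_right_mono)
      then have "x + real i * h \<in> {a..b}" using x by auto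
      then show ?thesis using elim i by auto
    qed
    then show ?case unfolding fin_diff_on_def using fin_diff_cong[of r f x h g] by auto
  qed
qed

lemma set_integral_cong_AE_Icc:
  fixes f g :: "real \<Rightarrow> real"
  assumes "f \<in> borel_measurable borel" "g \<in> borel_measurable borel" "AE x in lborel. x \<in> {a..b} \<longrightarrow> f x = g x"
  shows "(LINT x:{a..b}|lborel. f x) = (LINT x:{a..b}|lborel. g x)"
  unfolding set_lebesgue_integral_def
  by (rule integral_cong_AE) (use assms in \<open>auto elim!: eventually_mono split: split_indicator\<close>)

lemma pw_poly_mono: "k \<le> k' \<Longrightarrow> pw_poly a b k m \<subseteq> pw_poly a b k' m"
  unfolding pw_poly_def using order_trans by blast

text \<open>The order \<open>r = \<lfloor>\<alpha>\<rfloor> + 1\<close> of the seminorm gives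
  approximants of degree at most \<open>\<lfloor>\<alpha>\<rfloor>\<close>, and this is at most
  \<open>k\<close>. The factor \<open>(b - a) + 1\<close> is the price of passing from
  \<open>L\<^sup>p\<close> to \<open>L\<^sup>2\<close>.\<close>

lemma besov_approx:
  assumes ab: "a < b" and \<alpha>: "0 < \<alpha>" "\<alpha> < real k + 1" and p: "2 \<le> p"
  shows "\<exists>C\<ge>0. \<forall>f R L. f \<in> borel_measurable borel \<longrightarrow> (AE x in lborel. x \<in> {a..b} \<longrightarrow> \<bar>f x\<bar> \<le> R) \<longrightarrow> 0 < L \<longrightarrow>
      besov_seminorm a b \<alpha> p f \<le> ennreal L \<longrightarrow>
      (\<forall>m>0. \<exists>q\<in>pw_poly a b k m. (LINT x:{a..b}|lborel. (f x - q x)\<^sup>2) \<le> C * L\<^sup>2 * real m powr (- (2 * \<alpha>)))"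
proof -
  define r where "r = nat \<lfloor>\<alpha>\<rfloor> + 1"
  have r: "0 < r" by (simp add: r_def)
  have "nat \<lfloor>\<alpha>\<rfloor> \<le> k"
  proof -
    have "\<lfloor>\<alpha>\<rfloor> < int k + 1" using \<alpha> by linarith
    then show ?thesis by linarith
  qed
  then have rk: "r - 1 \<le> k" by (simp add: r_def)
  obtain C where C: "C \<ge> 0" "\<And>f L m. bdd_borel f \<Longrightarrow> 0 \<le> L \<Longrightarrow>
     (\<forall>h>0. (LINT x:{a..b}|lborel. (fin_diff_on a b h r f x)\<^sup>2) \<le> L * h powr (2 * \<alpha>)) \<Longrightarrow> 0 < m \<Longrightarrow>
     (LINT x:{a..b}|lborel. (f x - quasi_interp a b r m f x)\<^sup>2) \<le> C * L * real m powr (- (2 * \<alpha>))"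
    using quasi_interp_rate[OF ab r \<alpha>(1)] by blast
  show ?thesis
  proof (intro exI[of _ "C * ((b - a) + 1)"] conjI allI impI)
    fix f R L m assume f[measurable]: "f \<in> borel_measurable borel" and R: "AE x in lborel. x \<in> {a..b} \<longrightarrow> \<bar>f x\<bar> \<le> R"
      and L: "0 < L" and B: "besov_seminorm a b \<alpha> p f \<le> ennreal L" and m: "0 < (m::nat)"
    \<comment> \<open>\<open>f\<close> is bounded only almost everywhere. The truncation is bounded
      everywhere, and its differences of order \<open>r\<close> agree with those of \<open>f\<close>
      off a null set, since only finitely many translates enter.\<close>
    define g where "g x = (if \<bar>f x\<bar> \<le> R then f x else 0)" for x
    have gm[measurable]: "g \<in> borel_measurable borel" unfolding g_def by measurable
    have gb: "bdd_borel g" unfolding bdd_borel_def using gm by (auto simp: g_def intro!: exI[of _ "\<bar>R\<bar>"])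
    have fg: "AE x in lborel. x \<in> {a..b} \<longrightarrow> f x = g x" using R by eventually_elim (auto simp: g_def)
    have mod: "(LINT x:{a..b}|lborel. (fin_diff_on a b h r g x)\<^sup>2) \<le> (L\<^sup>2 * ((b - a) + 1)) * h powr (2 * \<alpha>)" if h: "0 < h" for h
    proof -
      have fm: "fin_diff h r u \<in> borel_measurable borel" if "u \<in> borel_measurable borel" for r u
      proof (induction r)
        case 0
        have "fin_diff h 0 u = u" by (rule ext) simp
        then show ?case using that by simp
      next
        case (Suc r)
        have "fin_diff h (Suc r) u = (\<lambda>x. fin_diff h r u (x + h) - fin_diff h r u x)" by (rule ext) simp
        then show ?case using Suc by simp
      qed
      have fom[measurable]: "fin_diff_on a b h r u \<in> borel_measurable borel" if "u \<in> borel_measurable borel" for u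
      proof -
        note [measurable] = fm[OF that]
        show ?thesis unfolding fin_diff_on_def by measurable
      qed
      define A where "A = L * h powr \<alpha>"
      have A: "0 < A" using L h by (simp add: A_def)
      have "(\<integral>\<^sup>+x. ennreal (indicator {a..b} x * (fin_diff_on a b h r f x)\<^sup>2) \<partial>lborel) \<le> ennreal (A\<^sup>2 * ((b - a) + 1))"
        using Lp_norm_le_of_besov[OF h B] L fom[OF f] A unfolding r_def A_def
        by (intro nn_integral_square_le_of_Lp_norm[OF ab p]) auto
      moreover have "(\<integral>\<^sup>+x. ennreal (indicator {a..b} x * (fin_diff_on a b h r f x)\<^sup>2) \<partial>lborel)
         = (\<integral>\<^sup>+x. ennreal (indicator {a..b} x * (fin_diff_on a b h r g x)\<^sup>2) \<partial>lborel)"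
        using AE_fin_diff_on_cong[OF h fg, of r] by (intro nn_integral_cong_AE) (auto elim!: eventually_mono)
      ultimately have le: "(\<integral>\<^sup>+x. ennreal (indicator {a..b} x * (fin_diff_on a b h r g x)\<^sup>2) \<partial>lborel) \<le> ennreal (A\<^sup>2 * ((b - a) + 1))" by simp
      have "(LINT x:{a..b}|lborel. (fin_diff_on a b h r g x)\<^sup>2) \<le> A\<^sup>2 * ((b - a) + 1)"
      proof -
        have "set_integrable lborel {a..b} (\<lambda>x. (fin_diff_on a b h r g x)\<^sup>2)"
          by (intro set_integrable_bdd[of _ _ a b] bdd_borel_square bdd_borel_fin_diff_on gb) auto
        then have "integrable lborel (\<lambda>x. indicator {a..b} x * (fin_diff_on a b h r g x)\<^sup>2)" by (simp add: set_integrable_def)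
        from nn_integral_eq_integral[OF this] le
        have "ennreal (\<integral>x. indicator {a..b} x * (fin_diff_on a b h r g x)\<^sup>2 \<partial>lborel) \<le> ennreal (A\<^sup>2 * ((b - a) + 1))" by simp
        then show ?thesis using ab by (subst (asm) ennreal_le_iff) (auto simp: set_lebesgue_integral_def)
      qed
      also have "A\<^sup>2 = L\<^sup>2 * h powr (2 * \<alpha>)"
      proof -
        have "(h powr \<alpha>)\<^sup>2 = h powr (2 * \<alpha>)" by (simp add: power2_eq_square powr_add[symmetric])
        then show ?thesis by (simp add: A_def power_mult_distrib)
      qed
      finally show ?thesis by (simp add: mult_ac)
    qed
    have "(LINT x:{a..b}|lborel. (g x - quasi_interp a b r m g x)\<^sup>2) \<le> C * (L\<^sup>2 * ((b - a) + 1)) * real m powr (- (2 * \<alpha>))"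
      using mod ab by (intro C(2)[OF gb _ _ m]) auto
    moreover have "(LINT x:{a..b}|lborel. (f x - quasi_interp a b r m g x)\<^sup>2) = (LINT x:{a..b}|lborel. (g x - quasi_interp a b r m g x)\<^sup>2)"
    proof (rule set_integral_cong_AE_Icc)
      have [measurable]: "quasi_interp a b r m g \<in> borel_measurable borel"
        by (rule pw_poly_borel[OF ab m quasi_interp_mem[OF ab]])
      show "(\<lambda>x. (f x - quasi_interp a b r m g x)\<^sup>2) \<in> borel_measurable borel" "(\<lambda>x. (g x - quasi_interp a b r m g x)\<^sup>2) \<in> borel_measurable borel"
        by measurable
      show "AE x in lborel. x \<in> {a..b} \<longrightarrow> (f x - quasi_interp a b r m g x)\<^sup>2 = (g x - quasi_interp a b r m g x)\<^sup>2"
        using fg by eventually_elim auto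
    qed
    moreover have "quasi_interp a b r m g \<in> pw_poly a b k m" using quasi_interp_mem[OF ab] pw_poly_mono[OF rk] by blast
    ultimately show "\<exists>q\<in>pw_poly a b k m. (LINT x:{a..b}|lborel. (f x - q x)\<^sup>2) \<le> C * ((b - a) + 1) * L\<^sup>2 * real m powr (- (2 * \<alpha>))"
      by (intro bexI[of _ "quasi_interp a b r m g"]) (auto simp: mult_ac)
  qed (use C ab in auto)
qed

section \<open>Risk of the penalized estimator\<close>

text \<open>The inequality behind the oracle bound, for a single path: \<open>bm\<close> and \<open>bs\<close> are the squared
  biases of the selected and of the reference model, \<open>chi\<close> the squared stochastic error of the
  selected one, and \<open>W\<close> the centred linear term.\<close>

lemma oracle_inequality:
  fixes c c'' T m ms bm bs chi V U W pm ps :: real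
  assumes c: "1 < c" and c'': "0 < c''" and T: "0 < T" and m: "0 < m" and ms: "0 < ms"
    and b: "0 \<le> bm" "0 \<le> bs" and chi: "chi = (U + V) / T" "0 \<le> chi"
    and crit: "bm \<le> bs + 2 * W + chi + ps - pm"
    and pen: "c * V / T + c'' * m / T \<le> pm"
  defines "\<kappa> \<equiv> min (1/4) (c''/4)" and "lam \<equiv> min (1/2) (c - 1)" and "\<tau> \<equiv> 2 * bm + 2 * bs + (m + ms) / T"
  shows "lam * (bm + chi) \<le> 3/2 * bs + ps + \<kappa> * ms / T + T / (\<kappa>\<^sup>2 * c'' * m * \<tau>\<^sup>2) * W ^ 4 + 8 * c ^ 4 / (c'' ^ 3 * m ^ 3 * T) * U ^ 4"
proof -
  have k: "0 < \<kappa>" "\<kappa> \<le> 1/4" "\<kappa> \<le> c''/4" using c'' by (auto simp: \<kappa>_def)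
  have l: "0 < lam" "lam \<le> 1/2" "lam \<le> c - 1" unfolding lam_def min_def using c by auto
  have mT: "0 < (m + ms) / T" using m ms T by simp
  have t: "0 < \<tau>" unfolding \<tau>_def using b mT by linarith
  have 1: "2 * W \<le> \<kappa> * \<tau> + W\<^sup>2 / (\<kappa> * \<tau>)"
  proof -
    have "0 \<le> (\<kappa> * \<tau> - W)\<^sup>2 / (\<kappa> * \<tau>)" using k t by simp
    also have "\<dots> = \<kappa> * \<tau> - 2 * W + W\<^sup>2 / (\<kappa> * \<tau>)" using k t by (simp add: power2_eq_square field_simps)
    finally show ?thesis by simp
  qed
  \<comment> \<open>A quarter of the penalty term \<open>c'' * m / T\<close>. One quarter is spent
    in fact 2, one in fact 5, and the remaining half is \<open>t2 / T\<close> in fact 3.\<close>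
  define t1 where "t1 = c'' / 4 * m / T"
  have t1: "0 < t1" using c'' m T by (simp add: t1_def)
  have 2: "W\<^sup>2 / (\<kappa> * \<tau>) \<le> t1 + T / (\<kappa>\<^sup>2 * c'' * m * \<tau>\<^sup>2) * W ^ 4"
  proof -
    define x where "x = W\<^sup>2 / (\<kappa> * \<tau>)"
    have "0 \<le> (x - 2 * t1)\<^sup>2 / (4 * t1)" using t1 by simp
    also have "\<dots> = x\<^sup>2 / (4 * t1) - x + t1" using t1 by (simp add: power2_eq_square field_simps)
    finally have "x \<le> t1 + x\<^sup>2 / (4 * t1)" by simp
    moreover have "x\<^sup>2 / (4 * t1) = T / (\<kappa>\<^sup>2 * c'' * m * \<tau>\<^sup>2) * W ^ 4"
      using k t c'' m T by (simp add: x_def t1_def power_divide power_mult_distrib power2_eq_square power4_eq_xxxx field_simps)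
    ultimately show ?thesis by (simp add: x_def)
  qed
  define t2 where "t2 = c'' / 2 * m"
  have t2: "0 < t2" using c'' m by (simp add: t2_def)
  have 3: "(c * U - t2) / T \<le> 8 * c ^ 4 / (c'' ^ 3 * m ^ 3 * T) * U ^ 4"
  proof -
    define y where "y = c * U"
    \<comment> \<open>Where \<open>y\<close> exceeds \<open>t2\<close>, it is at most
      \<open>y\<close> times \<open>(y / t2) ^ 3\<close>. This Markov-type step turns the excess of
      \<open>U\<close> over its share of the penalty into a fourth moment.\<close>
    have "y - t2 \<le> y ^ 4 / t2 ^ 3"
    proof (cases "y \<le> t2")
      case True
      have "0 \<le> y ^ 4 / t2 ^ 3" using t2 by simp
      then show ?thesis using True by linarith
    next
      case False
      then have "t2 ^ 3 \<le> y ^ 3" using t2 by (intro power_mono) auto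
      then have "y * t2 ^ 3 \<le> y * y ^ 3" using False t2 by (intro mult_left_mono) auto
      then have "y \<le> y ^ 4 / t2 ^ 3" using t2 by (simp add: pos_le_divide_eq power4_eq_xxxx power3_eq_cube)
      then show ?thesis using t2 by linarith
    qed
    then have "(y - t2) / T \<le> (y ^ 4 / t2 ^ 3) / T" using T by (intro divide_right_mono) auto
    also have "(y ^ 4 / t2 ^ 3) / T = 8 * c ^ 4 / (c'' ^ 3 * m ^ 3 * T) * U ^ 4"
      using c'' m T by (simp add: y_def t2_def power_mult_distrib power_divide)
    finally show ?thesis by (simp add: y_def)
  qed
  have 4: "c * chi - pm \<le> (c * U - t2) / T - 2 * t1"
  proof -
    have "c * chi = c * U / T + c * V / T" unfolding chi by (simp add: add_divide_distrib distrib_left)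
    moreover have "t2 / T + 2 * t1 = c'' * m / T" by (simp add: t1_def t2_def field_simps)
    ultimately show ?thesis using pen by (simp add: diff_divide_distrib)
  qed
  \<comment> \<open>Since \<open>2 * \<kappa> \<le> 1/2\<close>, at most half of \<open>bm\<close>
    is used up here, and the other half remains on the left side of the final inequality.\<close>
  have 5: "\<kappa> * \<tau> \<le> bm / 2 + bs / 2 + t1 + \<kappa> * ms / T"
  proof -
    have "\<kappa> * bm \<le> bm / 4" "\<kappa> * bs \<le> bs / 4" using mult_right_mono[OF k(2) b(1)] mult_right_mono[OF k(2) b(2)] by simp_all
    moreover have "\<kappa> * (m / T) \<le> t1"
      using mult_right_mono[OF k(3), of "m / T"] m T by (simp add: t1_def)
    moreover have "\<kappa> * \<tau> = 2 * (\<kappa> * bm) + 2 * (\<kappa> * bs) + \<kappa> * (m / T) + \<kappa> * ms / T"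
      by (simp add: \<tau>_def distrib_left add_divide_distrib)
    ultimately show ?thesis by linarith
  qed
  \<comment> \<open>The excess \<open>c - 1\<close> of the penalty constant over 1 is what keeps a
    positive multiple of \<open>chi\<close> on the left.\<close>
  have 6: "lam * (bm + chi) \<le> bm / 2 + (c - 1) * chi"
    using mult_right_mono[OF l(2) b(1)] mult_right_mono[OF l(3) chi(2)] by (simp add: distrib_left)
  have 7: "(c - 1) * chi = c * chi - chi" by (simp add: left_diff_distrib)
  show ?thesis using 1 2 3 4 5 6 7 crit by linarith
qed

definition proj_error :: "real \<Rightarrow> real \<Rightarrow> nat \<Rightarrow> (nat \<Rightarrow> real \<Rightarrow> real) \<Rightarrow> (real \<Rightarrow> real) \<Rightarrow> nat \<Rightarrow> real" where
  "proj_error a b k \<phi> s m = (LINT x:{a..b}|lborel. (s x - (\<Sum>l<pw_dim k m. (LINT y:{a..b}|lborel. \<phi> l y * s y) * \<phi> l x))\<^sup>2)"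

section \<open>Orthogonal projections of an essentially bounded function\<close>

lemma set_integrable_ae_bdd:
  fixes f :: "real \<Rightarrow> real"
  assumes [measurable]: "f \<in> borel_measurable borel" and B: "AE x in lborel. x \<in> {a..b} \<longrightarrow> \<bar>f x\<bar> \<le> B"
  shows "set_integrable lborel {a..b} f"
proof -
  have "integrable lborel (\<lambda>x. \<bar>B\<bar> * indicator {a..b} x)"
    by (intro integrable_mult_right integrable_real_indicator) (auto simp: emeasure_lborel_Icc_eq)
  then show ?thesis unfolding set_integrable_def
    by (rule Bochner_Integration.integrable_bound) (use B in \<open>auto elim!: eventually_mono split: split_indicator\<close>)
qed

lemma ae_bdd_mult:
  fixes f g :: "real \<Rightarrow> real"
  assumes "AE x in lborel. x \<in> {a..b} \<longrightarrow> \<bar>f x\<bar> \<le> B" "AE x in lborel. x \<in> {a..b} \<longrightarrow> \<bar>g x\<bar> \<le> C"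
  shows "AE x in lborel. x \<in> {a..b} \<longrightarrow> \<bar>f x * g x\<bar> \<le> \<bar>B\<bar> * \<bar>C\<bar>"
  using assms
proof eventually_elim
  case (elim x)
  show ?case using elim by (auto simp: abs_mult intro!: mult_mono)
qed

context
  fixes a b :: real and s :: "real \<Rightarrow> real" and R :: real and \<phi> :: "nat \<Rightarrow> real \<Rightarrow> real" and k m :: nat
  assumes ab: "a < b" and s_borel [measurable]: "s \<in> borel_measurable borel"
    and R: "AE x in lborel. x \<in> {a..b} \<longrightarrow> \<bar>s x\<bar> \<le> R" and m: "0 < m" and onb: "pw_onb a b k m \<phi>"
begin

lemma onb_mem: "l < pw_dim k m \<Longrightarrow> \<phi> l \<in> pw_poly a b k m"
  using onb by (simp add: pw_onb_def)

lemma integrable_onb_s: "l < pw_dim k m \<Longrightarrow> set_integrable lborel {a..b} (\<lambda>x. \<phi> l x * s x)"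
proof -
  assume l: "l < pw_dim k m"
  obtain B where B: "\<And>x. \<bar>\<phi> l x\<bar> \<le> B" using pw_poly_bounded[OF ab m onb_mem[OF l]] by blast
  have [measurable]: "\<phi> l \<in> borel_measurable borel" by (rule pw_poly_borel[OF ab m onb_mem[OF l]])
  show ?thesis by (rule set_integrable_ae_bdd[OF _ ae_bdd_mult[OF _ R]]) (use B in auto)
qed

lemma integrable_s_square: "set_integrable lborel {a..b} (\<lambda>x. (s x)\<^sup>2)"
  unfolding power2_eq_square by (rule set_integrable_ae_bdd[OF _ ae_bdd_mult[OF R R]]) simp

lemma integral_square_diff_onb:
  "(LINT x:{a..b}|lborel. (s x - (\<Sum>l<pw_dim k m. c l * \<phi> l x))\<^sup>2)
    = (LINT x:{a..b}|lborel. (s x)\<^sup>2) - 2 * (\<Sum>l<pw_dim k m. c l * (LINT x:{a..b}|lborel. \<phi> l x * s x)) + (\<Sum>l<pw_dim k m. (c l)\<^sup>2)"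
proof -
  let ?d = "pw_dim k m"
  let ?q = "\<lambda>x. \<Sum>l<?d. c l * \<phi> l x"
  have q: "?q \<in> pw_poly a b k m" by (intro pw_poly_sum onb_mem) simp
  have i1: "set_integrable lborel {a..b} (\<lambda>x. \<Sum>l<?d. c l * (\<phi> l x * s x))"
    by (intro set_integral_sum_real(2) set_integrable_mult_right integrable_onb_s) simp
  have i2: "set_integrable lborel {a..b} (\<lambda>x. (?q x)\<^sup>2)"
    using integrable_pw_poly_mult[OF ab m m q q] by (simp only: power2_eq_square)
  have "(s x - ?q x)\<^sup>2 = ((s x)\<^sup>2 - 2 * (\<Sum>l<?d. c l * (\<phi> l x * s x))) + (?q x)\<^sup>2" for x
  proof -
    have "(\<Sum>l<?d. c l * (\<phi> l x * s x)) = ?q x * s x" by (simp add: sum_distrib_right mult.assoc)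
    then show ?thesis by (simp add: power2_diff algebra_simps)
  qed
  then have "(LINT x:{a..b}|lborel. (s x - ?q x)\<^sup>2) = (LINT x:{a..b}|lborel. ((s x)\<^sup>2 - 2 * (\<Sum>l<?d. c l * (\<phi> l x * s x))) + (?q x)\<^sup>2)" by (simp only:)
  also have "\<dots> = (LINT x:{a..b}|lborel. (s x)\<^sup>2) - (LINT x:{a..b}|lborel. 2 * (\<Sum>l<?d. c l * (\<phi> l x * s x))) + (LINT x:{a..b}|lborel. (?q x)\<^sup>2)"
    using i1 i2 integrable_s_square
    by (subst set_integral_add(2)) (auto intro!: set_integral_diff set_integrable_mult_right)
  also have "(LINT x:{a..b}|lborel. 2 * (\<Sum>l<?d. c l * (\<phi> l x * s x))) = 2 * (\<Sum>l<?d. c l * (LINT x:{a..b}|lborel. \<phi> l x * s x))"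
  proof -
    have "(LINT x:{a..b}|lborel. (\<Sum>l<?d. c l * (\<phi> l x * s x))) = (\<Sum>l<?d. (LINT x:{a..b}|lborel. c l * (\<phi> l x * s x)))"
      by (intro set_integral_sum_real(1) set_integrable_mult_right integrable_onb_s) simp
    then show ?thesis by simp
  qed
  also have "(LINT x:{a..b}|lborel. (?q x)\<^sup>2) = (\<Sum>l<?d. (c l)\<^sup>2)" by (rule pw_onb_integral_square[OF ab m onb])
  finally show ?thesis .
qed

lemma integrable_square_diff_onb:
  "set_integrable lborel {a..b} (\<lambda>x. (s x - (\<Sum>l<pw_dim k m. c l * \<phi> l x))\<^sup>2)"
proof -
  let ?q = "\<lambda>x. \<Sum>l<pw_dim k m. c l * \<phi> l x"
  have q: "?q \<in> pw_poly a b k m" by (intro pw_poly_sum onb_mem) simp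
  obtain B where B: "\<And>x. \<bar>?q x\<bar> \<le> B" using pw_poly_bounded[OF ab m q] by blast
  have [measurable]: "?q \<in> borel_measurable borel" by (rule pw_poly_borel[OF ab m q])
  have d: "AE x in lborel. x \<in> {a..b} \<longrightarrow> \<bar>s x - ?q x\<bar> \<le> R + B"
    using R
  proof eventually_elim
    case (elim x)
    show ?case using elim B[of x] by (auto intro: order_trans[OF abs_triangle_ineq4] add_mono)
  qed
  show ?thesis unfolding power2_eq_square by (rule set_integrable_ae_bdd[OF _ ae_bdd_mult[OF d d]]) measurable
qed

lemma proj_error_eq:
  "proj_error a b k \<phi> s m = (LINT x:{a..b}|lborel. (s x)\<^sup>2) - (\<Sum>l<pw_dim k m. (LINT x:{a..b}|lborel. \<phi> l x * s x)\<^sup>2)"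
  unfolding proj_error_def integral_square_diff_onb by (simp add: power2_eq_square)

lemma proj_error_nonneg: "0 \<le> proj_error a b k \<phi> s m"
  unfolding proj_error_def set_lebesgue_integral_def by (intro Bochner_Integration.integral_nonneg) auto

lemma proj_error_le:
  assumes q: "q \<in> pw_poly a b k m"
  shows "proj_error a b k \<phi> s m \<le> (LINT x:{a..b}|lborel. (s x - q x)\<^sup>2)"
proof -
  obtain c where c: "\<And>x. q x = (\<Sum>l<pw_dim k m. c l * \<phi> l x)" using onb q unfolding pw_onb_def by meson
  define \<beta> where "\<beta> l = (LINT x:{a..b}|lborel. \<phi> l x * s x)" for l
  have "0 \<le> (\<Sum>l<pw_dim k m. (c l - \<beta> l)\<^sup>2)" by (intro sum_nonneg) auto
  also have "\<dots> = (\<Sum>l<pw_dim k m. (c l)\<^sup>2) - 2 * (\<Sum>l<pw_dim k m. c l * \<beta> l) + (\<Sum>l<pw_dim k m. (\<beta> l)\<^sup>2)"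
    by (simp add: power2_diff sum.distrib sum_subtractf sum_distrib_left mult.assoc)
  finally show ?thesis unfolding proj_error_eq c integral_square_diff_onb \<beta>_def[symmetric] by linarith
qed

text \<open>Pythagoras: the error of the projection is orthogonal to the space. For estimated
  coefficients this splits the loss into squared bias and squared stochastic error.\<close>

lemma integral_square_diff_onb_error:
  "(LINT x:{a..b}|lborel. (s x - (\<Sum>l<pw_dim k m. c l * \<phi> l x))\<^sup>2)
    = proj_error a b k \<phi> s m + (\<Sum>l<pw_dim k m. (c l - (LINT x:{a..b}|lborel. \<phi> l x * s x))\<^sup>2)"
proof -
  define \<beta> where "\<beta> l = (LINT x:{a..b}|lborel. \<phi> l x * s x)" for l
  have "(\<Sum>l<pw_dim k m. (c l - \<beta> l)\<^sup>2) = (\<Sum>l<pw_dim k m. (c l)\<^sup>2) - 2 * (\<Sum>l<pw_dim k m. c l * \<beta> l) + (\<Sum>l<pw_dim k m. (\<beta> l)\<^sup>2)"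
    by (simp add: power2_diff sum.distrib sum_subtractf sum_distrib_left mult.assoc)
  then show ?thesis unfolding proj_error_eq integral_square_diff_onb \<beta>_def[symmetric] by linarith
qed

lemma integral_s_square_le: "0 \<le> R \<Longrightarrow> (LINT x:{a..b}|lborel. (s x)\<^sup>2) \<le> R\<^sup>2 * (b - a)"
proof -
  assume R0: "0 \<le> R"
  have c: "set_integrable lborel {a..b} (\<lambda>x. R\<^sup>2)" by (intro set_integrable_bdd[of _ _ a b] bdd_borel_const) auto
  have "(LINT x:{a..b}|lborel. (s x)\<^sup>2) \<le> (LINT x:{a..b}|lborel. R\<^sup>2)"
  proof (rule set_integral_mono_AE[OF integrable_s_square c])
    show "AE x\<in>{a..b} in lborel. (s x)\<^sup>2 \<le> R\<^sup>2"
      using R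
    proof eventually_elim
      case (elim x)
      then show ?case using power_mono[of "\<bar>s x\<bar>" R 2] by auto
    qed
  qed
  also have "\<dots> = R\<^sup>2 * (b - a)" using ab unfolding set_lebesgue_integral_def by simp
  finally show ?thesis .
qed

end

section \<open>Jump averages and the set of models\<close>

context levy_jumps begin

text \<open>On a cadlag path the jump measure has finitely many atoms in the rectangle. The sizes in
  \<open>{a..b}\<close> are nonzero, and the jump measure carries only times \<open>t > 0\<close>,
  so the closed time interval agrees with the index set of \<open>jump_sum\<close>.\<close>

lemma jump_average_eq:
  assumes cad: "cadlag (\<lambda>t. X t \<omega>)" and ab: "0 \<notin> {a..b}" and g[measurable]: "g \<in> borel_measurable borel" and T: "0 < T"
  shows "jump_average a b X T \<omega> g = jump_sum X a b T g \<omega> / T"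
proof -
  let ?S = "{t. 0 < t \<and> jump X t \<omega> \<noteq> 0}" and ?J = "{t. 0 < t \<and> t \<le> T \<and> jump X t \<omega> \<in> {a..b}}"
  let ?f = "\<lambda>z. indicator ({0..T} \<times> {a..b}) z *\<^sub>R g (snd z)"
  have fin: "finite ?J" by (rule finite_jump_set[OF cad ab])
  have [measurable]: "({0..T} \<times> {a..b}) \<in> sets (borel :: (real \<times> real) measure)" by (intro borel_Times) auto
  have fm: "?f \<in> borel_measurable (borel :: (real \<times> real) measure)"
    unfolding borel_prod[symmetric] by measurable
  have sub: "{t \<in> ?S. ?f (t, jump X t \<omega>) \<noteq> 0} \<subseteq> ?J" by (auto split: split_indicator_asm)
  have "(LINT z:{0..T} \<times> {a..b}|jump_measure X \<omega>. g (snd z)) = (\<integral>t. ?f (t, jump X t \<omega>) \<partial>count_space ?S)"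
    unfolding set_lebesgue_integral_def jump_measure_def by (rule integral_distr[OF _ fm]) auto
  also have "\<dots> = (\<Sum>t | t \<in> ?S \<and> ?f (t, jump X t \<omega>) \<noteq> 0. ?f (t, jump X t \<omega>))"
    by (rule lebesgue_integral_count_space_finite_support) (rule finite_subset[OF sub fin])
  also have "\<dots> = (\<Sum>t\<in>?J. ?f (t, jump X t \<omega>))"
    using fin sub ab by (intro sum.mono_neutral_left) auto
  also have "\<dots> = jump_sum X a b T g \<omega>"
    unfolding jump_sum_def by (intro sum.cong) auto
  finally show ?thesis by (simp add: jump_average_def)
qed

lemma jump_sum_linear: "jump_sum X a b T (\<lambda>x. \<Sum>l\<in>I. c l * g l x) \<omega> = (\<Sum>l\<in>I. c l * jump_sum X a b T (g l) \<omega> :: real)"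
  unfolding jump_sum_def sum_distrib_left by (rule sum.swap)

lemma jump_sum_subtract: "jump_sum X a b T (\<lambda>x. f x - g x) \<omega> = (jump_sum X a b T f \<omega> - jump_sum X a b T g \<omega> :: real)"
  unfolding jump_sum_def by (rule sum_subtractf)

lemma regular_pw_poly:
  assumes ab: "a < b" "0 \<notin> {a..b}" and m: "0 < m" and f: "f \<in> pw_poly a b k m"
  shows "regular a b f"
proof -
  obtain B where B: "\<And>x. \<bar>f x\<bar> \<le> B" using pw_poly_bounded[OF ab(1) m f] by blast
  show ?thesis
  proof (rule regularI[OF ab(2), of "grid_point a b m ` {..m}" f B])
    show "f x = 0" if "x \<notin> {a..b}" for x using f that by (auto simp: pw_poly_def)
    show "isCont f x" if "x \<in> {a..b}" "x \<notin> grid_point a b m ` {..m}" for x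
      by (rule pw_poly_isCont[OF ab(1) m f that])
  qed (use B pw_poly_borel[OF ab(1) m f] in auto)
qed

lemma integral_mult_s_le:
  assumes ab: "0 \<notin> {a..b}" and R: "AE x in lborel. x \<in> {a..b} \<longrightarrow> s x \<le> R" and h: "regular a b h" "\<And>x. 0 \<le> h x"
  shows "(LINT x:{a..b}|lborel. h x * s x) \<le> R * (LINT x:{a..b}|lborel. h x)"
proof -
  have hb: "bdd_borel h" using h(1) by (auto simp: regular_def bdd_borel_def)
  have "set_integrable lborel {a..b} (\<lambda>x. R * h x)"
    by (intro set_integrable_bdd[of _ _ a b] bdd_borel_cmult hb) auto
  then have "(LINT x:{a..b}|lborel. h x * s x) \<le> (LINT x:{a..b}|lborel. R * h x)"
  proof (rule set_integral_mono_AE[OF integrable_regular_s[OF ab h(1)]])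
    show "AE x\<in>{a..b} in lborel. h x * s x \<le> R * h x"
      using R
    proof eventually_elim
      case (elim x)
      then show ?case using mult_right_mono[of "s x" R "h x"] h(2)[of x] by (auto simp: mult.commute)
    qed
  qed
  then show ?thesis by simp
qed

end

lemma finite_model_set:
  assumes ab: "a < b" and T: "0 < T"
  shows "finite (model_set a b k T)" "\<And>m. m \<in> model_set a b k T \<Longrightarrow> 0 < m \<and> real m \<le> (b - a) * T"
proof -
  show le: "0 < m \<and> real m \<le> (b - a) * T" if "m \<in> model_set a b k T" for m
  proof -
    have m: "0 < m" "D_const a b k m \<le> ennreal T" using that by (auto simp: model_set_def)
    have "ennreal (real m / (b - a)) \<le> ennreal T" using D_const_ge[OF ab m(1), of k] m(2) by (rule order_trans)
    then have "real m / (b - a) \<le> T" using T by (simp add: ennreal_le_iff)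
    then show ?thesis using m ab by (simp add: divide_le_eq mult.commute)
  qed
  have "model_set a b k T \<subseteq> {..nat \<lfloor>(b - a) * T\<rfloor>}"
    using le by (auto simp: le_nat_floor)
  then show "finite (model_set a b k T)" by (rule finite_subset) simp
qed

lemma ennreal_weighted_sum:
  assumes "0 \<le> l" "0 \<le> A" "0 \<le> C" "0 \<le> j" and n: "\<And>m. 0 \<le> P m" "\<And>m. 0 \<le> w m" "\<And>m. 0 \<le> Q m" "\<And>m. 0 \<le> u m"
  shows "ennreal l * (ennreal A + ennreal C * ennreal j + (\<Sum>m\<in>I. ennreal (P m) * ennreal (w m) + ennreal (Q m) * ennreal (u m)))
    = ennreal (l * (A + C * j + (\<Sum>m\<in>I. P m * w m + Q m * u m)))"
proof -
  have nn: "0 \<le> P m * w m" "0 \<le> Q m * u m" for m using n by simp_all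
  have 1: "ennreal (P m) * ennreal (w m) + ennreal (Q m) * ennreal (u m) = ennreal (P m * w m + Q m * u m)" for m
    using nn n by (simp only: ennreal_mult[symmetric] ennreal_plus[symmetric])
  have 2: "(\<Sum>m\<in>I. ennreal (P m * w m + Q m * u m)) = ennreal (\<Sum>m\<in>I. P m * w m + Q m * u m)"
    using nn by (intro sum_ennreal add_nonneg_nonneg)
  have 3: "0 \<le> (\<Sum>m\<in>I. P m * w m + Q m * u m)" using nn by (intro sum_nonneg add_nonneg_nonneg)
  have 4: "0 \<le> C * j" using assms by simp
  show ?thesis
    unfolding 1 2 using assms(1-4) 3 4 by (simp only: ennreal_mult[symmetric] ennreal_plus[symmetric] add_nonneg_nonneg)
qed

section \<open>Risk bound relative to a reference model\<close>

context levy_jumps begin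

text \<open>\<open>K1\<close> collects what multiplies \<open>ms / T\<close>: the mean of the
  \<open>V_hat\<close> part of the penalty, its \<open>D_const\<close> and dimension parts, and the
  \<kappa> of the oracle inequality. The two summands of \<open>K2\<close> come from the fourth
  moments of \<open>W\<close> and of \<open>U\<close>.\<close>

lemma risk_le:
  fixes \<phi> :: "nat \<Rightarrow> nat \<Rightarrow> real \<Rightarrow> real"
  assumes ab: "a < b" "0 \<notin> {a..b}" and c: "1 < c" and c': "0 < c'" and c'': "0 < c''"
    and onb: "\<And>m. m \<ge> 1 \<Longrightarrow> pw_onb a b k m (\<phi> m)"
    and C0: "0 < C0" "\<And>m f x. 0 < m \<Longrightarrow> f \<in> pw_poly a b k m \<Longrightarrow> (f x)\<^sup>2 \<le> C0 * real m * (LINT x:{a..b}|lborel. (f x)\<^sup>2)"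
    and R: "0 \<le> R" "AE x in lborel. x \<in> {a..b} \<longrightarrow> s x \<le> R"
    and T: "0 < T" and sel: "model_selector a b k \<phi> c c' c'' M X mhat" and ms: "ms \<in> model_set a b k T"
  defines "\<kappa> \<equiv> min (1/4) (c''/4)" and "lam \<equiv> min (1/2) (c - 1)"
    and "K1 \<equiv> c * R * (real k + 1) + c' * C0 + c'' * (real k + 1) + min (1/4) (c''/4)"
    and "K2 \<equiv> exp 1 * (16 * (R + 1)\<^sup>2 + 24 * C0 * (R\<^sup>2 * (b - a)) * (R + 1)) / ((min (1/4) (c''/4))\<^sup>2 * c'')
          + 8 * c ^ 4 / c'' ^ 3 * (exp (33 * (R + 1) + 388 * (R + 1) * (C0 * (b - a))) * (real k + 1)\<^sup>2)"
  shows "risk a b k \<phi> M X mhat s T \<le>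
    ennreal (1 / lam * (3/2 * proj_error a b k (\<phi> ms) s ms + K1 * (real ms / T) + K2 / T * (\<Sum>m\<in>model_set a b k T. 1 / real m)))"
proof -
  define MS where "MS = model_set a b k T"
  have fin: "finite MS" and MS: "\<And>m. m \<in> MS \<Longrightarrow> 0 < m \<and> real m \<le> (b - a) * T"
    unfolding MS_def using finite_model_set[OF ab(1) T] by auto
  have msM: "ms \<in> MS" using ms by (simp add: MS_def)
  have ms0: "0 < ms" using MS[OF msM] by simp
  have onb': "pw_onb a b k m (\<phi> m)" if "0 < m" for m using onb[of m] that by simp
  have k0: "0 < \<kappa>" using c'' by (simp add: \<kappa>_def)
  have l0: "0 < lam" using c by (simp add: lam_def)
  have absR: "AE x in lborel. x \<in> {a..b} \<longrightarrow> \<bar>s x\<bar> \<le> R"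
    using R(2)
  proof eventually_elim
    case (elim x)
    show ?case using elim s_nonneg[of x] ab(2) by (cases "x = 0") auto
  qed
  define d where "d m = pw_dim k m" for m
  have d0: "0 < d m" "real (d m) = real m * (real k + 1)" if "0 < m" for m using that by (auto simp: d_def pw_dim_def algebra_simps)
  have mem: "\<phi> m l \<in> pw_poly a b k m" if "0 < m" "l < d m" for m l
    using onb'[OF that(1)] that(2) by (simp add: pw_onb_def d_def)
  have reg: "regular a b (\<phi> m l)" if "0 < m" "l < d m" for m l
    by (rule regular_pw_poly[OF ab that(1) mem[OF that]])
  define J where "J g \<omega> = jump_sum X a b T g \<omega>" for g :: "real \<Rightarrow> real" and \<omega>
  define \<beta> where "\<beta> m l = (LINT x:{a..b}|lborel. \<phi> m l x * s x)" for m l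
  define sq where "sq m x = (\<Sum>l<d m. (\<phi> m l x)\<^sup>2)" for m x
  have sqreg: "regular a b (sq m)" if "0 < m" for m
    unfolding sq_def using reg[OF that] by (intro regular_sum regular_comp[of _ _ _ "\<lambda>y. y\<^sup>2"]) (auto intro!: continuous_intros)
  have sqle: "sq m x \<le> C0 * real m" if "0 < m" for m x
    unfolding sq_def d_def using C0 that by (intro sum_onb_square_le[OF ab(1) that onb'[OF that]]) auto
  have sq0: "0 \<le> sq m x" for m x unfolding sq_def by (intro sum_nonneg) auto
  define bias where "bias m = proj_error a b k (\<phi> m) s m" for m
  have bias0: "0 \<le> bias m" if "0 < m" for m
    unfolding bias_def using proj_error_nonneg[OF ab(1) borel_s absR that onb'[OF that]] .
  define S2 where "S2 = (LINT x:{a..b}|lborel. (s x)\<^sup>2)"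
  have bias_eq: "bias m = S2 - (\<Sum>l<d m. (\<beta> m l)\<^sup>2)" if "0 < m" for m
    unfolding bias_def S2_def \<beta>_def d_def by (rule proj_error_eq[OF ab(1) borel_s absR that onb'[OF that]])
  have S2le: "S2 \<le> R\<^sup>2 * (b - a)"
    unfolding S2_def by (rule integral_s_square_le[OF ab(1) borel_s absR ms0 onb'[OF ms0] R(1)])
  define pr where "pr m x = (\<Sum>l<d m. \<beta> m l * \<phi> m l x)" for m x
  have prmem: "pr m \<in> pw_poly a b k m" if "0 < m" for m
    unfolding pr_def using mem[OF that] by (intro pw_poly_sum) auto
  have prreg: "regular a b (pr m)" if "0 < m" for m by (rule regular_pw_poly[OF ab that prmem[OF that]])
  have pr2: "(pr m x)\<^sup>2 \<le> C0 * real m * (R\<^sup>2 * (b - a))" if "0 < m" for m x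
  proof -
    have "(LINT x:{a..b}|lborel. (pr m x)\<^sup>2) = (\<Sum>l<d m. (\<beta> m l)\<^sup>2)"
      unfolding pr_def d_def by (rule pw_onb_integral_square[OF ab(1) that onb'[OF that]])
    also have "\<dots> \<le> R\<^sup>2 * (b - a)" using bias_eq[OF that] bias0[OF that] S2le by linarith
    finally have "C0 * real m * (LINT x:{a..b}|lborel. (pr m x)\<^sup>2) \<le> C0 * real m * (R\<^sup>2 * (b - a))"
      using C0(1) by (intro mult_left_mono) auto
    then show ?thesis using C0(2)[OF that prmem[OF that], of x] by linarith
  qed
  have intpr: "(LINT x:{a..b}|lborel. pr m x * s x) = (\<Sum>l<d m. (\<beta> m l)\<^sup>2)" if "0 < m" for m
  proof -
    have "(LINT x:{a..b}|lborel. pr m x * s x) = (LINT x:{a..b}|lborel. (\<Sum>l<d m. \<beta> m l * (\<phi> m l x * s x)))"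
      by (simp add: pr_def sum_distrib_right mult.assoc)
    also have "\<dots> = (\<Sum>l<d m. (LINT x:{a..b}|lborel. \<beta> m l * (\<phi> m l x * s x)))"
      by (intro set_integral_sum_real(1) set_integrable_mult_right integrable_regular_s[OF ab(2)] reg[OF that]) auto
    finally show ?thesis by (simp add: \<beta>_def power2_eq_square)
  qed
  define g where "g m x = pr m x - pr ms x" for m x
  have greg: "regular a b (g m)" if "0 < m" for m
    using regular_add[OF prreg[OF that] regular_comp[OF prreg[OF ms0], of uminus]] by (simp add: g_def[abs_def])
  \<comment> \<open>It dominates the squared norm of \<open>g m\<close> and, through
    \<open>(m + ms) / T\<close>, also its squared sup norm divided by \<open>T\<close>, up to a
    constant. Hence the fourth moment of \<open>W m\<close> is of order
    \<open>\<tau>\<^sup>2 / T\<^sup>2\<close>, which the weight \<open>P m\<close>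
    compensates.\<close>
  define \<tau> where "\<tau> m = 2 * bias m + 2 * bias ms + (real m + real ms) / T" for m
  have \<tau>0: "0 < \<tau> m" "real m + real ms \<le> T * \<tau> m" if "0 < m" for m
  proof -
    have q: "0 < (real m + real ms) / T" using that T by simp
    then show "0 < \<tau> m" using bias0[OF that] bias0[OF ms0] unfolding \<tau>_def by linarith
    have "(real m + real ms) / T \<le> \<tau> m" using bias0[OF that] bias0[OF ms0] unfolding \<tau>_def by linarith
    then show "real m + real ms \<le> T * \<tau> m" using T by (simp add: pos_divide_le_eq mult.commute)
  qed
  have g2: "(LINT x:{a..b}|lborel. (g m x)\<^sup>2) \<le> \<tau> m" if m: "0 < m" for m
  proof -
    have i: "set_integrable lborel {a..b} (\<lambda>x. (s x - pr m x)\<^sup>2)" if "0 < m" for m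
      unfolding pr_def d_def by (rule integrable_square_diff_onb[OF ab(1) borel_s absR that onb'[OF that]])
    have e: "bias m = (LINT x:{a..b}|lborel. (s x - pr m x)\<^sup>2)" for m
      by (simp add: bias_def proj_error_def pr_def d_def \<beta>_def)
    have gi: "set_integrable lborel {a..b} (\<lambda>x. (g m x)\<^sup>2)"
      using regular_mult[OF greg[OF m] greg[OF m]]
      by (intro set_integrable_bdd[of _ _ a b]) (auto simp: regular_def bdd_borel_def power2_eq_square)
    have "(LINT x:{a..b}|lborel. (g m x)\<^sup>2) \<le> (LINT x:{a..b}|lborel. 2 * (s x - pr m x)\<^sup>2 + 2 * (s x - pr ms x)\<^sup>2)"
    proof (rule set_integral_mono[OF gi])
      show "set_integrable lborel {a..b} (\<lambda>x. 2 * (s x - pr m x)\<^sup>2 + 2 * (s x - pr ms x)\<^sup>2)"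
        by (intro set_integral_add(1) set_integrable_mult_right i m ms0)
      fix x
      have "0 \<le> ((s x - pr m x) + (s x - pr ms x))\<^sup>2" by simp
      then show "(g m x)\<^sup>2 \<le> 2 * (s x - pr m x)\<^sup>2 + 2 * (s x - pr ms x)\<^sup>2"
        by (simp add: g_def power2_eq_square algebra_simps)
    qed
    also have "\<dots> = 2 * bias m + 2 * bias ms"
      unfolding e using i[OF m] i[OF ms0] by (subst set_integral_add(2)) auto
    also have "\<dots> \<le> \<tau> m" using T by (simp add: \<tau>_def)
    finally show ?thesis .
  qed
  define U where "U m \<omega> = ((\<Sum>l<d m. (J (\<phi> m l) \<omega> - T * \<beta> m l)\<^sup>2) - J (sq m) \<omega>) / T" for m \<omega>
  define W where "W m \<omega> = (J (g m) \<omega> - T * (LINT x:{a..b}|lborel. g m x * s x)) / T" for m \<omega>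
  define chi where "chi m \<omega> = (\<Sum>l<d m. (J (\<phi> m l) \<omega> / T - \<beta> m l)\<^sup>2)" for m \<omega>
  have chi0: "0 \<le> chi m \<omega>" for m \<omega> unfolding chi_def by (intro sum_nonneg) auto
  have chi_eq: "chi m \<omega> = (U m \<omega> + J (sq m) \<omega> / T) / T" for m \<omega>
  proof -
    have "(J (\<phi> m l) \<omega> / T - \<beta> m l)\<^sup>2 = (J (\<phi> m l) \<omega> - T * \<beta> m l)\<^sup>2 / (T * T)" for l
      using T by (simp add: power2_eq_square field_simps)
    then have "chi m \<omega> = (\<Sum>l<d m. (J (\<phi> m l) \<omega> - T * \<beta> m l)\<^sup>2) / (T * T)"
      unfolding chi_def sum_divide_distrib by simp
    then show ?thesis by (simp add: U_def diff_divide_distrib)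
  qed
  define lin where "lin m \<omega> = (\<Sum>l<d m. \<beta> m l * (J (\<phi> m l) \<omega> / T - \<beta> m l))" for m \<omega>
  have W_eq: "W m \<omega> = lin m \<omega> - lin ms \<omega>" if m: "0 < m" for m \<omega>
  proof -
    have Jpr: "J (pr m) \<omega> = (\<Sum>l<d m. \<beta> m l * J (\<phi> m l) \<omega>)" for m
      unfolding J_def pr_def[abs_def] by (rule jump_sum_linear)
    have l: "lin m \<omega> = J (pr m) \<omega> / T - (\<Sum>l<d m. (\<beta> m l)\<^sup>2)" for m
      by (simp add: lin_def Jpr sum_divide_distrib sum_subtractf right_diff_distrib power2_eq_square)
    have 1: "(LINT x:{a..b}|lborel. g m x * s x) = (\<Sum>l<d m. (\<beta> m l)\<^sup>2) - (\<Sum>l<d ms. (\<beta> ms l)\<^sup>2)"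
      using integrable_regular_s[OF ab(2) prreg[OF m]] integrable_regular_s[OF ab(2) prreg[OF ms0]]
      by (simp add: g_def left_diff_distrib intpr[OF m] intpr[OF ms0])
    have 2: "J (g m) \<omega> = J (pr m) \<omega> - J (pr ms) \<omega>" unfolding J_def g_def[abs_def] by (rule jump_sum_subtract)
    show ?thesis unfolding W_def 1 2 l using T by (simp add: field_simps)
  qed
  define A where "A = 3/2 * bias ms + (c' * C0 + c'' * (real k + 1) + \<kappa>) * (real ms / T)"
  define P where "P m = T / (\<kappa>\<^sup>2 * c'' * real m * (\<tau> m)\<^sup>2)" for m
  define Q where "Q m = 8 * c ^ 4 / (c'' ^ 3 * real m ^ 3 * T)" for m
  have A0: "0 \<le> A" using bias0[OF ms0] c' c'' C0(1) k0 T by (simp add: A_def)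
  have P0: "0 \<le> P m" for m using T c'' by (simp add: P_def)
  have Q0: "0 \<le> Q m" for m using T c'' c by (simp add: Q_def)
  have pathwise: "lam * (eta_norm a b (\<lambda>x. s x - penalized_est a b k \<phi> X mhat T \<omega> x))\<^sup>2
      \<le> A + c / T\<^sup>2 * J (sq ms) \<omega> + (\<Sum>m\<in>MS. P m * W m \<omega> ^ 4 + Q m * U m \<omega> ^ 4)"
    if cad: "cadlag (\<lambda>t. X t \<omega>)"
      and arg: "is_arg_min (\<lambda>m. - (eta_norm a b (proj_est a b k \<phi> X T \<omega> m))\<^sup>2 + penalty a b k \<phi> c c' c'' X T \<omega> m)
           (\<lambda>m. m \<in> MS) (mhat T \<omega>)" for \<omega>
  proof -
    define m where "m = mhat T \<omega>"
    have mM: "m \<in> MS" using arg by (simp add: is_arg_min_def m_def)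
    have m0: "0 < m" using MS[OF mM] by simp
    have ja: "jump_average a b X T \<omega> h = J h \<omega> / T" if "h \<in> borel_measurable borel" for h
      unfolding J_def by (rule jump_average_eq[OF cad ab(2) that T])
    have est: "proj_est a b k \<phi> X T \<omega> m x = (\<Sum>l<d m. J (\<phi> m l) \<omega> / T * \<phi> m l x)" if "0 < m" for m x
      unfolding proj_est_def d_def[symmetric] using ja[OF regular_borel[OF reg[OF that]]] by simp
    have norm: "(eta_norm a b (proj_est a b k \<phi> X T \<omega> m))\<^sup>2 = chi m \<omega> + 2 * lin m \<omega> + (S2 - bias m)" if "0 < m" for m
    proof -
      have "(eta_norm a b (proj_est a b k \<phi> X T \<omega> m))\<^sup>2 = (LINT x:{a..b}|lborel. (\<Sum>l<d m. J (\<phi> m l) \<omega> / T * \<phi> m l x)\<^sup>2)"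
        unfolding eta_norm_def est[OF that] set_lebesgue_integral_def
        by (intro real_sqrt_pow2 Bochner_Integration.integral_nonneg) auto
      also have "\<dots> = (\<Sum>l<d m. (J (\<phi> m l) \<omega> / T)\<^sup>2)"
        unfolding d_def by (rule pw_onb_integral_square[OF ab(1) that onb'[OF that]])
      also have "\<dots> = (\<Sum>l<d m. (J (\<phi> m l) \<omega> / T - \<beta> m l)\<^sup>2 + 2 * (\<beta> m l * (J (\<phi> m l) \<omega> / T - \<beta> m l)) + (\<beta> m l)\<^sup>2)"
        by (intro sum.cong) (auto simp: power2_eq_square algebra_simps)
      also have "\<dots> = chi m \<omega> + 2 * lin m \<omega> + (S2 - bias m)"
        by (simp add: sum.distrib chi_def lin_def sum_distrib_left bias_eq[OF that])
      finally show ?thesis .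
    qed
    have V: "V_hat a b k \<phi> X T \<omega> m = J (sq m) \<omega> / T" if "0 < m" for m
      unfolding V_hat_def d_def[symmetric] using ja[OF regular_borel[OF sqreg[OF that]]] by (simp add: sq_def[abs_def])
    define pen where "pen m = penalty a b k \<phi> c c' c'' X T \<omega> m" for m
    have pen1: "c * (J (sq m) \<omega> / T) / T + c'' * real m / T \<le> pen m"
    proof -
      have "c'' * real m / T \<le> c'' * real (d m) / T"
        using d0[OF m0] c'' T by (intro divide_right_mono mult_left_mono) (auto simp: distrib_left)
      moreover have "0 \<le> c' * enn2real (D_const a b k m) / T" using c' T by simp
      ultimately show ?thesis unfolding pen_def penalty_def V[OF m0] d_def by linarith
    qed
    have pen2: "pen ms \<le> c / T\<^sup>2 * J (sq ms) \<omega> + (c' * C0 + c'' * (real k + 1)) * (real ms / T)"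
    proof -
      have "D_const a b k ms \<le> ennreal (C0 * real ms)"
        using C0 ms0 by (intro D_const_le[OF ab(1) ms0]) auto
      then have "enn2real (D_const a b k ms) \<le> C0 * real ms" using C0(1) by (intro enn2real_leI) auto
      then have "c' * enn2real (D_const a b k ms) / T \<le> c' * (C0 * real ms) / T"
        using c' T by (intro divide_right_mono mult_left_mono) auto
      moreover have "pen ms = c / T\<^sup>2 * J (sq ms) \<omega> + c' * enn2real (D_const a b k ms) / T + c'' * (real ms * (real k + 1)) / T"
        unfolding pen_def penalty_def V[OF ms0] d_def[symmetric] d0(2)[OF ms0] by (simp add: power2_eq_square)
      moreover have "(c' * C0 + c'' * (real k + 1)) * (real ms / T) = c' * (C0 * real ms) / T + c'' * (real ms * (real k + 1)) / T"
        using T by (simp add: field_simps)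
      ultimately show ?thesis by linarith
    qed
    have min: "- (eta_norm a b (proj_est a b k \<phi> X T \<omega> m))\<^sup>2 + pen m \<le> - (eta_norm a b (proj_est a b k \<phi> X T \<omega> ms))\<^sup>2 + pen ms"
      using arg msM unfolding is_arg_min_def pen_def m_def by (metis linorder_not_less)
    \<comment> \<open>The minimality of the criterion at \<open>m\<close>, rewritten by
      \<open>norm\<close>. The stochastic error of the reference model enters with a favourable sign
      and is dropped.\<close>
    have crit: "bias m \<le> bias ms + 2 * W m \<omega> + chi m \<omega> + pen ms - pen m"
      using min chi0[of ms \<omega>] unfolding norm[OF m0] norm[OF ms0] W_eq[OF m0] by argo
    have loss: "(eta_norm a b (\<lambda>x. s x - penalized_est a b k \<phi> X mhat T \<omega> x))\<^sup>2 = bias m + chi m \<omega>"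
    proof -
      have "(eta_norm a b (\<lambda>x. s x - penalized_est a b k \<phi> X mhat T \<omega> x))\<^sup>2
          = (LINT x:{a..b}|lborel. (s x - (\<Sum>l<d m. J (\<phi> m l) \<omega> / T * \<phi> m l x))\<^sup>2)"
        unfolding eta_norm_def penalized_est_def m_def[symmetric] est[OF m0] set_lebesgue_integral_def
        by (intro real_sqrt_pow2 Bochner_Integration.integral_nonneg) auto
      also have "\<dots> = bias m + chi m \<omega>"
        unfolding bias_def chi_def \<beta>_def d_def by (rule integral_square_diff_onb_error[OF ab(1) borel_s absR m0 onb'[OF m0]])
      finally show ?thesis .
    qed
    have "lam * (bias m + chi m \<omega>) \<le> 3/2 * bias ms + pen ms + \<kappa> * real ms / T + P m * W m \<omega> ^ 4 + Q m * U m \<omega> ^ 4"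
      unfolding lam_def \<kappa>_def P_def Q_def \<tau>_def using m0 ms0
      by (intro oracle_inequality[OF c c'' T _ _ bias0[OF m0] bias0[OF ms0] chi_eq chi0 crit pen1]) auto
    \<comment> \<open>The selected model is random. Replacing its terms by the sum over all models
      makes the bound a fixed combination of random variables, whose mean can be taken term by
      term.\<close>
    moreover have "P m * W m \<omega> ^ 4 + Q m * U m \<omega> ^ 4 \<le> (\<Sum>m\<in>MS. P m * W m \<omega> ^ 4 + Q m * U m \<omega> ^ 4)"
      using P0 Q0 by (intro member_le_sum[OF mM _ fin, of "\<lambda>m. P m * W m \<omega> ^ 4 + Q m * U m \<omega> ^ 4"]) auto
    moreover have "3/2 * bias ms + \<kappa> * real ms / T + (c' * C0 + c'' * (real k + 1)) * (real ms / T) = A"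
      by (simp add: A_def distrib_right add_divide_distrib)
    ultimately show ?thesis using pen2 unfolding loss by linarith
  qed
  define E1 where "E1 = exp 1 * (16 * (R + 1)\<^sup>2 + 24 * C0 * (R\<^sup>2 * (b - a)) * (R + 1))"
  define E2 where "E2 = exp (33 * (R + 1) + 388 * (R + 1) * (C0 * (b - a)))"
  define Z where "Z \<omega> = ennreal (1 / lam) * (ennreal A + ennreal (c / T\<^sup>2) * ennreal (J (sq ms) \<omega>)
      + (\<Sum>m\<in>MS. ennreal (P m) * ennreal (W m \<omega> ^ 4) + ennreal (Q m) * ennreal (U m \<omega> ^ 4)))" for \<omega>
  have Jm[measurable]: "J h \<in> borel_measurable (completion M)" if "regular a b h" for h
    unfolding J_def[abs_def] using regular_measurable_jump_sum[OF ab(2) that T] by simp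
  have Wm: "W m \<in> borel_measurable (completion M)" if "0 < m" for m
    unfolding W_def[abs_def] using Jm[OF greg[OF that]] by measurable
  have Um: "U m \<in> borel_measurable (completion M)" if "0 < m" for m
    unfolding U_def[abs_def] using Jm[OF sqreg[OF that]] Jm[OF reg[OF that]]
    by (intro borel_measurable_divide borel_measurable_diff borel_measurable_sum borel_measurable_power borel_measurable_const) auto
  have sel': "AE \<omega> in M. is_arg_min (\<lambda>m. - (eta_norm a b (proj_est a b k \<phi> X T \<omega> m))\<^sup>2 + penalty a b k \<phi> c c' c'' X T \<omega> m)
           (\<lambda>m. m \<in> MS) (mhat T \<omega>)"
    using sel T ms unfolding model_selector_def MS_def by blast
  have "risk a b k \<phi> M X mhat s T \<le> (\<integral>\<^sup>+\<omega>. Z \<omega> \<partial>M)"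
    unfolding risk_def
  proof (rule nn_integral_mono_AE)
    show "AE \<omega> in M. ennreal ((eta_norm a b (\<lambda>x. s x - penalized_est a b k \<phi> X mhat T \<omega> x))\<^sup>2) \<le> Z \<omega>"
      using AE_cadlag sel'
    proof eventually_elim
      case (elim \<omega>)
      let ?r = "A + c / T\<^sup>2 * J (sq ms) \<omega> + (\<Sum>m\<in>MS. P m * W m \<omega> ^ 4 + Q m * U m \<omega> ^ 4)"
      have J0: "0 \<le> J (sq ms) \<omega>" unfolding J_def jump_sum_def by (intro sum_nonneg sq0)
      have "(eta_norm a b (\<lambda>x. s x - penalized_est a b k \<phi> X mhat T \<omega> x))\<^sup>2 \<le> 1 / lam * ?r"
        using pathwise[OF elim] l0 by (simp add: pos_le_divide_eq mult.commute)
      then have "ennreal ((eta_norm a b (\<lambda>x. s x - penalized_est a b k \<phi> X mhat T \<omega> x))\<^sup>2) \<le> ennreal (1 / lam * ?r)"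
        by (rule ennreal_leI)
      also have "\<dots> = Z \<omega>"
        unfolding Z_def using A0 l0 c J0 P0 Q0 by (intro ennreal_weighted_sum[symmetric]) auto
      finally show ?case .
    qed
  qed
  \<comment> \<open>Jump sums are measurable for the completion, so linearity of the integral is
    applied there; the integral itself is the same over \<open>M\<close>.\<close>
  also have "\<dots> = (\<integral>\<^sup>+\<omega>. Z \<omega> \<partial>completion M)" by (rule nn_integral_completion[symmetric])
  also have "\<dots> = ennreal (1 / lam) * (ennreal A + ennreal (c / T\<^sup>2) * (\<integral>\<^sup>+\<omega>. ennreal (J (sq ms) \<omega>) \<partial>M)
      + (\<Sum>m\<in>MS. ennreal (P m) * (\<integral>\<^sup>+\<omega>. ennreal (W m \<omega> ^ 4) \<partial>M) + ennreal (Q m) * (\<integral>\<^sup>+\<omega>. ennreal (U m \<omega> ^ 4) \<partial>M)))"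
  proof -
    interpret Cm: prob_space "completion M" by (rule prob_space_completion)
    have W4: "(\<lambda>\<omega>. ennreal (W m \<omega> ^ 4)) \<in> borel_measurable (completion M)" if "m \<in> MS" for m
      using Wm[of m] MS[OF that] by simp
    have U4: "(\<lambda>\<omega>. ennreal (U m \<omega> ^ 4)) \<in> borel_measurable (completion M)" if "m \<in> MS" for m
      using Um[of m] MS[OF that] by simp
    have J4: "(\<lambda>\<omega>. ennreal (J (sq ms) \<omega>)) \<in> borel_measurable (completion M)"
      using Jm[OF sqreg[OF ms0]] by simp
    have "(\<integral>\<^sup>+\<omega>. (\<Sum>m\<in>MS. ennreal (P m) * ennreal (W m \<omega> ^ 4) + ennreal (Q m) * ennreal (U m \<omega> ^ 4)) \<partial>completion M)
       = (\<Sum>m\<in>MS. (\<integral>\<^sup>+\<omega>. ennreal (P m) * ennreal (W m \<omega> ^ 4) + ennreal (Q m) * ennreal (U m \<omega> ^ 4) \<partial>completion M))"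
      using W4 U4 by (intro nn_integral_sum borel_measurable_add borel_measurable_times borel_measurable_const) auto
    also have "\<dots> = (\<Sum>m\<in>MS. ennreal (P m) * (\<integral>\<^sup>+\<omega>. ennreal (W m \<omega> ^ 4) \<partial>M) + ennreal (Q m) * (\<integral>\<^sup>+\<omega>. ennreal (U m \<omega> ^ 4) \<partial>M))"
    proof (rule sum.cong[OF refl])
      fix m assume m: "m \<in> MS"
      show "(\<integral>\<^sup>+\<omega>. ennreal (P m) * ennreal (W m \<omega> ^ 4) + ennreal (Q m) * ennreal (U m \<omega> ^ 4) \<partial>completion M)
         = ennreal (P m) * (\<integral>\<^sup>+\<omega>. ennreal (W m \<omega> ^ 4) \<partial>M) + ennreal (Q m) * (\<integral>\<^sup>+\<omega>. ennreal (U m \<omega> ^ 4) \<partial>M)"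
        unfolding nn_integral_add[OF borel_measurable_times_ennreal[OF borel_measurable_const W4[OF m]] borel_measurable_times_ennreal[OF borel_measurable_const U4[OF m]]]
        unfolding nn_integral_cmult[OF W4[OF m]] nn_integral_cmult[OF U4[OF m]] unfolding nn_integral_completion ..
    qed
    finally have S: "(\<integral>\<^sup>+\<omega>. (\<Sum>m\<in>MS. ennreal (P m) * ennreal (W m \<omega> ^ 4) + ennreal (Q m) * ennreal (U m \<omega> ^ 4)) \<partial>completion M)
       = (\<Sum>m\<in>MS. ennreal (P m) * (\<integral>\<^sup>+\<omega>. ennreal (W m \<omega> ^ 4) \<partial>M) + ennreal (Q m) * (\<integral>\<^sup>+\<omega>. ennreal (U m \<omega> ^ 4) \<partial>M))" .
    have Sm: "(\<lambda>\<omega>. \<Sum>m\<in>MS. ennreal (P m) * ennreal (W m \<omega> ^ 4) + ennreal (Q m) * ennreal (U m \<omega> ^ 4)) \<in> borel_measurable (completion M)"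
      using W4 U4 by (intro borel_measurable_sum borel_measurable_add borel_measurable_times borel_measurable_const) auto
    have AJ: "(\<lambda>\<omega>. ennreal A + ennreal (c / T\<^sup>2) * ennreal (J (sq ms) \<omega>)) \<in> borel_measurable (completion M)"
      using J4 by measurable
    have "(\<integral>\<^sup>+\<omega>. Z \<omega> \<partial>completion M) = ennreal (1 / lam) * (\<integral>\<^sup>+\<omega>. ennreal A + ennreal (c / T\<^sup>2) * ennreal (J (sq ms) \<omega>)
      + (\<Sum>m\<in>MS. ennreal (P m) * ennreal (W m \<omega> ^ 4) + ennreal (Q m) * ennreal (U m \<omega> ^ 4)) \<partial>completion M)"
      unfolding Z_def by (rule nn_integral_cmult) (intro borel_measurable_add AJ Sm)
    also have "(\<integral>\<^sup>+\<omega>. ennreal A + ennreal (c / T\<^sup>2) * ennreal (J (sq ms) \<omega>)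
      + (\<Sum>m\<in>MS. ennreal (P m) * ennreal (W m \<omega> ^ 4) + ennreal (Q m) * ennreal (U m \<omega> ^ 4)) \<partial>completion M)
      = (\<integral>\<^sup>+\<omega>. ennreal A + ennreal (c / T\<^sup>2) * ennreal (J (sq ms) \<omega>) \<partial>completion M)
        + (\<Sum>m\<in>MS. ennreal (P m) * (\<integral>\<^sup>+\<omega>. ennreal (W m \<omega> ^ 4) \<partial>M) + ennreal (Q m) * (\<integral>\<^sup>+\<omega>. ennreal (U m \<omega> ^ 4) \<partial>M))"
      by (subst nn_integral_add[OF AJ Sm]) (simp only: S)
    also have "(\<integral>\<^sup>+\<omega>. ennreal A + ennreal (c / T\<^sup>2) * ennreal (J (sq ms) \<omega>) \<partial>completion M)
       = ennreal A + ennreal (c / T\<^sup>2) * (\<integral>\<^sup>+\<omega>. ennreal (J (sq ms) \<omega>) \<partial>M)"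
    proof -
      have "(\<integral>\<^sup>+\<omega>. ennreal A + ennreal (c / T\<^sup>2) * ennreal (J (sq ms) \<omega>) \<partial>completion M)
        = (\<integral>\<^sup>+\<omega>. ennreal A \<partial>completion M) + (\<integral>\<^sup>+\<omega>. ennreal (c / T\<^sup>2) * ennreal (J (sq ms) \<omega>) \<partial>completion M)"
        using J4 by (intro nn_integral_add) auto
      also have "(\<integral>\<^sup>+\<omega>. ennreal A \<partial>completion M) = ennreal A" by (simp only: nn_integral_const Cm.emeasure_space_1 mult_1_right)
      also have "(\<integral>\<^sup>+\<omega>. ennreal (c / T\<^sup>2) * ennreal (J (sq ms) \<omega>) \<partial>completion M) = ennreal (c / T\<^sup>2) * (\<integral>\<^sup>+\<omega>. ennreal (J (sq ms) \<omega>) \<partial>completion M)"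
        by (rule nn_integral_cmult[OF J4])
      finally show ?thesis by (simp only: nn_integral_completion)
    qed
    finally show ?thesis .
  qed
  also have "\<dots> \<le> ennreal (1 / lam) * (ennreal A + ennreal (c / T\<^sup>2) * ennreal (T * (R * real (d ms)))
      + (\<Sum>m\<in>MS. ennreal (P m) * ennreal ((\<tau> m)\<^sup>2 * E1 / T\<^sup>2) + ennreal (Q m) * ennreal (E2 * (real (d m))\<^sup>2)))"
  proof (intro mult_left_mono add_mono order_refl sum_mono zero_le)
    have "(\<integral>\<^sup>+\<omega>. ennreal (J (sq ms) \<omega>) \<partial>M) \<le> ennreal (T * (LINT x:{a..b}|lborel. sq ms x * s x))"
      unfolding J_def by (rule nn_integral_jump_sum_le[OF ab(2) T sqreg[OF ms0] sq0])
    also have "\<dots> \<le> ennreal (T * (R * real (d ms)))"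
    proof (intro ennreal_leI mult_left_mono)
      have "(LINT x:{a..b}|lborel. sq ms x) = (\<Sum>l<d ms. (LINT x:{a..b}|lborel. \<phi> ms l x * \<phi> ms l x))"
        unfolding sq_def power2_eq_square
        by (intro set_integral_sum_real(1) integrable_pw_poly_mult[OF ab(1) ms0 ms0 mem[OF ms0] mem[OF ms0]]) auto
      also have "\<dots> = (\<Sum>l<d ms. 1)"
        using onb'[OF ms0] by (intro sum.cong) (auto simp: pw_onb_def eta_inner_def d_def)
      finally have "(LINT x:{a..b}|lborel. sq ms x) = real (d ms)" by simp
      then show "(LINT x:{a..b}|lborel. sq ms x * s x) \<le> R * real (d ms)"
        using integral_mult_s_le[OF ab(2) R(2) sqreg[OF ms0] sq0] by simp
    qed (use T in auto)
    finally show "(\<integral>\<^sup>+\<omega>. ennreal (J (sq ms) \<omega>) \<partial>M) \<le> ennreal (T * (R * real (d ms)))" .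
  next
    fix m assume mM: "m \<in> MS"
    have m: "0 < m" using MS[OF mM] by simp
    \<comment> \<open>A bound for the square of \<open>g m\<close>. By
      \<open>m + ms \<le> T * \<tau> m\<close> it is of order \<open>T * \<tau> m\<close> like
      \<open>K\<close>, so both terms of the fourth moment bound are of order
      \<open>T\<^sup>2 * \<tau>\<^sup>2\<close>. The \<open>R + 1\<close> in \<open>K\<close> makes
      the required inequality strict.\<close>
    define B2 where "B2 = 2 * (C0 * (real m + real ms) * (R\<^sup>2 * (b - a)))"
    have B20: "0 \<le> B2" using C0(1) ab(1) by (simp add: B2_def)
    define K where "K = T * ((R + 1) * \<tau> m)"
    have gB: "\<bar>g m x\<bar> \<le> sqrt B2" for x
    proof (rule real_le_rsqrt)
      have "(g m x)\<^sup>2 \<le> 2 * (pr m x)\<^sup>2 + 2 * (pr ms x)\<^sup>2"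
      proof -
        have "0 \<le> (pr m x + pr ms x)\<^sup>2" by simp
        then show ?thesis by (simp add: g_def power2_eq_square algebra_simps)
      qed
      also have "\<dots> \<le> B2" using pr2[OF m, of x] pr2[OF ms0, of x] unfolding B2_def by (simp add: distrib_left distrib_right)
      finally show "\<bar>g m x\<bar>\<^sup>2 \<le> B2" by simp
    qed
    have gK: "T * (LINT x:{a..b}|lborel. (g m x)\<^sup>2 * s x) < K"
    proof -
      have "(LINT x:{a..b}|lborel. (g m x)\<^sup>2 * s x) \<le> R * (LINT x:{a..b}|lborel. (g m x)\<^sup>2)"
        using regular_mult[OF greg[OF m] greg[OF m]] by (intro integral_mult_s_le[OF ab(2) R(2)]) (auto simp: power2_eq_square)
      also have "\<dots> \<le> R * \<tau> m" by (rule mult_left_mono[OF g2[OF m] R(1)])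
      also have "\<dots> < (R + 1) * \<tau> m" using \<tau>0(1)[OF m] by (simp add: distrib_right)
      finally show ?thesis unfolding K_def using T by (intro mult_strict_left_mono)
    qed
    have "(\<integral>\<^sup>+\<omega>. ennreal (W m \<omega> ^ 4) \<partial>M) = (\<integral>\<^sup>+\<omega>. ennreal (1 / T ^ 4) * ennreal ((J (g m) \<omega> - T * (LINT x:{a..b}|lborel. g m x * s x)) ^ 4) \<partial>completion M)"
      unfolding W_def nn_integral_completion using T by (simp add: ennreal_mult[symmetric] power_divide)
    also have "\<dots> = ennreal (1 / T ^ 4) * (\<integral>\<^sup>+\<omega>. ennreal ((J (g m) \<omega> - T * (LINT x:{a..b}|lborel. g m x * s x)) ^ 4) \<partial>completion M)"
      by (intro nn_integral_cmult measurable_compose[OF _ measurable_ennreal] borel_measurable_power borel_measurable_diff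
          borel_measurable_const Jm[OF greg[OF m]])
    also have "\<dots> \<le> ennreal (1 / T ^ 4) * ennreal (exp 1 * (16 * K\<^sup>2 + 12 * (sqrt B2)\<^sup>2 * K))"
      unfolding nn_integral_completion J_def by (intro mult_left_mono jump_sum_fourth_moment[OF ab(2) T greg[OF m] gB gK]) simp
    also have "\<dots> = ennreal (1 / T ^ 4 * (exp 1 * (16 * K\<^sup>2 + 12 * B2 * K)))"
      using B20 \<tau>0[OF m] R(1) T by (subst ennreal_mult) (auto simp: K_def)
    also have "\<dots> \<le> ennreal ((\<tau> m)\<^sup>2 * E1 / T\<^sup>2)"
    proof (rule ennreal_leI)
      have "C0 * (real m + real ms) * (R\<^sup>2 * (b - a)) \<le> C0 * (T * \<tau> m) * (R\<^sup>2 * (b - a))"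
        using \<tau>0(2)[OF m] C0(1) ab(1) by (intro mult_right_mono mult_left_mono) auto
      then have "12 * B2 * K \<le> 12 * (2 * (C0 * (T * \<tau> m) * (R\<^sup>2 * (b - a)))) * K"
        unfolding B2_def using \<tau>0(1)[OF m] R(1) T by (intro mult_right_mono) (auto simp: K_def)
      then have "exp 1 * (16 * K\<^sup>2 + 12 * B2 * K) \<le> exp 1 * (16 * K\<^sup>2 + 12 * (2 * (C0 * (T * \<tau> m) * (R\<^sup>2 * (b - a)))) * K)"
        by simp
      also have "\<dots> = T\<^sup>2 * ((\<tau> m)\<^sup>2 * E1)" by (simp add: K_def E1_def power2_eq_square algebra_simps)
      finally have "1 / T ^ 4 * (exp 1 * (16 * K\<^sup>2 + 12 * B2 * K)) \<le> 1 / T ^ 4 * (T\<^sup>2 * ((\<tau> m)\<^sup>2 * E1))"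
        by (rule mult_left_mono) simp
      also have "\<dots> = (\<tau> m)\<^sup>2 * E1 / T\<^sup>2" using T by (simp add: power4_eq_xxxx power2_eq_square)
      finally show "1 / T ^ 4 * (exp 1 * (16 * K\<^sup>2 + 12 * B2 * K)) \<le> (\<tau> m)\<^sup>2 * E1 / T\<^sup>2" .
    qed
    finally show "(\<integral>\<^sup>+\<omega>. ennreal (W m \<omega> ^ 4) \<partial>M) \<le> ennreal ((\<tau> m)\<^sup>2 * E1 / T\<^sup>2)" .
    \<comment> \<open>The restriction to models with \<open>D_const\<close> at most \<open>T\<close>
      enters here: it gives \<open>m \<le> (b - a) * T\<close>, so the quadratic statistic satisfies
      its hypothesis with \<open>C2 = C0 * (b - a)\<close> for all models at once.\<close>
    have "(\<Sum>l<d m. (\<phi> m l x)\<^sup>2) \<le> C0 * (b - a) * T" for x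
    proof -
      have "C0 * real m \<le> C0 * ((b - a) * T)" using MS[OF mM] C0(1) by (intro mult_left_mono) auto
      then show ?thesis using sqle[OF m, of x] by (simp add: sq_def mult.assoc)
    qed
    moreover have "(LINT x:{a..b}|lborel. (\<Sum>l<d m. e l * \<phi> m l x)\<^sup>2 * s x) \<le> R * (\<Sum>l<d m. (e l)\<^sup>2)" for e
    proof -
      let ?q = "\<lambda>x. \<Sum>l<d m. e l * \<phi> m l x"
      have "?q \<in> pw_poly a b k m" using mem[OF m] by (intro pw_poly_sum) auto
      then have "regular a b ?q" by (rule regular_pw_poly[OF ab m])
      from regular_mult[OF this this] have "(LINT x:{a..b}|lborel. (?q x)\<^sup>2 * s x) \<le> R * (LINT x:{a..b}|lborel. (?q x)\<^sup>2)"
        by (intro integral_mult_s_le[OF ab(2) R(2)]) (auto simp: power2_eq_square)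
      then show ?thesis unfolding d_def pw_onb_integral_square[OF ab(1) m onb'[OF m]] .
    qed
    moreover have "0 < d m" using d0(1)[OF m] .
    ultimately show "(\<integral>\<^sup>+\<omega>. ennreal (U m \<omega> ^ 4) \<partial>M) \<le> ennreal (E2 * (real (d m))\<^sup>2)"
      unfolding U_def J_def \<beta>_def sq_def[abs_def] E2_def
      using ab(1) C0(1) by (intro jump_quadratic_fourth_moment[OF ab(2) T _ R(1)] reg[OF m]) auto
  qed
  also have "\<dots> = ennreal (1 / lam * (A + c / T\<^sup>2 * (T * (R * real (d ms))) + (\<Sum>m\<in>MS. P m * ((\<tau> m)\<^sup>2 * E1 / T\<^sup>2) + Q m * (E2 * (real (d m))\<^sup>2))))"
  proof -
    have E: "0 \<le> E1" "0 \<le> E2" using R(1) C0(1) ab(1) by (simp_all add: E1_def E2_def)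
    show ?thesis using A0 l0 c T R(1) P0 Q0 E by (intro ennreal_weighted_sum) auto
  qed
  also have "A + c / T\<^sup>2 * (T * (R * real (d ms))) + (\<Sum>m\<in>MS. P m * ((\<tau> m)\<^sup>2 * E1 / T\<^sup>2) + Q m * (E2 * (real (d m))\<^sup>2))
     = 3/2 * proj_error a b k (\<phi> ms) s ms + K1 * (real ms / T) + K2 / T * (\<Sum>m\<in>model_set a b k T. 1 / real m)"
  proof -
    have "P m * ((\<tau> m)\<^sup>2 * E1 / T\<^sup>2) + Q m * (E2 * (real (d m))\<^sup>2) = K2 / T * (1 / real m)" if "m \<in> MS" for m
    proof -
      have m: "0 < m" using MS[OF that] by simp
      have "P m * ((\<tau> m)\<^sup>2 * E1 / T\<^sup>2) = E1 / (\<kappa>\<^sup>2 * c'') / T * (1 / real m)"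
        using m T \<tau>0(1)[OF m] k0 c'' by (simp add: P_def power2_eq_square)
      moreover have "Q m * (E2 * (real (d m))\<^sup>2) = 8 * c ^ 4 / c'' ^ 3 * (E2 * (real k + 1)\<^sup>2) / T * (1 / real m)"
        unfolding d0(2)[OF m] using m T c'' by (simp add: Q_def power2_eq_square power3_eq_cube ac_simps)
      moreover have "K2 = E1 / (\<kappa>\<^sup>2 * c'') + 8 * c ^ 4 / c'' ^ 3 * (E2 * (real k + 1)\<^sup>2)"
        by (simp add: K2_def E1_def E2_def \<kappa>_def)
      ultimately show ?thesis by (simp only: add_divide_distrib distrib_right)
    qed
    then have 1: "(\<Sum>m\<in>MS. P m * ((\<tau> m)\<^sup>2 * E1 / T\<^sup>2) + Q m * (E2 * (real (d m))\<^sup>2)) = K2 / T * (\<Sum>m\<in>model_set a b k T. 1 / real m)"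
      unfolding sum_distrib_left MS_def[symmetric] by (intro sum.cong) auto
    have 2: "A + c / T\<^sup>2 * (T * (R * real (d ms))) = 3/2 * proj_error a b k (\<phi> ms) s ms + K1 * (real ms / T)"
    proof -
      have "c / T\<^sup>2 * (T * (R * real (d ms))) = c * R * (real k + 1) * (real ms / T)"
        unfolding d0(2)[OF ms0] using T by (simp add: power2_eq_square)
      then show ?thesis unfolding A_def K1_def bias_def \<kappa>_def by (simp add: distrib_right add_divide_distrib)
    qed
    show ?thesis unfolding 1 2 ..
  qed
  finally show ?thesis .
qed

end

section \<open>Choice of the reference model and the rate\<close>

lemma sum_inverse_le_ln: "0 < n \<Longrightarrow> (\<Sum>m=1..n. 1 / real m) \<le> 1 + ln (real n)"
proof (induction n rule: nat_induct_non_zero)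
  case (Suc n)
  have "ln (real n) - ln (real (Suc n)) \<le> (real n - real (Suc n)) / real (Suc n)"
    using Suc.hyps by (intro ln_diff_le) auto
  also have "\<dots> = - (1 / real (Suc n))" by simp
  finally show ?case using Suc.IH by simp
qed simp

text \<open>The logarithm of the harmonic sum is traded for a small power of \<open>x\<close>, in
  the form in which it will be compared with \<open>T powr \<theta>\<close>.\<close>

lemma sum_inverse_le_powr:
  assumes \<theta>: "0 < \<theta>" and I: "\<And>m. m \<in> I \<Longrightarrow> 0 < m \<and> real m \<le> x"
  shows "(\<Sum>m\<in>I. 1 / real m) \<le> 1 + x powr \<theta> / \<theta>"
proof (cases "1 \<le> x")
  case False
  have "I = {}"
  proof (rule ccontr)
    assume "I \<noteq> {}"
    then obtain m where "m \<in> I" by blast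
    then have "1 \<le> m" "real m \<le> x" using I[of m] by auto
    then show False using False by simp
  qed
  then show ?thesis using \<theta> by simp
next
  case True
  define N where "N = nat \<lfloor>x\<rfloor>"
  have N: "0 < N" "real N \<le> x" using True by (auto simp: N_def le_nat_floor)
  have "I \<subseteq> {1..N}" using I by (auto simp: N_def le_nat_floor Suc_le_eq)
  then have "(\<Sum>m\<in>I. 1 / real m) \<le> (\<Sum>m=1..N. 1 / real m)" by (intro sum_mono2) auto
  also have "\<dots> \<le> 1 + ln (real N)" by (rule sum_inverse_le_ln[OF N(1)])
  also have "ln (real N) \<le> real N powr \<theta> / \<theta>" using N \<theta> by (intro ln_powr_bound) auto
  also have "\<dots> \<le> x powr \<theta> / \<theta>" using N \<theta> by (intro divide_right_mono powr_mono2) auto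
  finally show ?thesis by simp
qed

text \<open>\<open>C\<close> and \<open>T0\<close> are chosen before the process and its density and
  depend on the latter only through \<open>R\<close> and \<open>L\<close>. This uniformity covers
  both a single density and the supremum over the class.\<close>

lemma risk_rate:
  fixes a b c c' c'' \<alpha> R L :: real and k :: nat and p :: ennreal and \<phi> :: "nat \<Rightarrow> nat \<Rightarrow> real \<Rightarrow> real"
  assumes ab: "a < b" "0 \<notin> {a..b}" and c: "1 < c" and c': "0 < c'" and c'': "0 < c''"
    and p: "2 \<le> p" and \<alpha>: "0 < \<alpha>" "\<alpha> < real k + 1" and onb: "\<And>m. m \<ge> 1 \<Longrightarrow> pw_onb a b k m (\<phi> m)"
    and R: "0 \<le> R" and L: "0 < L"
  shows "\<exists>C T0. \<forall>(M :: 'w measure) X s mhat T. levy_process M X \<longrightarrow> has_levy_density M X s \<longrightarrow>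
    (AE x in lborel. x \<in> {a..b} \<longrightarrow> s x \<le> R) \<longrightarrow> besov_seminorm a b \<alpha> p s \<le> ennreal L \<longrightarrow>
    model_selector a b k \<phi> c c' c'' M X mhat \<longrightarrow> T0 \<le> T \<longrightarrow>
    ennreal (T powr (2 * \<alpha> / (2 * \<alpha> + 1))) * risk a b k \<phi> M X mhat s T \<le> ennreal C"
proof -
  have "\<exists>C>0. \<forall>m>0. \<forall>f\<in>pw_poly a b k m. \<forall>x. (f x)\<^sup>2 \<le> C * real m * (LINT x:{a..b}|lborel. (f x)\<^sup>2)"
    by (rule pw_poly_sup_bound[OF ab(1) onb]) simp
  then obtain C0 where C0: "0 < C0" "\<And>m f x. 0 < m \<Longrightarrow> f \<in> pw_poly a b k m \<Longrightarrow> (f x)\<^sup>2 \<le> C0 * real m * (LINT x:{a..b}|lborel. (f x)\<^sup>2)"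
    by blast
  obtain Ca where Ca: "0 \<le> Ca" "\<And>f R L m. f \<in> borel_measurable borel \<Longrightarrow> (AE x in lborel. x \<in> {a..b} \<longrightarrow> \<bar>f x\<bar> \<le> R) \<Longrightarrow> 0 < L \<Longrightarrow>
      besov_seminorm a b \<alpha> p f \<le> ennreal L \<Longrightarrow> 0 < m \<Longrightarrow>
      \<exists>q\<in>pw_poly a b k m. (LINT x:{a..b}|lborel. (f x - q x)\<^sup>2) \<le> Ca * L\<^sup>2 * real m powr (- (2 * \<alpha>))"
    using besov_approx[OF ab(1) \<alpha> p] by blast
  define \<theta> where "\<theta> = 1 / (2 * \<alpha> + 1)"
  have \<theta>: "0 < \<theta>" "\<theta> < 1" using \<alpha> by (auto simp: \<theta>_def)
  have \<theta>1: "2 * \<alpha> / (2 * \<alpha> + 1) = 1 - \<theta>" "2 * \<alpha> * \<theta> = 1 - \<theta>" using \<alpha> by (auto simp: \<theta>_def field_simps)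
  \<comment> \<open>From \<open>T0\<close> on, \<open>2 * C0 * T powr \<theta> \<le> T\<close>,
    which makes the reference model below admissible.\<close>
  define T0 where "T0 = max 1 ((2 * C0) powr (1 / (1 - \<theta>)))"
  define lam where "lam = min (1/2) (c - 1)"
  define K1 where "K1 = c * R * (real k + 1) + c' * C0 + c'' * (real k + 1) + min (1/4) (c''/4)"
  define K2 where "K2 = exp 1 * (16 * (R + 1)\<^sup>2 + 24 * C0 * (R\<^sup>2 * (b - a)) * (R + 1)) / ((min (1/4) (c''/4))\<^sup>2 * c'')
          + 8 * c ^ 4 / c'' ^ 3 * (exp (33 * (R + 1) + 388 * (R + 1) * (C0 * (b - a))) * (real k + 1)\<^sup>2)"
  define C3 where "C3 = 1 + (b - a) powr \<theta> / \<theta>"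
  define C where "C = 1 / lam * (3/2 * (Ca * L\<^sup>2) + K1 * 2 + K2 * C3)"
  have lam0: "0 < lam" using c by (simp add: lam_def)
  have K0: "0 \<le> K1" "0 \<le> K2" using c c' c'' R C0(1) ab(1) by (simp_all add: K1_def K2_def)
  show ?thesis
  proof (rule exI[of _ C], rule exI[of _ T0], intro allI impI)
    fix M :: "'w measure" and X s mhat T
    assume levy: "levy_process M X" "has_levy_density M X s" and sR: "AE x in lborel. x \<in> {a..b} \<longrightarrow> s x \<le> R"
      and bes: "besov_seminorm a b \<alpha> p s \<le> ennreal L" and sel: "model_selector a b k \<phi> c c' c'' M X mhat" and T: "T0 \<le> T"
    interpret levy_jumps M X s using levy by unfold_locales
    have T1: "1 \<le> T" and T2: "(2 * C0) powr (1 / (1 - \<theta>)) \<le> T" using T by (auto simp: T0_def)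
    define t where "t = T powr \<theta>"
    have t1: "1 \<le> t" using T1 \<theta> by (simp add: t_def ge_one_powr_ge_zero)
    have tT: "T powr (1 - \<theta>) * t = T" using T1 by (simp add: t_def powr_add[symmetric])
    define u where "u = T powr (1 - \<theta>)"
    have u0: "0 < u" using T1 by (simp add: u_def)
    have ut: "u * t = T" using tT by (simp add: u_def)
    have uC: "2 * C0 \<le> u"
    proof -
      have "2 * C0 = ((2 * C0) powr (1 / (1 - \<theta>))) powr (1 - \<theta>)" using C0(1) \<theta> by (simp add: powr_powr)
      also have "\<dots> \<le> u" unfolding u_def using T2 \<theta> by (intro powr_mono2) auto
      finally show ?thesis .
    qed
    \<comment> \<open>With about \<open>T powr \<theta>\<close> cells the squared bias and
      \<open>m / T\<close> are both of order \<open>1 / u\<close>. Since \<open>t \<ge> 1\<close>,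
      rounding up costs at most a factor 2.\<close>
    define m where "m = nat \<lceil>t\<rceil>"
    have m: "t \<le> real m" "real m \<le> 2 * t" using t1 by (auto simp: m_def) linarith+
    have m0: "0 < m" using m(1) t1 by (cases m) auto
    have mT: "m \<in> model_set a b k T"
    proof -
      have "D_const a b k m \<le> ennreal (C0 * real m)"
        using C0 m0 by (intro D_const_le[OF ab(1) m0]) auto
      also have "\<dots> \<le> ennreal T"
      proof (rule ennreal_leI)
        have "C0 * real m \<le> C0 * (2 * t)" using m(2) C0(1) by (intro mult_left_mono) auto
        also have "\<dots> = 2 * C0 * t" by simp
        also have "\<dots> \<le> u * t" using uC t1 by (intro mult_right_mono) auto
        finally show "C0 * real m \<le> T" unfolding ut .
      qed
      finally show ?thesis using m0 by (simp add: model_set_def)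
    qed
    have absR: "AE x in lborel. x \<in> {a..b} \<longrightarrow> \<bar>s x\<bar> \<le> R"
      using sR
    proof eventually_elim
      case (elim x)
      show ?case using elim s_nonneg[of x] ab(2) by (cases "x = 0") auto
    qed
    obtain q where q: "q \<in> pw_poly a b k m" "(LINT x:{a..b}|lborel. (s x - q x)\<^sup>2) \<le> Ca * L\<^sup>2 * real m powr (- (2 * \<alpha>))"
      using Ca(2)[OF borel_s absR L bes m0] by blast
    define bias where "bias = proj_error a b k (\<phi> m) s m"
    have "bias \<le> (LINT x:{a..b}|lborel. (s x - q x)\<^sup>2)"
      unfolding bias_def using proj_error_le[OF ab(1) borel_s absR m0 onb q(1)] m0 by simp
    also note q(2)
    also have "Ca * L\<^sup>2 * real m powr (- (2 * \<alpha>)) \<le> Ca * L\<^sup>2 * t powr (- (2 * \<alpha>))"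
      using m(1) t1 \<alpha> Ca(1) by (intro mult_left_mono powr_mono2') auto
    \<comment> \<open>The exponent is \<open>- 2 * \<alpha> * \<theta>\<close>, which equals
      \<open>- (1 - \<theta>)\<close> by the choice of \<theta>.\<close>
    also have "t powr (- (2 * \<alpha>)) = 1 / u"
      using \<theta>1(2) by (simp add: t_def u_def powr_powr powr_minus_divide mult.commute)
    finally have b1: "u * bias \<le> Ca * L\<^sup>2" using u0 by (simp add: pos_le_divide_eq mult.commute)
    have b2: "u * (real m / T) \<le> 2"
    proof -
      have "u * (real m / T) \<le> u * (2 * t / T)" using m(2) u0 T1 by (intro mult_left_mono divide_right_mono) auto
      also have "\<dots> = 2 * (u * t) / T" by simp
      also have "\<dots> = 2" unfolding ut using T1 by simp
      finally show ?thesis .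
    qed
    define S where "S = (\<Sum>m\<in>model_set a b k T. 1 / real m)"
    have b3: "u * (S / T) \<le> C3"
    proof -
      have "S \<le> 1 + ((b - a) * T) powr \<theta> / \<theta>"
        unfolding S_def
      proof (rule sum_inverse_le_powr[OF \<theta>(1)])
        fix m assume "m \<in> model_set a b k T"
        then show "0 < m \<and> real m \<le> (b - a) * T" using T1 by (intro finite_model_set(2)[OF ab(1)]) auto
      qed
      also have "\<dots> = 1 + (b - a) powr \<theta> / \<theta> * t" using ab(1) T1 by (simp add: t_def powr_mult)
      also have "\<dots> \<le> C3 * t" using t1 by (simp add: C3_def distrib_right)
      finally have "u * (S / T) \<le> u * (C3 * t / T)" using u0 T1 by (intro mult_left_mono divide_right_mono) auto
      also have "\<dots> = C3 * (u * t) / T" by simp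
      also have "\<dots> = C3" unfolding ut using T1 by simp
      finally show ?thesis .
    qed
    define Y where "Y = 1 / lam * (3/2 * bias + K1 * (real m / T) + K2 / T * S)"
    have "risk a b k \<phi> M X mhat s T \<le> ennreal Y"
      unfolding Y_def bias_def S_def lam_def K1_def K2_def
      using T1 by (intro risk_le[OF ab c c' c'' onb C0 R sR _ sel mT]) auto
    then have "ennreal u * risk a b k \<phi> M X mhat s T \<le> ennreal u * ennreal Y" by (rule mult_left_mono) simp
    also have "\<dots> = ennreal (u * Y)" using u0 by (simp add: ennreal_mult'[symmetric])
    also have "u * Y \<le> C"
    proof -
      have "u * Y = 1 / lam * (3/2 * (u * bias) + K1 * (u * (real m / T)) + K2 * (u * (S / T)))"
        by (simp add: Y_def algebra_simps)
      also have "\<dots> \<le> C"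
        unfolding C_def using b1 b2 b3 K0 lam0 by (intro mult_left_mono add_mono) auto
      finally show ?thesis .
    qed
    finally show "ennreal (T powr (2 * \<alpha> / (2 * \<alpha> + 1))) * risk a b k \<phi> M X mhat s T \<le> ennreal C"
      unfolding \<theta>1(1) u_def by (simp add: ennreal_leI)
  qed
qed

lemma Linf_norm_AE_le:
  assumes "Linf_norm a b f < ennreal R"
  shows "AE x in lborel. x \<in> {a..b} \<longrightarrow> \<bar>f x\<bar> \<le> R"
proof -
  have R0: "0 \<le> R"
  proof (rule ccontr)
    assume "\<not> 0 \<le> R"
    then have "ennreal R = 0" by (simp add: ennreal_neg)
    then show False using assms by simp
  qed
  have "AE x in restrict_space lborel {a..b}. ennreal \<bar>f x\<bar> \<le> Linf_norm a b f"
    unfolding Linf_norm_def by (rule esssup_AE)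
  then have "AE x in lborel. x \<in> {a..b} \<longrightarrow> ennreal \<bar>f x\<bar> \<le> Linf_norm a b f"
    by (subst (asm) AE_restrict_space_iff) auto
  then show ?thesis
  proof eventually_elim
    case (elim x)
    show ?case
    proof
      assume "x \<in> {a..b}"
      then have "ennreal \<bar>f x\<bar> \<le> ennreal R" using elim assms by (meson order_trans less_imp_le)
      then show "\<bar>f x\<bar> \<le> R" using R0 by (simp add: ennreal_le_iff)
    qed
  qed
qed

theorem corollary5p1:
  fixes a b c c' c'' \<alpha> :: real and k :: nat and p :: ennreal
    and \<phi> :: "nat \<Rightarrow> nat \<Rightarrow> real \<Rightarrow> real"
  assumes "a < b" and "0 \<notin> {a..b}"
    and "c > 1" and "c' > 0" and "c'' > 0"
    and "2 \<le> p" and "0 < \<alpha>" and "\<alpha> < real k + 1"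
    and "\<And>m. m \<ge> 1 \<Longrightarrow> pw_onb a b k m (\<phi> m)"
  shows
    "(\<forall>(M :: 'w measure) X s mhat.
        levy_process M X \<and> has_levy_density M X s \<and>
        (\<forall>x\<in>{a..b}. 0 < s x) \<and> bounded (s ` {a..b}) \<and>
        model_selector a b k \<phi> c c' c'' M X mhat \<and>
        s \<in> besov a b \<alpha> p \<longrightarrow>
        Limsup at_top
          (\<lambda>T. ennreal (T powr (2 * \<alpha> / (2 * \<alpha> + 1))) * risk a b k \<phi> M X mhat s T) < \<infinity>)
     \<and>
     (\<forall>R>0. \<forall>L>0. \<forall>(P :: (real \<Rightarrow> real) \<Rightarrow> 'v measure) X mhat.
        (\<forall>s\<in>levy_class a b \<alpha> p R L.
           levy_process (P s) X \<and> has_levy_density (P s) X s \<and>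
           model_selector a b k \<phi> c c' c'' (P s) X mhat) \<longrightarrow>
        Limsup at_top
          (\<lambda>T. ennreal (T powr (2 * \<alpha> / (2 * \<alpha> + 1))) *
               (SUP s\<in>levy_class a b \<alpha> p R L. risk a b k \<phi> (P s) X mhat s T)) < \<infinity>)"
proof (intro conjI allI impI)
  fix M :: "'w measure" and X s mhat
  assume A: "levy_process M X \<and> has_levy_density M X s \<and> (\<forall>x\<in>{a..b}. 0 < s x) \<and> bounded (s ` {a..b}) \<and>
        model_selector a b k \<phi> c c' c'' M X mhat \<and> s \<in> besov a b \<alpha> p"
  obtain R where R: "0 < R" "\<And>x. x \<in> {a..b} \<Longrightarrow> \<bar>s x\<bar> \<le> R" using A unfolding bounded_pos by auto
  \<comment> \<open>The added 1 makes the bound positive even if the seminorm is 0.\<close>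
  define L where "L = enn2real (besov_seminorm a b \<alpha> p s) + 1"
  have L: "0 < L" by (simp add: L_def add_nonneg_pos)
  have "besov_seminorm a b \<alpha> p s = ennreal (enn2real (besov_seminorm a b \<alpha> p s))"
    using A by (simp add: besov_def)
  also have "\<dots> \<le> ennreal L" by (intro ennreal_leI) (simp add: L_def)
  finally have bes: "besov_seminorm a b \<alpha> p s \<le> ennreal L" .
  have sR: "AE x in lborel. x \<in> {a..b} \<longrightarrow> s x \<le> R" using R(2) by (intro AE_I2) (auto simp: abs_le_iff)
  obtain C T0 where C: "\<forall>(M :: 'w measure) X s mhat T. levy_process M X \<longrightarrow> has_levy_density M X s \<longrightarrow>
    (AE x in lborel. x \<in> {a..b} \<longrightarrow> s x \<le> R) \<longrightarrow> besov_seminorm a b \<alpha> p s \<le> ennreal L \<longrightarrow>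
    model_selector a b k \<phi> c c' c'' M X mhat \<longrightarrow> T0 \<le> T \<longrightarrow>
    ennreal (T powr (2 * \<alpha> / (2 * \<alpha> + 1))) * risk a b k \<phi> M X mhat s T \<le> ennreal C"
    by (rule exE[OF risk_rate[OF assms less_imp_le[OF R(1)] L]], assumption, elim exE, rule that)
  have "Limsup at_top (\<lambda>T. ennreal (T powr (2 * \<alpha> / (2 * \<alpha> + 1))) * risk a b k \<phi> M X mhat s T) \<le> ennreal C"
  proof (intro Limsup_bounded eventually_mono[OF eventually_ge_at_top[of T0]])
    fix T assume "T0 \<le> T"
    then show "ennreal (T powr (2 * \<alpha> / (2 * \<alpha> + 1))) * risk a b k \<phi> M X mhat s T \<le> ennreal C"
      using A by (intro C[rule_format] sR bes) auto
  qed
  also have "\<dots> < \<infinity>" by simp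
  finally show "Limsup at_top (\<lambda>T. ennreal (T powr (2 * \<alpha> / (2 * \<alpha> + 1))) * risk a b k \<phi> M X mhat s T) < \<infinity>" .
next
  fix R L :: real and P :: "(real \<Rightarrow> real) \<Rightarrow> 'v measure" and X mhat
  assume R: "0 < R" and L: "0 < L" and A: "\<forall>s\<in>levy_class a b \<alpha> p R L.
           levy_process (P s) X \<and> has_levy_density (P s) X s \<and> model_selector a b k \<phi> c c' c'' (P s) X mhat"
  obtain C T0 where C: "\<forall>(M :: 'v measure) X s mhat T. levy_process M X \<longrightarrow> has_levy_density M X s \<longrightarrow>
    (AE x in lborel. x \<in> {a..b} \<longrightarrow> s x \<le> R) \<longrightarrow> besov_seminorm a b \<alpha> p s \<le> ennreal L \<longrightarrow>
    model_selector a b k \<phi> c c' c'' M X mhat \<longrightarrow> T0 \<le> T \<longrightarrow>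
    ennreal (T powr (2 * \<alpha> / (2 * \<alpha> + 1))) * risk a b k \<phi> M X mhat s T \<le> ennreal C"
    by (rule exE[OF risk_rate[OF assms less_imp_le[OF R] L]], assumption, elim exE, rule that)
  have "ennreal (T powr (2 * \<alpha> / (2 * \<alpha> + 1))) * (SUP s\<in>levy_class a b \<alpha> p R L. risk a b k \<phi> (P s) X mhat s T) \<le> ennreal C"
    if T: "T0 \<le> T" for T
    unfolding SUP_mult_left_ennreal
  proof (rule SUP_least)
    fix s assume s: "s \<in> levy_class a b \<alpha> p R L"
    have "Linf_norm a b s < ennreal R" using s by (simp add: levy_class_def)
    from Linf_norm_AE_le[OF this] have sR: "AE x in lborel. x \<in> {a..b} \<longrightarrow> s x \<le> R"
      by eventually_elim (auto simp: abs_le_iff)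
    have bes: "besov_seminorm a b \<alpha> p s \<le> ennreal L" using s by (simp add: levy_class_def less_imp_le)
    show "ennreal (T powr (2 * \<alpha> / (2 * \<alpha> + 1))) * risk a b k \<phi> (P s) X mhat s T \<le> ennreal C"
      using A s T by (intro C[rule_format] sR bes) auto
  qed
  then have "Limsup at_top (\<lambda>T. ennreal (T powr (2 * \<alpha> / (2 * \<alpha> + 1))) *
      (SUP s\<in>levy_class a b \<alpha> p R L. risk a b k \<phi> (P s) X mhat s T)) \<le> ennreal C"
    by (intro Limsup_bounded eventually_mono[OF eventually_ge_at_top[of T0]])
  also have "\<dots> < \<infinity>" by simp
  finally show "Limsup at_top (\<lambda>T. ennreal (T powr (2 * \<alpha> / (2 * \<alpha> + 1))) *
      (SUP s\<in>levy_class a b \<alpha> p R L. risk a b k \<phi> (P s) X mhat s T)) < \<infinity>" .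
qed

end
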